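(* Let $b:(0,\infty)\to\mathbb{R}$ be a regular boundary such that for each $T>0$, $b$ is continuously differentiable on $(0,T]$, and such that $|b'(t)|=O(t^{-\epsilon})$ as $t\downarrow 0$ for some $0<\epsilon<1/2$. Let $(W_t)_{t\ge0}$ be a standard Brownian motion started at $0$ and let $\tau=\inf\{t>0:\ W_t\le b(t)\}$. Then $\tau$ has a continuous density function $f$, and for each $p<1$, $f$ is the unique continuous solution of the integral equation $$\frac{e^{-\frac{b(t)^2}{4t}}D_{p}(-b(t)/\sqrt{t})}{t^{(p+1)/2}}=\int_{0}^t e^{-\frac{(b(s)-b(t))^2}{4(t-s)}}\,\frac{D_{p}\big((b(s)-b(t))/\sqrt{t-s}\big)}{(t-s)^{(p+1)/2}}\,f(s)\,ds,\qquad t>0.$$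
   Context: A boundary is a continuous function $b:(0,\infty)\to\mathbb{R}$ with $b(0):=\lim_{t\downarrow0}b(t)\le 0$; it is called regular if $P(\tau=0)=0$ for $\tau=\inf\{t>0: W_t\le b(t)\}$. Continuous solutions are functions continuous on $[0,\infty)$. $D_p$ ($p\in\mathbb{R}$) is the parabolic cylinder function: the entire solution of $u''(z)+\left(p+\tfrac12-\tfrac{z^2}{4}\right)u(z)=0$ normalized by $D_p(z)\sim z^p e^{-z^2/4}$ as $z\to+\infty$. For $p<0$, $D_p(z)=\frac{e^{-z^2/4}}{\Gamma(-p)}\int_0^\infty e^{-xz-x^2/2}x^{-p-1}\,dx$. *)

theory Defs
  imports
    "HOL-Probability.Probability"
    "HOL-Complex_Analysis.Complex_Analysis"
    "HOL-Library.Landau_Symbols"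
begin

text \<open>Only times \<open>t \<ge> 0\<close> are relevant; the values of \<open>W\<close> at negative times are arbitrary.\<close>

definition standard_brownian_motion :: "'a measure \<Rightarrow> (real \<Rightarrow> 'a \<Rightarrow> real) \<Rightarrow> bool" where
  "standard_brownian_motion M W \<longleftrightarrow>
     prob_space M \<and>
     (\<forall>t\<ge>0. W t \<in> borel_measurable M) \<and>
     (AE \<omega> in M. W 0 \<omega> = 0) \<and>
     (\<forall>\<omega>\<in>space M. continuous_on {0..} (\<lambda>t. W t \<omega>)) \<and>
     (\<forall>s t. 0 \<le> s \<longrightarrow> s < t \<longrightarrow>
        distributed M lborel (\<lambda>\<omega>. W t \<omega> - W s \<omega>) (normal_density 0 (sqrt (t - s)))) \<and>
     (\<forall>(n::nat) (ts :: nat \<Rightarrow> real). 0 \<le> ts 0 \<longrightarrow> strict_mono ts \<longrightarrow>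
        prob_space.indep_vars M (\<lambda>_. borel) (\<lambda>i \<omega>. W (ts (Suc i)) \<omega> - W (ts i) \<omega>) {..<n})"

text \<open>The infimum of the empty set is \<open>\<infinity>\<close>, so the first passage time is extended-real valued.\<close>

definition first_passage_time :: "(real \<Rightarrow> 'a \<Rightarrow> real) \<Rightarrow> (real \<Rightarrow> real) \<Rightarrow> 'a \<Rightarrow> ereal" where
  "first_passage_time W b \<omega> = (INF t\<in>{t. 0 < t \<and> W t \<omega> \<le> b t}. ereal t)"

text \<open>A function on \<open>(0, \<infinity>)\<close> is represented by a total function whose values at
  \<open>t \<le> 0\<close> are irrelevant; \<open>b\<^sub>0\<close> is the number written \<open>b(0)\<close> informally.\<close>

definition boundary :: "(real \<Rightarrow> real) \<Rightarrow> bool" where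
  "boundary b \<longleftrightarrow>
     continuous_on {0<..} b \<and> (\<exists>b\<^sub>0\<le>0. (b \<longlongrightarrow> b\<^sub>0) (at_right 0))"

definition regular_boundary ::
    "'a measure \<Rightarrow> (real \<Rightarrow> 'a \<Rightarrow> real) \<Rightarrow> (real \<Rightarrow> real) \<Rightarrow> bool" where
  "regular_boundary M W b \<longleftrightarrow>
     boundary b \<and> \<P>(\<omega> in M. first_passage_time W b \<omega> = 0) = 0"

text \<open>A density on \<open>[0, \<infinity>)\<close> of a random time that may be infinite with positive probability:
  the total mass of \<open>f\<close> is the probability that the time is finite.\<close>

definition has_time_density :: "'a measure \<Rightarrow> ('a \<Rightarrow> ereal) \<Rightarrow> (real \<Rightarrow> real) \<Rightarrow> bool" where
  "has_time_density M \<tau> f \<longleftrightarrow>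
     \<tau> \<in> borel_measurable M \<and>
     (\<forall>t\<ge>0. 0 \<le> f t) \<and>
     (\<forall>A\<in>sets borel. A \<subseteq> {0..} \<longrightarrow>
        emeasure M {\<omega>\<in>space M. \<tau> \<omega> \<in> ereal ` A} = (\<integral>\<^sup>+t\<in>A. ennreal (f t) \<partial>lborel))"

definition is_parabolic_cylinder :: "real \<Rightarrow> (complex \<Rightarrow> complex) \<Rightarrow> bool" where
  "is_parabolic_cylinder p u \<longleftrightarrow>
     u holomorphic_on UNIV \<and>
     (\<forall>z. deriv (deriv u) z + (of_real p + 1 / 2 - z\<^sup>2 / 4) * u z = 0) \<and>
     (\<lambda>x::real. u (of_real x)) \<sim>[at_top] (\<lambda>x. of_real (x powr p * exp (- x\<^sup>2 / 4)))"

definition parabolic_cylinder :: "real \<Rightarrow> complex \<Rightarrow> complex" where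
  "parabolic_cylinder p = (THE u. is_parabolic_cylinder p u)"

text \<open>For real \<open>p\<close> the function is real on the real axis.\<close>

definition parabolic_cylinder_real :: "real \<Rightarrow> real \<Rightarrow> real" where
  "parabolic_cylinder_real p x = Re (parabolic_cylinder p (of_real x))"

definition passage_kernel :: "real \<Rightarrow> real \<Rightarrow> real \<Rightarrow> real" where
  "passage_kernel p x t =
     exp (- x\<^sup>2 / (4 * t)) * parabolic_cylinder_real p (x / sqrt t) / t powr ((p + 1) / 2)"

text \<open>The integral equation, with the integral required to converge absolutely
  (a non-integrable integrand would have integral \<open>0\<close> by convention).\<close>

definition solves_passage_equation :: "real \<Rightarrow> (real \<Rightarrow> real) \<Rightarrow> (real \<Rightarrow> real) \<Rightarrow> bool" where
  "solves_passage_equation p b f \<longleftrightarrow>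
     (\<forall>t>0.
        set_integrable lborel {0<..<t} (\<lambda>s. passage_kernel p (b s - b t) (t - s) * f s) \<and>
        passage_kernel p (- b t) t =
          (LBINT s:{0<..<t}. passage_kernel p (b s - b t) (t - s) * f s))"

end

theory Submission
  imports Defs "HOL-Real_Asymp.Real_Asymp"
begin

text \<open>
  Let \<open>\<psi>(x,t) = x t\<^sup>-\<^sup>3\<^sup>/\<^sup>2 exp (-x\<^sup>2/2t)\<close> be the heat flux. For every \<open>p < 1\<close> the kernel of the integral equation is the
  Abel transform of \<open>\<psi>\<close> in space: it equals \<open>1/\<Gamma>(1-p)\<close> times the integral of \<open>u\<^sup>-\<^sup>p \<psi>(x+u,t)\<close> over \<open>u > 0\<close>.
  Since the Abel transform is injective on functions that decay exponentially towards \<open>-\<infinity>\<close>, an identity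
  below the boundary for one value of \<open>p\<close> gives the identity for \<open>\<psi>\<close>, hence for all \<open>p\<close>.

  The strong Markov property at \<open>\<tau>\<close>, obtained by discretising time, gives for \<open>y \<le> b(t)\<close> that
  \<open>P(W\<^sub>t \<le> y)\<close> is the expectation of \<open>\<Phi>((y - b(\<tau>))/\<surd>(t - \<tau>))\<close> on \<open>\<tau> < t\<close>; this is the equation for \<open>p = -1\<close> (when \<open>y = b(t)\<close>).
  Its derivative in \<open>t\<close> is a Volterra equation of the second kind with a weakly singular kernel; Picard
  iteration yields a continuous solution, and Gronwall's lemma identifies it with the density of \<open>\<tau>\<close>.
  For uniqueness let \<open>D\<close> be the difference of two solutions. A Brownian motion started below the boundary
  and run backwards in time until it meets the boundary shows that the potential of \<open>D\<close> vanishes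
  below the boundary, for the given \<open>p\<close>; by Abel inversion it then vanishes for \<open>p = -1\<close>, where Gronwall's
  lemma forces \<open>D = 0\<close>. Regularity enters only through \<open>b(0) < 0\<close>: under the bound on \<open>b'\<close> a boundary
  starting at \<open>0\<close> is hit immediately with positive probability.
\<close>

section \<open>Power weights and parabolic cylinder functions\<close>

text \<open>\<open>heat_flux\<close> is the kernel of the excluded endpoint p = 1. Its Abel
  transform of order a = 1 - p > 0 gives the kernel for p, and a = 2 gives p = -1, whose kernel
  \<open>gauss_tail\<close> is bounded and tends to sqrt(pi/2) on the diagonal. This nonzero limit
  makes p = -1 the working case: differentiating the first-kind equation leaves a multiple of the
  unknown, hence an equation of the second kind. Two derivatives of this kernel are used. The one in
  t acts on a density and gives existence; the one in s enters by Stieltjes integration by parts,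
  needs only a distribution function, and so compares the law of \<tau> with the candidate before a
  density is known. Both are singular of order 1/2 + \<epsilon> < 1. An Abel transform at x sees the
  whole half-line below x, so an identity on the curve alone cannot be inverted. Hence the strong
  Markov identity is proved for every y \<le> b(t), and uniqueness first carries the vanishing of a
  potential from the curve to the region below. Conversely, integration over u > 0 lets identities
  strictly below the curve imply those on it.\<close>

definition power_measure :: "real \<Rightarrow> real measure" where
  "power_measure a = density lborel (\<lambda>u. ennreal (indicator {0<..} u * u powr (a - 1)))"

lemma sets_power_measure [measurable_cong, simp]: "sets (power_measure a) = sets borel"
  and space_power_measure [simp]: "space (power_measure a) = UNIV"
  by (simp_all add: power_measure_def)

lemma sigma_finite_power_measure: "sigma_finite_measure (power_measure a)"
  unfolding power_measure_def
  by (rule sigma_finite_measure.sigma_finite_iff_density_finite[THEN iffD2, OF sigma_finite_lborel]) auto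

lemma AE_power_measure: "AE u in power_measure a. 0 < u"
  unfolding power_measure_def by (subst AE_density) (auto simp: indicator_def)

lemma integrable_power_measure_iff:
  fixes f :: "real \<Rightarrow> 'b::{banach, second_countable_topology}"
  assumes [measurable]: "f \<in> borel_measurable borel"
  shows "integrable (power_measure a) f \<longleftrightarrow>
    set_integrable lborel {0<..} (\<lambda>u. (u powr (a - 1)) *\<^sub>R f u)"
  unfolding power_measure_def set_integrable_def
  by (subst integrable_density) (auto simp: indicator_def cong: if_cong)

lemma integral_power_measure:
  fixes f :: "real \<Rightarrow> 'b::{banach, second_countable_topology}"
  assumes [measurable]: "f \<in> borel_measurable borel"
  shows "(\<integral>u. f u \<partial>power_measure a) = (LBINT u:{0<..}. (u powr (a - 1)) *\<^sub>R f u)"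
  unfolding power_measure_def set_lebesgue_integral_def
  by (subst integral_density) (auto simp: indicator_def cong: if_cong)

lemma nn_integral_power_measure:
  assumes [measurable]: "f \<in> borel_measurable borel"
  shows "(\<integral>\<^sup>+u. f u \<partial>power_measure a) = (\<integral>\<^sup>+u\<in>{0<..}. ennreal (u powr (a - 1)) * f u \<partial>lborel)"
  unfolding power_measure_def
  by (subst nn_integral_density) (auto intro!: nn_integral_cong simp: indicator_def)

lemma nn_integral_power_measure_scale:
  assumes [measurable]: "f \<in> borel_measurable borel" and c: "0 < c"
  shows "(\<integral>\<^sup>+u. f u \<partial>power_measure a) = ennreal (c powr a) * (\<integral>\<^sup>+u. f (c * u) \<partial>power_measure a)"
proof -
  have "(\<integral>\<^sup>+u. f u \<partial>power_measure a) = ennreal c *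
      (\<integral>\<^sup>+u. (ennreal ((c * u) powr (a - 1)) * f (c * u)) * indicator {0<..} (c * u) \<partial>lborel)"
    unfolding nn_integral_power_measure[OF assms(1)]
    by (subst nn_integral_real_affine[where c=c and t=0]) (use c in auto)
  also have "(\<integral>\<^sup>+u. (ennreal ((c * u) powr (a - 1)) * f (c * u)) * indicator {0<..} (c * u) \<partial>lborel)
     = (\<integral>\<^sup>+u. ennreal (c powr (a - 1)) * (ennreal (u powr (a - 1)) * f (c * u) * indicator {0<..} u) \<partial>lborel)"
    using c by (intro nn_integral_cong)
      (auto simp: indicator_def powr_mult ennreal_mult zero_less_mult_iff mult_ac)
  also have "\<dots> = ennreal (c powr (a - 1)) * (\<integral>\<^sup>+u. f (c * u) \<partial>power_measure a)"
    by (subst nn_integral_cmult) (auto simp: nn_integral_power_measure)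
  also have "ennreal c * \<dots> = ennreal (c powr a) * (\<integral>\<^sup>+u. f (c * u) \<partial>power_measure a)"
    using c by (simp add: mult.assoc[symmetric] ennreal_mult[symmetric] powr_mult_base)
  finally show ?thesis .
qed

lemma integral_power_measure_scale:
  fixes f :: "real \<Rightarrow> real"
  assumes [measurable]: "f \<in> borel_measurable borel" and c: "0 < c"
  shows "(\<integral>u. f u \<partial>power_measure a) = c powr a * (\<integral>u. f (c * u) \<partial>power_measure a)"
proof -
  have "(\<integral>u. f u \<partial>power_measure a) = c *
      (\<integral>u. indicator {0<..} (c * u) * ((c * u) powr (a - 1) * f (c * u)) \<partial>lborel)"
    unfolding integral_power_measure[OF assms(1)] set_lebesgue_integral_def
    by (subst lborel_integral_real_affine[where c=c and t=0]) (use c in auto)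
  also have "(\<integral>u. indicator {0<..} (c * u) * ((c * u) powr (a - 1) * f (c * u)) \<partial>lborel)
     = (\<integral>u. c powr (a - 1) * (indicator {0<..} u * (u powr (a - 1) * f (c * u))) \<partial>lborel)"
    using c by (intro Bochner_Integration.integral_cong)
      (auto simp: indicator_def powr_mult zero_less_mult_iff mult_ac)
  also have "\<dots> = c powr (a - 1) * (\<integral>u. f (c * u) \<partial>power_measure a)"
    by (simp add: integral_power_measure set_lebesgue_integral_def)
  also have "c * \<dots> = c powr a * (\<integral>u. f (c * u) \<partial>power_measure a)"
    using c by (simp add: mult.assoc[symmetric] powr_mult_base)
  finally show ?thesis .
qed

lemma nn_integral_power_measure_exp:
  assumes "0 < a" "0 < l"
  shows "(\<integral>\<^sup>+u. ennreal (exp (- (l * u))) \<partial>power_measure a) = ennreal (Gamma a / l powr a)"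
proof -
  have 1: "(\<integral>\<^sup>+u. ennreal (exp (- u)) \<partial>power_measure a) = ennreal (Gamma a)"
  proof -
    have "((\<lambda>t. indicator {0<..} t * (t powr (a - 1) * exp (- t))) has_integral Gamma a) UNIV"
    proof (rule has_integral_spike[OF _ _ has_integral_restrict_UNIV[THEN iffD2, OF Gamma_integral_real[OF assms(1)]]])
      show "negligible {0::real}" by simp
    qed (auto simp: indicator_def exp_minus divide_inverse)
    from nn_integral_has_integral_lborel[OF _ _ this] show ?thesis
      by (subst nn_integral_power_measure)
         (auto intro!: nn_integral_cong simp: ennreal_mult[symmetric] indicator_def elim!: trans[rotated])
  qed
  have "(\<integral>\<^sup>+u. ennreal (exp (- (l * u))) \<partial>power_measure a) =
     ennreal ((1/l) powr a) * (\<integral>\<^sup>+u. ennreal (exp (- u)) \<partial>power_measure a)"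
    using assms by (subst nn_integral_power_measure_scale[where c="1/l"]) auto
  then show ?thesis using assms unfolding 1
    by (simp add: ennreal_mult[symmetric] powr_divide Gamma_real_nonneg)
qed

lemma has_bochner_integral_power_measure_exp:
  assumes "0 < a" "0 < l"
  shows "has_bochner_integral (power_measure a) (\<lambda>u. exp (- (l * u))) (Gamma a / l powr a)"
  by (rule has_bochner_integral_nn_integral)
     (use assms nn_integral_power_measure_exp in \<open>auto simp: Gamma_real_nonneg\<close>)

lemmas integrable_power_measure_exp = has_bochner_integral_power_measure_exp[THEN integrable.intros]
lemmas integral_power_measure_exp = has_bochner_integral_power_measure_exp[THEN has_bochner_integral_integral_eq]

lemma integrable_power_measure_exp_bound:
  fixes f :: "real \<Rightarrow> 'b::{banach, second_countable_topology}"
  assumes "0 < a" "0 < l" "f \<in> borel_measurable borel"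
    and "\<And>u. 0 < u \<Longrightarrow> norm (f u) \<le> C * exp (- (l * u))"
  shows "integrable (power_measure a) f"
proof (rule Bochner_Integration.integrable_bound[OF integrable_mult_right[OF integrable_power_measure_exp[OF assms(1,2)], of C]])
  show "AE x in power_measure a. norm (f x) \<le> norm (C * exp (- (l * x)))"
    using AE_power_measure by eventually_elim (use assms(4) in force)
qed (use assms(3) in \<open>auto simp: measurable_def\<close>)

section \<open>Uniqueness of the normalised parabolic cylinder function\<close>

lemma mult_lower_quarter: "1 \<le> (r::real)" if "1/2 < s * r" "s \<le> 1/4" "0 \<le> s"
proof (rule ccontr)
  assume "\<not> 1 \<le> r"
  then have "s * r \<le> s * 1" using that by (intro mult_left_mono) auto
  with that show False by simp
qed

text \<open>Wronskian argument. With w = u - v the Wronskian of u and w is a constant c, so q = w/u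
  has derivative c/u^2 far out on the real axis. Both functions have the same asymptotics, hence q
  tends to 0, while 1/u^2 grows because u decays; this forces c = 0, then q = 0 on a ray, and the
  identity theorem finishes.\<close>

lemma is_parabolic_cylinder_unique:
  assumes u: "is_parabolic_cylinder p u" and v: "is_parabolic_cylinder p v"
  shows "u = v"
proof -
  define w where "w = (\<lambda>z. u z - v z)"
  define g where "g = (\<lambda>x::real. x powr p * exp (- x\<^sup>2 / 4))"
  have hu: "u holomorphic_on UNIV" and hv: "v holomorphic_on UNIV"
    using u v by (auto simp: is_parabolic_cylinder_def)
  have hw: "w holomorphic_on UNIV" unfolding w_def by (intro holomorphic_intros hu hv)
  have du: "(u has_field_derivative deriv u z) (at z)" "(deriv u has_field_derivative deriv (deriv u) z) (at z)" for z
    using hu holomorphic_deriv[OF hu open_UNIV] by (auto intro!: holomorphic_derivI[of _ UNIV])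
  have dv: "(v has_field_derivative deriv v z) (at z)" "(deriv v has_field_derivative deriv (deriv v) z) (at z)" for z
    using hv holomorphic_deriv[OF hv open_UNIV] by (auto intro!: holomorphic_derivI[of _ UNIV])
  define dw where "dw = (\<lambda>z. deriv u z - deriv v z)"
  have dw: "(w has_field_derivative dw z) (at z)" for z
    unfolding w_def dw_def by (intro derivative_intros du dv)
  have ode: "deriv (deriv u) z = - ((of_real p + 1 / 2 - z\<^sup>2 / 4) * u z)"
    "deriv (deriv v) z = - ((of_real p + 1 / 2 - z\<^sup>2 / 4) * v z)" for z
    using u v unfolding is_parabolic_cylinder_def by (auto simp: eq_neg_iff_add_eq_0)
  have ddu: "(deriv u has_field_derivative - ((of_real p + 1 / 2 - z\<^sup>2 / 4) * u z)) (at z)" for z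
    using du(2)[of z] unfolding ode .
  have ddw: "(dw has_field_derivative - ((of_real p + 1 / 2 - z\<^sup>2 / 4) * w z)) (at z)" for z
    using DERIV_diff[OF du(2)[of z] dv(2)[of z]] unfolding ode dw_def w_def
    by (simp only: right_diff_distrib minus_diff_minus minus_diff_eq)
  have "\<exists>c. \<forall>z. u z * dw z - w z * deriv u z = c"
  proof -
    have "((\<lambda>z. u z * dw z - w z * deriv u z) has_field_derivative 0) (at z)" for z
      by (rule derivative_eq_intros du dw ddw ddu refl)+ (simp add: algebra_simps)
    then show ?thesis
      using has_field_derivative_zero_constant[of UNIV "\<lambda>z. u z * dw z - w z * deriv u z"] by auto
  qed
  then obtain c where c: "\<And>z. u z * dw z - w z * deriv u z = c" by blast
  have gnz: "\<forall>\<^sub>F x in at_top. of_real (g x) \<noteq> (0::complex)"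
    unfolding g_def by (rule eventually_mono[OF eventually_gt_at_top[of 0]]) auto
  have ag: "((\<lambda>x::real. h (of_real x) / of_real (g x)) \<longlongrightarrow> 1) at_top" if "is_parabolic_cylinder p h" for h
  proof -
    have "(\<lambda>x. h (of_real x)) \<sim>[at_top] (\<lambda>x. of_real (g x))"
      using that unfolding is_parabolic_cylinder_def g_def by blast
    then show ?thesis
      by (rule asymp_equivD_strong) (use gnz in eventually_elim, blast)
  qed
  note ug = ag[OF u] and vg = ag[OF v]
  have g0: "(g \<longlongrightarrow> 0) at_top" unfolding g_def by real_asymp
  have gpos: "\<forall>\<^sub>F x in at_top. g x > 0"
    unfolding g_def by (rule eventually_mono[OF eventually_gt_at_top[of 0]]) auto
  define q where "q = (\<lambda>x::real. w (of_real x) / u (of_real x))"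
  have "((\<lambda>x. Re ((of_real (g x) / u (of_real x))\<^sup>2)) \<longlongrightarrow> 1) at_top"
  proof -
    have "((\<lambda>x. Re ((inverse (u (of_real x) / of_real (g x)))\<^sup>2)) \<longlongrightarrow> Re ((inverse 1)\<^sup>2)) at_top"
      by (intro tendsto_intros ug) auto
    then show ?thesis by simp
  qed
  then have e1: "\<forall>\<^sub>F x in at_top. Re ((of_real (g x) / u (of_real x))\<^sup>2) > 1/2"
    by (rule order_tendstoD) simp
  have "((\<lambda>x. v (of_real x) / of_real (g x) / (u (of_real x) / of_real (g x))) \<longlongrightarrow> 1 / 1) at_top"
    by (intro tendsto_intros ug vg) auto
  then have vu: "((\<lambda>x. 1 - v (of_real x) / of_real (g x) / (u (of_real x) / of_real (g x))) \<longlongrightarrow> 1 - 1 / 1) at_top"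
    by (rule tendsto_diff[OF tendsto_const])
  have unz: "\<forall>\<^sub>F x::real in at_top. u (of_real x) \<noteq> 0"
    using e1 by eventually_elim auto
  have q0: "(q \<longlongrightarrow> 0) at_top"
  proof (rule Lim_transform_eventually)
    show "((\<lambda>x. 1 - v (of_real x) / of_real (g x) / (u (of_real x) / of_real (g x))) \<longlongrightarrow> 0) at_top"
      using vu by simp
    show "\<forall>\<^sub>F x in at_top. 1 - v (of_real x) / of_real (g x) / (u (of_real x) / of_real (g x)) = q x"
      using unz gpos by eventually_elim (auto simp: q_def w_def field_simps)
  qed
  have "\<forall>\<^sub>F x in at_top. g x < 1/2" using g0 by (rule order_tendstoD) simp
  \<comment> \<open>Since g < 1/2, the square g^2 is at most 1/4, whereas the real part of (g/u)^2
    exceeds 1/2; the quotient is therefore at least 1. The real part is what the mean value theorem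
    below can use, u being complex valued.\<close>
  with e1 gpos have "\<forall>\<^sub>F x in at_top. u (of_real x) \<noteq> 0 \<and> Re (1 / (u (of_real x))\<^sup>2) \<ge> 1"
  proof eventually_elim
    case (elim x)
    have "Re ((of_real (g x) / u (of_real x))\<^sup>2) = (g x)\<^sup>2 * Re (1 / (u (of_real x))\<^sup>2)"
    proof -
      have "(of_real (g x) / u (of_real x))\<^sup>2 = of_real ((g x)\<^sup>2) * (1 / (u (of_real x))\<^sup>2)"
        by (simp add: power_divide)
      then show ?thesis by (simp only: times_complex.sel Re_complex_of_real Im_complex_of_real)
    qed
    with elim have "(g x)\<^sup>2 * Re (1 / (u (of_real x))\<^sup>2) > 1/2" by simp
    moreover have "(g x)\<^sup>2 \<le> 1/4" using elim power_mono[of "g x" "1/2" 2] by (simp add: power2_eq_square)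
    ultimately have "Re (1 / (u (of_real x))\<^sup>2) \<ge> 1"
      by (rule mult_lower_quarter) auto
    with elim show ?case by auto
  qed
  then obtain X where X: "\<And>x. x \<ge> X \<Longrightarrow> u (of_real x) \<noteq> 0 \<and> Re (1 / (u (of_real x))\<^sup>2) \<ge> 1"
    by (auto simp: eventually_at_top_linorder)
  have dq: "(q has_vector_derivative c / (u (of_real x))\<^sup>2) (at x)" if "x \<ge> X" for x
  proof -
    have "((\<lambda>z. w z / u z) has_field_derivative (c / (u (of_real x))\<^sup>2)) (at (of_real x))"
      using DERIV_divide[OF dw du(1), of "of_real x"] X[OF that] c[of "of_real x"]
      by (simp add: power2_eq_square mult.commute)
    then show ?thesis unfolding q_def by (rule has_vector_derivative_real_field)
  qed
  have c0: "c = 0"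
  proof (rule ccontr)
    assume cn: "c \<noteq> 0"
    have drq: "((\<lambda>x. Re (q x / c)) has_real_derivative Re (1 / (u (of_real x))\<^sup>2)) (at x)" if "x \<ge> X" for x
    proof -
      have "((\<lambda>x. q x / c) has_vector_derivative (c / (u (of_real x))\<^sup>2) / c) (at x)"
        by (rule has_vector_derivative_divide[OF dq[OF that]])
      then show ?thesis using cn
        by (auto simp: has_real_derivative_iff_has_vector_derivative
            dest: bounded_linear.has_vector_derivative[OF bounded_linear_Re])
    qed
    \<comment> \<open>A growth of at least 1 on every unit interval is incompatible with q tending
      to 0.\<close>
    have "Re (q (x + 1) / c) - Re (q x / c) \<ge> 1" if "x \<ge> X" for x
    proof -
      from MVT2[of x "x+1" "\<lambda>x. Re (q x / c)" "\<lambda>x. Re (1 / (u (of_real x))\<^sup>2)"] drq that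
      obtain z where "z > x" "Re (q (x + 1) / c) - Re (q x / c) = Re (1 / (u (of_real z))\<^sup>2)" by auto
      with X[of z] that show ?thesis by auto
    qed
    moreover have "((\<lambda>x. Re (q (x + 1) / c) - Re (q x / c)) \<longlongrightarrow> Re (0 / c) - Re (0 / c)) at_top"
    proof -
      have "filterlim (\<lambda>x::real. x + 1) at_top at_top" by real_asymp
      from filterlim_compose[OF q0 this] have "((\<lambda>x. q (x + 1)) \<longlongrightarrow> 0) at_top" .
      then show ?thesis by (intro tendsto_diff tendsto_Re tendsto_divide q0 tendsto_const cn)
    qed
    ultimately have "1 \<le> Re (0 / c) - Re (0 / c)"
      by (intro tendsto_lowerbound[where F=at_top]) (auto intro!: eventually_mono[OF eventually_ge_at_top[of X]])
    then show False by simp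
  qed
  have qz: "q x = 0" if "x \<ge> X" for x
  proof -
    have "q y = q X" if "y \<ge> X" for y
    proof (rule has_derivative_zero_unique[of "{X..}" q, symmetric])
      fix t assume "t \<in> {X..}" then show "(q has_derivative (\<lambda>h. 0)) (at t within {X..})"
        using dq[of t] c0 by (auto simp: has_vector_derivative_def intro: has_derivative_at_withinI)
    qed (use that in auto)
    note qc = this
    have "(q \<longlongrightarrow> q X) at_top"
      by (rule tendsto_eventually) (rule eventually_mono[OF eventually_ge_at_top[of X]], rule qc)
    with q0 have "q X = 0" using tendsto_unique trivial_limit_at_top_linorder by blast
    with qc[OF that] show ?thesis by (rule trans)
  qed
  have wz: "w (of_real x) = 0" if "x \<ge> X" for x
    using qz[OF that] X[OF that] by (auto simp: q_def)
  have lim: "complex_of_real X islimpt complex_of_real ` {X..}"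
  proof (rule islimptI)
    fix T :: "complex set" assume "complex_of_real X \<in> T" "open T"
    then obtain e where e: "e > 0" "ball (of_real X) e \<subseteq> T" using open_contains_ball by blast
    have "complex_of_real (X + e/2) \<in> ball (of_real X) e"
      using e(1) by (simp add: dist_norm)
    then have "complex_of_real (X + e/2) \<in> T" using e(2) by blast
    moreover have "complex_of_real (X + e/2) \<in> complex_of_real ` {X..}"
      using e(1) by (intro imageI) auto
    moreover have "complex_of_real (X + e/2) \<noteq> complex_of_real X"
      using e(1) by (simp only: of_real_eq_iff)
    ultimately show "\<exists>y\<in>complex_of_real ` {X..}. y \<in> T \<and> y \<noteq> complex_of_real X" by blast
  qed
  have "w z = 0" for z
    by (rule analytic_continuation[OF hw open_UNIV connected_UNIV subset_UNIV UNIV_I lim _ UNIV_I])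
       (auto intro: wz)
  then show ?thesis by (auto simp: w_def fun_eq_iff)
qed

section \<open>Integral representation of the parabolic cylinder function for p < 1\<close>

lemma power_measure_shift_power:
  fixes f :: "real \<Rightarrow> 'b::{banach, second_countable_topology}"
  assumes [measurable]: "f \<in> borel_measurable borel"
  shows "integrable (power_measure (a + real n)) f \<longleftrightarrow> integrable (power_measure a) (\<lambda>u. (u ^ n) *\<^sub>R f u)"
    and "(\<integral>u. f u \<partial>power_measure (a + real n)) = (\<integral>u. (u ^ n) *\<^sub>R f u \<partial>power_measure a)"
proof -
  have eq: "(\<lambda>u. indicator {0<..} u *\<^sub>R (u powr (a + real n - 1)) *\<^sub>R f u) =
    (\<lambda>u. indicator {0<..} u *\<^sub>R (u powr (a - 1)) *\<^sub>R (u ^ n) *\<^sub>R f u)"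
    by (auto simp: indicator_def powr_add[symmetric] powr_realpow[symmetric] algebra_simps)
  show "integrable (power_measure (a + real n)) f \<longleftrightarrow> integrable (power_measure a) (\<lambda>u. (u ^ n) *\<^sub>R f u)"
    by (subst (1 2) integrable_power_measure_iff) (auto simp only: set_integrable_def eq, measurable)
  show "(\<integral>u. f u \<partial>power_measure (a + real n)) = (\<integral>u. (u ^ n) *\<^sub>R f u \<partial>power_measure a)"
    by (subst (1 2) integral_power_measure) (auto simp only: set_lebesgue_integral_def eq, measurable)
qed

lemmas power_measure_shift_1 = power_measure_shift_power[where n=1, simplified]
lemmas power_measure_shift_2 = power_measure_shift_power[where n=2, simplified]

lemma norm_integral_le_AE:
  fixes f :: "'a \<Rightarrow> 'b::{banach, second_countable_topology}"
  assumes "integrable M f" "integrable M g" "AE x in M. norm (f x) \<le> g x"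
  shows "norm (integral\<^sup>L M f) \<le> (\<integral>x. g x \<partial>M)"
  by (rule order_trans[OF integral_norm_bound integral_mono_AE]) (use assms in auto)

text \<open>For a > 0 this is Gamma(a) e^(z^2/4) D_(-a)(z), by the classical formula for negative
  order.\<close>

definition cylinder_integral :: "real \<Rightarrow> complex \<Rightarrow> complex" where
  "cylinder_integral a z = (\<integral>x. exp (- of_real x * z - of_real (x\<^sup>2 / 2)) \<partial>power_measure a)"

text \<open>Completing the square trades the Gaussian for e^(-x). The spare factor e^(x m) leaves
  room for the growth of e^(-x h) in a difference quotient, where |h| \<le> 1 allows m = 1.\<close>

lemma norm_cylinder_integrand:
  fixes z :: complex
  assumes "0 \<le> x"
  shows "norm (exp (- of_real x * z - of_real (x\<^sup>2 / 2))) * exp (x * m)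
    \<le> exp ((\<bar>Re z\<bar> + \<bar>m\<bar> + 1)\<^sup>2 / 2) * exp (- (1 * x))"
proof -
  have "- x * Re z + x * m - x\<^sup>2 / 2 + x \<le> x * (\<bar>Re z\<bar> + \<bar>m\<bar> + 1) - x\<^sup>2 / 2"
    using assms mult_left_mono[of "- Re z + m" "\<bar>Re z\<bar> + \<bar>m\<bar>" x] by (simp add: algebra_simps)
  also have "\<dots> \<le> (\<bar>Re z\<bar> + \<bar>m\<bar> + 1)\<^sup>2 / 2"
    using zero_le_power2[of "x - (\<bar>Re z\<bar> + \<bar>m\<bar> + 1)"] by (simp add: power2_eq_square algebra_simps)
  finally show ?thesis
    by (simp add: norm_exp_eq_Re exp_add[symmetric] algebra_simps)
qed

lemma integrable_cylinder_integrand: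
  assumes "0 < a"
  shows "integrable (power_measure a) (\<lambda>x. exp (- of_real x * z - of_real (x\<^sup>2 / 2) :: complex))"
  by (rule integrable_power_measure_exp_bound[OF assms zero_less_one, where C="exp ((\<bar>Re z\<bar> + \<bar>0\<bar> + 1)\<^sup>2 / 2)"])
     (measurable, use norm_cylinder_integrand[of _ z 0] in simp)

text \<open>Differentiation under the integral by hand: the second-order Taylor remainder of exp
  bounds the error of the difference quotient by |h| K, and K is finite because a factor x^2 only
  shifts the exponent of the weight by 2.\<close>

lemma DERIV_cylinder_integral:
  assumes a: "0 < a"
  shows "(cylinder_integral a has_field_derivative - cylinder_integral (a + 1) z) (at z)"
proof -
  let ?e = "\<lambda>x z. exp (- of_real x * z - of_real (x\<^sup>2 / 2)) :: complex"
  define C where "C = exp ((\<bar>Re z\<bar> + \<bar>1\<bar> + 1)\<^sup>2 / 2)"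
  have i1': "integrable (power_measure a) (\<lambda>x. of_real x * ?e x z)"
    using integrable_cylinder_integrand[of "a + 1" z] a
    by (simp add: power_measure_shift_1 scaleR_conv_of_real)
  have e1: "cylinder_integral (a + 1) z = (\<integral>x. of_real x * ?e x z \<partial>power_measure a)"
    unfolding cylinder_integral_def by (simp add: power_measure_shift_1 scaleR_conv_of_real)
  have i2: "integrable (power_measure a) (\<lambda>x. x\<^sup>2 * exp (- (1 * x)))"
    using integrable_power_measure_exp[of "a + 2" 1] a by (simp add: power_measure_shift_2)
  define K where "K = (\<integral>x. C * (x\<^sup>2 * exp (- (1 * x))) \<partial>power_measure a)"
  have bound: "norm ((cylinder_integral a (z + h) - cylinder_integral a z) / h + cylinder_integral (a + 1) z) \<le> norm h * K"
    if h: "norm h \<le> 1" "h \<noteq> 0" for h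
  proof -
    have "(cylinder_integral a (z + h) - cylinder_integral a z) / h + cylinder_integral (a + 1) z
      = (\<integral>x. (?e x (z + h) - ?e x z) / h + of_real x * ?e x z \<partial>power_measure a)"
      unfolding e1 unfolding cylinder_integral_def using h i1'
      by (simp add: integrable_cylinder_integrand[OF a, simplified])
    also have "norm \<dots> \<le> (\<integral>x. norm h * (C * (x\<^sup>2 * exp (- (1 * x)))) \<partial>power_measure a)"
    proof (rule norm_integral_le_AE)
      show "integrable (power_measure a) (\<lambda>x. (?e x (z + h) - ?e x z) / h + of_real x * ?e x z)"
        by (intro Bochner_Integration.integrable_add Bochner_Integration.integrable_diff integrable_divide_zero
            integrable_cylinder_integrand[OF a] i1')
      show "integrable (power_measure a) (\<lambda>x. norm h * (C * (x\<^sup>2 * exp (- (1 * x)))))"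
        by (intro integrable_mult_right i2)
      show "AE x in power_measure a. norm ((?e x (z + h) - ?e x z) / h + of_real x * ?e x z)
        \<le> norm h * (C * (x\<^sup>2 * exp (- (1 * x))))"
        using AE_power_measure
      proof eventually_elim
        case (elim x)
        let ?y = "- of_real x * h :: complex"
        have "(?e x (z + h) - ?e x z) / h + of_real x * ?e x z = ?e x z * (exp ?y - (1 + ?y)) / h"
        proof -
          have "?e x (z + h) = ?e x z * exp ?y" by (simp add: exp_add[symmetric] algebra_simps)
          moreover have "(E * Y - E) / h + of_real x * E = E * (Y - (1 + ?y)) / h" for E Y
            using h(2) by (simp add: field_simps)
          ultimately show ?thesis by simp
        qed
        also have "norm \<dots> = norm (?e x z) * norm (exp ?y - (1 + ?y)) / norm h"
          by (simp add: norm_mult norm_divide)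
        also have "norm (exp ?y - (1 + ?y)) \<le> exp (norm ?y) * (norm ?y)\<^sup>2"
          using Taylor_exp_field[of ?y 1] by (simp add: power2_eq_square)
        also have "norm (?e x z) * (exp (norm ?y) * (norm ?y)\<^sup>2) / norm h
            = (norm (?e x z) * exp (x * norm h)) * (x\<^sup>2 * norm h)"
          using elim h by (simp add: norm_mult power2_eq_square field_simps)
        also have "norm (?e x z) * exp (x * norm h) \<le> norm (?e x z) * exp (x * 1)"
          using elim h by (intro mult_left_mono) auto
        also have "\<dots> \<le> C * exp (- (1 * x))"
          unfolding C_def using elim by (intro norm_cylinder_integrand) auto
        finally show ?case using elim by (simp add: mult_ac divide_right_mono mult_left_mono mult_right_mono)
      qed
    qed
    also have "\<dots> = norm h * K" by (simp add: K_def)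
    finally show ?thesis .
  qed
  have "((\<lambda>h. (cylinder_integral a (z + h) - cylinder_integral a z) / h + cylinder_integral (a + 1) z) \<longlongrightarrow> 0) (at 0)"
  proof (rule Lim_null_comparison)
    show "\<forall>\<^sub>F h in at 0. norm ((cylinder_integral a (z + h) - cylinder_integral a z) / h + cylinder_integral (a + 1) z) \<le> norm h * K"
      unfolding eventually_at using bound by (intro exI[of _ 1]) (auto simp: dist_norm)
    have "((\<lambda>h::complex. norm h * K) \<longlongrightarrow> norm (0::complex) * K) (at 0)" by (intro tendsto_intros)
    then show "((\<lambda>h::complex. norm h * K) \<longlongrightarrow> 0) (at 0)" by simp
  qed
  then show ?thesis unfolding DERIV_def
    by (simp add: LIM_zero_iff[symmetric, where l="- cylinder_integral (a + 1) z"])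
qed

text \<open>Integrate the derivative of x^a e^(-xz - x^2/2) over the half-line; the boundary term at
  0 vanishes because a > 0. This is the three-term recurrence of the parabolic cylinder functions in
  disguise and closes the ODE computation.\<close>

lemma cylinder_integral_recurrence:
  assumes a: "0 < a"
  shows "of_real a * cylinder_integral a z = z * cylinder_integral (a + 1) z + cylinder_integral (a + 2) z"
proof -
  let ?e = "\<lambda>x. exp (- of_real x * z - of_real (x\<^sup>2 / 2)) :: complex"
  let ?F = "\<lambda>x. of_real (x powr a) * ?e x"
  let ?f = "\<lambda>x. (x powr (a - 1)) *\<^sub>R ((of_real a - of_real x * z - of_real (x\<^sup>2)) * ?e x)"
  define C where "C = exp ((\<bar>Re z\<bar> + \<bar>0\<bar> + 1)\<^sup>2 / 2)"
  have i1': "integrable (power_measure a) (\<lambda>x. of_real x * ?e x)" "integrable (power_measure a) (\<lambda>x. of_real (x\<^sup>2) * ?e x)"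
    using integrable_cylinder_integrand[of "a + 1" z] integrable_cylinder_integrand[of "a + 2" z] a
    by (simp_all add: power_measure_shift_1 power_measure_shift_2 scaleR_conv_of_real)
  have s1': "cylinder_integral (a + 1) z = (\<integral>x. of_real x * ?e x \<partial>power_measure a)"
     "cylinder_integral (a + 2) z = (\<integral>x. of_real (x\<^sup>2) * ?e x \<partial>power_measure a)"
    unfolding cylinder_integral_def by (simp_all add: power_measure_shift_1 power_measure_shift_2 scaleR_conv_of_real)
  have int: "integrable (power_measure a) (\<lambda>x. (of_real a - of_real x * z - of_real (x\<^sup>2)) * ?e x)"
  proof -
    have "integrable (power_measure a) (\<lambda>x. of_real a * ?e x - z * (of_real x * ?e x) - of_real (x\<^sup>2) * ?e x)"
      by (intro Bochner_Integration.integrable_diff integrable_mult_right i1' integrable_cylinder_integrand a)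
    then show ?thesis by (rule Bochner_Integration.integrable_cong[THEN iffD1, rotated 2]) (auto simp: algebra_simps)
  qed
  have "(LBINT x=0..\<infinity>. ?f x) = 0 - 0"
  proof (rule interval_integral_FTC_integrable[where F="?F"])
    show "(?F has_vector_derivative ?f x) (at x)" if "0 < ereal x" "ereal x < \<infinity>" for x
    proof -
      have x: "x > 0" using that by simp
      have 1: "((\<lambda>x. of_real (x powr a) :: complex) has_vector_derivative of_real (a * x powr (a - 1))) (at x)"
        using x by (intro has_vector_derivative_of_real)
          (auto simp: has_real_derivative_iff_has_vector_derivative[symmetric] intro!: derivative_eq_intros)
      have 2: "((\<lambda>x. - of_real x * z - of_real (x\<^sup>2 / 2)) has_vector_derivative (- z - of_real x)) (at x)"
        unfolding has_vector_derivative_def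
        by (auto intro!: derivative_eq_intros simp: scaleR_conv_of_real algebra_simps)
      have 3: "(?e has_vector_derivative (- z - of_real x) * ?e x) (at x)"
        using field_vector_diff_chain_at[OF 2 DERIV_exp] by (simp add: o_def)
      have "?f x = of_real (x powr a) * ((- z - of_real x) * ?e x) + of_real (a * x powr (a - 1)) * ?e x"
      proof -
        have "x powr a = x powr (a - 1) * x" using x by (simp add: powr_diff)
        then show ?thesis by (simp add: scaleR_conv_of_real algebra_simps power2_eq_square)
      qed
      then show ?thesis using has_vector_derivative_mult[OF 1 3] by simp
    qed
    show "isCont ?f x" if "0 < ereal x" "ereal x < \<infinity>" for x
      using that by (auto intro!: continuous_intros)
    show "set_integrable lborel (einterval 0 \<infinity>) ?f"
      using int by (subst (asm) integrable_power_measure_iff) (auto simp: zero_ereal_def)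
    have lim0: "(?F \<longlongrightarrow> 0) (at_right 0)"
    proof -
      have "(?F \<longlongrightarrow> of_real (0 powr a) * ?e 0) (at_right 0)"
        using a by (intro tendsto_intros tendsto_powr') (auto intro: eventually_at_right_less eventually_mono[OF eventually_at_right_less[of 0]])
      then show ?thesis using a by simp
    qed
    then show "((?F \<circ> real_of_ereal) \<longlongrightarrow> 0) (at_right 0)"
      by (simp add: zero_ereal_def ereal_tendsto_simps)
    have "(?F \<longlongrightarrow> 0) at_top"
    proof (rule Lim_null_comparison)
      show "\<forall>\<^sub>F x in at_top. norm (?F x) \<le> C * (x powr a * exp (- x))"
        using eventually_ge_at_top[of 0]
      proof eventually_elim
        case (elim x)
        have "norm (?F x) = x powr a * (norm (?e x) * exp (x * 0))" by (simp add: norm_mult)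
        also have "\<dots> \<le> x powr a * (C * exp (- (1 * x)))" unfolding C_def
          by (intro mult_left_mono norm_cylinder_integrand elim) auto
        finally show ?case by (simp add: mult_ac)
      qed
      have "((\<lambda>x. x powr a * exp (- x)) \<longlongrightarrow> 0) at_top" by real_asymp
      from tendsto_mult_left[OF this, of C] show "((\<lambda>x. C * (x powr a * exp (- x))) \<longlongrightarrow> 0) at_top" by simp
    qed
    then show "((?F \<circ> real_of_ereal) \<longlongrightarrow> 0) (at_left \<infinity>)"
      by (simp add: ereal_tendsto_simps)
  qed simp
  then have "0 = (LBINT x:{0<..}. ?f x)"
    by (simp add: interval_lebesgue_integral_def zero_ereal_def)
  also have "\<dots> = (\<integral>x. (of_real a - of_real x * z - of_real (x\<^sup>2)) * ?e x \<partial>power_measure a)"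
    by (subst integral_power_measure) auto
  also have "\<dots> = (\<integral>x. of_real a * ?e x - z * (of_real x * ?e x) - of_real (x\<^sup>2) * ?e x \<partial>power_measure a)"
    by (rule Bochner_Integration.integral_cong) (auto simp: algebra_simps)
  also have "\<dots> = of_real a * cylinder_integral a z - z * cylinder_integral (a + 1) z - cylinder_integral (a + 2) z"
    unfolding s1' unfolding cylinder_integral_def
    by (subst Bochner_Integration.integral_diff, (intro Bochner_Integration.integrable_diff integrable_mult_right i1' integrable_cylinder_integrand a)+)+ simp
  finally show ?thesis by (simp add: algebra_simps)
qed

lemma cylinder_integral_of_real:
  "cylinder_integral a (of_real x) = of_real (\<integral>u. exp (- u * x - u\<^sup>2 / 2) \<partial>power_measure a)"
  unfolding cylinder_integral_def
  by (subst integral_complex_of_real[symmetric]) (simp add: exp_of_real[symmetric])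

lemma integrable_cylinder_real:
  assumes "0 < a"
  shows "integrable (power_measure a) (\<lambda>u. exp (- u * x - u\<^sup>2 / 2))"
  using integrable_cylinder_integrand[OF assms, of "of_real x"]
  by (subst complex_of_real_integrable_eq[symmetric]) (simp add: exp_of_real[symmetric])

text \<open>Squeezed by 1 - u^2/2 \<le> e^(-u^2/2) \<le> 1: both outer integrals are Gamma
  integrals, and the lower one loses only a term of order x^(-2).\<close>

lemma tendsto_cylinder_integral:
  assumes a: "0 < a"
  shows "((\<lambda>x. x powr a * (\<integral>u. exp (- u * x - u\<^sup>2 / 2) \<partial>power_measure a)) \<longlongrightarrow> Gamma a) at_top"
proof (rule tendsto_sandwich)
  have i2: "integrable (power_measure a) (\<lambda>u. u\<^sup>2 * exp (- (x * u)))"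
    and s2: "(\<integral>u. u\<^sup>2 * exp (- (x * u)) \<partial>power_measure a) = Gamma (a + 2) / x powr (a + 2)" if "x > 0" for x
    using integrable_power_measure_exp[of "a + 2" x] integral_power_measure_exp[of "a + 2" x] a that
    by (simp_all add: power_measure_shift_2)
  show "\<forall>\<^sub>F x in at_top. x powr a * (\<integral>u. exp (- u * x - u\<^sup>2 / 2) \<partial>power_measure a) \<le> Gamma a"
    using eventually_gt_at_top[of 0]
  proof eventually_elim
    case (elim x)
    have "(\<integral>u. exp (- u * x - u\<^sup>2 / 2) \<partial>power_measure a) \<le> (\<integral>u. exp (- (x * u)) \<partial>power_measure a)"
      using a elim by (intro integral_mono integrable_cylinder_real integrable_power_measure_exp) (auto simp: mult.commute)
    then have "(\<integral>u. exp (- u * x - u\<^sup>2 / 2) \<partial>power_measure a) \<le> Gamma a / x powr a"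
      using elim a by (simp add: integral_power_measure_exp)
    from mult_left_mono[OF this, of "x powr a"] show ?case using elim by simp
  qed
  show "\<forall>\<^sub>F x in at_top. Gamma a - Gamma (a + 2) / (2 * x\<^sup>2) \<le> x powr a * (\<integral>u. exp (- u * x - u\<^sup>2 / 2) \<partial>power_measure a)"
    using eventually_gt_at_top[of 0]
  proof eventually_elim
    case (elim x)
    have "(\<integral>u. exp (- (x * u)) - 1/2 * (u\<^sup>2 * exp (- (x * u))) \<partial>power_measure a) \<le> (\<integral>u. exp (- u * x - u\<^sup>2 / 2) \<partial>power_measure a)"
    proof (rule integral_mono_AE)
      show "AE u in power_measure a. exp (- (x * u)) - 1/2 * (u\<^sup>2 * exp (- (x * u))) \<le> exp (- u * x - u\<^sup>2 / 2)"
        using AE_power_measure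
      proof eventually_elim
        case (elim u)
        have "exp (- (x * u)) * (1 - u\<^sup>2 / 2) \<le> exp (- (x * u)) * exp (- (u\<^sup>2 / 2))"
          using exp_ge_add_one_self[of "- (u\<^sup>2 / 2)"] by (intro mult_left_mono) auto
        then show ?case using elim by (simp add: exp_add[symmetric] algebra_simps)
      qed
      show "integrable (power_measure a) (\<lambda>u. exp (- (x * u)) - 1/2 * (u\<^sup>2 * exp (- (x * u))))"
        by (intro Bochner_Integration.integrable_diff integrable_mult_right i2 integrable_power_measure_exp a elim)
    qed (rule integrable_cylinder_real[OF a])
    also have "(\<integral>u. exp (- (x * u)) - 1/2 * (u\<^sup>2 * exp (- (x * u))) \<partial>power_measure a) = Gamma a / x powr a - 1/2 * (Gamma (a + 2) / x powr (a + 2))"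
      using a elim i2 s2 by (subst Bochner_Integration.integral_diff) (auto intro!: integrable_power_measure_exp simp: integral_power_measure_exp)
    finally have "x powr a * (Gamma a / x powr a - 1/2 * (Gamma (a + 2) / x powr (a + 2))) \<le> x powr a * (\<integral>u. exp (- u * x - u\<^sup>2 / 2) \<partial>power_measure a)"
      by (intro mult_left_mono) auto
    moreover have "x powr (a + 2) = x powr a * x\<^sup>2" using elim by (simp add: powr_add)
    ultimately show ?case using elim by (simp add: right_diff_distrib)
  qed
  show "((\<lambda>x. Gamma a - Gamma (a + 2) / (2 * x\<^sup>2)) \<longlongrightarrow> Gamma a) at_top" by real_asymp
qed simp

text \<open>The formula is the recurrence D_p = z D_(p-1) + (1 - p) D_(p-2) written with
  \<open>cylinder_integral\<close>. Both terms on the right have negative order as soon as p < 1, so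
  the range 0 \<le> p < 1 is reached as well.\<close>

lemma is_parabolic_cylinder_integral:
  assumes p: "p < 1"
  shows "is_parabolic_cylinder p (\<lambda>z. exp (- z\<^sup>2 / 4) *
    (z * cylinder_integral (1 - p) z + cylinder_integral (2 - p) z) / of_real (Gamma (1 - p)))"
proof -
  define a where "a = 1 - p"
  have a: "0 < a" and ap: "1 - p = a" "2 - p = a + 1" "p = 1 - a" using p by (auto simp: a_def)
  define N where "N = (\<lambda>z. z * cylinder_integral a z + cylinder_integral (a + 1) z)"
  define u where "u = (\<lambda>z. exp (- z\<^sup>2 / 4) * N z / of_real (Gamma a) :: complex)"
  have G: "Gamma a > 0" using a by (rule Gamma_real_pos)
  note dI = DERIV_cylinder_integral[OF a] DERIV_cylinder_integral[of "a+1"]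
  \<comment> \<open>Writing I(a) for \<open>cylinder_integral a z\<close>, the recurrence collapses
    the derivative to I(a) - a I(a) = p I(a), a single integral.\<close>
  have dN: "(N has_field_derivative of_real p * cylinder_integral a z) (at z)" for z
  proof -
    have "(N has_field_derivative (cylinder_integral a z + z * (- cylinder_integral (a + 1) z) + (- cylinder_integral (a + 1 + 1) z))) (at z)"
      unfolding N_def using a by (auto intro!: derivative_eq_intros dI)
    also have "cylinder_integral a z + z * (- cylinder_integral (a + 1) z) + (- cylinder_integral (a + 1 + 1) z) = of_real p * cylinder_integral a z"
      using cylinder_integral_recurrence[OF a, of z] by (simp add: ap(3) algebra_simps add.assoc)
    finally show ?thesis .
  qed
  define u1 where "u1 = (\<lambda>z. exp (- z\<^sup>2 / 4) * (of_real p * cylinder_integral a z - z / 2 * N z) / of_real (Gamma a))"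
  have du: "(u has_field_derivative u1 z) (at z)" for z
    unfolding u_def u1_def using G
    by (auto intro!: derivative_eq_intros dN simp: field_simps)
  have du1: "(u1 has_field_derivative - ((of_real p + 1 / 2 - z\<^sup>2 / 4) * u z)) (at z)" for z
  proof -
    have "(u1 has_field_derivative (exp (- z\<^sup>2 / 4) * (- z / 2) * (of_real p * cylinder_integral a z - z / 2 * N z)
      + exp (- z\<^sup>2 / 4) * (of_real p * (- cylinder_integral (a + 1) z) - (1 / 2 * N z + z / 2 * (of_real p * cylinder_integral a z)))) / of_real (Gamma a)) (at z)"
      unfolding u1_def using G
      by (auto intro!: derivative_eq_intros dN dI) (simp add: field_simps)
    also have "(exp (- z\<^sup>2 / 4) * (- z / 2) * (of_real p * cylinder_integral a z - z / 2 * N z)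
      + exp (- z\<^sup>2 / 4) * (of_real p * (- cylinder_integral (a + 1) z) - (1 / 2 * N z + z / 2 * (of_real p * cylinder_integral a z))))
      = - ((of_real p + 1 / 2 - z\<^sup>2 / 4) * (exp (- z\<^sup>2 / 4) * N z))"
      unfolding N_def by (simp add: field_simps power2_eq_square)
    finally show ?thesis by (simp add: u_def)
  qed
  have eq: "deriv u = u1" "deriv u1 = (\<lambda>z. - ((of_real p + 1 / 2 - z\<^sup>2 / 4) * u z))"
    using du du1 by (auto intro!: DERIV_imp_deriv)
  have "u holomorphic_on UNIV" using du by (auto simp: holomorphic_on_def field_differentiable_def)
  moreover have "(\<lambda>x::real. u (of_real x)) \<sim>[at_top] (\<lambda>x. of_real (x powr p * exp (- x\<^sup>2 / 4)))"
  proof (rule asymp_equivI')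
    let ?I = "\<lambda>a x. \<integral>u. exp (- u * x - u\<^sup>2 / 2) \<partial>power_measure a"
    have "((\<lambda>x. (x powr a * ?I a x + x powr (-2) * (x powr (a + 1) * ?I (a + 1) x)) / Gamma a) \<longlongrightarrow> (Gamma a + 0 * Gamma (a + 1)) / Gamma a) at_top"
    proof -
      have "((\<lambda>x::real. x powr (-2)) \<longlongrightarrow> 0) at_top" by real_asymp
      moreover have "Gamma a \<noteq> 0" using G by simp
      ultimately show ?thesis using a by (intro tendsto_intros tendsto_cylinder_integral) auto
    qed
    then have "((\<lambda>x. complex_of_real ((x powr a * ?I a x + x powr (-2) * (x powr (a + 1) * ?I (a + 1) x)) / Gamma a)) \<longlongrightarrow> of_real 1) at_top"
      using G by (intro tendsto_of_real) simp
    moreover have "\<forall>\<^sub>F x in at_top. complex_of_real ((x powr a * ?I a x + x powr (-2) * (x powr (a + 1) * ?I (a + 1) x)) / Gamma a)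
       = u (of_real x) / of_real (x powr p * exp (- x\<^sup>2 / 4))"
      using eventually_gt_at_top[of 0]
    proof eventually_elim
      case (elim x)
      have "u (of_real x) = of_real (exp (- x\<^sup>2 / 4) * (x * ?I a x + ?I (a + 1) x) / Gamma a)"
        unfolding u_def N_def cylinder_integral_of_real by (simp add: exp_of_real[symmetric])
      moreover have "x powr a * ?I a x + x powr (-2) * (x powr (a + 1) * ?I (a + 1) x) = (x * ?I a x + ?I (a + 1) x) / x powr p"
      proof -
        have "x powr a = x / x powr p" "x powr (-2) * x powr (a + 1) = 1 / x powr p"
          using elim by (auto simp: ap(3) powr_diff powr_add[symmetric] powr_minus_divide[symmetric])
        then show ?thesis by (simp add: add_divide_distrib mult.assoc[symmetric])
      qed
      ultimately show ?case using elim by (simp only: of_real_divide[symmetric]) simp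
    qed
    ultimately show "((\<lambda>x. u (of_real x) / of_real (x powr p * exp (- x\<^sup>2 / 4))) \<longlongrightarrow> 1) at_top"
      by (auto intro: Lim_transform_eventually)
  qed
  ultimately have "is_parabolic_cylinder p u"
    unfolding is_parabolic_cylinder_def eq by simp
  then show ?thesis unfolding u_def N_def ap(1,2) .
qed

section \<open>The heat flux and the Abel transform\<close>

text \<open>Equal to - sqrt(2 pi) times the space derivative of the Gaussian heat kernel at time r.
  For x > 0 it is, up to the factor sqrt(2 pi), the density of the first passage of Brownian motion
  to the level x.\<close>

definition heat_flux :: "real \<Rightarrow> real \<Rightarrow> real" where
  "heat_flux x r = x / (r * sqrt r) * exp (- x\<^sup>2 / (2 * r))"

lemma borel_measurable_heat_flux [measurable (raw)]:
  assumes "f \<in> borel_measurable M" "g \<in> borel_measurable M"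
  shows "(\<lambda>x. heat_flux (f x) (g x)) \<in> borel_measurable M"
  unfolding heat_flux_def using assms by measurable

text \<open>With v = w + 1 it suffices to bound |w + 1| by 2 e^(w^2/2); the constant is 2 e^(1/2)
  \<le> 4. Replacing the Gaussian by a plain exponential keeps later integrals against the power
  weights explicit Gamma integrals.\<close>

lemma abs_mult_exp_le: "\<bar>v\<bar> * exp (- v\<^sup>2 / 2) \<le> 4 * exp (- (v::real))"
proof -
  define w where "w = v - 1"
  have 1: "\<bar>w\<bar> \<le> exp (w\<^sup>2 / 2)"
  proof -
    have "\<bar>w\<bar> \<le> 1 + w\<^sup>2 / 2" using zero_le_power2[of "\<bar>w\<bar> - 1"] by (simp add: power2_diff)
    also have "\<dots> \<le> exp (w\<^sup>2 / 2)" by (rule exp_ge_add_one_self)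
    finally show ?thesis .
  qed
  have "\<bar>v\<bar> \<le> 1 + \<bar>w\<bar>" by (simp add: w_def)
  also have "\<dots> \<le> 2 * exp (w\<^sup>2 / 2)" using 1 by (smt (verit) one_le_exp_iff zero_le_power2 divide_nonneg_pos)
  finally have "\<bar>v\<bar> * exp (- v\<^sup>2 / 2) \<le> 2 * exp (w\<^sup>2 / 2) * exp (- v\<^sup>2 / 2)" by (rule mult_right_mono) simp
  also have "\<dots> = 2 * exp (1/2) * exp (- v)"
    by (simp add: exp_add[symmetric] w_def power2_diff field_simps)
  also have "2 * exp (1/2) \<le> (4::real)"
    using exp_bound[of "1/2"] by (simp add: power2_eq_square)
  finally show ?thesis by simp
qed

lemma abs_heat_flux_le:
  assumes "0 < r"
  shows "\<bar>heat_flux x r\<bar> \<le> 4 / r * exp (- x / sqrt r)"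
proof -
  let ?v = "x / sqrt r"
  have "\<bar>heat_flux x r\<bar> = (\<bar>?v\<bar> * exp (- ?v\<^sup>2 / 2)) / r"
    using assms by (simp add: heat_flux_def abs_mult power_divide mult.commute)
  also have "\<dots> \<le> (4 * exp (- ?v)) / r"
    using assms by (intro divide_right_mono abs_mult_exp_le) auto
  finally show ?thesis by simp
qed

lemma parabolic_cylinder_eq:
  assumes "p < 1"
  shows "parabolic_cylinder p = (\<lambda>z. exp (- z\<^sup>2 / 4) *
    (z * cylinder_integral (1 - p) z + cylinder_integral (2 - p) z) / of_real (Gamma (1 - p)))"
  unfolding parabolic_cylinder_def
  using is_parabolic_cylinder_integral[OF assms] is_parabolic_cylinder_unique by (intro the_equality) blast+

text \<open>Substituting u -> sqrt(t) u reduces to t = 1. There the two factors e^(-z^2/4), one from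
  the kernel and one from D_p, complete the square in e^(-uz - u^2/2), so that the recurrence form
  of D_p becomes the integral of (z + u) e^(-(z+u)^2/2).\<close>

theorem passage_kernel_eq:
  assumes p: "p < 1" and t: "0 < t"
  shows "passage_kernel p x t = (\<integral>u. heat_flux (x + u) t \<partial>power_measure (1 - p)) / Gamma (1 - p)"
proof -
  define a where "a = 1 - p"
  have a: "0 < a" and ap: "1 - p = a" "2 - p = a + 1" using p by (auto simp: a_def)
  define z where "z = x / sqrt t"
  let ?I = "\<lambda>a. \<integral>u. exp (- u * z - u\<^sup>2 / 2) \<partial>power_measure a"
  have "parabolic_cylinder p (of_real z) = of_real (exp (- z\<^sup>2 / 4) * (z * ?I a + ?I (a + 1)) / Gamma a)"
    unfolding parabolic_cylinder_eq[OF p] ap cylinder_integral_of_real by (simp add: exp_of_real[symmetric])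
  then have 1: "parabolic_cylinder_real p z = exp (- z\<^sup>2 / 4) * (z * ?I a + ?I (a + 1)) / Gamma a"
    unfolding parabolic_cylinder_real_def by (simp only: Re_complex_of_real)
  have i: "integrable (power_measure a) (\<lambda>u. u * exp (- u * z - u\<^sup>2 / 2))"
    using integrable_cylinder_real[of "a + 1" z] a by (simp add: power_measure_shift_1)
  have "z * ?I a + ?I (a + 1) = (\<integral>u. z * exp (- u * z - u\<^sup>2 / 2) + u * exp (- u * z - u\<^sup>2 / 2) \<partial>power_measure a)"
    using i integrable_cylinder_real[OF a, of z] by (simp add: power_measure_shift_1)
  then have "exp (- z\<^sup>2 / 2) * (z * ?I a + ?I (a + 1)) =
    (\<integral>u. exp (- z\<^sup>2 / 2) * (z * exp (- u * z - u\<^sup>2 / 2) + u * exp (- u * z - u\<^sup>2 / 2)) \<partial>power_measure a)"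
    by simp
  also have "\<dots> = (\<integral>u. (z + u) * exp (- (z + u)\<^sup>2 / 2) \<partial>power_measure a)"
  proof (rule Bochner_Integration.integral_cong[OF refl])
    fix u
    have "exp (- z\<^sup>2 / 2) * exp (- u * z - u\<^sup>2 / 2) = exp (- (z + u)\<^sup>2 / 2)"
      by (simp add: exp_add[symmetric] power2_sum field_simps)
    then show "exp (- z\<^sup>2 / 2) * (z * exp (- u * z - u\<^sup>2 / 2) + u * exp (- u * z - u\<^sup>2 / 2)) = (z + u) * exp (- (z + u)\<^sup>2 / 2)"
      by (simp only: distrib_right[symmetric] mult.left_commute[of _ "z + u"])
  qed
  finally have 2: "exp (- z\<^sup>2 / 2) * (z * ?I a + ?I (a + 1)) = (\<integral>u. (z + u) * exp (- (z + u)\<^sup>2 / 2) \<partial>power_measure a)" .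
  have "(\<integral>u. heat_flux (x + u) t \<partial>power_measure a) = sqrt t powr a * (\<integral>u. heat_flux (x + sqrt t * u) t \<partial>power_measure a)"
    using t by (subst integral_power_measure_scale[where c="sqrt t"]) auto
  also have "(\<integral>u. heat_flux (x + sqrt t * u) t \<partial>power_measure a) = (\<integral>u. ((z + u) * exp (- (z + u)\<^sup>2 / 2)) / t \<partial>power_measure a)"
  proof (rule Bochner_Integration.integral_cong[OF refl])
    fix u
    have "x + sqrt t * u = sqrt t * (z + u)" using t by (simp add: z_def field_simps)
    then show "heat_flux (x + sqrt t * u) t = ((z + u) * exp (- (z + u)\<^sup>2 / 2)) / t"
      using t by (simp only: heat_flux_def power_mult_distrib) simp
  qed
  also have "\<dots> = (exp (- z\<^sup>2 / 2) * (z * ?I a + ?I (a + 1))) / t" using 2 by simp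
  finally have 3: "(\<integral>u. heat_flux (x + u) t \<partial>power_measure a) = sqrt t powr a / t * (exp (- z\<^sup>2 / 2) * (z * ?I a + ?I (a + 1)))"
    by simp
  have "sqrt t powr a / t = 1 / t powr ((p + 1) / 2)"
  proof -
    have "sqrt t powr a / t = t powr (a / 2 - 1)" using t by (simp add: powr_half_sqrt[symmetric] powr_powr powr_diff)
    also have "a / 2 - 1 = - ((p + 1) / 2)" by (simp add: a_def field_simps)
    finally show ?thesis by (simp only: powr_minus_divide)
  qed
  moreover have "exp (- x\<^sup>2 / (4 * t)) * exp (- z\<^sup>2 / 4) = exp (- z\<^sup>2 / 2)"
    using t by (simp add: exp_add[symmetric] z_def power_divide field_simps)
  ultimately show ?thesis
    unfolding passage_kernel_def z_def[symmetric] 1 3 ap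
    by (simp add: mult.assoc[symmetric])
qed

section \<open>Semigroup property and injectivity of the Abel transform\<close>

lemma continuous_within_integral_dominated:
  fixes f :: "real \<Rightarrow> 'a \<Rightarrow> real"
  assumes meas: "\<And>x. x \<in> S \<Longrightarrow> f x \<in> borel_measurable M"
    and x0: "x0 \<in> S" and g: "integrable M g"
    and bound: "\<And>x. x \<in> S \<Longrightarrow> AE y in M. \<bar>f x y\<bar> \<le> g y"
    and cont: "AE y in M. continuous (at x0 within S) (\<lambda>x. f x y)"
  shows "continuous (at x0 within S) (\<lambda>x. \<integral>y. f x y \<partial>M)"
  unfolding continuous_within tendsto_at_iff_sequentially
proof (intro allI impI)
  fix X assume X: "\<forall>i. X i \<in> S - {x0}" "X \<longlonglongrightarrow> x0"
  have "(\<lambda>i. \<integral>y. f (X i) y \<partial>M) \<longlonglongrightarrow> (\<integral>y. f x0 y \<partial>M)"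
  proof (rule integral_dominated_convergence[where w=g])
    show "AE y in M. (\<lambda>i. f (X i) y) \<longlonglongrightarrow> f x0 y"
      using cont
    proof eventually_elim
      case (elim y)
      then show ?case using X unfolding continuous_within tendsto_at_iff_sequentially by (auto simp: o_def)
    qed
    show "AE y in M. norm (f (X i) y) \<le> g y" for i using bound[of "X i"] X by auto
  qed (use X meas x0 g in auto)
  then show "((\<lambda>x. \<integral>y. f x y \<partial>M) \<circ> X) \<longlonglongrightarrow> (\<integral>y. f x0 y \<partial>M)" by (simp add: o_def)
qed

text \<open>The convolution of u^(a-1) and u^(d-1) is a Beta multiple of u^(a+d-1): the semigroup
  property of fractional integrals without their Gamma normalisation.\<close>

lemma nn_integral_power_measure_add:
  assumes a: "0 < a" and d: "0 < d"
  obtains B :: real where "0 < B" and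
    "\<And>f. f \<in> borel_measurable borel \<Longrightarrow>
      (\<integral>\<^sup>+v. \<integral>\<^sup>+u. f (u + v) \<partial>power_measure a \<partial>power_measure d) = ennreal B * (\<integral>\<^sup>+z. f z \<partial>power_measure (a + d))"
proof -
  define b where "b = (\<integral>\<^sup>+v. ennreal (indicator {0<..<1} v * v powr (d - 1) * (1 - v) powr (a - 1)) \<partial>lborel)"
  have main: "(\<integral>\<^sup>+v. \<integral>\<^sup>+u. f (u + v) \<partial>power_measure a \<partial>power_measure d) = b * (\<integral>\<^sup>+z. f z \<partial>power_measure (a + d))"
    if [measurable]: "f \<in> borel_measurable borel" for f :: "real \<Rightarrow> ennreal"
  proof -
    let ?k = "\<lambda>z v. ennreal (indicator {0<..} v * indicator {0<..} (z - v) * v powr (d - 1) * (z - v) powr (a - 1))"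
    have inner: "(\<integral>\<^sup>+u. f (u + v) \<partial>power_measure a) = (\<integral>\<^sup>+z. ennreal (indicator {v<..} z * (z - v) powr (a - 1)) * f z \<partial>lborel)" for v
    proof -
      have "(\<integral>\<^sup>+z. ennreal (indicator {v<..} z * (z - v) powr (a - 1)) * f z \<partial>lborel)
        = (\<integral>\<^sup>+u. ennreal (indicator {v<..} (v + 1 * u) * ((v + 1 * u) - v) powr (a - 1)) * f (v + 1 * u) \<partial>lborel)"
        by (subst nn_integral_real_affine[where c=1 and t=v]) auto
      also have "\<dots> = (\<integral>\<^sup>+u. f (u + v) \<partial>power_measure a)"
        by (subst nn_integral_power_measure) (auto intro!: nn_integral_cong simp: indicator_def add.commute)
      finally show ?thesis by simp
    qed
    have kint: "(\<integral>\<^sup>+v. ?k z v \<partial>lborel) = ennreal (indicator {0<..} z * z powr (a + d - 1)) * b" for z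
    proof (cases "z > 0")
      case True
      have "(\<integral>\<^sup>+v. ?k z v \<partial>lborel) = ennreal z * (\<integral>\<^sup>+v. ?k z (0 + z * v) \<partial>lborel)"
        using True by (subst nn_integral_real_affine[where c=z and t=0]) auto
      also have "(\<integral>\<^sup>+v. ?k z (0 + z * v) \<partial>lborel) =
        (\<integral>\<^sup>+v. ennreal (z powr (d - 1) * z powr (a - 1)) * ennreal (indicator {0<..<1} v * v powr (d - 1) * (1 - v) powr (a - 1)) \<partial>lborel)"
      proof (rule nn_integral_cong)
        fix v
        have "(z - z * v) powr (a - 1) = z powr (a - 1) * (1 - v) powr (a - 1)" if "0 < v" "v < 1"
          using True that by (subst powr_mult[symmetric]) (auto simp: algebra_simps)
        then show "?k z (0 + z * v) = ennreal (z powr (d - 1) * z powr (a - 1)) * ennreal (indicator {0<..<1} v * v powr (d - 1) * (1 - v) powr (a - 1))"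
          using True by (auto simp: indicator_def powr_mult ennreal_mult[symmetric] zero_less_mult_iff mult_ac)
      qed
      also have "\<dots> = ennreal (z powr (d - 1) * z powr (a - 1)) * b"
        unfolding b_def by (rule nn_integral_cmult) measurable
      also have "ennreal z * \<dots> = ennreal (z * (z powr (d - 1) * z powr (a - 1))) * b"
        using True by (simp add: ennreal_mult mult.assoc)
      also have "z * (z powr (d - 1) * z powr (a - 1)) = z powr (a + d - 1)"
        using True by (simp add: powr_add[symmetric] powr_mult_base algebra_simps)
      finally show ?thesis using True by simp
    next
      case False
      then have "?k z = (\<lambda>v. 0)" by (auto simp: indicator_def)
      then show ?thesis using False by simp
    qed
    have "(\<integral>\<^sup>+v. \<integral>\<^sup>+u. f (u + v) \<partial>power_measure a \<partial>power_measure d)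
      = (\<integral>\<^sup>+v. ennreal (indicator {0<..} v * v powr (d - 1)) * (\<integral>\<^sup>+z. ennreal (indicator {v<..} z * (z - v) powr (a - 1)) * f z \<partial>lborel) \<partial>lborel)"
      unfolding inner by (subst nn_integral_power_measure) (auto intro!: nn_integral_cong simp: indicator_def)
    also have "\<dots> = (\<integral>\<^sup>+v. \<integral>\<^sup>+z. ?k z v * f z \<partial>lborel \<partial>lborel)"
      by (subst nn_integral_cmult[symmetric], measurable)
         (auto intro!: nn_integral_cong simp: indicator_def ennreal_mult[symmetric] mult.assoc[symmetric])
    also have "\<dots> = (\<integral>\<^sup>+z. \<integral>\<^sup>+v. ?k z v * f z \<partial>lborel \<partial>lborel)"
      by (rule lborel_pair.Fubini') measurable
    also have "\<dots> = (\<integral>\<^sup>+z. b * (ennreal (indicator {0<..} z * z powr (a + d - 1)) * f z) \<partial>lborel)"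
      by (intro nn_integral_cong, subst nn_integral_multc, measurable) (subst kint, simp add: mult_ac)
    also have "\<dots> = b * (\<integral>\<^sup>+z. f z \<partial>power_measure (a + d))"
    proof -
      have "(\<integral>\<^sup>+z. f z \<partial>power_measure (a + d)) = (\<integral>\<^sup>+z. ennreal (indicator {0<..} z * z powr (a + d - 1)) * f z \<partial>lborel)"
        by (subst nn_integral_power_measure) (auto intro!: nn_integral_cong simp: indicator_def)
      then show ?thesis by (simp add: nn_integral_cmult)
    qed
    finally show ?thesis .
  qed
  have "(\<integral>\<^sup>+v. \<integral>\<^sup>+u. ennreal (exp (- (u + v))) \<partial>power_measure a \<partial>power_measure d) = ennreal (Gamma a * Gamma d)"
  proof -
    have "(\<integral>\<^sup>+u. ennreal (exp (- (u + v))) \<partial>power_measure a) = ennreal (exp (- (1 * v))) * ennreal (Gamma a)" for v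
      using nn_integral_power_measure_exp[OF a zero_less_one]
      by (subst nn_integral_cmult[symmetric, where f = "\<lambda>u. ennreal (exp (- (1 * u)))", THEN trans, of _ "ennreal (exp (- (1 * v)))", symmetric])
         (auto simp: ennreal_mult[symmetric] exp_add[symmetric] mult_ac add.commute intro!: nn_integral_cong)
    then have "(\<integral>\<^sup>+v. \<integral>\<^sup>+u. ennreal (exp (- (u + v))) \<partial>power_measure a \<partial>power_measure d)
      = (\<integral>\<^sup>+v. ennreal (exp (- (1 * v))) \<partial>power_measure d) * ennreal (Gamma a)"
      by (simp only: nn_integral_multc[of "\<lambda>v. ennreal (exp (- (1 * v)))"] measurable_ident_sets) (subst nn_integral_multc, auto)
    then show ?thesis using nn_integral_power_measure_exp[OF d zero_less_one]
      by (simp add: ennreal_mult[symmetric] Gamma_real_nonneg a d mult.commute)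
  qed
  \<comment> \<open>Testing the identity on e^(-z), where both sides are known, shows that the Beta
    integral b is finite and nonzero without evaluating it.\<close>
  with main[of "\<lambda>z. ennreal (exp (- z))"] nn_integral_power_measure_exp[of "a + d" 1] a d
  have eq: "ennreal (Gamma a * Gamma d) = b * ennreal (Gamma (a + d))" by simp
  have pos: "Gamma a > 0" "Gamma d > 0" "Gamma (a + d) > 0" using a d by (auto intro!: Gamma_real_pos)
  have "b \<noteq> top" using eq pos by (auto simp: ennreal_top_mult)
  moreover have "b \<noteq> 0" using eq pos by auto
  ultimately obtain B where "b = ennreal B" "B > 0"
    by (cases b) (auto simp: less_le)
  with main that show ?thesis by blast
qed

text \<open>Signed functions follow from the nonnegative case by identifying the image of the
  product measure under addition, which settles integrability and the value of the integral
  together.\<close>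

lemma integral_power_measure_add:
  assumes a: "0 < a" and d: "0 < d"
  obtains B :: real where "0 < B" and
    "\<And>f :: real \<Rightarrow> real. f \<in> borel_measurable borel \<Longrightarrow> integrable (power_measure (a + d)) f \<Longrightarrow>
      (\<integral>v. \<integral>u. f (u + v) \<partial>power_measure a \<partial>power_measure d) = B * (\<integral>z. f z \<partial>power_measure (a + d))"
proof -
  obtain B where B: "0 < B" and nn: "\<And>f. f \<in> borel_measurable borel \<Longrightarrow>
      (\<integral>\<^sup>+v. \<integral>\<^sup>+u. f (u + v) \<partial>power_measure a \<partial>power_measure d) = ennreal B * (\<integral>\<^sup>+z. f z \<partial>power_measure (a + d))"
    using nn_integral_power_measure_add[OF a d] by blast
  interpret d: sigma_finite_measure "power_measure d" by (rule sigma_finite_power_measure)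
  interpret a: sigma_finite_measure "power_measure a" by (rule sigma_finite_power_measure)
  interpret pair_sigma_finite "power_measure d" "power_measure a" ..
  let ?P = "power_measure d \<Otimes>\<^sub>M power_measure a"
  have dist: "distr ?P borel (\<lambda>(v, u). u + v) = density (power_measure (a + d)) (\<lambda>_. ennreal B)"
  proof (rule measure_eqI)
    fix A assume "A \<in> sets (distr ?P borel (\<lambda>(v, u). u + v))"
    then have A[measurable]: "A \<in> sets borel" by simp
    have "emeasure (distr ?P borel (\<lambda>(v, u). u + v)) A = (\<integral>\<^sup>+x. indicator A x \<partial>distr ?P borel (\<lambda>(v, u). u + v))"
      by simp
    also have "\<dots> = (\<integral>\<^sup>+x. indicator A (case x of (v, u) \<Rightarrow> u + v) \<partial>?P)"
      by (rule nn_integral_distr) measurable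
    also have "\<dots> = (\<integral>\<^sup>+v. \<integral>\<^sup>+u. indicator A (u + v) \<partial>power_measure a \<partial>power_measure d)"
      by (subst a.nn_integral_fst[symmetric]) auto
    also have "\<dots> = ennreal B * emeasure (power_measure (a + d)) A"
      by (subst nn) auto
    finally show "emeasure (distr ?P borel (\<lambda>(v, u). u + v)) A = emeasure (density (power_measure (a + d)) (\<lambda>_. ennreal B)) A"
      by (simp add: emeasure_density_const)
  qed simp
  show ?thesis
  proof (rule that[OF B])
    fix f :: "real \<Rightarrow> real" assume [measurable]: "f \<in> borel_measurable borel" and f: "integrable (power_measure (a + d)) f"
    have i1: "integrable (distr ?P borel (\<lambda>(v, u). u + v)) f"
      unfolding dist using f B integrable_density[of f "power_measure (a + d)" "\<lambda>_. B"] by simp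
    then have i2: "integrable ?P (\<lambda>(v, u). f (u + v))"
      by (subst (asm) integrable_distr_eq) (auto simp: case_prod_beta')
    have "(\<integral>v. \<integral>u. f (u + v) \<partial>power_measure a \<partial>power_measure d) = (\<integral>x. (case x of (v, u) \<Rightarrow> f (u + v)) \<partial>?P)"
      using integral_fst'[OF i2] by simp
    also have "\<dots> = (\<integral>x. f x \<partial>distr ?P borel (\<lambda>(v, u). u + v))"
      by (subst integral_distr) (auto simp: case_prod_beta')
    also have "\<dots> = B * (\<integral>z. f z \<partial>power_measure (a + d))"
      unfolding dist using B integral_density[of f "power_measure (a + d)" "\<lambda>_. B"] by simp
    finally show "(\<integral>v. \<integral>u. f (u + v) \<partial>power_measure a \<partial>power_measure d) = B * (\<integral>z. f z \<partial>power_measure (a + d))" .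
  qed
qed

text \<open>The class on which the Abel transform is inverted. The constants may degenerate as x0
  approaches c, since potentials can be singular at the curve; values at and above c are free apart
  from measurability.\<close>

definition exp_decay_below :: "real \<Rightarrow> (real \<Rightarrow> real) \<Rightarrow> bool" where
  "exp_decay_below c w \<longleftrightarrow> w \<in> borel_measurable borel \<and> continuous_on {..<c} w \<and>
     (\<forall>x0<c. \<exists>C l. 0 < l \<and> (\<forall>x\<le>x0. \<bar>w x\<bar> \<le> C * exp (l * x)))"

lemma exp_diff_split: "C * exp (l * (x - u)) = C * exp (l * x) * exp (- (l * u) :: real)"
  by (simp add: right_diff_distrib exp_diff exp_minus divide_inverse)

lemma exp_decay_belowE:
  assumes "exp_decay_below c w" "x0 < c"
  obtains C l where "0 < l" "0 \<le> C" "\<And>x. x \<le> x0 \<Longrightarrow> \<bar>w x\<bar> \<le> C * exp (l * x)"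
proof -
  obtain C l where *: "0 < l" "\<And>x. x \<le> x0 \<Longrightarrow> \<bar>w x\<bar> \<le> C * exp (l * x)"
    using assms unfolding exp_decay_below_def by blast
  have "0 \<le> C * exp (l * x0)" using *(2)[of x0] by (meson abs_ge_zero order_refl order_trans)
  then have "0 \<le> C" by (simp add: zero_le_mult_iff)
  with * that show ?thesis by blast
qed

lemma measurable_exp_decay_below: "exp_decay_below c w \<Longrightarrow> w \<in> borel_measurable borel"
  by (simp add: exp_decay_below_def)

lemma integrable_exp_decay_below:
  assumes w: "exp_decay_below c w" and a: "0 < a" and x: "x < c"
  shows "integrable (power_measure a) (\<lambda>u. w (x - u))"
proof -
  note [measurable] = measurable_exp_decay_below[OF w]
  obtain C l where C: "0 < l" "0 \<le> C" "\<And>y. y \<le> x \<Longrightarrow> \<bar>w y\<bar> \<le> C * exp (l * y)"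
    using exp_decay_belowE[OF w x] by blast
  show ?thesis
    by (rule integrable_power_measure_exp_bound[OF a C(1), where C="C * exp (l * x)"])
       (use C(3)[of "x - _"] in \<open>auto simp: exp_diff_split\<close>)
qed

lemma integral_below_eq:
  assumes w: "exp_decay_below c w" and x: "x < c"
  shows "set_integrable lborel {..<x} w" "(\<integral>u. w (x - u) \<partial>power_measure 1) = (LBINT y:{..<x}. w y)"
proof -
  note [measurable] = measurable_exp_decay_below[OF w]
  have "integrable lborel (\<lambda>u. indicator {0<..} u *\<^sub>R (u powr (1 - 1) *\<^sub>R w (x - u)))"
    using integrable_exp_decay_below[OF w zero_less_one x]
    by (subst (asm) integrable_power_measure_iff) (auto simp: set_integrable_def)
  moreover have eq: "(\<lambda>u. indicator {0<..} u *\<^sub>R (u powr (1 - 1) *\<^sub>R w (x - u))) = (\<lambda>u. indicator {..<x} (x + (-1) * u) *\<^sub>R w (x + (-1) * u))"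
    by (auto simp: indicator_def fun_eq_iff)
  ultimately have "integrable lborel (\<lambda>u. indicator {..<x} (x + (-1) * u) *\<^sub>R w (x + (-1) * u))" by simp
  then show "set_integrable lborel {..<x} w"
    unfolding set_integrable_def by (subst (asm) lborel_integrable_real_affine_iff) auto
  have "(LBINT y:{..<x}. w y) = (\<integral>u. indicator {..<x} (x + (-1) * u) *\<^sub>R w (x + (-1) * u) \<partial>lborel)"
    unfolding set_lebesgue_integral_def by (subst lborel_integral_real_affine[where c="-1" and t=x]) auto
  then show "(\<integral>u. w (x - u) \<partial>power_measure 1) = (LBINT y:{..<x}. w y)"
    unfolding eq[symmetric] set_lebesgue_integral_def[symmetric] by (simp add: integral_power_measure)
qed

text \<open>For order 1 the transform is a primitive, and a continuous integrand is recovered from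
  it by differentiation.\<close>

lemma exp_decay_below_eq_0_of_integral:
  assumes w: "exp_decay_below c w" and 0: "\<And>x. x < c \<Longrightarrow> (\<integral>u. w (x - u) \<partial>power_measure 1) = 0" and x: "x < c"
  shows "w x = 0"
proof -
  note [measurable] = measurable_exp_decay_below[OF w]
  define a where "a = x - 1"
  define b where "b = (x + c) / 2"
  have ab: "a < x" "x < b" "b < c" using x by (auto simp: a_def b_def)
  have cont: "continuous_on {a..b} w"
    using w ab unfolding exp_decay_below_def by (auto elim: continuous_on_subset)
  have "integral {a..y} w = 0" if y: "y \<in> {a..b}" for y
  proof -
    have iy: "set_integrable lborel {..<y} w" and ia: "set_integrable lborel {..<a} w" and
      z: "(LBINT z:{..<y}. w z) = 0" "(LBINT z:{..<a}. w z) = 0"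
      using integral_below_eq[OF w, of y] integral_below_eq[OF w, of a] 0[of y] 0[of a] y ab by auto
    have un: "{..<a} \<union> {a..<y} = {..<y}" using y by auto
    have i: "set_integrable lborel {a..<y} w"
      by (rule set_integrable_subset[OF iy]) auto
    have "(LBINT z:{..<a} \<union> {a..<y}. w z) = (LBINT z:{..<a}. w z) + (LBINT z:{a..<y}. w z)"
      by (rule set_integral_Un[OF _ ia i]) auto
    then have "(LBINT z:{a..<y}. w z) = 0" unfolding un z by simp
    then have "integral {a..<y} w = 0" using set_borel_integral_eq_integral(2)[OF i] by simp
    moreover have "integral {a..<y} w = integral {a..y} w"
      by (rule integral_spike_set; rule negligible_subset[of "{y}"]; auto)
    ultimately show ?thesis by simp
  qed
  then have e: "((\<lambda>y. integral {a..y} w) has_real_derivative 0) (at x within {a..b})"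
    by - (rule has_field_derivative_transform_within[where f="\<lambda>_. 0" and d=1], use ab in \<open>simp_all\<close>)
  moreover have "((\<lambda>y. integral {a..y} w) has_real_derivative w x) (at x within {a..b})"
    using integral_has_real_derivative[OF cont, of x] ab by auto
  moreover have "at x within {a..b} = at x" using ab by (intro at_within_interior) auto
  ultimately show ?thesis using DERIV_unique[of "\<lambda>y. integral {a..y} w" "w x" x 0] by simp
qed

text \<open>Closure of the class under the transform is what permits iteration in the inversion. The
  exponential bound reproduces itself because e^(l(x-u)) factors, leaving a Gamma integral as new
  constant.\<close>

lemma exp_decay_below_integral:
  assumes w: "exp_decay_below c w" and a: "0 < a"
  shows "exp_decay_below c (\<lambda>x. \<integral>u. w (x - u) \<partial>power_measure a)"
  unfolding exp_decay_below_def
proof (intro conjI allI impI)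
  note [measurable] = measurable_exp_decay_below[OF w]
  interpret sigma_finite_measure "power_measure a" by (rule sigma_finite_power_measure)
  show "(\<lambda>x. \<integral>u. w (x - u) \<partial>power_measure a) \<in> borel_measurable borel" by measurable
  show "\<exists>C l. 0 < l \<and> (\<forall>x\<le>x0. \<bar>\<integral>u. w (x - u) \<partial>power_measure a\<bar> \<le> C * exp (l * x))" if x0: "x0 < c" for x0
  proof -
    obtain C l where C: "0 < l" "0 \<le> C" "\<And>y. y \<le> x0 \<Longrightarrow> \<bar>w y\<bar> \<le> C * exp (l * y)"
      using exp_decay_belowE[OF w x0] by blast
    have "\<bar>\<integral>u. w (x - u) \<partial>power_measure a\<bar> \<le> (C * (Gamma a / l powr a)) * exp (l * x)" if "x \<le> x0" for x
    proof -
      have "norm (\<integral>u. w (x - u) \<partial>power_measure a) \<le> (\<integral>u. C * exp (l * x) * exp (- (l * u)) \<partial>power_measure a)"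
      proof (rule norm_integral_le_AE)
        show "AE u in power_measure a. norm (w (x - u)) \<le> C * exp (l * x) * exp (- (l * u))"
          using AE_power_measure
        proof eventually_elim
          case (elim u)
          then show ?case using C(3)[of "x - u"] that by (auto simp: exp_diff_split)
        qed
      qed (use that x0 a C(1) in \<open>auto intro!: integrable_exp_decay_below[OF w] integrable_power_measure_exp\<close>)
      then show ?thesis using a C(1) by (simp add: integral_power_measure_exp) (simp add: mult_ac)
    qed
    with C(1) show ?thesis by blast
  qed
  show "continuous_on {..<c} (\<lambda>x. \<integral>u. w (x - u) \<partial>power_measure a)"
    unfolding continuous_on_eq_continuous_at[OF open_lessThan]
  proof
    fix x assume x: "x \<in> {..<c}"
    define x0 where "x0 = (x + c) / 2"
    have x0: "x < x0" "x0 < c" using x by (auto simp: x0_def)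
    obtain C l where C: "0 < l" "0 \<le> C" "\<And>y. y \<le> x0 \<Longrightarrow> \<bar>w y\<bar> \<le> C * exp (l * y)"
      using exp_decay_belowE[OF w x0(2)] by blast
    have "continuous (at x within {..<x0}) (\<lambda>x. \<integral>u. w (x - u) \<partial>power_measure a)"
    proof (rule continuous_within_integral_dominated[where g="\<lambda>u. C * exp (l * x0) * exp (- (l * u))"])
      fix y assume y: "y \<in> {..<x0}"
      show "AE u in power_measure a. \<bar>w (y - u)\<bar> \<le> C * exp (l * x0) * exp (- (l * u))"
        using AE_power_measure
      proof eventually_elim
        case (elim u)
        have "\<bar>w (y - u)\<bar> \<le> C * exp (l * (y - u))" using elim y by (intro C) auto
        also have "\<dots> \<le> C * exp (l * x0 - l * u)"
          using y C by (intro mult_left_mono) (auto simp: right_diff_distrib)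
        finally show ?case by (simp add: mult.assoc exp_add[symmetric])
      qed
    next
      show "AE u in power_measure a. continuous (at x within {..<x0}) (\<lambda>x. w (x - u))"
        using AE_power_measure
      proof eventually_elim
        case (elim u)
        have "isCont w (x - u)" using w elim x unfolding exp_decay_below_def
          by (intro continuous_on_interior[of "{..<c}"]) (auto simp: interior_open)
        then have "isCont (\<lambda>x. w (x - u)) x" by (intro isCont_o2[where f="\<lambda>x. x - u" and g=w]) (auto intro!: continuous_intros)
        then show ?case by (rule continuous_at_imp_continuous_at_within)
      qed
    qed (use x0 C a in \<open>auto intro!: integrable_power_measure_exp\<close>)
    moreover have "at x within {..<x0} = at x" using x0 by (intro at_within_open) auto
    ultimately show "isCont (\<lambda>x. \<integral>u. w (x - u) \<partial>power_measure a) x" by simp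
  qed
qed

lemma integral_exp_decay_below_add:
  assumes w: "exp_decay_below c w" and a: "0 < a" and d: "0 < d" and x: "x < c"
  obtains B where "0 < B" "(\<integral>v. \<integral>u. w (x - v - u) \<partial>power_measure a \<partial>power_measure d) = B * (\<integral>z. w (x - z) \<partial>power_measure (a + d))"
proof -
  note [measurable] = measurable_exp_decay_below[OF w]
  obtain B where B: "0 < B" "\<And>f :: real \<Rightarrow> real. f \<in> borel_measurable borel \<Longrightarrow> integrable (power_measure (a + d)) f \<Longrightarrow>
      (\<integral>v. \<integral>u. f (u + v) \<partial>power_measure a \<partial>power_measure d) = B * (\<integral>z. f z \<partial>power_measure (a + d))"
    using integral_power_measure_add[OF a d] by blast
  have "(\<integral>v. \<integral>u. w (x - (u + v)) \<partial>power_measure a \<partial>power_measure d) = B * (\<integral>z. w (x - z) \<partial>power_measure (a + d))"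
    by (rule B(2)[of "\<lambda>z. w (x - z)"]) (use a d in \<open>auto intro!: integrable_exp_decay_below[OF w] x\<close>)
  then show ?thesis using that[OF B(1)] by (simp add: algebra_simps)
qed

text \<open>A further transform of order d = n - a raises the order to a natural number n by the
  semigroup property; an integer order is then undone one unit at a time by differentiation.\<close>

theorem abel_injective:
  assumes w: "exp_decay_below c w" and a: "0 < a"
    and 0: "\<And>x. x < c \<Longrightarrow> (\<integral>u. w (x - u) \<partial>power_measure a) = 0" and x: "x < c"
  shows "w x = 0"
proof -
  have nat: "w x = 0" if "exp_decay_below c w" "\<And>x. x < c \<Longrightarrow> (\<integral>u. w (x - u) \<partial>power_measure (real (Suc n))) = 0" "x < c" for n w x
    using that
  proof (induction n arbitrary: w x)
    case 0
    then show ?case using exp_decay_below_eq_0_of_integral[of c w x] by simp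
  next
    case (Suc n)
    define w1 where "w1 = (\<lambda>x. \<integral>u. w (x - u) \<partial>power_measure 1)"
    have w1: "exp_decay_below c w1" unfolding w1_def by (rule exp_decay_below_integral[OF Suc.prems(1)]) simp
    have "w1 y = 0" if "y < c" for y
    proof (rule Suc.IH[OF w1 _ that])
      fix y assume y: "y < c"
      obtain B where "(\<integral>v. \<integral>u. w (y - v - u) \<partial>power_measure 1 \<partial>power_measure (real (Suc n))) = B * (\<integral>z. w (y - z) \<partial>power_measure (1 + real (Suc n)))"
        using integral_exp_decay_below_add[OF Suc.prems(1) _ _ y, of 1 "real (Suc n)"] by auto
      then show "(\<integral>u. w1 (y - u) \<partial>power_measure (real (Suc n))) = 0"
        using Suc.prems(2)[OF y] by (simp add: w1_def)
    qed
    then show ?case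
      using exp_decay_below_eq_0_of_integral[OF Suc.prems(1) _ Suc.prems(3)] by (simp add: w1_def)
  qed
  obtain n :: nat where n: "a < real n" using reals_Archimedean2 by blast
  then obtain m where m: "n = Suc m" using a by (cases n) auto
  define d where "d = real n - a"
  have d: "0 < d" "a + d = real (Suc m)" using n m by (auto simp: d_def)
  show ?thesis
  proof (rule nat[OF w _ x, of m])
    fix y assume y: "y < c"
    obtain B where B: "0 < B" "(\<integral>v. \<integral>u. w (y - v - u) \<partial>power_measure a \<partial>power_measure d) = B * (\<integral>z. w (y - z) \<partial>power_measure (real (Suc m)))"
      using integral_exp_decay_below_add[OF w a d(1) y] unfolding d(2) by blast
    moreover have "(\<integral>v. \<integral>u. w (y - v - u) \<partial>power_measure a \<partial>power_measure d) = (\<integral>v. 0 \<partial>power_measure d)"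
    proof (rule integral_cong_AE)
      note [measurable] = measurable_exp_decay_below[OF w]
      interpret sigma_finite_measure "power_measure a" by (rule sigma_finite_power_measure)
      show "(\<lambda>v. \<integral>u. w (y - v - u) \<partial>power_measure a) \<in> borel_measurable (power_measure d)" by measurable
      show "AE v in power_measure d. (\<integral>u. w (y - v - u) \<partial>power_measure a) = 0"
        using AE_power_measure by eventually_elim (use 0 y in auto)
    qed simp
    ultimately show "(\<integral>u. w (y - u) \<partial>power_measure (real (Suc m))) = 0" by simp
  qed
qed

section \<open>Gaussian tails and first hits of continuous paths\<close>

text \<open>This is sqrt(2 pi) times the standard normal tail, left unnormalised so that it equals
  the kernel for p = -1 exactly. It is the source of the factors sqrt(2 pi) in the probabilistic
  statements.\<close>

definition gauss_tail :: "real \<Rightarrow> real" where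
  "gauss_tail z = (LBINT v:{z<..}. exp (- v\<^sup>2 / 2))"

lemma gauss_integrable: "integrable lborel (\<lambda>v::real. exp (- v\<^sup>2 / 2))"
  and gauss_integral: "(LBINT v. exp (- v\<^sup>2 / 2)) = sqrt (2 * pi)"
proof -
  have eq: "(\<lambda>v::real. exp (- v\<^sup>2 / 2)) = (\<lambda>v. sqrt (2 * pi) * std_normal_density v)"
    by (auto simp: std_normal_density_def)
  show "integrable lborel (\<lambda>v::real. exp (- v\<^sup>2 / 2))" unfolding eq by simp
  show "(LBINT v. exp (- v\<^sup>2 / 2)) = sqrt (2 * pi)" unfolding eq by simp
qed

lemma gauss_set_integrable: "A \<in> sets borel \<Longrightarrow> set_integrable lborel A (\<lambda>v::real. exp (- v\<^sup>2 / 2))"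
  unfolding set_integrable_def by (intro integrable_mult_indicator gauss_integrable) simp

lemma gauss_tail_nonneg: "0 \<le> gauss_tail z"
  unfolding gauss_tail_def set_lebesgue_integral_def by (rule integral_nonneg_AE) auto

lemma gauss_tail_le: "gauss_tail z \<le> sqrt (2 * pi)"
  unfolding gauss_tail_def set_lebesgue_integral_def gauss_integral[symmetric]
  using gauss_set_integrable[of "{z<..}"] gauss_integrable
  by (intro integral_mono) (auto simp: set_integrable_def indicator_def)

lemma gauss_tail_alt:
  assumes "z0 \<le> z"
  shows "gauss_tail z = gauss_tail z0 - integral {z0..z} (\<lambda>v. exp (- v\<^sup>2 / 2))"
proof -
  have un: "{z0<..} = {z0<..z} \<union> {z<..}" using assms by auto
  have "gauss_tail z0 = (LBINT v:{z0<..z}. exp (- v\<^sup>2 / 2)) + gauss_tail z"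
    unfolding gauss_tail_def un by (rule set_integral_Un) (force, (rule gauss_set_integrable, simp)+)
  also have "(LBINT v:{z0<..z}. exp (- v\<^sup>2 / 2)) = integral {z0<..z} (\<lambda>v. exp (- v\<^sup>2 / 2))"
    by (rule set_borel_integral_eq_integral(2)) (rule gauss_set_integrable, simp)
  also have "\<dots> = integral {z0..z} (\<lambda>v. exp (- v\<^sup>2 / 2))"
    by (rule integral_spike_set; rule negligible_subset[of "{z0}"]; auto)
  finally show ?thesis by simp
qed

lemma DERIV_gauss_tail: "(gauss_tail has_real_derivative - exp (- z\<^sup>2 / 2)) (at z)"
proof -
  have "((\<lambda>y. integral {z - 1..y} (\<lambda>v. exp (- v\<^sup>2 / 2))) has_real_derivative exp (- z\<^sup>2 / 2)) (at z within {z - 1..z + 1})"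
    by (rule integral_has_real_derivative) (auto intro!: continuous_intros)
  moreover have "at z within {z - 1..z + 1} = at z" by (rule at_within_interior) auto
  ultimately have "((\<lambda>y. gauss_tail (z - 1) - integral {z - 1..y} (\<lambda>v. exp (- v\<^sup>2 / 2))) has_real_derivative - exp (- z\<^sup>2 / 2)) (at z)"
    by (auto intro!: derivative_eq_intros)
  then show ?thesis
    by (rule has_field_derivative_transform_within[where d=1])
       (simp_all only: dist_real_def UNIV_I zero_less_one, intro gauss_tail_alt[symmetric], simp)
qed

lemma isCont_gauss_tail: "isCont gauss_tail z"
  using DERIV_gauss_tail by (rule DERIV_isCont)

lemma continuous_on_gauss_tail [continuous_intros]:
  "continuous_on S f \<Longrightarrow> continuous_on S (\<lambda>x. gauss_tail (f x))"
  using continuous_on_compose2[of UNIV gauss_tail S f] isCont_gauss_tail by (auto simp: continuous_on_eq_continuous_at)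

lemma borel_measurable_gauss_tail [measurable]: "gauss_tail \<in> borel_measurable borel"
  by (rule borel_measurable_continuous_onI) (rule continuous_on_gauss_tail, simp)

lemma gauss_tail_uminus: "gauss_tail (- z) = (LBINT v:{..<z}. exp (- v\<^sup>2 / 2))"
  unfolding gauss_tail_def set_lebesgue_integral_def
  by (subst lborel_integral_real_affine[where c="-1" and t=0]) (auto simp: indicator_def cong: if_cong)

lemma gauss_tail_0: "gauss_tail 0 = sqrt (pi / 2)"
proof -
  have "gauss_tail 0 = (LBINT v:{..0}. exp (- v\<^sup>2 / 2))"
    using gauss_tail_uminus[of 0] unfolding set_lebesgue_integral_def
    by (simp, intro integral_cong_AE) (auto intro!: AE_I[where N="{0}"] simp: indicator_def)
  moreover have "sqrt (2 * pi) = (LBINT v:{..0} \<union> {0<..}. exp (- v\<^sup>2 / 2))"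
  proof -
    have "{..0} \<union> {0<..} = (UNIV :: real set)" by auto
    then show ?thesis unfolding gauss_integral[symmetric] set_lebesgue_integral_def by simp
  qed
  moreover have "\<dots> = (LBINT v:{..0}. exp (- v\<^sup>2 / 2)) + (LBINT v:{0<..}. exp (- v\<^sup>2 / 2))"
    by (rule set_integral_Un) (force, (rule gauss_set_integrable, simp)+)
  ultimately have "2 * gauss_tail 0 = sqrt (2 * pi)" by (simp add: gauss_tail_def)
  moreover have "sqrt (2 * pi) = 2 * sqrt (pi / 2)"
    by (rule real_sqrt_unique) (auto simp: power_mult_distrib)
  ultimately show ?thesis by simp
qed

text \<open>Order 2 = 1 - p belongs to p = -1. After scaling, one integration by parts in u (z+u)
  e^(-(z+u)^2/2) leaves the Gaussian tail.\<close>

lemma integral_heat_flux_2: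
  assumes r: "0 < r"
  shows "(\<integral>u. heat_flux (x + u) r \<partial>power_measure 2) = gauss_tail (x / sqrt r)"
proof -
  define z where "z = x / sqrt r"
  let ?e = "\<lambda>u. exp (- (z + u)\<^sup>2 / 2)"
  have "(\<integral>u. heat_flux (x + u) r \<partial>power_measure 2) = sqrt r powr 2 * (\<integral>u. heat_flux (x + sqrt r * u) r \<partial>power_measure 2)"
    using r by (subst integral_power_measure_scale[where c="sqrt r"]) auto
  also have "(\<integral>u. heat_flux (x + sqrt r * u) r \<partial>power_measure 2) = (\<integral>u. ((z + u) * ?e u) / r \<partial>power_measure 2)"
  proof (rule Bochner_Integration.integral_cong[OF refl])
    fix u
    have "x + sqrt r * u = sqrt r * (z + u)" using r by (simp add: z_def field_simps)
    then show "heat_flux (x + sqrt r * u) r = ((z + u) * ?e u) / r"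
      using r by (simp only: heat_flux_def power_mult_distrib) simp
  qed
  finally have 1: "(\<integral>u. heat_flux (x + u) r \<partial>power_measure 2) = (\<integral>u. (z + u) * ?e u \<partial>power_measure 2)"
    using r by simp
  have eb: "?e u \<le> 2 * exp (- z) * exp (- (1 * u))" for u
  proof -
    have "?e u \<le> exp (1/2) * exp (- (z + u))"
      using zero_le_power2[of "(z + u) - 1"] by (simp add: exp_add[symmetric] power2_diff del: power2_sum)
    also have "exp (1/2) \<le> (2::real)" using exp_bound[of "1/2"] by (simp add: power2_eq_square)
    finally show ?thesis by (simp add: exp_add[symmetric] mult.assoc)
  qed
  have i2: "integrable (power_measure 2) (\<lambda>u. (z + u) * ?e u)"
  proof (rule integrable_power_measure_exp_bound[of 2 1])
    fix u show "norm ((z + u) * ?e u) \<le> 4 * exp (- z) * exp (- (1 * u))"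
      using abs_mult_exp_le[of "z + u"] by (simp add: abs_mult mult.assoc exp_add[symmetric])
  qed auto
  have i1: "integrable (power_measure 1) ?e"
    by (rule integrable_power_measure_exp_bound[of 1 1, where C="2 * exp (- z)"]) (use eb in auto)
  have i2': "set_integrable lborel {0<..} (\<lambda>u. u * ((z + u) * ?e u))"
  proof (subst set_integrable_cong[OF refl refl])
    show "set_integrable lborel {0<..} (\<lambda>u. (u powr (2 - 1)) *\<^sub>R ((z + u) * ?e u))"
      using i2 by (subst (asm) integrable_power_measure_iff) auto
  qed auto
  have s2': "(\<integral>u. (z + u) * ?e u \<partial>power_measure 2) = (LBINT u:{0<..}. u * ((z + u) * ?e u))"
    by (subst integral_power_measure) (auto intro!: set_lebesgue_integral_cong)
  have i1': "set_integrable lborel {0<..} ?e"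
  proof (subst set_integrable_cong[OF refl refl])
    show "set_integrable lborel {0<..} (\<lambda>u. (u powr (1 - 1)) *\<^sub>R ?e u)"
      using i1 by (subst (asm) integrable_power_measure_iff) auto
  qed auto
  have "(LBINT u=0..\<infinity>. u * ((z + u) * ?e u) - ?e u) = 0 - 0"
  proof (rule interval_integral_FTC_integrable[where F="\<lambda>u. - (u * ?e u)"])
    show "((\<lambda>u. - (u * ?e u)) has_vector_derivative u * ((z + u) * ?e u) - ?e u) (at u)" for u
      unfolding has_real_derivative_iff_has_vector_derivative[symmetric]
      by (rule derivative_eq_intros refl | simp add: algebra_simps power2_eq_square)+ (simp add: field_simps)
    show "isCont (\<lambda>u. u * ((z + u) * ?e u) - ?e u) u" for u by (auto intro!: continuous_intros)
    show "set_integrable lborel (einterval 0 \<infinity>) (\<lambda>u. u * ((z + u) * ?e u) - ?e u)"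
      using i2' i1' by (auto simp: zero_ereal_def intro!: set_integral_diff)
    have "((\<lambda>u. - (u * ?e u)) \<longlongrightarrow> - (0 * ?e 0)) (at_right 0)" by (intro tendsto_intros) auto
    then show "(((\<lambda>u. - (u * ?e u)) \<circ> real_of_ereal) \<longlongrightarrow> 0) (at_right 0)"
      by (simp add: zero_ereal_def ereal_tendsto_simps)
    have "((\<lambda>u. - (u * ?e u)) \<longlongrightarrow> 0) at_top" by real_asymp
    then show "(((\<lambda>u. - (u * ?e u)) \<circ> real_of_ereal) \<longlongrightarrow> 0) (at_left \<infinity>)"
      by (simp add: ereal_tendsto_simps)
  qed simp
  then have "(LBINT u:{0<..}. u * ((z + u) * ?e u) - ?e u) = 0"
    by (simp add: interval_lebesgue_integral_def zero_ereal_def)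
  then have "(LBINT u:{0<..}. u * ((z + u) * ?e u)) = (LBINT u:{0<..}. ?e u)"
    using set_integral_diff(2)[OF i2' i1'] by simp
  also have "\<dots> = gauss_tail z"
    unfolding gauss_tail_def set_lebesgue_integral_def
    by (subst (2) lborel_integral_real_affine[where c=1 and t=z]) (auto simp: indicator_def cong: if_cong)
  finally show ?thesis unfolding 1 s2' by (simp only: z_def)
qed

lemma passage_kernel_minus_1:
  assumes "0 < r"
  shows "passage_kernel (-1) x r = gauss_tail (x / sqrt r)"
  using passage_kernel_eq[of "-1" r x] integral_heat_flux_2[OF assms, of x] assms by (simp add: Gamma_numeral)

lemma measure_normal_atMost:
  assumes r: "0 < r"
  shows "measure (density lborel (\<lambda>x. ennreal (normal_density 0 (sqrt r) x))) {..z} = gauss_tail (- z / sqrt r) / sqrt (2 * pi)"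
proof -
  have "measure (density lborel (\<lambda>x. ennreal (normal_density 0 (sqrt r) x))) {..z} =
      (\<integral>x. indicator {..z} x \<partial>density lborel (\<lambda>x. ennreal (normal_density 0 (sqrt r) x)))" by simp
  also have "\<dots> = (LBINT x. normal_density 0 (sqrt r) x * indicator {..z} x)"
    by (subst integral_density) auto
  also have "\<dots> = sqrt r * (LBINT v. normal_density 0 (sqrt r) (0 + sqrt r * v) * indicator {..z} (0 + sqrt r * v))"
    using r by (subst lborel_integral_real_affine[where c="sqrt r" and t=0]) auto
  also have "(LBINT v. normal_density 0 (sqrt r) (0 + sqrt r * v) * indicator {..z} (0 + sqrt r * v))
    = (LBINT v. indicator {..<z / sqrt r} v *\<^sub>R exp (- v\<^sup>2 / 2) / (sqrt (2 * pi) * sqrt r))"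
  proof (rule integral_cong_AE)
    show "AE v in lborel. normal_density 0 (sqrt r) (0 + sqrt r * v) * indicator {..z} (0 + sqrt r * v)
      = indicator {..<z / sqrt r} v *\<^sub>R exp (- v\<^sup>2 / 2) / (sqrt (2 * pi) * sqrt r)"
      using AE_lborel_singleton[of "z / sqrt r"]
    proof eventually_elim
      case (elim v)
      have "(sqrt r * v \<le> z) = (v < z / sqrt r)" using elim r by (auto simp: field_simps less_le)
      moreover have "normal_density 0 (sqrt r) (sqrt r * v) = exp (- (v\<^sup>2 / 2)) / (sqrt (2 * pi) * sqrt r)"
        using r by (simp add: normal_density_def power_mult_distrib real_sqrt_mult)
      ultimately show ?case by (auto simp: indicator_def)
    qed
  qed auto
  also have "\<dots> = gauss_tail (- (z / sqrt r)) / (sqrt (2 * pi) * sqrt r)"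
    unfolding gauss_tail_uminus set_lebesgue_integral_def by simp
  finally show ?thesis using r by simp
qed

section \<open>First hitting times of a single continuous path\<close>

text \<open>A continuous path attains its minimum on a compact interval, so reaching level 0 can be
  tested at countably many times. This is the source of the measurability of first passage
  times.\<close>

lemma exists_le_zero_iff_rational:
  fixes d :: "real \<Rightarrow> real"
  assumes uv: "u < v" and cont: "continuous_on {u..v} d"
  shows "(\<exists>t\<in>{u..v}. d t \<le> 0) \<longleftrightarrow> (\<forall>j::nat. \<exists>r\<in>\<rat>. u \<le> r \<and> r \<le> v \<and> d r < 1 / real (Suc j))"
proof
  assume "\<exists>t\<in>{u..v}. d t \<le> 0"
  then obtain t where t: "t \<in> {u..v}" "d t \<le> 0" by blast
  show "\<forall>j::nat. \<exists>r\<in>\<rat>. u \<le> r \<and> r \<le> v \<and> d r < 1 / real (Suc j)"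
  proof
    fix j :: nat
    have "1 / real (Suc j) > 0" by simp
    then obtain e where e: "e > 0" "\<And>x. x \<in> {u..v} \<Longrightarrow> dist x t < e \<Longrightarrow> dist (d x) (d t) < 1 / real (Suc j)"
      using cont t(1) unfolding continuous_on_iff by blast
    have "max u (t - e) < min v (t + e)" using t uv e(1) by auto
    then obtain r where r: "r \<in> \<rat>" "max u (t - e) < r" "r < min v (t + e)" using Rats_dense_in_real by blast
    then have "dist (d r) (d t) < 1 / real (Suc j)" by (intro e(2)) (auto simp: dist_real_def)
    then have "d r < 1 / real (Suc j)" using t(2) by (auto simp: dist_real_def)
    with r show "\<exists>r\<in>\<rat>. u \<le> r \<and> r \<le> v \<and> d r < 1 / real (Suc j)" by (intro bexI[of _ r]) auto
  qed
next
  assume *: "\<forall>j::nat. \<exists>r\<in>\<rat>. u \<le> r \<and> r \<le> v \<and> d r < 1 / real (Suc j)"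
  obtain m where m: "m \<in> {u..v}" "\<And>x. x \<in> {u..v} \<Longrightarrow> d m \<le> d x"
    using continuous_attains_inf[of "{u..v}" d] cont uv by auto
  have "d m \<le> 1 / real (Suc j)" for j using * m(2) by (meson atLeastAtMost_iff less_le_trans less_imp_le order_trans)
  then have "d m \<le> 0"
    by (intro LIMSEQ_le_const[OF LIMSEQ_inverse_real_of_nat]) (auto simp: inverse_eq_divide)
  with m(1) show "\<exists>t\<in>{u..v}. d t \<le> 0" by blast
qed

lemma grid_point_between:
  assumes "0 < t" "0 \<le> lo" "lo < hi" "hi \<le> t"
  shows "\<forall>\<^sub>F n in sequentially. \<exists>k\<le>Suc n. lo < real k * t / real (Suc n) \<and> real k * t / real (Suc n) < hi"
proof -
  obtain n0 :: nat where n0: "t / (hi - lo) < real n0" using reals_Archimedean2 by blast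
  show ?thesis
  proof (rule eventually_sequentiallyI[of n0])
    fix n assume "n0 \<le> n"
    then have "t / (hi - lo) < real (Suc n)" using n0 by linarith
    then have n: "t < (hi - lo) * real (Suc n)" using assms by (simp add: pos_divide_less_eq mult.commute)
    define k where "k = nat \<lfloor>lo * real (Suc n) / t\<rfloor> + 1"
    have k: "real k = of_int \<lfloor>lo * real (Suc n) / t\<rfloor> + 1" using assms by (simp add: k_def)
    have 1: "lo * real (Suc n) / t < real k" "real k \<le> lo * real (Suc n) / t + 1" unfolding k by linarith+
    have 2: "lo < real k * t / real (Suc n)" using 1(1) assms by (simp add: field_simps)
    have "real k * t \<le> lo * real (Suc n) + t" using 1(2) assms by (simp add: field_simps)
    also have "\<dots> < hi * real (Suc n)" using n by (simp add: algebra_simps)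
    finally have 3: "real k * t / real (Suc n) < hi" by (simp add: field_simps)
    then have "real k * t / real (Suc n) < t" using assms by linarith
    then have "real k * t < t * real (Suc n)" by (simp add: pos_divide_less_eq)
    then have "real k < real (Suc n)" using assms by (simp add: mult.commute)
    with 2 3 show "\<exists>k\<le>Suc n. lo < real k * t / real (Suc n) \<and> real k * t / real (Suc n) < hi"
      by (intro exI[of _ k]) auto
  qed
qed

text \<open>The strict inequality makes S relatively open in [0,t], so it contains intervals
  arbitrarily close to \<open>Inf S\<close>, and every fine enough grid meets them. With w \<le>
  \<delta> instead, a path that merely touches the level could be missed by all grids.\<close>

lemma grid_first_hit:
  fixes w :: "real \<Rightarrow> real"
  assumes t: "0 < t" and cont: "continuous_on {0..t} w" and s0: "s0 \<in> {0..t}" "w s0 < \<delta>" and w0: "\<delta> \<le> w 0"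
  defines "S \<equiv> {s \<in> {0..t}. w s < \<delta>}"
  defines "\<kappa> \<equiv> \<lambda>n::nat. LEAST k. w (real k * t / real (Suc n)) < \<delta>"
  shows "0 \<le> Inf S" "Inf S < t" "w (Inf S) = \<delta>"
    "\<forall>\<^sub>F n in sequentially. \<exists>k\<le>Suc n. w (real k * t / real (Suc n)) < \<delta>"
    "(\<lambda>n. real (\<kappa> n) * t / real (Suc n)) \<longlonglongrightarrow> Inf S"
proof -
  have Sne: "S \<noteq> {}" and bdd: "bdd_below S" using s0 by (auto simp: S_def intro: bdd_belowI[of _ 0])
  \<comment> \<open>A point of S may be an endpoint of [0,t], so the open interval is only required
    to lie close to s, cut down to [0,t].\<close>
  have near: "\<exists>lo hi. 0 \<le> lo \<and> lo < hi \<and> hi \<le> t \<and> hi \<le> s + e \<and> s - e \<le> lo \<and> {lo<..<hi} \<subseteq> S"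
    if s: "s \<in> S" and e: "e > 0" for s e
  proof -
    have "\<delta> - w s > 0" "s \<in> {0..t}" using s by (auto simp: S_def)
    then obtain d where d: "d > 0" "\<And>x. x \<in> {0..t} \<Longrightarrow> dist x s < d \<Longrightarrow> dist (w x) (w s) < \<delta> - w s"
      using cont unfolding continuous_on_iff by meson
    have "{max 0 (s - min d e)<..<min t (s + min d e)} \<subseteq> S"
    proof
      fix x assume "x \<in> {max 0 (s - min d e)<..<min t (s + min d e)}"
      then have "x \<in> {0..t}" "dist x s < d" by (auto simp: dist_real_def)
      with d(2)[of x] show "x \<in> S" by (auto simp: S_def dist_real_def)
    qed
    then show ?thesis using d(1) e s t
      by (intro exI[of _ "max 0 (s - min d e)"] exI[of _ "min t (s + min d e)"]) (auto simp: S_def)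
  qed
  show I0: "0 \<le> Inf S" using Sne by (intro cInf_greatest) (auto simp: S_def)
  have ev: "\<forall>\<^sub>F n in sequentially. \<exists>k\<le>Suc n. real k * t / real (Suc n) \<in> S \<and> real k * t / real (Suc n) < Inf S + e" if e: "e > 0" for e
  proof -
    obtain s where s: "s \<in> S" "s < Inf S + e / 2"
      using cInf_lessD[OF Sne, of "Inf S + e/2"] e by auto
    obtain lo hi where lh: "0 \<le> lo" "lo < hi" "hi \<le> t" "hi \<le> s + e/2" "{lo<..<hi} \<subseteq> S"
      using near[OF s(1), of "e/2"] e by auto
    show ?thesis
      using grid_point_between[OF t lh(1-3)]
      by eventually_elim (use lh s in \<open>force\<close>)
  qed
  show It: "Inf S < t"
  proof -
    obtain lo hi where lh: "0 \<le> lo" "lo < hi" "hi \<le> t" "{lo<..<hi} \<subseteq> S"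
      using near[of s0 1] s0 by (auto simp: S_def)
    then have "(lo + hi) / 2 \<in> S" by auto
    then have "Inf S \<le> (lo + hi) / 2" using bdd by (rule cInf_lower)
    with lh show ?thesis by auto
  qed
  show evk: "\<forall>\<^sub>F n in sequentially. \<exists>k\<le>Suc n. w (real k * t / real (Suc n)) < \<delta>"
    using ev[OF zero_less_one] by eventually_elim (auto simp: S_def)
  have kap: "real (\<kappa> n) * t / real (Suc n) \<in> S \<and> real (\<kappa> n) * t / real (Suc n) \<le> real k * t / real (Suc n)"
    if "k \<le> Suc n" "w (real k * t / real (Suc n)) < \<delta>" for k n
  proof -
    have le: "\<kappa> n \<le> k" unfolding \<kappa>_def by (rule Least_le) (use that in auto)
    have "w (real (\<kappa> n) * t / real (Suc n)) < \<delta>" unfolding \<kappa>_def by (rule LeastI[of _ k]) (use that in auto)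
    moreover have "real (\<kappa> n) * t / real (Suc n) \<le> real k * t / real (Suc n)"
      using le t by (intro divide_right_mono mult_right_mono) auto
    moreover have "real k * t \<le> real (Suc n) * t" using that(1) t by (intro mult_right_mono) auto
    then have "real k * t / real (Suc n) \<le> t" by (simp add: pos_divide_le_eq mult.commute)
    ultimately show ?thesis using t by (auto simp: S_def)
  qed
  show lim: "(\<lambda>n. real (\<kappa> n) * t / real (Suc n)) \<longlonglongrightarrow> Inf S"
  proof (rule LIMSEQ_I)
    fix e :: real assume "e > 0"
    from ev[OF this] show "\<exists>no. \<forall>n\<ge>no. norm (real (\<kappa> n) * t / real (Suc n) - Inf S) < e"
      unfolding eventually_sequentially
    proof (elim ex_forward, intro allI impI)
      fix N n assume *: "\<forall>n\<ge>N. \<exists>k\<le>Suc n. real k * t / real (Suc n) \<in> S \<and> real k * t / real (Suc n) < Inf S + e" "N \<le> n"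
      then obtain k where k: "k \<le> Suc n" "real k * t / real (Suc n) \<in> S" "real k * t / real (Suc n) < Inf S + e" by blast
      with kap[of k n] have "real (\<kappa> n) * t / real (Suc n) \<in> S" "real (\<kappa> n) * t / real (Suc n) < Inf S + e" by (auto simp: S_def)
      moreover then have "Inf S \<le> real (\<kappa> n) * t / real (Suc n)" using bdd by (intro cInf_lower)
      ultimately show "norm (real (\<kappa> n) * t / real (Suc n) - Inf S) < e" by simp
    qed
  qed
  have Iin: "Inf S \<in> {0..t}" using I0 It by simp
  have "(\<lambda>n. w (real (\<kappa> n) * t / real (Suc n))) \<longlonglongrightarrow> w (Inf S)"
  proof (rule continuous_on_tendsto_compose[OF cont lim Iin])
    show "\<forall>\<^sub>F n in sequentially. real (\<kappa> n) * t / real (Suc n) \<in> {0..t}"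
      using evk by eventually_elim (use kap in \<open>auto simp: S_def\<close>)
  qed
  moreover have "\<forall>\<^sub>F n in sequentially. w (real (\<kappa> n) * t / real (Suc n)) \<le> \<delta>"
    using evk by eventually_elim (use kap in \<open>force simp: S_def\<close>)
  ultimately have le: "w (Inf S) \<le> \<delta>" by (intro tendsto_upperbound) auto
  \<comment> \<open>A value below \<delta> at the infimum would, by continuity, put earlier points
    into S; the start w 0 \<ge> \<delta> guarantees that earlier points exist.\<close>
  show "w (Inf S) = \<delta>"
  proof (rule ccontr)
    assume "w (Inf S) \<noteq> \<delta>"
    then have "Inf S \<in> S" using le Iin by (auto simp: S_def)
    then have pos: "Inf S > 0" using w0 I0 by (auto simp: S_def less_le)
    have "\<delta> - w (Inf S) > 0" using \<open>Inf S \<in> S\<close> by (auto simp: S_def)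
    then obtain d where d: "d > 0" "\<And>x. x \<in> {0..t} \<Longrightarrow> dist x (Inf S) < d \<Longrightarrow> dist (w x) (w (Inf S)) < \<delta> - w (Inf S)"
      using cont Iin unfolding continuous_on_iff by meson
    define x where "x = max (Inf S / 2) (Inf S - d / 2)"
    have "x \<in> {0..t}" "dist x (Inf S) < d" "x < Inf S" using d(1) pos It by (auto simp: x_def dist_real_def)
    with d(2)[of x] have "x \<in> S" by (auto simp: S_def dist_real_def)
    then have "Inf S \<le> x" using bdd by (rule cInf_lower)
    with \<open>x < Inf S\<close> show False by simp
  qed
qed

lemma first_hit_closed:
  fixes w :: "real \<Rightarrow> real"
  assumes cont: "continuous_on {0..} w" and w0: "0 < w 0" and s: "0 < s" "w s \<le> 0"
  defines "D \<equiv> {s. 0 < s \<and> w s \<le> 0}"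
  shows "Inf D \<in> D" "(INF t\<in>D. ereal t) = ereal (Inf D)"
proof -
  have D: "D = {s \<in> {0..}. w s \<le> 0}" using w0 by (auto simp: D_def less_le)
  have "closed D" unfolding D by (rule continuous_on_closed_Collect_le[OF cont]) (auto intro!: continuous_intros)
  moreover have ne: "D \<noteq> {}" and bdd: "bdd_below D" using s by (auto simp: D_def intro: bdd_belowI[of _ 0])
  ultimately show *: "Inf D \<in> D" by (intro closed_contains_Inf)
  show "(INF t\<in>D. ereal t) = ereal (Inf D)"
    using * bdd by (intro antisym INF_lower INF_greatest) (auto intro: cInf_lower)
qed

text \<open>Before the first zero \<sigma> the path has a positive minimum on [0, \<sigma> - e/2],
  so it stays above small levels there, and the strict entrance times converge to \<sigma>. The
  condition w t \<noteq> 0 removes the one bad case, a first touch exactly at t, where the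
  approximations count a hit and the limit does not.\<close>

lemma first_hit_limit:
  fixes w :: "real \<Rightarrow> real" and g :: "real \<Rightarrow> real \<Rightarrow> real"
  assumes t: "0 < t" and cont: "continuous_on {0..} w" and w0: "0 < w 0" and wt: "w t \<noteq> 0"
    and g: "continuous_on ({0..<t} \<times> UNIV) (\<lambda>(s, x). g s x)"
    and \<delta>: "\<delta> \<longlonglongrightarrow> 0" "\<And>m. 0 < \<delta> m"
  shows "(\<lambda>m. if \<exists>s\<in>{0..t}. w s < \<delta> m then g (Inf {s\<in>{0..t}. w s < \<delta> m}) (\<delta> m) else 0)
    \<longlonglongrightarrow> (if (INF s\<in>{s. 0 < s \<and> w s \<le> 0}. ereal s) < ereal t
        then g (real_of_ereal (INF s\<in>{s. 0 < s \<and> w s \<le> 0}. ereal s)) 0 else 0)"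
proof -
  define D where "D = {s. 0 < s \<and> w s \<le> 0}"
  have ct: "continuous_on {0..t} w" by (rule continuous_on_subset[OF cont]) auto
  show ?thesis
  proof (cases "(INF s\<in>D. ereal s) < ereal t")
    case True
    then obtain s1 where s1: "0 < s1" "w s1 \<le> 0" "s1 < t" by (auto simp: INF_less_iff D_def)
    define \<sigma> where "\<sigma> = Inf D"
    have \<sigma>: "0 < \<sigma>" "w \<sigma> \<le> 0" and I: "(INF s\<in>D. ereal s) = ereal \<sigma>"
      using first_hit_closed[OF cont w0 s1(1,2)] by (auto simp: \<sigma>_def D_def)
    have \<sigma>t: "\<sigma> < t" using True I by simp
    have below: "w s > 0" if "0 \<le> s" "s < \<sigma>" for s
    proof (rule ccontr)
      assume "\<not> w s > 0"
      then have "s \<in> D" using that w0 by (auto simp: D_def less_le)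
      then have "\<sigma> \<le> s" unfolding \<sigma>_def by (intro cInf_lower bdd_belowI[of _ 0]) (auto simp: D_def)
      with that show False by simp
    qed
    define \<rho> where "\<rho> = (\<lambda>m. Inf {s\<in>{0..t}. w s < \<delta> m})"
    have ex: "\<exists>s\<in>{0..t}. w s < \<delta> m" for m using \<sigma> \<sigma>t \<delta>(2)[of m] by (intro bexI[of _ \<sigma>]) auto
    have \<rho>le: "0 \<le> \<rho> m" "\<rho> m \<le> \<sigma>" for m
    proof -
      show "0 \<le> \<rho> m" unfolding \<rho>_def using ex[of m] by (intro cInf_greatest) auto
      show "\<rho> m \<le> \<sigma>" unfolding \<rho>_def using \<sigma> \<sigma>t \<delta>(2)[of m] by (intro cInf_lower) (auto intro: bdd_belowI[of _ 0])
    qed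
    have lim: "\<rho> \<longlonglongrightarrow> \<sigma>"
    proof (rule LIMSEQ_I)
      fix e :: real assume e: "e > 0"
      show "\<exists>no. \<forall>m\<ge>no. norm (\<rho> m - \<sigma>) < e"
      proof (cases "\<sigma> - e / 2 < 0")
        case True
        have "norm (\<rho> m - \<sigma>) < e" for m using \<rho>le[of m] True e unfolding real_norm_def by linarith
        then show ?thesis by blast
      next
        case False
        obtain m0 where m0: "m0 \<in> {0..\<sigma> - e/2}" "\<And>s. s \<in> {0..\<sigma> - e/2} \<Longrightarrow> w m0 \<le> w s"
          using continuous_attains_inf[of "{0..\<sigma> - e/2}" w] continuous_on_subset[OF cont] False by auto
        have "w m0 > 0" using m0(1) e by (intro below) auto
        from order_tendstoD(2)[OF \<delta>(1) this] obtain N where N: "\<And>m. m \<ge> N \<Longrightarrow> \<delta> m < w m0"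
          by (auto simp: eventually_sequentially)
        have "\<sigma> - e/2 \<le> \<rho> m" if "m \<ge> N" for m
          unfolding \<rho>_def
        proof (rule cInf_greatest)
          show "{s \<in> {0..t}. w s < \<delta> m} \<noteq> {}" using ex[of m] by auto
          fix s assume "s \<in> {s \<in> {0..t}. w s < \<delta> m}"
          then show "\<sigma> - e/2 \<le> s" using m0(2)[of s] N[OF that] by force
        qed
        then have "norm (\<rho> m - \<sigma>) < e" if "m \<ge> N" for m
          using \<rho>le[of m] that e unfolding real_norm_def by force
        then show ?thesis by blast
      qed
    qed
    have "(\<lambda>m. g (\<rho> m) (\<delta> m)) \<longlonglongrightarrow> g \<sigma> 0"
      using continuous_on_tendsto_compose[OF g tendsto_Pair[OF lim \<delta>(1)]] \<sigma> \<sigma>t \<rho>le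
      by (auto intro!: always_eventually intro: le_less_trans)
    then show ?thesis using ex True I unfolding D_def[symmetric] \<rho>_def by simp
  next
    case False
    have pos: "w s > 0" if s: "s \<in> {0..t}" for s
    proof (cases "s < t")
      case True
      show ?thesis
      proof (rule ccontr)
        assume "\<not> w s > 0"
        then have "s \<in> D" using s w0 by (auto simp: D_def less_le)
        then have "(INF s\<in>D. ereal s) < ereal t" using True by (auto simp: INF_less_iff)
        with False show False by simp
      qed
    next
      case F: False
      then have st: "s = t" using s by simp
      have "0 \<le> w t"
      proof (rule ccontr)
        assume "\<not> 0 \<le> w t"
        then have "- w t > 0" by simp
        then obtain d where d: "d > 0" "\<And>x. x \<in> {0..t} \<Longrightarrow> dist x t < d \<Longrightarrow> dist (w x) (w t) < - w t"
          using ct t unfolding continuous_on_iff by (metis atLeastAtMost_iff less_eq_real_def)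
        define x where "x = max (t / 2) (t - d / 2)"
        have x: "x \<in> {0..t}" "dist x t < d" "x < t" "0 < x" using d(1) t by (auto simp: x_def dist_real_def)
        with d(2)[of x] have "w x < 0" by (auto simp: dist_real_def)
        then have "(INF s\<in>D. ereal s) < ereal t" using x by (auto simp: INF_less_iff D_def intro!: exI[of _ x])
        with False show False by simp
      qed
      with wt st show ?thesis by simp
    qed
    obtain m0 where m0: "m0 \<in> {0..t}" "\<And>s. s \<in> {0..t} \<Longrightarrow> w m0 \<le> w s"
      using continuous_attains_inf[of "{0..t}" w] ct t by auto
    from order_tendstoD(2)[OF \<delta>(1) pos[OF m0(1)]]
    have "\<forall>\<^sub>F m in sequentially. \<not> (\<exists>s\<in>{0..t}. w s < \<delta> m)"
      by eventually_elim (use m0(2) in force)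
    then have "(\<lambda>m. if \<exists>s\<in>{0..t}. w s < \<delta> m then g (Inf {s\<in>{0..t}. w s < \<delta> m}) (\<delta> m) else 0) \<longlonglongrightarrow> 0"
      by (rule tendsto_eventually[OF eventually_mono]) simp
    then show ?thesis using False unfolding D_def by simp
  qed
qed

lemma sum_first_hit:
  fixes f :: "nat \<Rightarrow> real"
  shows "(\<Sum>k\<le>N. if P k \<and> (\<forall>j<k. \<not> P j) then f k else 0) = (if \<exists>k\<le>N. P k then f (LEAST k. P k) else 0)"
proof (cases "\<exists>k\<le>N. P k")
  case True
  then obtain k where k: "k \<le> N" "P k" by blast
  define l where "l = (LEAST k. P k)"
  have l: "P l" "l \<le> N" using k Least_le[of P k] LeastI[of P k] by (auto simp: l_def)
  have "P j \<and> (\<forall>i<j. \<not> P i) \<longleftrightarrow> j = l" for j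
    using l(1) unfolding l_def by (metis LeastI_ex Least_le not_less not_less_Least order.strict_iff_order)
  then have "(\<Sum>k\<le>N. if P k \<and> (\<forall>j<k. \<not> P j) then f k else 0) = (\<Sum>k\<le>N. if k = l then f k else 0)" by simp
  also have "\<dots> = f l" using l(2) by (simp add: sum.delta)
  finally show ?thesis using True l_def by simp
next
  case False
  then show ?thesis by (auto intro!: sum.neutral)
qed

section \<open>The strong Markov property at the first passage\<close>

context
  fixes M :: "'a measure" and W :: "real \<Rightarrow> 'a \<Rightarrow> real"
  assumes bm: "standard_brownian_motion M W"
begin

interpretation prob_space M using bm by (simp add: standard_brownian_motion_def)

lemma bm_measurable: "0 \<le> s \<Longrightarrow> W s \<in> borel_measurable M"
  and bm_0: "AE \<omega> in M. W 0 \<omega> = 0"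
  and bm_continuous: "\<omega> \<in> space M \<Longrightarrow> continuous_on {0..} (\<lambda>s. W s \<omega>)"
  and bm_increment: "0 \<le> s \<Longrightarrow> s < t \<Longrightarrow> distributed M lborel (\<lambda>\<omega>. W t \<omega> - W s \<omega>) (normal_density 0 (sqrt (t - s)))"
  using bm by (auto simp: standard_brownian_motion_def)

lemma bm_increment_le:
  assumes "0 \<le> s" "s < t"
  shows "measure (distr M borel (\<lambda>\<omega>. W t \<omega> - W s \<omega>)) {..z} = gauss_tail (- z / sqrt (t - s)) / sqrt (2 * pi)"
proof -
  have "distr M lborel (\<lambda>\<omega>. W t \<omega> - W s \<omega>) = density lborel (normal_density 0 (sqrt (t - s)))"
    by (rule distributed_distr_eq_density[OF bm_increment[OF assms]])
  moreover have "distr M borel (\<lambda>\<omega>. W t \<omega> - W s \<omega>) = distr M lborel (\<lambda>\<omega>. W t \<omega> - W s \<omega>)"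
    by (rule distr_cong) auto
  ultimately show ?thesis using measure_normal_atMost[of "t - s" z] assms by simp
qed

text \<open>Markov property at a fixed grid time. A concerns the first k increments, the rest of the
  path the later ones; independence makes the joint law a product, and the inner integral over the
  later increments is a Gaussian distribution function.\<close>

lemma bm_grid_markov:
  assumes h: "0 < h" and k: "k < N" and A: "A \<in> sets (PiM {..<k} (\<lambda>_. borel))"
  defines "X \<equiv> \<lambda>\<omega>. restrict (\<lambda>i. W (real (Suc i) * h) \<omega> - W (real i * h) \<omega>) {..<k}"
  defines "S \<equiv> \<lambda>x. \<Sum>i<k. x i :: real"
  shows "(\<integral>\<omega>. indicator A (X \<omega>) * indicator {..y} (S (X \<omega>) + (W (real N * h) \<omega> - W (real k * h) \<omega>)) \<partial>M)
    = (\<integral>\<omega>. indicator A (X \<omega>) * (gauss_tail ((S (X \<omega>) - y) / sqrt (real N * h - real k * h)) / sqrt (2 * pi)) \<partial>M)"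
proof -
  let ?D = "\<lambda>i \<omega>. W (real (Suc i) * h) \<omega> - W (real i * h) \<omega>"
  let ?P = "PiM {..<k} (\<lambda>_. borel :: real measure)"
  let ?Q = "PiM {k..<N} (\<lambda>_. borel :: real measure)"
  define Z where "Z = (\<lambda>\<omega>. restrict (\<lambda>i. ?D i \<omega>) {k..<N})"
  define R where "R = (\<lambda>x. \<Sum>i\<in>{k..<N}. x i :: real)"
  have sm: "strict_mono (\<lambda>i. real i * h)" using h by (auto simp: strict_mono_def)
  have iv: "0 \<le> ts 0 \<Longrightarrow> strict_mono ts \<Longrightarrow> indep_vars (\<lambda>_. borel) (\<lambda>i \<omega>. W (ts (Suc i)) \<omega> - W (ts i) \<omega>) {..<N}" for ts
    using bm unfolding standard_brownian_motion_def by blast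
  have "indep_vars (\<lambda>_. borel) ?D {..<N}"
    using iv[OF _ sm] by (simp del: of_nat_Suc)
  then have ind: "indep_var ?P X ?Q Z"
    unfolding X_def Z_def by (rule indep_var_restrict) (use k in auto)
  have RZ: "R (Z \<omega>) = W (real N * h) \<omega> - W (real k * h) \<omega>" for \<omega>
  proof -
    have "R (Z \<omega>) = (\<Sum>i\<in>{k..<N}. ?D i \<omega>)" by (auto simp: R_def Z_def)
    also have "\<dots> = W (real N * h) \<omega> - W (real k * h) \<omega>"
      using k by (intro sum_Suc_diff'[where f="\<lambda>i. W (real i * h) \<omega>"]) simp
    finally show ?thesis .
  qed
  have X[measurable]: "X \<in> measurable M ?P" and Z[measurable]: "Z \<in> measurable M ?Q"
    using ind by (auto dest: indep_var_rv1 indep_var_rv2)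
  have S[measurable]: "S \<in> borel_measurable ?P" unfolding S_def by measurable
  have R[measurable]: "R \<in> borel_measurable ?Q" unfolding R_def by measurable
  have Y[measurable]: "(\<lambda>\<omega>. W (real N * h) \<omega> - W (real k * h) \<omega>) \<in> borel_measurable M"
    unfolding RZ[symmetric] by measurable
  note [measurable] = A
  interpret PX: prob_space "distr M ?P X" by (rule prob_space_distr) measurable
  interpret PZ: prob_space "distr M ?Q Z" by (rule prob_space_distr) measurable
  interpret PP: pair_prob_space "distr M ?P X" "distr M ?Q Z" ..
  let ?g = "\<lambda>(x, v). indicator A x * indicator {..y} (S x + R v) :: real"
  have gm[measurable]: "?g \<in> borel_measurable (?P \<Otimes>\<^sub>M ?Q)" by measurable
  have gi: "integrable (distr M ?P X \<Otimes>\<^sub>M distr M ?Q Z) ?g"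
    by (rule PP.P.integrable_const_bound[where B=1]) (auto simp: indicator_def)
  have "(\<integral>\<omega>. indicator A (X \<omega>) * indicator {..y} (S (X \<omega>) + R (Z \<omega>)) \<partial>M) = (\<integral>\<omega>. ?g (X \<omega>, Z \<omega>) \<partial>M)" by simp
  also have "\<dots> = (\<integral>z. ?g z \<partial>distr M (?P \<Otimes>\<^sub>M ?Q) (\<lambda>\<omega>. (X \<omega>, Z \<omega>)))"
    by (rule integral_distr[symmetric]) measurable
  also have "distr M (?P \<Otimes>\<^sub>M ?Q) (\<lambda>\<omega>. (X \<omega>, Z \<omega>)) = distr M ?P X \<Otimes>\<^sub>M distr M ?Q Z"
    using ind by (auto simp: indep_var_distribution_eq)
  also have "(\<integral>z. ?g z \<partial>(distr M ?P X \<Otimes>\<^sub>M distr M ?Q Z)) = (\<integral>x. (\<integral>v. ?g (x, v) \<partial>distr M ?Q Z) \<partial>distr M ?P X)"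
    by (rule PP.integral_fst'[OF gi, symmetric])
  also have "\<dots> = (\<integral>\<omega>. (\<integral>v. ?g (X \<omega>, v) \<partial>distr M ?Q Z) \<partial>M)"
    by (rule integral_distr) measurable
  also have "\<dots> = (\<integral>\<omega>. indicator A (X \<omega>) * (gauss_tail ((S (X \<omega>) - y) / sqrt (real N * h - real k * h)) / sqrt (2 * pi)) \<partial>M)"
  proof (rule Bochner_Integration.integral_cong[OF refl])
    fix \<omega> assume "\<omega> \<in> space M"
    then have [simp]: "X \<omega> \<in> space ?P" using X by (rule measurable_space[rotated])
    let ?Y = "\<lambda>\<omega>. W (real N * h) \<omega> - W (real k * h) \<omega>"
    have "(\<integral>v. ?g (X \<omega>, v) \<partial>distr M ?Q Z) = (\<integral>\<omega>'. ?g (X \<omega>, Z \<omega>') \<partial>M)"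
      by (rule integral_distr) (auto intro!: borel_measurable_times borel_measurable_indicator')
    also have "\<dots> = (\<integral>\<omega>'. indicator A (X \<omega>) * indicator {..y - S (X \<omega>)} (?Y \<omega>') \<partial>M)"
      by (rule Bochner_Integration.integral_cong) (auto simp: RZ indicator_def algebra_simps)
    also have "\<dots> = indicator A (X \<omega>) * (\<integral>\<omega>'. indicator {..y - S (X \<omega>)} (?Y \<omega>') \<partial>M)" by simp
    also have "(\<integral>\<omega>'. (indicator {..y - S (X \<omega>)} (?Y \<omega>') :: real) \<partial>M) = (\<integral>v. indicator {..y - S (X \<omega>)} v \<partial>distr M borel ?Y)"
      by (rule integral_distr[symmetric]) auto
    also have "\<dots> = measure (distr M borel ?Y) {..y - S (X \<omega>)}"
      by simp
    also have "\<dots> = gauss_tail (- (y - S (X \<omega>)) / sqrt (real N * h - real k * h)) / sqrt (2 * pi)"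
      using h k by (intro bm_increment_le) auto
    finally show "(\<integral>v. ?g (X \<omega>, v) \<partial>distr M ?Q Z) = indicator A (X \<omega>) * (gauss_tail ((S (X \<omega>) - y) / sqrt (real N * h - real k * h)) / sqrt (2 * pi))"
      by simp
  qed
  finally show ?thesis by (simp add: RZ)
qed

text \<open>Strong Markov property on the grid, by splitting over the first index k below c +
  \<delta>. The condition y < c t + \<delta> ensures that every path with W t \<le> y has such an
  index, at the latest N. At k = N no time is left, so T is an indicator times sqrt(2 pi).\<close>

lemma bm_grid_stopping:
  fixes c :: "real \<Rightarrow> real"
  assumes t: "0 < t" and N: "0 < N" and y: "y < c t + \<delta>"
  defines "s \<equiv> \<lambda>k::nat. real k * t / real N"
  defines "T \<equiv> \<lambda>k v. if k < N then gauss_tail ((v - y) / sqrt (t - s k)) else sqrt (2 * pi) * indicator {..y} v"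
  shows "(\<integral>\<omega>. (if \<exists>k\<le>N. W (s k) \<omega> - c (s k) < \<delta> then T (LEAST k. W (s k) \<omega> - c (s k) < \<delta>) (W (s (LEAST k. W (s k) \<omega> - c (s k) < \<delta>)) \<omega>) else 0) \<partial>M)
      = sqrt (2 * pi) * prob {\<omega> \<in> space M. W t \<omega> \<le> y}"
    and "(\<lambda>\<omega>. (if \<exists>k\<le>N. W (s k) \<omega> - c (s k) < \<delta> then T (LEAST k. W (s k) \<omega> - c (s k) < \<delta>) (W (s (LEAST k. W (s k) \<omega> - c (s k) < \<delta>)) \<omega>) else 0)) \<in> borel_measurable M"
proof -
  define h where "h = t / real N"
  have h: "0 < h" and sh: "s k = real k * h" for k using t N by (auto simp: h_def s_def)
  have sN: "s N = t" using N by (simp add: s_def)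
  have s0: "0 \<le> s k" for k using t by (simp add: s_def)
  note Wm[measurable] = bm_measurable[OF s0]
  have Wt[measurable]: "W t \<in> borel_measurable M" using t by (intro bm_measurable) simp
  define P where "P = (\<lambda>\<omega> k. W (s k) \<omega> - c (s k) < \<delta>)"
  define E where "E = (\<lambda>\<omega> k. P \<omega> k \<and> (\<forall>j<k. \<not> P \<omega> j))"
  have [measurable]: "Measurable.pred M (\<lambda>\<omega>. P \<omega> k)" for k unfolding P_def by measurable
  have [measurable]: "Measurable.pred M (\<lambda>\<omega>. E \<omega> k)" for k unfolding E_def by measurable
  have T[measurable]: "T k \<in> borel_measurable borel" for k unfolding T_def by measurable
  have Tb: "\<bar>T k v\<bar> \<le> sqrt (2 * pi)" for k v
    using gauss_tail_nonneg gauss_tail_le by (auto simp: T_def indicator_def)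
  have eq: "(if \<exists>k\<le>N. W (s k) \<omega> - c (s k) < \<delta> then T (LEAST k. W (s k) \<omega> - c (s k) < \<delta>) (W (s (LEAST k. W (s k) \<omega> - c (s k) < \<delta>)) \<omega>) else 0)
    = (\<Sum>k\<le>N. if E \<omega> k then T k (W (s k) \<omega>) else 0)" for \<omega>
    unfolding E_def P_def by (rule sum_first_hit[symmetric, where f="\<lambda>k. T k (W (s k) \<omega>)"])
  have step: "(\<integral>\<omega>. (if E \<omega> k then T k (W (s k) \<omega>) else 0) \<partial>M) = sqrt (2 * pi) * (\<integral>\<omega>. (if E \<omega> k then indicator {..y} (W t \<omega>) else 0) \<partial>M)" if k: "k \<le> N" for k
  proof (cases "k < N")
    case False
    then have "k = N" using k by simp
    then show ?thesis by (auto simp: T_def sN integral_mult_right_zero[symmetric] simp del: integral_mult_right_zero intro!: Bochner_Integration.integral_cong)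
  next
    case True
    let ?Q = "PiM {..<k} (\<lambda>_. borel :: real measure)"
    define X where "X = (\<lambda>\<omega>. restrict (\<lambda>i. W (real (Suc i) * h) \<omega> - W (real i * h) \<omega>) {..<k})"
    define A where "A = {x \<in> space ?Q. (\<Sum>i<k. x i) - c (s k) < \<delta> \<and> (\<forall>j<k. \<not> (\<Sum>i<j. x i) - c (s j) < \<delta>)}"
    have comp: "(\<lambda>x. \<Sum>i<j. x i) \<in> borel_measurable ?Q" if "j \<le> k" for j
      using that by (intro borel_measurable_sum measurable_component_singleton) auto
    have A: "A \<in> sets ?Q"
    proof -
      have "A = {x \<in> space ?Q. (\<Sum>i<k. x i) - c (s k) < \<delta>} \<inter> {x \<in> space ?Q. \<forall>j\<in>{..<k}. \<not> (\<Sum>i<j. x i) - c (s j) < \<delta>}"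
        by (auto simp: A_def)
      moreover have "{x \<in> space ?Q. (\<Sum>i<k. x i) - c (s k) < \<delta>} \<in> sets ?Q"
        using comp[of k] by measurable
      moreover have "{x \<in> space ?Q. \<not> (\<Sum>i<j. x i) - c (s j) < \<delta>} \<in> sets ?Q" if "j \<in> {..<k}" for j
        using comp[of j] that by (intro borel_measurable_less[THEN sets.sets_Collect_neg] borel_measurable_diff) auto
      ultimately show ?thesis by (auto intro!: sets.sets_Collect_finite_All)
    qed
    have tel: "(\<Sum>i<j. X \<omega> i) = W (s j) \<omega> - W 0 \<omega>" if "j \<le> k" for j \<omega>
    proof -
      have "(\<Sum>i<j. X \<omega> i) = (\<Sum>i\<in>{0..<j}. W (real (Suc i) * h) \<omega> - W (real i * h) \<omega>)"
        using that by (auto simp: X_def lessThan_atLeast0 intro!: sum.cong)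
      also have "\<dots> = W (real j * h) \<omega> - W (real 0 * h) \<omega>" by (rule sum_Suc_diff'[where f="\<lambda>i. W (real i * h) \<omega>"]) simp
      finally show ?thesis by (simp add: sh)
    qed
    have Xsp: "X \<omega> \<in> space ?Q" for \<omega> by (auto simp: X_def space_PiM)
    \<comment> \<open>Independence concerns increments, so the event is encoded by sums of
      increments. These give back W only where W 0 = 0, which holds almost surely.\<close>
    have EA: "indicator A (X \<omega>) = (if E \<omega> k then 1 else 0 :: real)" "(\<Sum>i<k. X \<omega> i) = W (s k) \<omega>" if "W 0 \<omega> = 0" for \<omega>
      using that Xsp[of \<omega>] tel[of _ \<omega>] by (auto simp: A_def E_def P_def indicator_def)
    have Xm[measurable]: "X \<in> measurable M ?Q"
      unfolding X_def using h by (intro measurable_restrict borel_measurable_diff bm_measurable) auto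
    note [measurable] = A comp[OF order_refl]
    have "(\<integral>\<omega>. (if E \<omega> k then T k (W (s k) \<omega>) else 0) \<partial>M)
      = (\<integral>\<omega>. sqrt (2 * pi) * (indicator A (X \<omega>) * (gauss_tail (((\<Sum>i<k. X \<omega> i) - y) / sqrt (real N * h - real k * h)) / sqrt (2 * pi))) \<partial>M)"
    proof (rule integral_cong_AE)
      show "AE \<omega> in M. (if E \<omega> k then T k (W (s k) \<omega>) else 0) = sqrt (2 * pi) * (indicator A (X \<omega>) * (gauss_tail (((\<Sum>i<k. X \<omega> i) - y) / sqrt (real N * h - real k * h)) / sqrt (2 * pi)))"
        using bm_0 by eventually_elim (use True sN in \<open>simp add: EA T_def sh\<close>)
    qed measurable
    also have "\<dots> = sqrt (2 * pi) * (\<integral>\<omega>. indicator A (X \<omega>) * indicator {..y} ((\<Sum>i<k. X \<omega> i) + (W (real N * h) \<omega> - W (real k * h) \<omega>)) \<partial>M)"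
      using bm_grid_markov[OF h True A, of y] unfolding X_def by (simp only: integral_mult_right_zero)
    also have "(\<integral>\<omega>. (indicator A (X \<omega>) :: real) * indicator {..y} ((\<Sum>i<k. X \<omega> i) + (W (real N * h) \<omega> - W (real k * h) \<omega>)) \<partial>M)
       = (\<integral>\<omega>. (if E \<omega> k then indicator {..y} (W t \<omega>) else 0) \<partial>M)"
      unfolding sh[symmetric] sN
    proof (rule integral_cong_AE)
      show "AE \<omega> in M. indicator A (X \<omega>) * indicator {..y} ((\<Sum>i<k. X \<omega> i) + (W t \<omega> - W (s k) \<omega>)) = (if E \<omega> k then indicator {..y} (W t \<omega>) else (0::real))"
        using bm_0 by eventually_elim (simp add: EA)
    qed measurable
    finally show ?thesis .
  qed
  have int: "integrable M (\<lambda>\<omega>. if E \<omega> k then T k (W (s k) \<omega>) else 0)" for k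
    by (rule integrable_const_bound[where B="sqrt (2 * pi)"]) (use Tb in auto)
  have int2: "integrable M (\<lambda>\<omega>. if E \<omega> k then indicator {..y} (W t \<omega>) else 0 :: real)" for k
    by (rule integrable_const_bound[where B=1]) (auto simp: indicator_def)
  have "(\<integral>\<omega>. (\<Sum>k\<le>N. if E \<omega> k then T k (W (s k) \<omega>) else 0) \<partial>M) = (\<Sum>k\<le>N. \<integral>\<omega>. (if E \<omega> k then T k (W (s k) \<omega>) else 0) \<partial>M)"
    by (rule Bochner_Integration.integral_sum) (rule int)
  also have "\<dots> = sqrt (2 * pi) * (\<Sum>k\<le>N. \<integral>\<omega>. (if E \<omega> k then indicator {..y} (W t \<omega>) else 0) \<partial>M)"
    by (simp add: step sum_distrib_left)
  also have "(\<Sum>k\<le>N. \<integral>\<omega>. (if E \<omega> k then indicator {..y} (W t \<omega>) else (0::real)) \<partial>M) = (\<integral>\<omega>. (\<Sum>k\<le>N. if E \<omega> k then indicator {..y} (W t \<omega>) else (0::real)) \<partial>M)"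
    by (rule Bochner_Integration.integral_sum[symmetric]) (rule int2)
  also have "\<dots> = (\<integral>\<omega>. indicator {\<omega> \<in> space M. W t \<omega> \<le> y} \<omega> \<partial>M)"
  proof (rule Bochner_Integration.integral_cong[OF refl])
    fix \<omega> assume "\<omega> \<in> space M"
    moreover have "P \<omega> N" if "W t \<omega> \<le> y" using that y by (auto simp: P_def sN)
    ultimately show "(\<Sum>k\<le>N. if E \<omega> k then indicator {..y} (W t \<omega>) else (0::real)) = indicator {\<omega> \<in> space M. W t \<omega> \<le> y} \<omega>"
      unfolding E_def by (subst sum_first_hit) (auto simp: indicator_def)
  qed
  also have "\<dots> = prob {\<omega> \<in> space M. W t \<omega> \<le> y}" by simp
  finally show "(\<integral>\<omega>. (if \<exists>k\<le>N. W (s k) \<omega> - c (s k) < \<delta> then T (LEAST k. W (s k) \<omega> - c (s k) < \<delta>) (W (s (LEAST k. W (s k) \<omega> - c (s k) < \<delta>)) \<omega>) else 0) \<partial>M)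
      = sqrt (2 * pi) * prob {\<omega> \<in> space M. W t \<omega> \<le> y}" unfolding eq .
  show "(\<lambda>\<omega>. (if \<exists>k\<le>N. W (s k) \<omega> - c (s k) < \<delta> then T (LEAST k. W (s k) \<omega> - c (s k) < \<delta>) (W (s (LEAST k. W (s k) \<omega> - c (s k) < \<delta>)) \<omega>) else 0)) \<in> borel_measurable M"
    unfolding eq by measurable
qed

text \<open>A hit before y takes place inside some rational interval [u,v] with u > 0; staying away
  from 0 matters because c is only known to be continuous on (0, \<infinity>).\<close>

lemma first_passage_measurable:
  assumes c: "continuous_on {0<..} c"
  shows "first_passage_time W c \<in> borel_measurable M"
proof (rule borel_measurableI_less)
  fix y :: ereal
  have cont: "continuous_on {u..v} (\<lambda>s. W s \<omega> - c s)" if "\<omega> \<in> space M" "0 < u" for \<omega> u v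
    using that by (intro continuous_intros continuous_on_subset[OF bm_continuous] continuous_on_subset[OF c]) auto
  have iff: "first_passage_time W c \<omega> < y \<longleftrightarrow>
      (\<exists>u\<in>\<rat>. \<exists>v\<in>\<rat>. 0 < u \<and> u < v \<and> ereal v < y \<and>
        (\<forall>j::nat. \<exists>r\<in>\<rat>. u \<le> r \<and> r \<le> v \<and> W r \<omega> - c r < 1 / real (Suc j)))" (is "?L \<longleftrightarrow> ?R")
    if \<omega>: "\<omega> \<in> space M" for \<omega>
  proof
    assume ?L
    then obtain t where t: "0 < t" "W t \<omega> \<le> c t" "ereal t < y"
      by (auto simp: first_passage_time_def INF_less_iff)
    obtain u where u: "u \<in> \<rat>" "0 < u" "u < t" using Rats_dense_in_real[OF t(1)] by auto
    obtain v where v: "v \<in> \<rat>" "t < v" "ereal v < y"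
    proof -
      obtain z where "ereal t < ereal z" "ereal z < y" using ereal_dense2[OF t(3)] by blast
      with Rats_dense_in_real[of t z] that show ?thesis by (meson ereal_less(2) less_ereal.simps(1) less_trans)
    qed
    have "\<exists>t\<in>{u..v}. W t \<omega> - c t \<le> 0" using t u v by (intro bexI[of _ t]) auto
    then have "\<forall>j::nat. \<exists>r\<in>\<rat>. u \<le> r \<and> r \<le> v \<and> W r \<omega> - c r < 1 / real (Suc j)"
      using exists_le_zero_iff_rational[OF _ cont[OF \<omega> u(2)], of v] u v by auto
    with u v show ?R by (intro bexI[of _ u] bexI[of _ v]) auto
  next
    assume ?R
    then obtain u v where uv: "0 < u" "u < v" "ereal v < y" "\<forall>j::nat. \<exists>r\<in>\<rat>. u \<le> r \<and> r \<le> v \<and> W r \<omega> - c r < 1 / real (Suc j)" by blast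
    then obtain t where "t \<in> {u..v}" "W t \<omega> - c t \<le> 0"
      using exists_le_zero_iff_rational[OF uv(2) cont[OF \<omega> uv(1)]] by blast
    then show ?L using uv by (auto simp: first_passage_time_def INF_less_iff intro!: exI[of _ t] le_less_trans[of "ereal t" "ereal v"])
  qed
  define Q where "Q = {p \<in> \<rat> \<times> \<rat>. 0 < fst p \<and> fst p < snd p \<and> ereal (snd p) < y}"
  define R where "R = (\<lambda>p::real \<times> real. {r \<in> \<rat>. fst p \<le> r \<and> r \<le> snd p})"
  have cQ: "countable Q" and cR: "countable (R p)" for p
    unfolding Q_def R_def by (auto intro: countable_subset[OF _ countable_SIGMA[OF countable_rat countable_rat]] countable_subset[OF _ countable_rat])
  have "{\<omega> \<in> space M. first_passage_time W c \<omega> < y} =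
    (\<Union>p\<in>Q. \<Inter>j::nat. \<Union>r\<in>R p. {\<omega> \<in> space M. W r \<omega> - c r < 1 / real (Suc j)})"
  proof (intro set_eqI iffI)
    fix \<omega> assume "\<omega> \<in> {\<omega> \<in> space M. first_passage_time W c \<omega> < y}"
    then have \<omega>: "\<omega> \<in> space M" "first_passage_time W c \<omega> < y" by auto
    from iffD1[OF iff[OF \<omega>(1)] \<omega>(2)] obtain u v where "u \<in> \<rat>" "v \<in> \<rat>" "0 < u" "u < v" "ereal v < y"
      "\<forall>j::nat. \<exists>r\<in>\<rat>. u \<le> r \<and> r \<le> v \<and> W r \<omega> - c r < 1 / real (Suc j)" by blast
    then show "\<omega> \<in> (\<Union>p\<in>Q. \<Inter>j::nat. \<Union>r\<in>R p. {\<omega> \<in> space M. W r \<omega> - c r < 1 / real (Suc j)})"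
      using \<omega> by (intro UN_I[of "(u, v)"]) (auto simp: Q_def R_def)
  next
    fix \<omega> assume "\<omega> \<in> (\<Union>p\<in>Q. \<Inter>j::nat. \<Union>r\<in>R p. {\<omega> \<in> space M. W r \<omega> - c r < 1 / real (Suc j)})"
    then obtain u v where uv: "(u, v) \<in> Q" and j: "\<And>j. \<exists>r\<in>R (u, v). \<omega> \<in> space M \<and> W r \<omega> - c r < 1 / real (Suc j)" by auto
    have \<omega>: "\<omega> \<in> space M" using j[of 0] by blast
    show "\<omega> \<in> {\<omega> \<in> space M. first_passage_time W c \<omega> < y}"
    proof -
      have "\<exists>u\<in>\<rat>. \<exists>v\<in>\<rat>. 0 < u \<and> u < v \<and> ereal v < y \<and>
        (\<forall>j::nat. \<exists>r\<in>\<rat>. u \<le> r \<and> r \<le> v \<and> W r \<omega> - c r < 1 / real (Suc j))"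
        using uv j unfolding Q_def R_def by (intro bexI[of _ u] bexI[of _ v]) fastforce+
      then show ?thesis using iff[OF \<omega>] \<omega> by blast
    qed
  qed
  also have "\<dots> \<in> sets M"
  proof -
    have "{\<omega> \<in> space M. W r \<omega> - c r < 1 / real (Suc j)} \<in> sets M" if "p \<in> Q" "r \<in> R p" for p r and j :: nat
    proof -
      have "0 \<le> r" using that by (auto simp: Q_def R_def)
      then show ?thesis using bm_measurable[of r] by measurable
    qed
    then have "(\<Union>r\<in>R p. {\<omega> \<in> space M. W r \<omega> - c r < 1 / real (Suc j)}) \<in> sets M" if "p \<in> Q" for p and j :: nat
      using that by (intro sets.countable_UN'[OF cR]) blast
    then have "(\<Inter>j::nat. \<Union>r\<in>R p. {\<omega> \<in> space M. W r \<omega> - c r < 1 / real (Suc j)}) \<in> sets M" if "p \<in> Q" for p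
      using that by (intro sets.countable_INT) blast+
    then show ?thesis by (intro sets.countable_UN'[OF cQ]) blast
  qed
  finally show "{\<omega> \<in> space M. first_passage_time W c \<omega> < y} \<in> sets M" .
qed

lemma bm_not_eq:
  assumes "0 < t"
  shows "AE \<omega> in M. W t \<omega> \<noteq> z"
proof -
  have "AE x in density lborel (normal_density 0 (sqrt (t - 0))). x \<noteq> z"
    by (subst AE_density) (use AE_lborel_singleton[of z] in \<open>auto elim!: eventually_mono\<close>)
  then have "AE x in distr M lborel (\<lambda>\<omega>. W t \<omega> - W 0 \<omega>). x \<noteq> z"
    unfolding distributed_distr_eq_density[OF bm_increment[OF order_refl assms]] .
  then have "AE \<omega> in M. W t \<omega> - W 0 \<omega> \<noteq> z"
    using bm_measurable[of t] bm_measurable[of 0] assms by (subst (asm) AE_distr_iff) auto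
  with bm_0 show ?thesis by eventually_elim simp
qed

text \<open>Two limits in this order: mesh to 0 at a fixed level \<delta>, where the strict entrance
  is visible to grids, then \<delta> to 0. In the first limit continuity gives W = c + \<delta> at
  the entrance time, so the overshoot of the discrete walk disappears.\<close>

theorem bm_first_passage_cdf:
  assumes t: "0 < t" and c: "continuous_on {0..} c" and c0: "c 0 < 0" and y: "y \<le> c t"
  defines "\<tau> \<equiv> first_passage_time W c"
  shows "(\<integral>\<omega>. (if \<tau> \<omega> < ereal t then gauss_tail ((c (real_of_ereal (\<tau> \<omega>)) - y) / sqrt (t - real_of_ereal (\<tau> \<omega>))) else 0) \<partial>M)
    = sqrt (2 * pi) * prob {\<omega> \<in> space M. W t \<omega> \<le> y}"
proof -
  have c': "continuous_on {0<..} c" by (rule continuous_on_subset[OF c]) auto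
  note \<tau>m[measurable] = first_passage_measurable[OF c', folded \<tau>_def]
  \<comment> \<open>Positive, tending to 0, and at most - c 0, so that a path with W 0 = 0 starts at
    or above the level c + \<delta>.\<close>
  define \<delta> where "\<delta> = (\<lambda>m::nat. - c 0 / real (m + 2))"
  have \<delta>: "0 < \<delta> m" "\<delta> m \<le> - c 0" for m
  proof -
    show "0 < \<delta> m" unfolding \<delta>_def using c0 by (intro divide_pos_pos) auto
    have "- c 0 \<le> - c 0 * real (m + 2)" using c0 by simp
    then show "\<delta> m \<le> - c 0" unfolding \<delta>_def by (subst pos_divide_le_eq) auto
  qed
  have \<delta>lim: "\<delta> \<longlonglongrightarrow> 0" unfolding \<delta>_def by real_asymp
  define T where "T = (\<lambda>(N::nat) k v. if k < N then gauss_tail ((v - y) / sqrt (t - real k * t / real N)) else sqrt (2 * pi) * indicator {..y} v)"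
  define P where "P = (\<lambda>m N \<omega> (k::nat). W (real k * t / real N) \<omega> - c (real k * t / real N) < \<delta> m)"
  define X where "X = (\<lambda>m (n::nat) \<omega>. if \<exists>k\<le>Suc n. P m (Suc n) \<omega> k
    then T (Suc n) (LEAST k. P m (Suc n) \<omega> k) (W (real (LEAST k. P m (Suc n) \<omega> k) * t / real (Suc n)) \<omega>) else 0)"
  have y': "y < c t + \<delta> m" for m using y \<delta>(1)[of m] by linarith
  have XE: "(\<integral>\<omega>. X m n \<omega> \<partial>M) = sqrt (2 * pi) * prob {\<omega> \<in> space M. W t \<omega> \<le> y}" for m n
    unfolding X_def T_def P_def by (rule bm_grid_stopping(1)[where c=c and N="Suc n" and t=t and y=y and \<delta>="\<delta> m", OF t _ y']) simp
  have Xm[measurable]: "X m n \<in> borel_measurable M" for m n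
    unfolding X_def T_def P_def by (rule bm_grid_stopping(2)[where c=c and N="Suc n" and t=t and y=y and \<delta>="\<delta> m", OF t _ y']) simp
  have Tb: "\<bar>T N k v\<bar> \<le> sqrt (2 * pi)" for N k v
    using gauss_tail_nonneg gauss_tail_le by (auto simp: T_def indicator_def)
  have Xb: "\<bar>X m n \<omega>\<bar> \<le> sqrt (2 * pi)" for m n \<omega> using Tb by (auto simp: X_def)
  define g where "g = (\<lambda>s x. gauss_tail ((c s + x - y) / sqrt (t - s)))"
  define Y where "Y = (\<lambda>m \<omega>. if \<exists>s\<in>{0..t}. W s \<omega> - c s < \<delta> m then g (Inf {s\<in>{0..t}. W s \<omega> - c s < \<delta> m}) (\<delta> m) else 0)"
  have XY: "(\<lambda>n. X m n \<omega>) \<longlonglongrightarrow> Y m \<omega>" if \<omega>: "\<omega> \<in> space M" "W 0 \<omega> = 0" for m \<omega>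
  proof -
    define w where "w = (\<lambda>s. W s \<omega> - c s)"
    have cw: "continuous_on {0..t} w" unfolding w_def
      by (intro continuous_intros continuous_on_subset[OF bm_continuous[OF \<omega>(1)]] continuous_on_subset[OF c]) auto
    have cW: "continuous_on {0..<t} (\<lambda>s. gauss_tail ((W s \<omega> - y) / sqrt (t - s)))"
      by (intro continuous_intros continuous_on_subset[OF bm_continuous[OF \<omega>(1)]]) auto
    have w0: "\<delta> m \<le> w 0" using \<delta>(2)[of m] \<omega>(2) by (simp add: w_def)
    show ?thesis
    proof (cases "\<exists>s\<in>{0..t}. w s < \<delta> m")
      case True
      then obtain s0 where s0: "s0 \<in> {0..t}" "w s0 < \<delta> m" by blast
      define \<rho> where "\<rho> = Inf {s\<in>{0..t}. w s < \<delta> m}"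
      define \<kappa> where "\<kappa> = (\<lambda>n::nat. LEAST k. w (real k * t / real (Suc n)) < \<delta> m)"
      have fh: "0 \<le> \<rho>" "\<rho> < t" "w \<rho> = \<delta> m"
        "\<forall>\<^sub>F n in sequentially. \<exists>k\<le>Suc n. w (real k * t / real (Suc n)) < \<delta> m"
        "(\<lambda>n. real (\<kappa> n) * t / real (Suc n)) \<longlonglongrightarrow> \<rho>"
        unfolding \<rho>_def \<kappa>_def by (rule grid_first_hit[OF t cw s0 w0])+
      have lim: "(\<lambda>n. gauss_tail ((W (real (\<kappa> n) * t / real (Suc n)) \<omega> - y) / sqrt (t - real (\<kappa> n) * t / real (Suc n))))
         \<longlonglongrightarrow> gauss_tail ((W \<rho> \<omega> - y) / sqrt (t - \<rho>))"
      proof (rule continuous_on_tendsto_compose[OF cW fh(5)])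
        show "\<forall>\<^sub>F n in sequentially. real (\<kappa> n) * t / real (Suc n) \<in> {0..<t}"
          using order_tendstoD(2)[OF fh(5,2)] by eventually_elim (use t in auto)
      qed (use fh in auto)
      have eq: "\<forall>\<^sub>F n in sequentially. gauss_tail ((W (real (\<kappa> n) * t / real (Suc n)) \<omega> - y) / sqrt (t - real (\<kappa> n) * t / real (Suc n))) = X m n \<omega>"
        using fh(4) order_tendstoD(2)[OF fh(5,2)]
      proof eventually_elim
        case (elim n)
        have "real (\<kappa> n) * t < t * real (Suc n)" using elim(2) by (simp add: pos_divide_less_eq)
        then have "real (\<kappa> n) < real (Suc n)" using t by (simp add: mult.commute)
        then have "\<kappa> n < Suc n" by simp
        moreover have "\<kappa> n = (LEAST k. P m (Suc n) \<omega> k)" by (simp only: \<kappa>_def P_def w_def)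
        moreover have "\<exists>k\<le>Suc n. P m (Suc n) \<omega> k" using elim(1) by (simp only: P_def w_def)
        ultimately show ?case unfolding X_def T_def by simp
      qed
      have "W \<rho> \<omega> = c \<rho> + \<delta> m" using fh(3) by (simp add: w_def)
      then have "gauss_tail ((W \<rho> \<omega> - y) / sqrt (t - \<rho>)) = Y m \<omega>"
        using True by (simp add: Y_def g_def \<rho>_def w_def)
      with Lim_transform_eventually[OF lim eq] show ?thesis by simp
    next
      case False
      have "X m n \<omega> = 0" for n
      proof -
        have "\<not> P m (Suc n) \<omega> k" if "k \<le> Suc n" for k
        proof -
          have "real k * t \<le> real (Suc n) * t" using that t by (intro mult_right_mono) auto
          then have "real k * t / real (Suc n) \<le> t" by (simp add: pos_divide_le_eq mult.commute)
          then show ?thesis using False t by (auto simp: P_def w_def)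
        qed
        then show ?thesis by (auto simp: X_def)
      qed
      then show ?thesis using False by (auto simp: Y_def w_def)
    qed
  qed
  \<comment> \<open>\<open>Y m\<close> involves an infimum over uncountably many times. The limit of
    the measurable \<open>X m n\<close> supplies a measurable version, equal to \<open>Y m\<close>
    wherever W 0 = 0.\<close>
  define Y' where "Y' = (\<lambda>m \<omega>. lim (\<lambda>n. X m n \<omega>))"
  have Y'm[measurable]: "Y' m \<in> borel_measurable M" for m unfolding Y'_def by measurable
  have sp: "AE \<omega> in M. \<omega> \<in> space M" by simp
  have Y'E: "(\<integral>\<omega>. Y' m \<omega> \<partial>M) = sqrt (2 * pi) * prob {\<omega> \<in> space M. W t \<omega> \<le> y}" for m
  proof -
    have "(\<lambda>n. \<integral>\<omega>. X m n \<omega> \<partial>M) \<longlonglongrightarrow> (\<integral>\<omega>. Y' m \<omega> \<partial>M)"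
    proof (rule integral_dominated_convergence[where w="\<lambda>_. sqrt (2 * pi)"])
      show "AE \<omega> in M. (\<lambda>n. X m n \<omega>) \<longlonglongrightarrow> Y' m \<omega>"
        using bm_0 sp by eventually_elim (auto simp: Y'_def dest!: XY intro: limI[THEN ssubst])
    qed (use Xb in auto)
    then show ?thesis unfolding XE by (rule LIMSEQ_unique[OF tendsto_const, symmetric])
  qed
  have Y'b: "AE \<omega> in M. norm (Y' m \<omega>) \<le> sqrt (2 * pi)" for m
    using bm_0 sp
  proof eventually_elim
    case (elim \<omega>)
    have "Y' m \<omega> = Y m \<omega>" unfolding Y'_def using elim by (intro limI XY)
    then show ?case using gauss_tail_nonneg gauss_tail_le by (auto simp: Y_def g_def)
  qed
  have "(\<lambda>m. \<integral>\<omega>. Y' m \<omega> \<partial>M) \<longlonglongrightarrow> (\<integral>\<omega>. (if \<tau> \<omega> < ereal t then g (real_of_ereal (\<tau> \<omega>)) 0 else 0) \<partial>M)"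
  proof (rule integral_dominated_convergence[where w="\<lambda>_. sqrt (2 * pi)"])
    show "AE \<omega> in M. (\<lambda>m. Y' m \<omega>) \<longlonglongrightarrow> (if \<tau> \<omega> < ereal t then g (real_of_ereal (\<tau> \<omega>)) 0 else 0)"
      using bm_0 sp bm_not_eq[OF t, of "c t"]
    proof eventually_elim
      case (elim \<omega>)
      have eq: "Y' m \<omega> = Y m \<omega>" for m unfolding Y'_def using elim by (intro limI XY)
      have cg: "continuous_on ({0..<t} \<times> UNIV) (\<lambda>(s, x). g s x)"
        unfolding g_def case_prod_beta' by (intro continuous_intros continuous_on_compose2[OF c]) auto
      have cw: "continuous_on {0..} (\<lambda>s. W s \<omega> - c s)"
        by (intro continuous_intros c bm_continuous elim)
      have \<tau>eq: "\<tau> \<omega> = (INF s\<in>{s. 0 < s \<and> W s \<omega> - c s \<le> 0}. ereal s)" by (simp add: \<tau>_def first_passage_time_def)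
      show ?case unfolding eq Y_def \<tau>eq
        by (rule first_hit_limit[OF t cw _ _ cg \<delta>lim \<delta>(1)]) (use elim c0 in auto)
    qed
    show "(\<lambda>\<omega>. if \<tau> \<omega> < ereal t then g (real_of_ereal (\<tau> \<omega>)) 0 else 0) \<in> borel_measurable M"
    proof -
      \<comment> \<open>Continuity of c on [0, \<infinity>) makes its cut-off a Borel function on
        the line. Nothing changes, because \<open>real_of_ereal\<close> sends the nonnegative
        passage time, \<infinity> included, into [0, \<infinity>).\<close>
      define cc where "cc = (\<lambda>s. indicator {0..} s *\<^sub>R c s)"
      have [measurable]: "cc \<in> borel_measurable borel"
        unfolding cc_def using borel_measurable_continuous_on_indicator[OF _ c] by simp
      have "0 \<le> \<tau> \<omega>" for \<omega> unfolding \<tau>_def first_passage_time_def by (rule INF_greatest) auto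
      then have "c (real_of_ereal (\<tau> \<omega>)) = cc (real_of_ereal (\<tau> \<omega>))" for \<omega> by (simp add: cc_def real_of_ereal_pos)
      then have "(\<lambda>\<omega>. if \<tau> \<omega> < ereal t then g (real_of_ereal (\<tau> \<omega>)) 0 else 0) =
        (\<lambda>\<omega>. if \<tau> \<omega> < ereal t then gauss_tail ((cc (real_of_ereal (\<tau> \<omega>)) - y) / sqrt (t - real_of_ereal (\<tau> \<omega>))) else 0)"
        unfolding g_def by (simp only: add_0_right)
      also have "\<dots> \<in> borel_measurable M" by measurable
      finally show ?thesis .
    qed
  qed (use Y'b in auto)
  then have "(\<integral>\<omega>. (if \<tau> \<omega> < ereal t then g (real_of_ereal (\<tau> \<omega>)) 0 else 0) \<partial>M) = sqrt (2 * pi) * prob {\<omega> \<in> space M. W t \<omega> \<le> y}"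
    unfolding Y'E by (rule LIMSEQ_unique[OF _ tendsto_const])
  then show ?thesis unfolding g_def by (simp only: add_0_right)
qed

end

section \<open>Heat potentials of weighted times and the kernel identity for every p < 1\<close>

lemma exp_decay_below_diff:
  assumes v: "exp_decay_below c v" and w: "exp_decay_below c w"
  shows "exp_decay_below c (\<lambda>x. v x - w x)"
  unfolding exp_decay_below_def
proof (intro conjI allI impI)
  note [measurable] = measurable_exp_decay_below[OF v] measurable_exp_decay_below[OF w]
  show "(\<lambda>x. v x - w x) \<in> borel_measurable borel" by measurable
  show "continuous_on {..<c} (\<lambda>x. v x - w x)"
    using v w unfolding exp_decay_below_def by (auto intro!: continuous_intros)
  fix x0 assume x0: "x0 < c"
  obtain C1 l1 where 1: "0 < l1" "0 \<le> C1" "\<And>x. x \<le> x0 \<Longrightarrow> \<bar>v x\<bar> \<le> C1 * exp (l1 * x)"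
    using exp_decay_belowE[OF v x0] by blast
  obtain C2 l2 where 2: "0 < l2" "0 \<le> C2" "\<And>x. x \<le> x0 \<Longrightarrow> \<bar>w x\<bar> \<le> C2 * exp (l2 * x)"
    using exp_decay_belowE[OF w x0] by blast
  define l where "l = min l1 l2"
  have dom: "C * exp (l' * x) \<le> (C * exp ((l' - l) * x0)) * exp (l * x)" if "x \<le> x0" "l \<le> l'" "0 \<le> C" for C l' x
  proof -
    have "(l' - l) * x \<le> (l' - l) * x0" using that by (intro mult_left_mono) auto
    then have "l' * x \<le> (l' - l) * x0 + l * x" by (simp add: algebra_simps)
    then have "C * exp (l' * x) \<le> C * exp ((l' - l) * x0 + l * x)" using that by (intro mult_left_mono) auto
    then show ?thesis by (simp add: exp_add mult.assoc)
  qed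
  have "\<bar>v x - w x\<bar> \<le> (C1 * exp ((l1 - l) * x0) + C2 * exp ((l2 - l) * x0)) * exp (l * x)" if "x \<le> x0" for x
  proof -
    have "l \<le> l1" "l \<le> l2" by (auto simp: l_def)
    then show ?thesis
      using 1(3)[OF that] 2(3)[OF that] dom[OF that, of l1 C1] dom[OF that, of l2 C2] 1(2) 2(2)
      unfolding distrib_right by linarith
  qed
  then show "\<exists>C l. 0 < l \<and> (\<forall>x\<le>x0. \<bar>v x - w x\<bar> \<le> C * exp (l * x))"
    using 1(1) 2(1) by (intro exI[of _ "C1 * exp ((l1 - l) * x0) + C2 * exp ((l2 - l) * x0)"] exI[of _ l]) (auto simp: l_def)
qed

lemma exp_decay_below_heat_flux:
  assumes t: "0 < t"
  shows "exp_decay_below c (\<lambda>x. heat_flux (- x) t)"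
  unfolding exp_decay_below_def
proof (intro conjI allI impI)
  show "(\<lambda>x. heat_flux (- x) t) \<in> borel_measurable borel" by measurable
  show "continuous_on {..<c} (\<lambda>x. heat_flux (- x) t)"
    unfolding heat_flux_def using t by (auto intro!: continuous_intros)
  show "\<exists>C l. 0 < l \<and> (\<forall>x\<le>x0. \<bar>heat_flux (- x) t\<bar> \<le> C * exp (l * x))" for x0
    using abs_heat_flux_le[OF t, of "- _"] t
    by (intro exI[of _ "4 / t"] exI[of _ "1 / sqrt t"]) auto
qed

text \<open>Near t the gap c s - x0 stays at least e > 0, and e^(-e/sqrt r) \<le> 2r/e^2 absorbs the
  factor 1/r; away from t the elapsed time is at least d and c is bounded. These two regimes give
  the two terms of K.\<close>

lemma exp_quotient_bound:
  fixes c :: "real \<Rightarrow> real"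
  assumes t: "0 < t" and c: "continuous_on UNIV c" and x0: "x0 < c t"
  obtains K where "0 \<le> K" "\<And>s. 0 \<le> s \<Longrightarrow> s < t \<Longrightarrow> 4 / (t - s) * exp (- (c s - x0) / sqrt (t - s)) \<le> K"
proof -
  define e where "e = (c t - x0) / 2"
  have e: "0 < e" using x0 by (simp add: e_def)
  obtain d where d: "0 < d" "\<And>s. dist s t < d \<Longrightarrow> dist (c s) (c t) < e"
    using c e unfolding continuous_on_iff by (metis UNIV_I)
  have "compact (c ` {0..t})" by (intro compact_continuous_image continuous_on_subset[OF c]) auto
  then obtain B where B: "\<And>s. s \<in> {0..t} \<Longrightarrow> \<bar>c s\<bar> \<le> B"
    by (metis bounded_iff compact_imp_bounded image_eqI real_norm_def)
  define K where "K = 8 / e\<^sup>2 + 4 / d * exp ((B + \<bar>x0\<bar>) / sqrt d)"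
  have key: "4 / r * exp (- (c s - x0) / sqrt r) \<le> K" if s: "0 \<le> s" "s < t" and r: "r = t - s" for s r
  proof (cases "r < d")
    case True
    have r0: "0 < r" using s r by simp
    have "dist (c s) (c t) < e" using True r s by (intro d(2)) (auto simp: dist_real_def)
    then have "e \<le> c s - x0" by (auto simp: dist_real_def e_def field_simps abs_if split: if_splits)
    then have "- (c s - x0) / sqrt r \<le> - e / sqrt r" using r0 by (intro divide_right_mono) auto
    then have "exp (- (c s - x0) / sqrt r) \<le> exp (- (e / sqrt r))" by simp
    also have "\<dots> = 1 / exp (e / sqrt r)" by (simp add: exp_minus divide_inverse)
    also have "\<dots> \<le> 1 / ((e / sqrt r)\<^sup>2 / 2)"
    proof -
      have "(e / sqrt r)\<^sup>2 / 2 \<le> exp (e / sqrt r)"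
      proof -
        have "0 \<le> e / sqrt r" using e r0 by simp
        from exp_lower_Taylor_quadratic[OF this] this show ?thesis by linarith
      qed
      then show ?thesis using e r0 by (intro divide_left_mono) auto
    qed
    also have "\<dots> = 2 * r / e\<^sup>2" using r0 by (simp add: power_divide)
    finally have "4 / r * exp (- (c s - x0) / sqrt r) \<le> 4 / r * (2 * r / e\<^sup>2)" using r0 by (intro mult_left_mono) auto
    also have "\<dots> = 8 / e\<^sup>2" using r0 by simp
    also have "\<dots> \<le> K" using d(1) by (simp add: K_def)
    finally show ?thesis .
  next
    case False
    have "- (c s - x0) / sqrt r \<le> (B + \<bar>x0\<bar>) / sqrt r"
      using B[of s] s r by (intro divide_right_mono) auto
    also have "\<dots> \<le> (B + \<bar>x0\<bar>) / sqrt d"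
      using False d(1) B[of 0] t by (intro divide_left_mono) auto
    finally have "4 / r * exp (- (c s - x0) / sqrt r) \<le> 4 / d * exp ((B + \<bar>x0\<bar>) / sqrt d)"
      using False d(1) by (intro mult_mono divide_left_mono) auto
    also have "\<dots> \<le> K" by (simp add: K_def)
    finally show ?thesis .
  qed
  show ?thesis
    by (rule that[of K]) (use d(1) key in \<open>auto simp: K_def\<close>)
qed

lemma heat_flux_uniform_bound:
  fixes c :: "real \<Rightarrow> real"
  assumes t: "0 < t" and c: "continuous_on UNIV c" and x0: "x0 < c t"
  obtains K where "0 \<le> K" "\<And>s x. 0 \<le> s \<Longrightarrow> s < t \<Longrightarrow> x \<le> x0 \<Longrightarrow> \<bar>heat_flux (c s - x) (t - s)\<bar> \<le> K * exp ((x - x0) / sqrt t)"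
proof -
  obtain K where K: "0 \<le> K" and key: "\<And>s. 0 \<le> s \<Longrightarrow> s < t \<Longrightarrow> 4 / (t - s) * exp (- (c s - x0) / sqrt (t - s)) \<le> K"
    using exp_quotient_bound[OF t c x0] by blast
  show ?thesis
  proof (rule that)
    show "0 \<le> K" by (rule K)
    fix s x assume s: "0 \<le> s" "s < t" and x: "x \<le> x0"
    define r where "r = t - s"
    have r: "0 < r" "r \<le> t" using s by (auto simp: r_def)
    have "\<bar>heat_flux (c s - x) r\<bar> \<le> 4 / r * exp (- (c s - x) / sqrt r)" using r by (intro abs_heat_flux_le)
    also have "exp (- (c s - x) / sqrt r) = exp (- (c s - x0) / sqrt r) * exp ((x - x0) / sqrt r)"
      by (simp add: exp_add[symmetric] add_divide_distrib[symmetric])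
    also have "4 / r * \<dots> = (4 / r * exp (- (c s - x0) / sqrt r)) * exp ((x - x0) / sqrt r)" by simp
    also have "\<dots> \<le> K * exp ((x - x0) / sqrt t)"
    proof (intro mult_mono key[OF s, folded r_def])
      have "(x0 - x) / sqrt t \<le> (x0 - x) / sqrt r" using r x by (intro divide_left_mono) auto
      then have "(x - x0) / sqrt r \<le> (x - x0) / sqrt t" by (simp add: diff_divide_distrib)
      then show "exp ((x - x0) / sqrt r) \<le> exp ((x - x0) / sqrt t)" by simp
    qed (use K in auto)
    finally show "\<bar>heat_flux (c s - x) (t - s)\<bar> \<le> K * exp ((x - x0) / sqrt t)" by (simp add: r_def)
  qed
qed

text \<open>The exponent of r is the time singularity of the kernel: for a = 1 - p it equals -
  (p+1)/2, which is above -1 exactly when p < 1.\<close>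

lemma integral_heat_flux_bound:
  assumes a: "0 < a" and r: "0 < r"
  shows "integrable (power_measure a) (\<lambda>u. heat_flux (X + u) r)"
    and "(\<integral>u. \<bar>heat_flux (X + u) r\<bar> \<partial>power_measure a) \<le> 4 * Gamma a * (r powr (a / 2 - 1) * exp (- X / sqrt r))"
proof -
  have b: "\<bar>heat_flux (X + u) r\<bar> \<le> (4 / r * exp (- X / sqrt r)) * exp (- (1 / sqrt r * u))" for u
    using abs_heat_flux_le[OF r, of "X + u"] by (simp add: exp_add[symmetric] add_divide_distrib algebra_simps diff_divide_distrib)
  show i: "integrable (power_measure a) (\<lambda>u. heat_flux (X + u) r)"
    by (rule integrable_power_measure_exp_bound[OF a, where l="1 / sqrt r" and C="4 / r * exp (- X / sqrt r)"]) (use r b in auto)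
  have "(\<integral>u. \<bar>heat_flux (X + u) r\<bar> \<partial>power_measure a) \<le> (\<integral>u. (4 / r * exp (- X / sqrt r)) * exp (- (1 / sqrt r * u)) \<partial>power_measure a)"
    using r b i a by (intro integral_mono integrable_mult_right integrable_power_measure_exp) auto
  also have "\<dots> = (4 / r * exp (- X / sqrt r)) * (Gamma a / (1 / sqrt r) powr a)"
    using r a by (simp add: integral_power_measure_exp del: times_divide_eq_left)
  also have "\<dots> = 4 * Gamma a * ((sqrt r powr a / r) * exp (- X / sqrt r))"
    using r by (simp add: powr_divide)
  also have "sqrt r powr a / r = r powr (a / 2 - 1)" using r by (simp add: powr_half_sqrt[symmetric] powr_powr powr_diff)
  finally show "(\<integral>u. \<bar>heat_flux (X + u) r\<bar> \<partial>power_measure a) \<le> 4 * Gamma a * (r powr (a / 2 - 1) * exp (- X / sqrt r))" .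
qed

text \<open>One setting for two uses: the law of the first passage (N the probability space,
  \<sigma> = \<tau>, q the indicator of \<tau> < t), and a signed density D on (0,t) (N Lebesgue
  measure, \<sigma> the identity, q = D on that interval).\<close>

locale weighted_times = sigma_finite_measure N for N :: "'b measure" +
  fixes \<sigma> q :: "'b \<Rightarrow> real" and t :: real and c :: "real \<Rightarrow> real"
  assumes t: "0 < t" and c: "continuous_on UNIV c" and \<sigma>[measurable]: "\<sigma> \<in> borel_measurable N"
    and q: "integrable N q" and q0: "\<And>\<omega>. q \<omega> \<noteq> 0 \<Longrightarrow> 0 \<le> \<sigma> \<omega> \<and> \<sigma> \<omega> < t"
begin

definition flux :: "real \<Rightarrow> real" where
  "flux x = (\<integral>\<omega>. q \<omega> * heat_flux (c (\<sigma> \<omega>) - x) (t - \<sigma> \<omega>) \<partial>N)"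

lemma q_measurable [measurable]: "q \<in> borel_measurable N" using q by auto
lemma c_measurable [measurable]: "c \<in> borel_measurable borel" using c by (rule borel_measurable_continuous_onI)

lemma flux_measurable [measurable]: "flux \<in> borel_measurable borel"
  unfolding flux_def by measurable

text \<open>\<open>heat_flux_uniform_bound\<close> is uniform over all times before t, so
  integration against q costs only the L1 norm of q; dominated convergence gives continuity below c
  t.\<close>

lemma exp_decay_below_flux: "exp_decay_below (c t) flux"
  unfolding exp_decay_below_def
proof (intro conjI allI impI)
  show "flux \<in> borel_measurable borel" by measurable
  show "\<exists>C l. 0 < l \<and> (\<forall>x\<le>x0. \<bar>flux x\<bar> \<le> C * exp (l * x))" if x0: "x0 < c t" for x0
  proof -
    obtain K where K: "0 \<le> K" "\<And>s x. 0 \<le> s \<Longrightarrow> s < t \<Longrightarrow> x \<le> x0 \<Longrightarrow> \<bar>heat_flux (c s - x) (t - s)\<bar> \<le> K * exp ((x - x0) / sqrt t)"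
      using heat_flux_uniform_bound[OF t c x0] by blast
    have "\<bar>flux x\<bar> \<le> ((\<integral>\<omega>. \<bar>q \<omega>\<bar> \<partial>N) * K * exp (- x0 / sqrt t)) * exp (1 / sqrt t * x)" if x: "x \<le> x0" for x
    proof -
      have b: "\<bar>q \<omega> * heat_flux (c (\<sigma> \<omega>) - x) (t - \<sigma> \<omega>)\<bar> \<le> \<bar>q \<omega>\<bar> * (K * exp ((x - x0) / sqrt t))" for \<omega>
        using K(2)[OF _ _ x, of "\<sigma> \<omega>"] q0[of \<omega>] by (cases "q \<omega> = 0") (auto simp: abs_mult intro!: mult_left_mono)
      have "norm (flux x) \<le> (\<integral>\<omega>. \<bar>q \<omega>\<bar> * (K * exp ((x - x0) / sqrt t)) \<partial>N)"
        unfolding flux_def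
      proof (rule norm_integral_le_AE)
        show "integrable N (\<lambda>\<omega>. \<bar>q \<omega>\<bar> * (K * exp ((x - x0) / sqrt t)))" using q by simp
        then show "integrable N (\<lambda>\<omega>. q \<omega> * heat_flux (c (\<sigma> \<omega>) - x) (t - \<sigma> \<omega>))"
          by (rule Bochner_Integration.integrable_bound) (use b K(1) in \<open>auto simp: abs_mult\<close>)
      qed (use b in auto)
      also have "\<dots> = (\<integral>\<omega>. \<bar>q \<omega>\<bar> \<partial>N) * (K * exp ((x - x0) / sqrt t))" by simp
      also have "exp ((x - x0) / sqrt t) = exp (- x0 / sqrt t) * exp (1 / sqrt t * x)"
        by (simp add: exp_add[symmetric] diff_divide_distrib)
      finally show ?thesis by (simp add: mult.assoc)
    qed
    then show ?thesis using t by (intro exI[of _ "(\<integral>\<omega>. \<bar>q \<omega>\<bar> \<partial>N) * K * exp (- x0 / sqrt t)"] exI[of _ "1 / sqrt t"]) auto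
  qed
  show "continuous_on {..<c t} flux"
    unfolding continuous_on_eq_continuous_at[OF open_lessThan]
  proof
    fix x assume x: "x \<in> {..<c t}"
    define x0 where "x0 = (x + c t) / 2"
    have x0: "x < x0" "x0 < c t" using x by (auto simp: x0_def)
    obtain K where K: "0 \<le> K" "\<And>s x. 0 \<le> s \<Longrightarrow> s < t \<Longrightarrow> x \<le> x0 \<Longrightarrow> \<bar>heat_flux (c s - x) (t - s)\<bar> \<le> K * exp ((x - x0) / sqrt t)"
      using heat_flux_uniform_bound[OF t c x0(2)] by blast
    have "continuous (at x within {..<x0}) flux"
      unfolding flux_def
    proof (rule continuous_within_integral_dominated[where g="\<lambda>\<omega>. \<bar>q \<omega>\<bar> * K"])
      show "integrable N (\<lambda>\<omega>. \<bar>q \<omega>\<bar> * K)" using q by simp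
      fix z assume z: "z \<in> {..<x0}"
      show "AE \<omega> in N. \<bar>q \<omega> * heat_flux (c (\<sigma> \<omega>) - z) (t - \<sigma> \<omega>)\<bar> \<le> \<bar>q \<omega>\<bar> * K"
      proof (rule AE_I2)
        fix \<omega>
        have "\<bar>heat_flux (c (\<sigma> \<omega>) - z) (t - \<sigma> \<omega>)\<bar> \<le> K" if "q \<omega> \<noteq> 0"
        proof -
          have "\<bar>heat_flux (c (\<sigma> \<omega>) - z) (t - \<sigma> \<omega>)\<bar> \<le> K * exp ((z - x0) / sqrt t)"
            using z q0[OF that] by (intro K) auto
          also have "\<dots> \<le> K * 1" using z t K(1) by (intro mult_left_mono) (auto simp: divide_nonpos_pos)
          finally show ?thesis by simp
        qed
        then show "\<bar>q \<omega> * heat_flux (c (\<sigma> \<omega>) - z) (t - \<sigma> \<omega>)\<bar> \<le> \<bar>q \<omega>\<bar> * K"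
          by (cases "q \<omega> = 0") (auto simp: abs_mult intro!: mult_left_mono)
      qed
    next
      show "AE \<omega> in N. continuous (at x within {..<x0}) (\<lambda>x. q \<omega> * heat_flux (c (\<sigma> \<omega>) - x) (t - \<sigma> \<omega>))"
      proof (rule AE_I2)
        fix \<omega> show "continuous (at x within {..<x0}) (\<lambda>x. q \<omega> * heat_flux (c (\<sigma> \<omega>) - x) (t - \<sigma> \<omega>))"
          using q0[of \<omega>] unfolding heat_flux_def by (cases "q \<omega> = 0") (auto intro!: continuous_intros)
      qed
    qed (use x0 in auto)
    moreover have "at x within {..<x0} = at x" using x0 by (intro at_within_open) auto
    ultimately show "isCont flux x" by simp
  qed
qed

text \<open>The point x may lie on the curve, where the uniform bounds valid strictly below it fail.
  Absolute convergence is therefore an explicit hypothesis, phrased with the majorant of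
  \<open>integral_heat_flux_bound\<close>.\<close>

lemma flux_fubini:
  assumes a: "0 < a" and int: "integrable N (\<lambda>\<omega>. q \<omega> * ((t - \<sigma> \<omega>) powr (a / 2 - 1) * exp (- (c (\<sigma> \<omega>) - x) / sqrt (t - \<sigma> \<omega>))))"
  shows "(\<integral>u. flux (x - u) \<partial>power_measure a) = (\<integral>\<omega>. q \<omega> * (\<integral>u. heat_flux (c (\<sigma> \<omega>) - x + u) (t - \<sigma> \<omega>) \<partial>power_measure a) \<partial>N)"
    and "integrable N (\<lambda>\<omega>. q \<omega> * (\<integral>u. heat_flux (c (\<sigma> \<omega>) - x + u) (t - \<sigma> \<omega>) \<partial>power_measure a))"
proof -
  interpret pa: sigma_finite_measure "power_measure a" by (rule sigma_finite_power_measure)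
  interpret P: pair_sigma_finite N "power_measure a" ..
  let ?f = "\<lambda>\<omega> u. q \<omega> * heat_flux (c (\<sigma> \<omega>) - x + u) (t - \<sigma> \<omega>)"
  let ?g = "\<lambda>\<omega>. (t - \<sigma> \<omega>) powr (a / 2 - 1) * exp (- (c (\<sigma> \<omega>) - x) / sqrt (t - \<sigma> \<omega>))"
  note hf = integral_heat_flux_bound[OF a]
  have fi: "integrable (N \<Otimes>\<^sub>M power_measure a) (\<lambda>(\<omega>, u). ?f \<omega> u)"
  proof (rule P.Fubini_integrable)
    show "(\<lambda>(\<omega>, u). ?f \<omega> u) \<in> borel_measurable (N \<Otimes>\<^sub>M power_measure a)" by measurable
    show "AE \<omega> in N. integrable (power_measure a) (\<lambda>u. case (\<omega>, u) of (\<omega>, u) \<Rightarrow> ?f \<omega> u)"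
    proof (rule AE_I2)
      fix \<omega> show "integrable (power_measure a) (\<lambda>u. case (\<omega>, u) of (\<omega>, u) \<Rightarrow> ?f \<omega> u)"
        using q0[of \<omega>] hf(1)[of "t - \<sigma> \<omega>"] by (cases "q \<omega> = 0") auto
    qed
    show "integrable N (\<lambda>\<omega>. \<integral>u. norm (case (\<omega>, u) of (\<omega>, u) \<Rightarrow> ?f \<omega> u) \<partial>power_measure a)"
    proof (rule Bochner_Integration.integrable_bound)
      show "integrable N (\<lambda>\<omega>. 4 * Gamma a * (q \<omega> * ?g \<omega>))" using int by simp
      show "(\<lambda>\<omega>. \<integral>u. norm (case (\<omega>, u) of (\<omega>, u) \<Rightarrow> ?f \<omega> u) \<partial>power_measure a) \<in> borel_measurable N" by measurable
      show "AE \<omega> in N. norm (\<integral>u. norm (case (\<omega>, u) of (\<omega>, u) \<Rightarrow> ?f \<omega> u) \<partial>power_measure a) \<le> norm (4 * Gamma a * (q \<omega> * ?g \<omega>))"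
      proof (rule AE_I2)
        fix \<omega>
        have "\<bar>q \<omega>\<bar> * (\<integral>u. \<bar>heat_flux (c (\<sigma> \<omega>) - x + u) (t - \<sigma> \<omega>)\<bar> \<partial>power_measure a) \<le> \<bar>q \<omega>\<bar> * (4 * Gamma a * ?g \<omega>)"
          using hf(2)[of "t - \<sigma> \<omega>" "c (\<sigma> \<omega>) - x"] q0[of \<omega>]
          by (cases "q \<omega> = 0") (auto intro!: mult_left_mono)
        moreover have "0 \<le> (\<integral>u. \<bar>heat_flux (c (\<sigma> \<omega>) - x + u) (t - \<sigma> \<omega>)\<bar> \<partial>power_measure a)"
          by (rule Bochner_Integration.integral_nonneg) simp
        ultimately show "norm (\<integral>u. norm (case (\<omega>, u) of (\<omega>, u) \<Rightarrow> ?f \<omega> u) \<partial>power_measure a) \<le> norm (4 * Gamma a * (q \<omega> * ?g \<omega>))"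
          using Gamma_real_pos[OF a] by (simp add: abs_mult mult_ac)
      qed
    qed
  qed
  have "(\<integral>u. flux (x - u) \<partial>power_measure a) = (\<integral>u. (\<integral>\<omega>. ?f \<omega> u \<partial>N) \<partial>power_measure a)"
    unfolding flux_def by (simp add: algebra_simps)
  also have "\<dots> = (\<integral>\<omega>. (\<integral>u. ?f \<omega> u \<partial>power_measure a) \<partial>N)"
    by (rule P.Fubini_integral[OF fi])
  also have "\<dots> = (\<integral>\<omega>. q \<omega> * (\<integral>u. heat_flux (c (\<sigma> \<omega>) - x + u) (t - \<sigma> \<omega>) \<partial>power_measure a) \<partial>N)" by simp
  finally show "(\<integral>u. flux (x - u) \<partial>power_measure a) = (\<integral>\<omega>. q \<omega> * (\<integral>u. heat_flux (c (\<sigma> \<omega>) - x + u) (t - \<sigma> \<omega>) \<partial>power_measure a) \<partial>N)" .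
  show "integrable N (\<lambda>\<omega>. q \<omega> * (\<integral>u. heat_flux (c (\<sigma> \<omega>) - x + u) (t - \<sigma> \<omega>) \<partial>power_measure a))"
    using P.integrable_fst'[OF fi] by simp
qed

lemma flux_kernel:
  assumes p: "p < 1" and int: "integrable N (\<lambda>\<omega>. q \<omega> * ((t - \<sigma> \<omega>) powr (- (p + 1) / 2) * exp (- (c (\<sigma> \<omega>) - x) / sqrt (t - \<sigma> \<omega>))))"
  shows "(\<integral>u. flux (x - u) \<partial>power_measure (1 - p)) = Gamma (1 - p) * (\<integral>\<omega>. q \<omega> * passage_kernel p (c (\<sigma> \<omega>) - x) (t - \<sigma> \<omega>) \<partial>N)"
    and "integrable N (\<lambda>\<omega>. q \<omega> * passage_kernel p (c (\<sigma> \<omega>) - x) (t - \<sigma> \<omega>))"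
proof -
  have a: "0 < 1 - p" and e: "(1 - p) / 2 - 1 = - (p + 1) / 2" using p by (auto simp: field_simps)
  have G: "Gamma (1 - p) > 0" using a by (rule Gamma_real_pos)
  have eq: "q \<omega> * (\<integral>u. heat_flux (c (\<sigma> \<omega>) - x + u) (t - \<sigma> \<omega>) \<partial>power_measure (1 - p)) = Gamma (1 - p) * (q \<omega> * passage_kernel p (c (\<sigma> \<omega>) - x) (t - \<sigma> \<omega>))" for \<omega>
    using q0[of \<omega>] passage_kernel_eq[OF p, of "t - \<sigma> \<omega>" "c (\<sigma> \<omega>) - x"] G by (cases "q \<omega> = 0") auto
  note F = flux_fubini[OF a, unfolded e, OF int, unfolded eq]
  show "(\<integral>u. flux (x - u) \<partial>power_measure (1 - p)) = Gamma (1 - p) * (\<integral>\<omega>. q \<omega> * passage_kernel p (c (\<sigma> \<omega>) - x) (t - \<sigma> \<omega>) \<partial>N)"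
    using F(1) by simp
  show "integrable N (\<lambda>\<omega>. q \<omega> * passage_kernel p (c (\<sigma> \<omega>) - x) (t - \<sigma> \<omega>))"
    using F(2) G by simp
qed

end

lemma first_passage_nonneg: "0 \<le> first_passage_time W c \<omega>"
  unfolding first_passage_time_def by (rule INF_greatest) auto

context
  fixes M :: "'a measure" and W :: "real \<Rightarrow> 'a \<Rightarrow> real" and c :: "real \<Rightarrow> real" and t :: real
  assumes bm: "standard_brownian_motion M W" and c: "continuous_on UNIV c" and c0: "c 0 < 0" and t: "0 < t"
begin

interpretation prob_space M using bm by (simp add: standard_brownian_motion_def)

private abbreviation (input) "\<tau> \<equiv> first_passage_time W c"
private abbreviation (input) "\<sigma> \<equiv> \<lambda>\<omega>. real_of_ereal (\<tau> \<omega>)"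
private abbreviation (input) "q \<equiv> \<lambda>\<omega>. if \<tau> \<omega> < ereal t then 1 else 0 :: real"

lemma first_passage_measurable' [measurable]: "first_passage_time W c \<in> borel_measurable M"
  by (rule first_passage_measurable[OF bm]) (rule continuous_on_subset[OF c], simp)

lemma first_passage_weighted: "weighted_times M \<sigma> q t c"
proof
  show "0 < t" "continuous_on UNIV c" by fact+
  show "integrable M q" by (rule integrable_const_bound[where B=1]) auto
  show "0 \<le> \<sigma> \<omega> \<and> \<sigma> \<omega> < t" if "q \<omega> \<noteq> 0" for \<omega>
    using that first_passage_nonneg[of W c \<omega>] by (cases "\<tau> \<omega>") (auto split: if_splits)
qed measurable

interpretation weighted_times M \<sigma> q t c by (rule first_passage_weighted)

lemma bm_prob_le: "sqrt (2 * pi) * prob {\<omega> \<in> space M. W t \<omega> \<le> y} = gauss_tail (- y / sqrt t)"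
proof -
  have [measurable]: "W t \<in> borel_measurable M" "W 0 \<in> borel_measurable M" using t by (auto intro: bm_measurable[OF bm])
  have m: "(\<lambda>\<omega>. W t \<omega> - W 0 \<omega>) \<in> borel_measurable M" by measurable
  have "prob {\<omega> \<in> space M. W t \<omega> \<le> y} = prob {\<omega> \<in> space M. W t \<omega> - W 0 \<omega> \<le> y}"
  proof (rule finite_measure_eq_AE)
    show "AE \<omega> in M. (\<omega> \<in> {\<omega> \<in> space M. W t \<omega> \<le> y}) = (\<omega> \<in> {\<omega> \<in> space M. W t \<omega> - W 0 \<omega> \<le> y})"
      using bm_0[OF bm] by eventually_elim simp
  qed measurable
  also have "\<dots> = measure (distr M borel (\<lambda>\<omega>. W t \<omega> - W 0 \<omega>)) {..y}"
    using m by (subst measure_distr) (auto intro!: arg_cong[where f=prob])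
  also have "\<dots> = gauss_tail (- y / sqrt (t - 0)) / sqrt (2 * pi)"
    by (rule bm_increment_le[OF bm order_refl t])
  finally show ?thesis by simp
qed

text \<open>The distribution identity says that the transforms of order 2 of both sides agree at
  every point below c t, and injectivity strips off the transform. What remains no longer depends on
  p.\<close>

lemma first_passage_flux:
  assumes x: "x < c t"
  shows "flux x = heat_flux (- x) t"
proof -
  have w: "exp_decay_below (c t) (\<lambda>x. heat_flux (- x) t - flux x)"
    by (intro exp_decay_below_diff exp_decay_below_heat_flux exp_decay_below_flux t)
  have "heat_flux (- x) t - flux x = 0"
  proof (rule abel_injective[OF w _ _ x, of 2])
    fix x assume x: "x < c t"
    obtain K where K: "0 \<le> K" "\<And>s. 0 \<le> s \<Longrightarrow> s < t \<Longrightarrow> 4 / (t - s) * exp (- (c s - x) / sqrt (t - s)) \<le> K"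
      using exp_quotient_bound[OF t c x] by blast
    have int: "integrable M (\<lambda>\<omega>. q \<omega> * ((t - \<sigma> \<omega>) powr (- (- 1 + 1) / 2) * exp (- (c (\<sigma> \<omega>) - x) / sqrt (t - \<sigma> \<omega>))))"
    proof (rule integrable_const_bound[where B="K * t"])
      show "AE \<omega> in M. norm (q \<omega> * ((t - \<sigma> \<omega>) powr (- (- 1 + 1) / 2) * exp (- (c (\<sigma> \<omega>) - x) / sqrt (t - \<sigma> \<omega>)))) \<le> K * t"
      proof (rule AE_I2)
        fix \<omega>
        show "norm (q \<omega> * ((t - \<sigma> \<omega>) powr (- (- 1 + 1) / 2) * exp (- (c (\<sigma> \<omega>) - x) / sqrt (t - \<sigma> \<omega>)))) \<le> K * t"
        proof (cases "q \<omega> = 0")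
          case False
          then have s: "0 \<le> \<sigma> \<omega>" "\<sigma> \<omega> < t" using q0[of \<omega>] by auto
          have "4 / (t - \<sigma> \<omega>) * exp (- (c (\<sigma> \<omega>) - x) / sqrt (t - \<sigma> \<omega>)) \<le> K" by (rule K(2)[OF s])
          then have "4 * exp (- (c (\<sigma> \<omega>) - x) / sqrt (t - \<sigma> \<omega>)) \<le> K * (t - \<sigma> \<omega>)" using s by (simp add: field_simps)
          also have "\<dots> \<le> K * t" using s K(1) by (intro mult_left_mono) auto
          finally have "exp (- (c (\<sigma> \<omega>) - x) / sqrt (t - \<sigma> \<omega>)) \<le> K * t"
            using exp_ge_zero[of "- (c (\<sigma> \<omega>) - x) / sqrt (t - \<sigma> \<omega>)"] by linarith
          then show ?thesis using s False by (simp split: if_splits)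
        qed (use K t in auto)
      qed
    qed measurable
    have "(\<integral>u. heat_flux (- (x - u)) t - flux (x - u) \<partial>power_measure 2) = (\<integral>u. heat_flux (- (x - u)) t \<partial>power_measure 2) - (\<integral>u. flux (x - u) \<partial>power_measure 2)"
      using x by (intro Bochner_Integration.integral_diff integrable_exp_decay_below[OF exp_decay_below_flux]
         integrable_exp_decay_below[OF exp_decay_below_heat_flux[OF t]]) auto
    also have "(\<integral>u. heat_flux (- (x - u)) t \<partial>power_measure 2) = gauss_tail (- x / sqrt t)"
      using integral_heat_flux_2[OF t, of "- x"] by (simp add: add.commute)
    also have "(\<integral>u. flux (x - u) \<partial>power_measure 2) = (\<integral>\<omega>. q \<omega> * passage_kernel (- 1) (c (\<sigma> \<omega>) - x) (t - \<sigma> \<omega>) \<partial>M)"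
      using flux_kernel(1)[OF _ int] by (simp add: Gamma_numeral)
    also have "\<dots> = (\<integral>\<omega>. (if \<tau> \<omega> < ereal t then gauss_tail ((c (\<sigma> \<omega>) - x) / sqrt (t - \<sigma> \<omega>)) else 0) \<partial>M)"
    proof (rule Bochner_Integration.integral_cong[OF refl])
      fix \<omega>
      show "q \<omega> * passage_kernel (- 1) (c (\<sigma> \<omega>) - x) (t - \<sigma> \<omega>) = (if \<tau> \<omega> < ereal t then gauss_tail ((c (\<sigma> \<omega>) - x) / sqrt (t - \<sigma> \<omega>)) else 0)"
        using q0[of \<omega>] passage_kernel_minus_1[of "t - \<sigma> \<omega>"] by auto
    qed
    also have "\<dots> = gauss_tail (- x / sqrt t)"
      unfolding bm_prob_le[symmetric] using x
      by (intro bm_first_passage_cdf[where c=c, OF bm t _ c0]) (auto intro: continuous_on_subset[OF c])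
    finally show "(\<integral>u. heat_flux (- (x - u)) t - flux (x - u) \<partial>power_measure 2) = 0" by simp
  qed simp
  then show ?thesis by simp
qed

text \<open>Transform of order 1 - p of the flux identity, taken at the curve point c t itself: only
  the values at c t - u with u > 0 enter, so the identity strictly below the curve is
  enough.\<close>

theorem first_passage_kernel:
  assumes p: "p < 1"
    and int: "integrable M (\<lambda>\<omega>. q \<omega> * ((t - \<sigma> \<omega>) powr (- (p + 1) / 2) * exp (- (c (\<sigma> \<omega>) - c t) / sqrt (t - \<sigma> \<omega>))))"
  shows "passage_kernel p (- c t) t = (\<integral>\<omega>. q \<omega> * passage_kernel p (c (\<sigma> \<omega>) - c t) (t - \<sigma> \<omega>) \<partial>M)"
    and "integrable M (\<lambda>\<omega>. q \<omega> * passage_kernel p (c (\<sigma> \<omega>) - c t) (t - \<sigma> \<omega>))"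
proof -
  have G: "Gamma (1 - p) > 0" using p by (intro Gamma_real_pos) auto
  have "(\<integral>u. heat_flux (- c t + u) t \<partial>power_measure (1 - p)) = (\<integral>u. flux (c t - u) \<partial>power_measure (1 - p))"
  proof (rule integral_cong_AE)
    show "AE u in power_measure (1 - p). heat_flux (- c t + u) t = flux (c t - u)"
      using AE_power_measure by eventually_elim (simp add: first_passage_flux)
  qed measurable
  also have "\<dots> = Gamma (1 - p) * (\<integral>\<omega>. q \<omega> * passage_kernel p (c (\<sigma> \<omega>) - c t) (t - \<sigma> \<omega>) \<partial>M)"
    by (rule flux_kernel(1)[OF p int])
  finally show "passage_kernel p (- c t) t = (\<integral>\<omega>. q \<omega> * passage_kernel p (c (\<sigma> \<omega>) - c t) (t - \<sigma> \<omega>) \<partial>M)"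
    using G by (simp add: passage_kernel_eq[OF p t])
  show "integrable M (\<lambda>\<omega>. q \<omega> * passage_kernel p (c (\<sigma> \<omega>) - c t) (t - \<sigma> \<omega>))"
    by (rule flux_kernel(2)[OF p int])
qed

end

section \<open>Weakly singular Volterra equations\<close>

lemma powr_add_le:
  fixes x y a :: real
  assumes "0 \<le> x" "0 \<le> y" "0 < a" "a \<le> 1"
  shows "(x + y) powr a \<le> x powr a + y powr a"
proof (cases "x + y = 0")
  case True
  then show ?thesis by simp
next
  case False
  define u v where "u = x / (x + y)" and "v = y / (x + y)"
  have pos: "0 < x + y" using False assms by linarith
  have uv: "0 \<le> u" "u \<le> 1" "0 \<le> v" "v \<le> 1" "u + v = 1" and xy: "x = (x + y) * u" "y = (x + y) * v"
    using pos assms by (auto simp: u_def v_def divide_simps)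
  have "u \<le> u powr a" "v \<le> v powr a"
    using powr_mono'[of a 1 u] powr_mono'[of a 1 v] uv assms by auto
  then have "(x + y) powr a * 1 \<le> (x + y) powr a * (u powr a + v powr a)" using uv by (intro mult_left_mono) auto
  also have "\<dots> = ((x + y) * u) powr a + ((x + y) * v) powr a" using pos uv by (simp add: powr_mult distrib_left)
  finally show ?thesis using xy by simp
qed

lemma set_integrable_powr:
  fixes \<theta> :: real
  assumes "\<theta> < 1"
  shows "set_integrable lborel {0<..<t} (\<lambda>s. s powr (- \<theta>))"
proof -
  have a: "0 < 1 - \<theta>" using assms by simp
  have "set_integrable lborel {0<..} (\<lambda>u. (u powr (1 - \<theta> - 1)) *\<^sub>R exp (- (1 * u)))"
    using integrable_power_measure_exp[OF a zero_less_one] by (subst (asm) integrable_power_measure_iff) auto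
  then have "set_integrable lborel {0<..} (\<lambda>u. exp t * (u powr (1 - \<theta> - 1)) *\<^sub>R exp (- (1 * u)))"
    by (intro set_integrable_mult_right)
  then have *: "integrable lborel (\<lambda>u. indicator {0<..} u *\<^sub>R (exp t * (u powr (1 - \<theta> - 1)) *\<^sub>R exp (- (1 * u))))"
    by (simp add: set_integrable_def)
  show ?thesis unfolding set_integrable_def
  proof (rule Bochner_Integration.integrable_bound[OF *])
    show "AE s in lborel. norm (indicator {0<..<t} s *\<^sub>R s powr (- \<theta>)) \<le> norm (indicator {0<..} s *\<^sub>R (exp t * (s powr (1 - \<theta> - 1)) *\<^sub>R exp (- (1 * s))))"
    proof (rule AE_I2)
      fix s :: real
      have "s powr (- \<theta>) * 1 \<le> s powr (- \<theta>) * exp (t - s)" if "s < t" using that by (intro mult_left_mono) auto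
      then show "norm (indicator {0<..<t} s *\<^sub>R s powr (- \<theta>)) \<le> norm (indicator {0<..} s *\<^sub>R (exp t * (s powr (1 - \<theta> - 1)) *\<^sub>R exp (- (1 * s))))"
        by (auto simp: indicator_def abs_mult exp_diff exp_minus field_simps)
    qed
  qed measurable
qed

lemma set_integral_reflect:
  fixes f :: "real \<Rightarrow> real"
  shows "set_integrable lborel {0<..<t} (\<lambda>s. f (t - s)) \<longleftrightarrow> set_integrable lborel {0<..<t} f"
    and "(LBINT s:{0<..<t}. f (t - s)) = (LBINT s:{0<..<t}. f s)"
proof -
  have eq: "(\<lambda>s. indicator {0<..<t} s *\<^sub>R f (t - s)) = (\<lambda>s. indicator {0<..<t} (t + (-1) * s) *\<^sub>R f (t + (-1) * s))"
    by (auto simp: indicator_def)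
  show "set_integrable lborel {0<..<t} (\<lambda>s. f (t - s)) \<longleftrightarrow> set_integrable lborel {0<..<t} f"
    unfolding set_integrable_def eq by (subst lborel_integrable_real_affine_iff) auto
  show "(LBINT s:{0<..<t}. f (t - s)) = (LBINT s:{0<..<t}. f s)"
    unfolding set_lebesgue_integral_def eq
    by (subst lborel_integral_real_affine[where c="-1" and t=t and f="\<lambda>s. indicator {0<..<t} s *\<^sub>R f s"]) auto
qed

lemma set_integrable_powr_reflect:
  fixes \<theta> :: real
  assumes "\<theta> < 1"
  shows "set_integrable lborel {0<..<t} (\<lambda>s. (t - s) powr (- \<theta>))"
  using set_integral_reflect(1)[of t "\<lambda>s. s powr (- \<theta>)"] set_integrable_powr[OF assms] by simp

lemma weighted_powr_integral_le:
  fixes \<theta> :: real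
  assumes th: "\<theta> < 1" and l: "0 < l"
  shows "(LBINT s:{0<..<t}. s powr (- \<theta>) * exp (- (l * s))) \<le> Gamma (1 - \<theta>) / l powr (1 - \<theta>)"
    and "set_integrable lborel {0<..<t} (\<lambda>s. s powr (- \<theta>) * exp (- (l * s)))"
proof -
  have a: "0 < 1 - \<theta>" using th by simp
  have i: "set_integrable lborel {0<..} (\<lambda>u. u powr (- \<theta>) * exp (- (l * u)))"
    using integrable_power_measure_exp[OF a l] by (subst (asm) integrable_power_measure_iff) auto
  show i2: "set_integrable lborel {0<..<t} (\<lambda>s. s powr (- \<theta>) * exp (- (l * s)))"
    by (rule set_integrable_subset[OF i]) auto
  have "Gamma (1 - \<theta>) / l powr (1 - \<theta>) = (LBINT u:{0<..}. u powr (- \<theta>) * exp (- (l * u)))"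
    using integral_power_measure_exp[OF a l] by (subst (asm) integral_power_measure) auto
  moreover have "(LBINT s:{0<..<t}. s powr (- \<theta>) * exp (- (l * s))) \<le> (LBINT u:{0<..}. u powr (- \<theta>) * exp (- (l * u)))"
    using i i2 unfolding set_lebesgue_integral_def set_integrable_def by (intro integral_mono) (auto simp: indicator_def)
  ultimately show "(LBINT s:{0<..<t}. s powr (- \<theta>) * exp (- (l * s))) \<le> Gamma (1 - \<theta>) / l powr (1 - \<theta>)" by simp
qed

text \<open>For s \<le> t/2 the weight e^(-l(t-s)) is at most e^(-ls); for s \<ge> t/2 the power
  s^(-\<theta>) is at most (t-s)^(-\<theta>). So the integrand is below h(s) + 2 h(t-s) with h(s) =
  s^(-\<theta>) e^(-ls), whence the factor 3.\<close>

lemma weighted_powr_sum_le: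
  fixes \<theta> :: real
  assumes th: "0 \<le> \<theta>" "\<theta> < 1" and l: "0 < l"
  shows "set_integrable lborel {0<..<t} (\<lambda>s. (s powr (- \<theta>) + (t - s) powr (- \<theta>)) * exp (- (l * (t - s))))"
    and "(LBINT s:{0<..<t}. (s powr (- \<theta>) + (t - s) powr (- \<theta>)) * exp (- (l * (t - s)))) \<le> 3 * (Gamma (1 - \<theta>) / l powr (1 - \<theta>))"
proof -
  let ?h = "\<lambda>s. s powr (- \<theta>) * exp (- (l * s))"
  have i1: "set_integrable lborel {0<..<t} ?h" by (rule weighted_powr_integral_le[OF th(2) l])
  have i2: "set_integrable lborel {0<..<t} (\<lambda>s. ?h (t - s))"
    unfolding set_integral_reflect(1)[of t ?h] by (rule i1)
  have dom: "(s powr (- \<theta>) + (t - s) powr (- \<theta>)) * exp (- (l * (t - s))) \<le> ?h s + 2 * ?h (t - s)" if s: "s \<in> {0<..<t}" for s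
  proof -
    have "s powr (- \<theta>) * exp (- (l * (t - s))) \<le> ?h s + ?h (t - s)"
    proof (cases "s \<le> t - s")
      case True
      then have "s powr (- \<theta>) * exp (- (l * (t - s))) \<le> ?h s" using l by (intro mult_left_mono) auto
      moreover have "0 \<le> ?h (t - s)" by simp
      ultimately show ?thesis by linarith
    next
      case False
      then have "s powr (- \<theta>) \<le> (t - s) powr (- \<theta>)" using s th by (intro powr_mono2') auto
      then have "s powr (- \<theta>) * exp (- (l * (t - s))) \<le> ?h (t - s)" by (intro mult_right_mono) auto
      moreover have "0 \<le> ?h s" by simp
      ultimately show ?thesis by linarith
    qed
    then show ?thesis by (simp add: distrib_right)
  qed
  have i3: "set_integrable lborel {0<..<t} (\<lambda>s. ?h s + 2 * ?h (t - s))"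
    by (intro set_integral_add set_integrable_mult_right i1 i2)
  show i: "set_integrable lborel {0<..<t} (\<lambda>s. (s powr (- \<theta>) + (t - s) powr (- \<theta>)) * exp (- (l * (t - s))))"
    by (rule set_integrable_bound[OF i3]) (use dom in \<open>auto simp: set_borel_measurable_def abs_mult\<close>)
  have "(LBINT s:{0<..<t}. (s powr (- \<theta>) + (t - s) powr (- \<theta>)) * exp (- (l * (t - s)))) \<le> (LBINT s:{0<..<t}. ?h s + 2 * ?h (t - s))"
    by (rule set_integral_mono[OF i i3 dom])
  also have "\<dots> = (LBINT s:{0<..<t}. ?h s) + 2 * (LBINT s:{0<..<t}. ?h (t - s))"
    using i1 i2 by (simp add: set_integral_add)
  also have "(LBINT s:{0<..<t}. ?h (t - s)) = (LBINT s:{0<..<t}. ?h s)" by (rule set_integral_reflect(2)[of t ?h])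
  also have "(LBINT s:{0<..<t}. ?h s) + 2 * (LBINT s:{0<..<t}. ?h s) \<le> 3 * (Gamma (1 - \<theta>) / l powr (1 - \<theta>))"
    using weighted_powr_integral_le(1)[OF th(2) l, of t] by linarith
  finally show "(LBINT s:{0<..<t}. (s powr (- \<theta>) + (t - s) powr (- \<theta>)) * exp (- (l * (t - s)))) \<le> 3 * (Gamma (1 - \<theta>) / l powr (1 - \<theta>))" .
qed

lemma small_weight_exists:
  fixes \<theta> :: real
  assumes "\<theta> < 1" "0 \<le> (K::real)"
  obtains l where "0 < l" "K * (Gamma (1 - \<theta>) / l powr (1 - \<theta>)) \<le> 1 / 2"
proof -
  have "((\<lambda>l. K * (Gamma (1 - \<theta>) * l powr (- (1 - \<theta>)))) \<longlongrightarrow> K * (Gamma (1 - \<theta>) * 0)) at_top"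
    using assms by (intro tendsto_mult tendsto_const tendsto_neg_powr filterlim_ident) auto
  then have "((\<lambda>l. K * (Gamma (1 - \<theta>) / l powr (1 - \<theta>))) \<longlongrightarrow> 0) at_top"
    by (simp only: powr_minus_divide mult_zero_right times_divide_eq_right mult_1_right)
  then have "\<forall>\<^sub>F l in at_top. K * (Gamma (1 - \<theta>) / l powr (1 - \<theta>)) < 1 / 2"
    by (intro order_tendstoD(2)) auto
  then have "\<forall>\<^sub>F l in at_top. 0 < l \<and> K * (Gamma (1 - \<theta>) / l powr (1 - \<theta>)) < 1 / 2"
    using eventually_gt_at_top[of 0] by eventually_elim auto
  then show ?thesis using that by (metis (mono_tags, lifting) eventually_at_top_linorder less_imp_le order_refl)
qed

text \<open>Let S be the supremum of e^(-ls)|G s| over (0,T], finite because G is bounded. For large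
  l the weighted kernel integral times K is at most 1/2, so the inequality reads S \<le>
  S/2.\<close>

lemma singular_gronwall:
  fixes G :: "real \<Rightarrow> real" and \<theta> :: real
  assumes th: "0 \<le> \<theta>" "\<theta> < 1" and K: "0 \<le> K" and G[measurable]: "G \<in> borel_measurable borel"
    and B: "\<And>t. 0 < t \<Longrightarrow> t \<le> T \<Longrightarrow> \<bar>G t\<bar> \<le> B"
    and ineq: "\<And>t. 0 < t \<Longrightarrow> t \<le> T \<Longrightarrow> \<bar>G t\<bar> \<le> K * (LBINT s:{0<..<t}. (s powr (- \<theta>) + (t - s) powr (- \<theta>)) * \<bar>G s\<bar>)"
    and t: "0 < t" "t \<le> T"
  shows "G t = 0"
proof -
  obtain l where l: "0 < l" "(K * 3) * (Gamma (1 - \<theta>) / l powr (1 - \<theta>)) \<le> 1 / 2"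
    using small_weight_exists[OF th(2), of "K * 3"] K by auto
  define g where "g = (\<lambda>s. exp (- (l * s)) * \<bar>G s\<bar>)"
  define S where "S = Sup (g ` {0<..T})"
  have gB: "g s \<le> B" if "0 < s" "s \<le> T" for s
  proof -
    have "g s \<le> 1 * \<bar>G s\<bar>" unfolding g_def using that l by (intro mult_right_mono) auto
    then show ?thesis using B[OF that] by simp
  qed
  have bdd: "bdd_above (g ` {0<..T})" using gB by (intro bdd_aboveI[of _ B]) auto
  have gS: "g s \<le> S" if "0 < s" "s \<le> T" for s unfolding S_def using that bdd by (intro cSup_upper) auto
  have g0: "0 \<le> g s" for s by (simp add: g_def)
  have S0: "0 \<le> S" using gS[OF t] g0[of t] by linarith
  have "g s \<le> S / 2" if s: "0 < s" "s \<le> T" for s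
  proof -
    let ?w = "\<lambda>r. (r powr (- \<theta>) + (s - r) powr (- \<theta>)) * exp (- (l * (s - r)))"
    have iw: "set_integrable lborel {0<..<s} ?w" by (rule weighted_powr_sum_le[OF th l(1)])
    have eq: "exp (- (l * s)) * ((r powr (- \<theta>) + (s - r) powr (- \<theta>)) * \<bar>G r\<bar>) = ?w r * g r" for r
      by (simp add: g_def exp_add[symmetric] mult_ac) (simp add: algebra_simps)
    have dom: "?w r * g r \<le> ?w r * S" if "r \<in> {0<..<s}" for r
      using gS[of r] that s by (intro mult_left_mono) auto
    have iwS: "set_integrable lborel {0<..<s} (\<lambda>r. ?w r * S)" using iw by simp
    have iwg: "set_integrable lborel {0<..<s} (\<lambda>r. ?w r * g r)"
    proof (rule set_integrable_bound[OF iwS])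
      show "AE x in lborel. x \<in> {0<..<s} \<longrightarrow> norm (?w x * g x) \<le> norm (?w x * S)"
        using dom g0 S0 by (auto simp: abs_mult intro!: AE_I2)
    qed (auto simp: set_borel_measurable_def g_def)
    have "g s \<le> exp (- (l * s)) * (K * (LBINT r:{0<..<s}. (r powr (- \<theta>) + (s - r) powr (- \<theta>)) * \<bar>G r\<bar>))"
      unfolding g_def by (intro mult_left_mono ineq s) auto
    also have "\<dots> = K * (LBINT r:{0<..<s}. ?w r * g r)"
      unfolding eq[symmetric] by simp
    also have "\<dots> \<le> K * (LBINT r:{0<..<s}. ?w r * S)"
      by (intro mult_left_mono K set_integral_mono[OF iwg iwS dom])
    also have "\<dots> = (K * (LBINT r:{0<..<s}. ?w r)) * S" by simp
    also have "\<dots> \<le> (1 / 2) * S"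
    proof (rule mult_right_mono[OF _ S0])
      have "K * (LBINT r:{0<..<s}. ?w r) \<le> K * (3 * (Gamma (1 - \<theta>) / l powr (1 - \<theta>)))"
        by (intro mult_left_mono K weighted_powr_sum_le(2)[OF th l(1)])
      then show "K * (LBINT r:{0<..<s}. ?w r) \<le> 1 / 2" using l(2) by simp
    qed
    finally show ?thesis by simp
  qed
  then have "S \<le> S / 2" unfolding S_def using t by (intro cSup_least) (auto simp: S_def)
  with S0 have "S = 0" by simp
  with gS[OF t] have "g t = 0" using g0[of t] by linarith
  then show ?thesis by (simp add: g_def)
qed

section \<open>The kernel for p = -1 along a smooth curve\<close>

lemma DERIV_divide_sqrt:
  fixes g h :: "real \<Rightarrow> real"
  assumes g: "(g has_real_derivative g') (at t)" and h: "(h has_real_derivative h') (at t)" and pos: "0 < h t"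
  shows "((\<lambda>t. g t / sqrt (h t)) has_real_derivative g' / sqrt (h t) - g t * h' / (2 * h t * sqrt (h t))) (at t)"
proof -
  have "((\<lambda>t. sqrt (h t)) has_real_derivative inverse (sqrt (h t)) / 2 * h') (at t)"
    by (rule DERIV_chain2[OF DERIV_real_sqrt[OF pos] h])
  from DERIV_divide[OF g this]
  have "((\<lambda>t. g t / sqrt (h t)) has_real_derivative (g' * sqrt (h t) - g t * (inverse (sqrt (h t)) / 2 * h')) / (sqrt (h t) * sqrt (h t))) (at t)"
    using pos by simp
  moreover have "(g' * q - g t * (inverse q / 2 * h')) / (q * q) = g' / q - g t * h' / (2 * (q * q) * q)" if "q > 0" for q
    using that by (simp add: field_simps)
  from this[of "sqrt (h t)"] pos
  have "(g' * sqrt (h t) - g t * (inverse (sqrt (h t)) / 2 * h')) / (sqrt (h t) * sqrt (h t)) = g' / sqrt (h t) - g t * h' / (2 * h t * sqrt (h t))"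
    by simp
  ultimately show ?thesis by simp
qed

lemma abs_add_le_double: "\<bar>x\<bar> \<le> a \<Longrightarrow> \<bar>y\<bar> \<le> a \<Longrightarrow> \<bar>x + y\<bar> \<le> 2 * (a::real)"
  by (rule order_trans[of _ "\<bar>x\<bar> + \<bar>y\<bar>"]) auto

lemma mult_powr_divide: "C * (x::real) powr a / x powr b = C * x powr (a - b)"
  by (simp add: powr_diff)

text \<open>The curve is continued to t \<le> 0 by the constant b0, which makes it continuous on the
  whole line; the time-reversed curve needs this as well. The sign of b0 is left open because the
  case b0 = 0 has to be studied in order to be excluded.\<close>

locale smooth_curve =
  fixes b db :: "real \<Rightarrow> real" and b0 \<epsilon> :: real
  assumes DERIV_b: "\<And>t. 0 < t \<Longrightarrow> (b has_real_derivative db t) (at t)"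
    and continuous_db: "continuous_on {0<..} db"
    and db_nonpos: "\<And>t. t \<le> 0 \<Longrightarrow> db t = 0"
    and b_nonpos: "\<And>t. t \<le> 0 \<Longrightarrow> b t = b0"
    and b_tendsto: "(b \<longlongrightarrow> b0) (at_right 0)"
    and eps: "0 < \<epsilon>" "\<epsilon> < 1 / 2"
    and db_bound: "\<And>T. 0 < T \<Longrightarrow> \<exists>C. \<forall>t. 0 < t \<and> t \<le> T \<longrightarrow> \<bar>db t\<bar> \<le> C * t powr (- \<epsilon>)"
begin

text \<open>Order of the singularity of the kernel derivatives: an increment of size
  (t-s)^(1-\<epsilon>) over (t-s)^(3/2). It stays below 1, hence integrable, because \<epsilon> <
  1/2.\<close>

definition \<theta> :: real where "\<theta> = 1 / 2 + \<epsilon>"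

lemma theta: "0 < \<theta>" "\<theta> < 1" "0 \<le> \<theta>" using eps by (auto simp: \<theta>_def)

lemma continuous_b: "continuous_on UNIV b"
proof -
  have "isCont b t" for t
  proof (cases t "0::real" rule: linorder_cases)
    case less
    have "\<forall>\<^sub>F x in nhds t. b x = b0"
      using less b_nonpos by (intro eventually_mono[OF eventually_nhds_in_open[of "{..<0}" t]]) auto
    then have "isCont b t \<longleftrightarrow> isCont (\<lambda>_. b0) t" by (rule isCont_cong)
    then show ?thesis by simp
  next
    case equal
    have "(b \<longlongrightarrow> b0) (at_left 0)"
      by (rule tendsto_eventually) (auto simp: eventually_at_left_field b_nonpos intro!: exI[of _ "-1"])
    then show ?thesis using b_tendsto b_nonpos[of 0] equal
      by (simp add: isCont_def filterlim_at_split)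
  next
    case greater
    then show ?thesis using DERIV_b DERIV_isCont by blast
  qed
  then show ?thesis by (simp add: continuous_at_imp_continuous_on)
qed

lemma isCont_b: "isCont b t"
  using continuous_b by (simp add: continuous_on_eq_continuous_at)

lemma isCont_db: "0 < t \<Longrightarrow> isCont db t"
  using continuous_db by (simp add: continuous_on_eq_continuous_at)

lemma b_measurable [measurable]: "b \<in> borel_measurable borel"
  using continuous_b by (rule borel_measurable_continuous_onI)

lemma db_measurable [measurable]: "db \<in> borel_measurable borel"
proof -
  have "(\<lambda>x. indicator {0<..} x *\<^sub>R db x) \<in> borel_measurable borel"
    by (rule borel_measurable_continuous_on_indicator[OF _ continuous_db]) simp
  also have "(\<lambda>x. indicator {0<..} x *\<^sub>R db x) = db"
    using db_nonpos by (auto simp: indicator_def fun_eq_iff not_less)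
  finally show ?thesis .
qed

lemma increment_bound:
  assumes C: "\<And>t. 0 < t \<Longrightarrow> t \<le> T \<Longrightarrow> \<bar>db t\<bar> \<le> C * t powr (- \<epsilon>)" and C0: "0 \<le> C" and st: "0 \<le> s" "s \<le> t" "t \<le> T"
  shows "\<bar>b t - b s\<bar> \<le> C / (1 - \<epsilon>) * (t - s) powr (1 - \<epsilon>)"
proof -
  let ?D = "C / (1 - \<epsilon>)"
  have D0: "0 \<le> ?D" using C0 eps by simp
  have pos: "\<bar>b t - b s\<bar> \<le> ?D * (t - s) powr (1 - \<epsilon>)" if s: "0 < s" "s \<le> t" for s
  proof -
    have d: "((\<lambda>u. ?D * u powr (1 - \<epsilon>)) has_real_derivative C * u powr (- \<epsilon>)) (at u)" if "0 < u" for u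
      using DERIV_cmult[OF has_real_derivative_powr[OF that, of "1 - \<epsilon>"], of ?D] eps by simp
    have 1: "?D * s powr (1 - \<epsilon>) - b s \<le> ?D * t powr (1 - \<epsilon>) - b t"
      proof (rule DERIV_nonneg_imp_nondecreasing[OF s(2)], intro exI conjI)
      fix x assume x: "s \<le> x" "x \<le> t"
      show "((\<lambda>u. ?D * u powr (1 - \<epsilon>) - b u) has_real_derivative C * x powr (- \<epsilon>) - db x) (at x)"
        using x s by (intro DERIV_diff d DERIV_b) auto
      show "0 \<le> C * x powr (- \<epsilon>) - db x" using C[of x] x s st by auto
    qed
    have 2: "?D * s powr (1 - \<epsilon>) + b s \<le> ?D * t powr (1 - \<epsilon>) + b t"
      proof (rule DERIV_nonneg_imp_nondecreasing[OF s(2)], intro exI conjI)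
      fix x assume x: "s \<le> x" "x \<le> t"
      show "((\<lambda>u. ?D * u powr (1 - \<epsilon>) + b u) has_real_derivative C * x powr (- \<epsilon>) + db x) (at x)"
        using x s by (intro DERIV_add d DERIV_b) auto
      show "0 \<le> C * x powr (- \<epsilon>) + db x" using C[of x] x s st by auto
    qed
    have "t powr (1 - \<epsilon>) \<le> s powr (1 - \<epsilon>) + (t - s) powr (1 - \<epsilon>)"
      using powr_add_le[of s "t - s" "1 - \<epsilon>"] s eps by simp
    then have "?D * t powr (1 - \<epsilon>) \<le> ?D * s powr (1 - \<epsilon>) + ?D * (t - s) powr (1 - \<epsilon>)"
      using mult_left_mono[OF _ D0] by (metis distrib_left)
    with 1 2 show ?thesis by linarith
  qed
  show ?thesis
  proof (cases "s = 0 \<and> 0 < t")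
    case True
    have "((\<lambda>s. \<bar>b t - b s\<bar>) \<longlongrightarrow> \<bar>b t - b 0\<bar>) (at_right 0)"
      using isCont_b[of 0] by (intro tendsto_intros) (simp add: isCont_def filterlim_at_split)
    moreover have "((\<lambda>s. ?D * (t - s) powr (1 - \<epsilon>)) \<longlongrightarrow> ?D * (t - 0) powr (1 - \<epsilon>)) (at_right 0)"
      using True by (intro tendsto_intros) auto
    moreover have "\<forall>\<^sub>F s in at_right 0. \<bar>b t - b s\<bar> \<le> ?D * (t - s) powr (1 - \<epsilon>)"
      unfolding eventually_at_right_field using True pos by (intro exI[of _ t]) auto
    ultimately show ?thesis using True by (auto intro: tendsto_le[OF trivial_limit_at_right_real])
  next
    case False
    then show ?thesis using pos[of s] st by (cases "s = 0") auto
  qed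
qed

definition bz :: "real \<Rightarrow> real \<Rightarrow> real" where "bz t s = (b s - b t) / sqrt (t - s)"

definition kern :: "real \<Rightarrow> real \<Rightarrow> real" where "kern t s = gauss_tail (bz t s)"

definition dkern_t :: "real \<Rightarrow> real \<Rightarrow> real" where
  "dkern_t t s = exp (- (bz t s)\<^sup>2 / 2) * (db t / sqrt (t - s) + (b s - b t) / (2 * (t - s) * sqrt (t - s)))"

definition dkern_s :: "real \<Rightarrow> real \<Rightarrow> real" where
  "dkern_s t s = - exp (- (bz t s)\<^sup>2 / 2) * (db s / sqrt (t - s) + (b s - b t) / (2 * (t - s) * sqrt (t - s)))"

lemma kernel_measurable [measurable (raw)]:
  assumes "f \<in> borel_measurable N" "g \<in> borel_measurable N"
  shows "(\<lambda>x. kern (f x) (g x)) \<in> borel_measurable N"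
    "(\<lambda>x. dkern_t (f x) (g x)) \<in> borel_measurable N"
    "(\<lambda>x. dkern_s (f x) (g x)) \<in> borel_measurable N"
  unfolding kern_def dkern_t_def dkern_s_def bz_def using assms by measurable

lemma DERIV_kern_t:
  assumes "0 \<le> s" "s < t"
  shows "((\<lambda>t. kern t s) has_real_derivative dkern_t t s) (at t)"
proof -
  have "((\<lambda>t. bz t s) has_real_derivative - (db t / sqrt (t - s) + (b s - b t) / (2 * (t - s) * sqrt (t - s)))) (at t)"
  proof -
    have dg: "((\<lambda>t. b s - b t) has_real_derivative - db t) (at t)" "((\<lambda>t. t - s) has_real_derivative 1) (at t)"
      using assms by (auto intro!: derivative_eq_intros DERIV_b)
    show ?thesis unfolding bz_def
      by (rule DERIV_cong[OF DERIV_divide_sqrt[OF dg]]) (use assms in simp_all)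
  qed
  from DERIV_chain2[OF DERIV_gauss_tail this] show ?thesis unfolding kern_def dkern_t_def by (simp only: mult_minus_left mult_minus_right minus_minus)
qed

lemma DERIV_kern_s:
  assumes "0 < s" "s < t"
  shows "((\<lambda>s. kern t s) has_real_derivative dkern_s t s) (at s)"
proof -
  have "((\<lambda>s. bz t s) has_real_derivative (db s / sqrt (t - s) + (b s - b t) / (2 * (t - s) * sqrt (t - s)))) (at s)"
  proof -
    have dg: "((\<lambda>s. b s - b t) has_real_derivative db s) (at s)" "((\<lambda>s. t - s) has_real_derivative - 1) (at s)"
      using assms by (auto intro!: derivative_eq_intros DERIV_b)
    show ?thesis unfolding bz_def
      by (rule DERIV_cong[OF DERIV_divide_sqrt[OF dg]]) (use assms in \<open>simp_all add: diff_divide_distrib\<close>)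
  qed
  from DERIV_chain2[OF DERIV_gauss_tail this] show ?thesis unfolding kern_def dkern_s_def .
qed

lemma constant_exists:
  assumes "0 < T"
  obtains C where "0 \<le> C" "\<And>t. 0 < t \<Longrightarrow> t \<le> T \<Longrightarrow> \<bar>db t\<bar> \<le> C * t powr (- \<epsilon>)"
    "\<And>s t. 0 \<le> s \<Longrightarrow> s \<le> t \<Longrightarrow> t \<le> T \<Longrightarrow> \<bar>b t - b s\<bar> \<le> C * (t - s) powr (1 - \<epsilon>)"
proof -
  obtain C0 where C0: "\<And>t. 0 < t \<Longrightarrow> t \<le> T \<Longrightarrow> \<bar>db t\<bar> \<le> C0 * t powr (- \<epsilon>)" using db_bound[OF assms] by blast
  define C1 where "C1 = max C0 0"
  have C1: "\<bar>db t\<bar> \<le> C1 * t powr (- \<epsilon>)" if "0 < t" "t \<le> T" for t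
    using C0[OF that] by (rule order_trans) (auto simp: C1_def intro!: mult_right_mono)
  have C10: "0 \<le> C1" by (simp add: C1_def)
  define C where "C = C1 / (1 - \<epsilon>)"
  have "C1 * (1 - \<epsilon>) \<le> C1 * 1" using C10 eps by (intro mult_left_mono) auto
  then have le: "C1 \<le> C" unfolding C_def using eps by (subst pos_le_divide_eq) auto
  show ?thesis
  proof (rule that[of C])
    show "0 \<le> C" using C10 le by simp
    show "\<bar>db t\<bar> \<le> C * t powr (- \<epsilon>)" if "0 < t" "t \<le> T" for t
      using C1[OF that] by (rule order_trans) (auto intro!: mult_right_mono le)
    show "\<bar>b t - b s\<bar> \<le> C * (t - s) powr (1 - \<epsilon>)" if "0 \<le> s" "s \<le> t" "t \<le> T" for s t
      unfolding C_def by (rule increment_bound[OF C1 C10 that])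
  qed
qed

lemma quotient_bound:
  assumes inc: "\<bar>b t - b s\<bar> \<le> C * (t - s) powr (1 - \<epsilon>)" and st: "s < t"
  shows "\<bar>bz t s\<bar> \<le> C * (t - s) powr (1 / 2 - \<epsilon>)"
    and "\<bar>(b s - b t) / (2 * (t - s) * sqrt (t - s))\<bar> \<le> C * (t - s) powr (- \<theta>)"
proof -
  have r: "0 < t - s" using st by simp
  have "\<bar>bz t s\<bar> = \<bar>b t - b s\<bar> / sqrt (t - s)" using r by (simp add: bz_def abs_minus_commute)
  also have "\<dots> \<le> C * (t - s) powr (1 - \<epsilon>) / sqrt (t - s)" using r inc by (intro divide_right_mono) auto
  also have "\<dots> = C * (t - s) powr (1 / 2 - \<epsilon>)"
    using r by (simp add: powr_half_sqrt[symmetric] mult_powr_divide)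
  finally show "\<bar>bz t s\<bar> \<le> C * (t - s) powr (1 / 2 - \<epsilon>)" .
  have C0: "0 \<le> C * (t - s) powr (1 - \<epsilon>)" using inc by linarith
  have "\<bar>(b s - b t) / (2 * (t - s) * sqrt (t - s))\<bar> = \<bar>b t - b s\<bar> / (2 * (t - s) * sqrt (t - s))"
    using r by (simp add: abs_minus_commute abs_mult)
  also have "\<dots> \<le> C * (t - s) powr (1 - \<epsilon>) / ((t - s) * sqrt (t - s))"
    using r inc C0 by (intro frac_le) auto
  also have "(t - s) * sqrt (t - s) = (t - s) powr (3 / 2)"
    using r by (simp add: powr_half_sqrt[symmetric] powr_mult_base)
  also have "C * (t - s) powr (1 - \<epsilon>) / (t - s) powr (3 / 2) = C * (t - s) powr (- \<theta>)"
    unfolding mult_powr_divide \<theta>_def by simp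
  finally show "\<bar>(b s - b t) / (2 * (t - s) * sqrt (t - s))\<bar> \<le> C * (t - s) powr (- \<theta>)" .
qed

text \<open>The derivative in t contains db t with t \<ge> t - s, so t^(-\<epsilon>) is absorbed
  into (t-s)^(-\<epsilon>). The derivative in s contains db s, which may blow up as s tends to 0;
  hence the second singularity in its bound.\<close>

lemma dkern_bounds:
  assumes "0 < T"
  obtains C where "0 \<le> C"
    "\<And>s t. 0 \<le> s \<Longrightarrow> s < t \<Longrightarrow> t \<le> T \<Longrightarrow> \<bar>dkern_t t s\<bar> \<le> C * (t - s) powr (- \<theta>)"
    "\<And>s t. 0 < s \<Longrightarrow> s < t \<Longrightarrow> t \<le> T \<Longrightarrow> \<bar>dkern_s t s\<bar> \<le> C * (s powr (- \<theta>) + (t - s) powr (- \<theta>))"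
    "\<And>s t. 0 \<le> s \<Longrightarrow> s < t \<Longrightarrow> t \<le> T \<Longrightarrow> \<bar>bz t s\<bar> \<le> C * (t - s) powr (1 / 2 - \<epsilon>)"
proof -
  obtain C where C: "0 \<le> C" and Cd: "\<And>t. 0 < t \<Longrightarrow> t \<le> T \<Longrightarrow> \<bar>db t\<bar> \<le> C * t powr (- \<epsilon>)"
    and Ci: "\<And>s t. 0 \<le> s \<Longrightarrow> s \<le> t \<Longrightarrow> t \<le> T \<Longrightarrow> \<bar>b t - b s\<bar> \<le> C * (t - s) powr (1 - \<epsilon>)"
    using constant_exists[OF assms] by blast
  have e1: "\<bar>exp (- (bz t s)\<^sup>2 / 2)\<bar> \<le> 1" for t s by simp
  show ?thesis
  proof (rule that[of "2 * C"])
    show "0 \<le> 2 * C" using C by simp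
    fix s t :: real assume st: "0 \<le> s" "s < t" "t \<le> T"
    have r: "0 < t - s" using st by simp
    note qb = quotient_bound[OF Ci[OF st(1) _ st(3)] st(2)]
    have "\<bar>db t / sqrt (t - s)\<bar> \<le> C * t powr (- \<epsilon>) / sqrt (t - s)"
      using r Cd[of t] st by (simp add: divide_right_mono)
    also have "\<dots> \<le> C * (t - s) powr (- \<epsilon>) / sqrt (t - s)"
      using r st C eps by (intro divide_right_mono mult_left_mono powr_mono2') auto
    also have "\<dots> = C * (t - s) powr (- \<theta>)"
    proof -
      have "- \<epsilon> - 1 / 2 = - \<theta>" by (simp add: \<theta>_def)
      then show ?thesis using r by (simp add: powr_half_sqrt[symmetric] mult_powr_divide)
    qed
    finally have 1: "\<bar>db t / sqrt (t - s)\<bar> \<le> C * (t - s) powr (- \<theta>)" .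
    have "\<bar>dkern_t t s\<bar> \<le> 1 * \<bar>db t / sqrt (t - s) + (b s - b t) / (2 * (t - s) * sqrt (t - s))\<bar>"
      unfolding dkern_t_def abs_mult by (intro mult_right_mono e1) auto
    also have "\<dots> \<le> 2 * C * (t - s) powr (- \<theta>)" unfolding mult.assoc[of 2 C] mult_1 by (rule abs_add_le_double[OF 1 qb(2)[OF less_imp_le[OF st(2)]]])
    finally show "\<bar>dkern_t t s\<bar> \<le> 2 * C * (t - s) powr (- \<theta>)" .
    have "\<bar>bz t s\<bar> \<le> C * (t - s) powr (1 / 2 - \<epsilon>)" using qb(1) st by simp
    also have "\<dots> \<le> 2 * C * (t - s) powr (1 / 2 - \<epsilon>)" using C by (intro mult_right_mono) auto
    finally show "\<bar>bz t s\<bar> \<le> 2 * C * (t - s) powr (1 / 2 - \<epsilon>)" .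
  next
    fix s t :: real assume st: "0 < s" "s < t" "t \<le> T"
    have r: "0 < t - s" using st by simp
    note qb = quotient_bound[OF Ci[of s t] st(2)]
    \<comment> \<open>The two exponents add up to - \<theta> and are negative, so replacing both
      bases by the smaller of s and t - s only increases the product.\<close>
    have pm: "s powr (- \<epsilon>) * (t - s) powr (- (1 / 2)) \<le> s powr (- \<theta>) + (t - s) powr (- \<theta>)"
    proof (cases "s \<le> t - s")
      case True
      have "(t - s) powr (- (1 / 2)) \<le> s powr (- (1 / 2))" using st True by (intro powr_mono2') auto
      then have "s powr (- \<epsilon>) * (t - s) powr (- (1 / 2)) \<le> s powr (- \<epsilon>) * s powr (- (1 / 2))" by (intro mult_left_mono) auto
      also have "\<dots> = s powr (- \<theta>)" by (simp add: powr_add[symmetric] \<theta>_def add.commute)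
      finally show ?thesis using powr_ge_zero[of "t - s" "- \<theta>"] by linarith
    next
      case False
      have "s powr (- \<epsilon>) \<le> (t - s) powr (- \<epsilon>)" using r False eps by (intro powr_mono2') auto
      then have "s powr (- \<epsilon>) * (t - s) powr (- (1 / 2)) \<le> (t - s) powr (- \<epsilon>) * (t - s) powr (- (1 / 2))" by (intro mult_right_mono) auto
      also have "\<dots> = (t - s) powr (- \<theta>)" by (simp add: powr_add[symmetric] \<theta>_def add.commute)
      finally show ?thesis using powr_ge_zero[of s "- \<theta>"] by linarith
    qed
    have "\<bar>db s / sqrt (t - s)\<bar> \<le> C * s powr (- \<epsilon>) / sqrt (t - s)"
      using r Cd[of s] st by (simp add: divide_right_mono)
    also have "\<dots> = C * (s powr (- \<epsilon>) * (t - s) powr (- (1 / 2)))"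
      using r by (simp add: powr_half_sqrt[symmetric] powr_minus_divide)
    also have "\<dots> \<le> C * (s powr (- \<theta>) + (t - s) powr (- \<theta>))" using C pm by (intro mult_left_mono) auto
    finally have 1: "\<bar>db s / sqrt (t - s)\<bar> \<le> C * (s powr (- \<theta>) + (t - s) powr (- \<theta>))" .
    have 2: "C * (t - s) powr (- \<theta>) \<le> C * (s powr (- \<theta>) + (t - s) powr (- \<theta>))" using C by (intro mult_left_mono) auto
    have "\<bar>dkern_s t s\<bar> \<le> 1 * \<bar>db s / sqrt (t - s) + (b s - b t) / (2 * (t - s) * sqrt (t - s))\<bar>"
      unfolding dkern_s_def abs_mult abs_minus by (intro mult_right_mono e1) auto
    also have "\<dots> \<le> 2 * C * (s powr (- \<theta>) + (t - s) powr (- \<theta>))" unfolding mult.assoc[of 2 C] mult_1 by (rule abs_add_le_double[OF 1 order_trans[OF qb(2)[OF less_imp_le[OF st(1)] less_imp_le[OF st(2)] st(3)] 2]])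
    finally show "\<bar>dkern_s t s\<bar> \<le> 2 * C * (s powr (- \<theta>) + (t - s) powr (- \<theta>))" .
  qed
qed

lemma bz_tendsto_right:
  assumes "0 \<le> s"
  shows "((\<lambda>r. bz r s) \<longlongrightarrow> 0) (at_right s)"
proof -
  obtain C where Cb: "\<And>r. s < r \<Longrightarrow> r \<le> s + 1 \<Longrightarrow> \<bar>bz r s\<bar> \<le> C * (r - s) powr (1 / 2 - \<epsilon>)"
    using dkern_bounds[of "s + 1"] assms by (metis add_nonneg_pos zero_less_one)
  show ?thesis
  proof (rule Lim_null_comparison)
    show "\<forall>\<^sub>F r in at_right s. norm (bz r s) \<le> C * (r - s) powr (1 / 2 - \<epsilon>)"
      unfolding eventually_at_right_field using Cb by (intro exI[of _ "s + 1"]) auto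
    have "((\<lambda>r. C * (r - s) powr (1 / 2 - \<epsilon>)) \<longlongrightarrow> C * (s - s) powr (1 / 2 - \<epsilon>)) (at_right s)"
      using eps by (intro tendsto_mult tendsto_const tendsto_powr' tendsto_diff tendsto_ident_at) (auto simp: eventually_at_right_field intro!: exI[of _ "s + 1"])
    then show "((\<lambda>r. C * (r - s) powr (1 / 2 - \<epsilon>)) \<longlongrightarrow> 0) (at_right s)" by simp
  qed
qed

lemma bz_tendsto_left:
  assumes "0 < t"
  shows "((\<lambda>r. bz t r) \<longlongrightarrow> 0) (at_left t)"
proof -
  obtain C where Cb: "\<And>r. 0 \<le> r \<Longrightarrow> r < t \<Longrightarrow> \<bar>bz t r\<bar> \<le> C * (t - r) powr (1 / 2 - \<epsilon>)"
    using dkern_bounds[OF assms] by (metis order_refl)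
  show ?thesis
  proof (rule Lim_null_comparison)
    show "\<forall>\<^sub>F r in at_left t. norm (bz t r) \<le> C * (t - r) powr (1 / 2 - \<epsilon>)"
      unfolding eventually_at_left_field using Cb assms by (intro exI[of _ 0]) auto
    have "((\<lambda>r. C * (t - r) powr (1 / 2 - \<epsilon>)) \<longlongrightarrow> C * (t - t) powr (1 / 2 - \<epsilon>)) (at_left t)"
      using eps by (intro tendsto_mult tendsto_const tendsto_powr' tendsto_diff tendsto_ident_at) (auto simp: eventually_at_left_field intro!: exI[of _ "t - 1"])
    then show "((\<lambda>r. C * (t - r) powr (1 / 2 - \<epsilon>)) \<longlongrightarrow> 0) (at_left t)" by simp
  qed
qed

text \<open>Since 1/2 - \<epsilon> > 0 the argument \<open>bz\<close> tends to 0, and the kernel to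
  half of the Gaussian mass. This diagonal value is the coefficient of the unknown in the
  second-kind equations.\<close>

lemma kern_diag_tendsto:
  shows "0 \<le> s \<Longrightarrow> ((\<lambda>r. kern r s) \<longlongrightarrow> sqrt (pi / 2)) (at_right s)"
    and "0 < t \<Longrightarrow> ((\<lambda>r. kern t r) \<longlongrightarrow> sqrt (pi / 2)) (at_left t)"
  unfolding kern_def gauss_tail_0[symmetric]
  by (rule isCont_tendsto_compose[OF isCont_gauss_tail bz_tendsto_right], assumption)
     (rule isCont_tendsto_compose[OF isCont_gauss_tail bz_tendsto_left], assumption)

lemma isCont_dkern_t: "0 \<le> s \<Longrightarrow> s < t \<Longrightarrow> isCont (\<lambda>t. dkern_t t s) t"
  unfolding dkern_t_def bz_def
  by (intro continuous_intros isCont_db isCont_b) auto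

lemma isCont_dkern_s: "0 < s \<Longrightarrow> s < t \<Longrightarrow> isCont (\<lambda>s. dkern_s t s) s"
  unfolding dkern_s_def bz_def
  by (intro continuous_intros isCont_db isCont_b) auto

lemma set_integrable_powr_shift: "set_integrable lborel {s<..<t} (\<lambda>r. (r - s) powr (- \<theta>))"
proof -
  have "set_integrable lborel {0<..<t - s} (\<lambda>r. r powr (- \<theta>))" by (rule set_integrable_powr[OF theta(2)])
  then have "integrable lborel (\<lambda>x. indicator {s<..<t} (s + 1 * x) *\<^sub>R ((s + 1 * x) - s) powr (- \<theta>))"
    unfolding set_integrable_def by (rule Bochner_Integration.integrable_cong[THEN iffD1, rotated 2]) (auto simp: indicator_def)
  then show ?thesis unfolding set_integrable_def
    using lborel_integrable_real_affine_iff[of 1 "\<lambda>x. indicator {s<..<t} x *\<^sub>R (x - s) powr (- \<theta>)" s] by simp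
qed

lemma set_integrable_dkern_t:
  assumes "0 \<le> s" "s < t"
  shows "set_integrable lborel {s<..<t} (\<lambda>r. dkern_t r s)"
proof -
  obtain C where C: "0 \<le> C" "\<And>s r. 0 \<le> s \<Longrightarrow> s < r \<Longrightarrow> r \<le> t \<Longrightarrow> \<bar>dkern_t r s\<bar> \<le> C * (r - s) powr (- \<theta>)"
    using dkern_bounds[of t] assms by (metis le_less_trans)
  have "set_integrable lborel {s<..<t} (\<lambda>r. C * (r - s) powr (- \<theta>))"
    by (intro set_integrable_mult_right set_integrable_powr_shift)
  then show ?thesis
    by (rule set_integrable_bound) (use C assms in \<open>auto simp: set_borel_measurable_def\<close>)
qed

lemma set_integrable_dkern_s:
  assumes "0 < t"
  shows "set_integrable lborel {0<..<t} (\<lambda>r. dkern_s t r)"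
proof -
  obtain C where C: "0 \<le> C" "\<And>s. 0 < s \<Longrightarrow> s < t \<Longrightarrow> \<bar>dkern_s t s\<bar> \<le> C * (s powr (- \<theta>) + (t - s) powr (- \<theta>))"
    using dkern_bounds[OF assms] by (metis order_refl)
  have "set_integrable lborel {0<..<t} (\<lambda>s. C * (s powr (- \<theta>) + (t - s) powr (- \<theta>)))"
    by (intro set_integrable_mult_right set_integral_add set_integrable_powr set_integrable_powr_reflect theta)
  then show ?thesis
    by (rule set_integrable_bound) (use C assms in \<open>auto simp: set_borel_measurable_def abs_of_nonneg\<close>)
qed

text \<open>Fundamental theorem of calculus started on the diagonal, where the kernel has a limit
  although its derivative is singular but integrable.\<close>

lemma kern_eq_integral_t:
  assumes st: "0 \<le> s" "s < t"
  shows "kern t s = sqrt (pi / 2) + (LBINT r:{s<..<t}. dkern_t r s)"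
proof -
  have "(LBINT r=ereal s..ereal t. dkern_t r s) = kern t s - sqrt (pi / 2)"
  proof (rule interval_integral_FTC_integrable[where F="\<lambda>r. kern r s"])
    show "ereal s < ereal t" using st by simp
    show "((\<lambda>r. kern r s) has_vector_derivative dkern_t x s) (at x)" if "ereal s < ereal x" "ereal x < ereal t" for x
      using DERIV_kern_t[of s x] st that by (simp add: has_real_derivative_iff_has_vector_derivative)
    show "isCont (\<lambda>r. dkern_t r s) x" if "ereal s < ereal x" "ereal x < ereal t" for x
      using that st by (intro isCont_dkern_t) auto
    show "set_integrable lborel (einterval (ereal s) (ereal t)) (\<lambda>r. dkern_t r s)"
      using set_integrable_dkern_t[OF st] by simp
    show "(((\<lambda>r. kern r s) \<circ> real_of_ereal) \<longlongrightarrow> sqrt (pi / 2)) (at_right (ereal s))"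
      using kern_diag_tendsto(1)[OF st(1)] by (simp add: ereal_tendsto_simps)
    have "isCont (\<lambda>r. kern r s) t" using DERIV_kern_t[OF st] by (rule DERIV_isCont)
    then have "((\<lambda>r. kern r s) \<longlongrightarrow> kern t s) (at_left t)" by (simp add: isCont_def filterlim_at_split)
    then show "(((\<lambda>r. kern r s) \<circ> real_of_ereal) \<longlongrightarrow> kern t s) (at_left (ereal t))"
      by (simp add: ereal_tendsto_simps)
  qed
  then show ?thesis using st by (simp add: interval_lebesgue_integral_def)
qed

lemma kern_eq_integral_s:
  assumes st: "0 \<le> s" "s < t"
  shows "kern t s = sqrt (pi / 2) - (LBINT r:{s<..<t}. dkern_s t r)"
proof -
  have "(LBINT r=ereal s..ereal t. dkern_s t r) = sqrt (pi / 2) - kern t s"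
  proof (rule interval_integral_FTC_integrable[where F="\<lambda>r. kern t r"])
    show "ereal s < ereal t" using st by simp
    show "((\<lambda>r. kern t r) has_vector_derivative dkern_s t x) (at x)" if "ereal s < ereal x" "ereal x < ereal t" for x
      using DERIV_kern_s[of x t] st that by (simp add: has_real_derivative_iff_has_vector_derivative)
    show "isCont (\<lambda>r. dkern_s t r) x" if "ereal s < ereal x" "ereal x < ereal t" for x
      using that st by (intro isCont_dkern_s) auto
    show "set_integrable lborel (einterval (ereal s) (ereal t)) (\<lambda>r. dkern_s t r)"
    proof -
      have "{s<..<t} \<subseteq> {0<..<t}" using st by (auto intro: le_less_trans)
      then show ?thesis using set_integrable_subset[OF set_integrable_dkern_s[of t], of "{s<..<t}"] st by simp
    qed
    show "(((\<lambda>r. kern t r) \<circ> real_of_ereal) \<longlongrightarrow> sqrt (pi / 2)) (at_left (ereal t))"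
      using kern_diag_tendsto(2)[of t] st by (simp add: ereal_tendsto_simps)
    have "isCont (\<lambda>r. kern t r) s" unfolding kern_def bz_def
      using st by (intro isCont_o2[OF _ isCont_gauss_tail] continuous_intros isCont_b) auto
    then have "((\<lambda>r. kern t r) \<longlongrightarrow> kern t s) (at_right s)" by (simp add: isCont_def filterlim_at_split)
    then show "(((\<lambda>r. kern t r) \<circ> real_of_ereal) \<longlongrightarrow> kern t s) (at_right (ereal s))"
      by (simp add: ereal_tendsto_simps)
  qed
  then show ?thesis using st by (simp add: interval_lebesgue_integral_def)
qed

text \<open>Integration by parts without a density: write \<open>kern t s\<close> as its diagonal
  value minus the integral of \<open>dkern_s\<close> over (s,t) and exchange integrals; the weighted
  time \<sigma> then enters only through its distribution function at r. It thus serves the law of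
  the passage time and a density alike.\<close>

lemma kern_stieltjes:
  assumes N: "sigma_finite_measure N" and t: "0 < t" and \<sigma>[measurable]: "\<sigma> \<in> borel_measurable N"
    and q: "integrable N q" and q0: "\<And>\<omega>. q \<omega> \<noteq> 0 \<Longrightarrow> 0 \<le> \<sigma> \<omega> \<and> \<sigma> \<omega> < t"
  shows "(\<integral>\<omega>. q \<omega> * kern t (\<sigma> \<omega>) \<partial>N) = sqrt (pi / 2) * (\<integral>\<omega>. q \<omega> \<partial>N)
      - (LBINT r:{0<..<t}. dkern_s t r * (\<integral>\<omega>. q \<omega> * indicator {..<r} (\<sigma> \<omega>) \<partial>N))"
    and "set_integrable lborel {0<..<t} (\<lambda>r. dkern_s t r * (\<integral>\<omega>. q \<omega> * indicator {..<r} (\<sigma> \<omega>) \<partial>N))"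
proof -
  interpret N: sigma_finite_measure N by (rule N)
  interpret P: pair_sigma_finite N lborel ..
  have [measurable]: "q \<in> borel_measurable N" using q by auto
  let ?f = "\<lambda>\<omega> r. (indicator {0<..<t} r * dkern_s t r) * (q \<omega> * indicator {0<..} (r - \<sigma> \<omega>))"
  define D where "D = (LBINT r. indicator {0<..<t} r * \<bar>dkern_s t r\<bar>)"
  have iD: "integrable lborel (\<lambda>r. indicator {0<..<t} r * \<bar>dkern_s t r\<bar>)"
    using set_integrable_abs[OF set_integrable_dkern_s[OF t]] by (simp add: set_integrable_def)
  have fb: "\<bar>?f \<omega> r\<bar> \<le> \<bar>q \<omega>\<bar> * (indicator {0<..<t} r * \<bar>dkern_s t r\<bar>)" for \<omega> r
    by (auto simp: abs_mult indicator_def)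
  have fi1: "integrable lborel (?f \<omega>)" for \<omega>
    by (rule Bochner_Integration.integrable_bound[OF integrable_mult_right[OF iD, of "\<bar>q \<omega>\<bar>"]])
       (measurable, use fb[of _ \<omega>] in \<open>auto intro!: AE_I2 simp: abs_mult\<close>)
  have fi: "integrable (N \<Otimes>\<^sub>M lborel) (\<lambda>(\<omega>, r). ?f \<omega> r)"
  proof (rule P.Fubini_integrable)
    show "(\<lambda>(\<omega>, r). ?f \<omega> r) \<in> borel_measurable (N \<Otimes>\<^sub>M lborel)" by measurable
    show "AE \<omega> in N. integrable lborel (\<lambda>r. case (\<omega>, r) of (\<omega>, r) \<Rightarrow> ?f \<omega> r)" using fi1 by simp
    show "integrable N (\<lambda>\<omega>. \<integral>r. norm (case (\<omega>, r) of (\<omega>, r) \<Rightarrow> ?f \<omega> r) \<partial>lborel)"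
    proof (rule Bochner_Integration.integrable_bound)
      show "integrable N (\<lambda>\<omega>. \<bar>q \<omega>\<bar> * D)" using q by simp
      show "(\<lambda>\<omega>. \<integral>r. norm (case (\<omega>, r) of (\<omega>, r) \<Rightarrow> ?f \<omega> r) \<partial>lborel) \<in> borel_measurable N" by measurable
      show "AE \<omega> in N. norm (\<integral>r. norm (case (\<omega>, r) of (\<omega>, r) \<Rightarrow> ?f \<omega> r) \<partial>lborel) \<le> norm (\<bar>q \<omega>\<bar> * D)"
      proof (rule AE_I2)
        fix \<omega>
        have "(LBINT r. \<bar>?f \<omega> r\<bar>) \<le> (LBINT r. \<bar>q \<omega>\<bar> * (indicator {0<..<t} r * \<bar>dkern_s t r\<bar>))"
          by (intro integral_mono integrable_abs fi1 integrable_mult_right iD fb)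
        also have "\<dots> = \<bar>q \<omega>\<bar> * D" by (simp add: D_def)
        finally have "(LBINT r. \<bar>?f \<omega> r\<bar>) \<le> \<bar>q \<omega>\<bar> * D" .
        moreover have "0 \<le> (LBINT r. \<bar>?f \<omega> r\<bar>)" by (rule Bochner_Integration.integral_nonneg) simp
        ultimately show "norm (\<integral>r. norm (case (\<omega>, r) of (\<omega>, r) \<Rightarrow> ?f \<omega> r) \<partial>lborel) \<le> norm (\<bar>q \<omega>\<bar> * D)" by simp
      qed
    qed
  qed
  have kq: "q \<omega> * kern t (\<sigma> \<omega>) = sqrt (pi / 2) * q \<omega> - (LBINT r. ?f \<omega> r)" for \<omega>
  proof (cases "q \<omega> = 0")
    case False
    then have s: "0 \<le> \<sigma> \<omega>" "\<sigma> \<omega> < t" using q0 by auto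
    have "(LBINT r. ?f \<omega> r) = (LBINT r. q \<omega> * (indicator {\<sigma> \<omega><..<t} r *\<^sub>R dkern_s t r))"
      using s by (intro Bochner_Integration.integral_cong) (auto simp: indicator_def)
    also have "\<dots> = q \<omega> * (sqrt (pi / 2) - kern t (\<sigma> \<omega>))"
      using kern_eq_integral_s[OF s] by (simp add: set_lebesgue_integral_def)
    finally show ?thesis by (simp add: algebra_simps)
  qed simp
  have ind: "(\<integral>\<omega>. ?f \<omega> r \<partial>N) = indicator {0<..<t} r * (dkern_s t r * (\<integral>\<omega>. q \<omega> * indicator {..<r} (\<sigma> \<omega>) \<partial>N))" for r
  proof -
    have "indicator {0<..} (r - \<sigma> \<omega>) = (indicator {..<r} (\<sigma> \<omega>) :: real)" for \<omega> by (auto simp: indicator_def)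
    then show ?thesis by simp
  qed
  have "(\<integral>\<omega>. q \<omega> * kern t (\<sigma> \<omega>) \<partial>N) = sqrt (pi / 2) * (\<integral>\<omega>. q \<omega> \<partial>N) - (\<integral>\<omega>. (LBINT r. ?f \<omega> r) \<partial>N)"
    unfolding kq using q P.integrable_fst'[OF fi] by (subst Bochner_Integration.integral_diff) auto
  also have "(\<integral>\<omega>. (LBINT r. ?f \<omega> r) \<partial>N) = (LBINT r. (\<integral>\<omega>. ?f \<omega> r \<partial>N))"
    using P.Fubini_integral[OF fi] by simp
  also have "\<dots> = (LBINT r:{0<..<t}. dkern_s t r * (\<integral>\<omega>. q \<omega> * indicator {..<r} (\<sigma> \<omega>) \<partial>N))"
    unfolding ind set_lebesgue_integral_def by simp
  finally show "(\<integral>\<omega>. q \<omega> * kern t (\<sigma> \<omega>) \<partial>N) = sqrt (pi / 2) * (\<integral>\<omega>. q \<omega> \<partial>N)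
      - (LBINT r:{0<..<t}. dkern_s t r * (\<integral>\<omega>. q \<omega> * indicator {..<r} (\<sigma> \<omega>) \<partial>N))" .
  show "set_integrable lborel {0<..<t} (\<lambda>r. dkern_s t r * (\<integral>\<omega>. q \<omega> * indicator {..<r} (\<sigma> \<omega>) \<partial>N))"
    using P.integrable_snd[OF fi] unfolding ind by (simp add: set_integrable_def)
qed

text \<open>Measurability and boundedness are what is known of the difference between a distribution
  function and a primitive, to which this is applied. The bound on \<open>dkern_s\<close> reduces it
  to \<open>singular_gronwall\<close>.\<close>

lemma volterra_unique:
  assumes G[measurable]: "G \<in> borel_measurable borel" and B: "\<And>t. 0 < t \<Longrightarrow> t \<le> T \<Longrightarrow> \<bar>G t\<bar> \<le> B"
    and eq: "\<And>t. 0 < t \<Longrightarrow> t \<le> T \<Longrightarrow> sqrt (pi / 2) * G t = (LBINT r:{0<..<t}. dkern_s t r * G r)"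
    and t: "0 < t" "t \<le> T"
  shows "G t = 0"
proof -
  have T: "0 < T" using t by simp
  obtain C where C: "0 \<le> C" "\<And>s t. 0 < s \<Longrightarrow> s < t \<Longrightarrow> t \<le> T \<Longrightarrow> \<bar>dkern_s t s\<bar> \<le> C * (s powr (- \<theta>) + (t - s) powr (- \<theta>))"
    using dkern_bounds[OF T] by metis
  let ?c = "sqrt (pi / 2)"
  have c: "0 < ?c" by simp
  show ?thesis
  proof (rule singular_gronwall[OF theta(3,2) _ G B _ t, where K="C / ?c"])
    fix t assume t: "0 < t" "t \<le> T"
    let ?w = "\<lambda>s. s powr (- \<theta>) + (t - s) powr (- \<theta>)"
    have B0: "0 \<le> B" using B[OF t] by linarith
    have iw: "set_integrable lborel {0<..<t} (\<lambda>s. ?w s * B)"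
      using theta by (intro set_integrable_mult_left set_integral_add set_integrable_powr set_integrable_powr_reflect) auto
    have iwG: "set_integrable lborel {0<..<t} (\<lambda>s. ?w s * \<bar>G s\<bar>)"
    proof (rule set_integrable_bound[OF iw])
      show "AE s in lborel. s \<in> {0<..<t} \<longrightarrow> norm (?w s * \<bar>G s\<bar>) \<le> norm (?w s * B)"
        using B t B0 by (auto simp: abs_mult intro!: AE_I2 mult_left_mono)
    qed (auto simp: set_borel_measurable_def)
    have iwC: "set_integrable lborel {0<..<t} (\<lambda>s. C * (?w s * \<bar>G s\<bar>))" by (intro set_integrable_mult_right iwG)
    have b: "\<bar>dkern_s t s * G s\<bar> \<le> C * (?w s * \<bar>G s\<bar>)" if "s \<in> {0<..<t}" for s
      using mult_right_mono[OF C(2)[of s t], of "\<bar>G s\<bar>"] that t by (simp add: abs_mult mult.assoc)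
    have iG: "set_integrable lborel {0<..<t} (\<lambda>s. dkern_s t s * G s)"
    proof (rule set_integrable_bound[OF iwC])
      show "AE s in lborel. s \<in> {0<..<t} \<longrightarrow> norm (dkern_s t s * G s) \<le> norm (C * (?w s * \<bar>G s\<bar>))"
        using b by (intro AE_I2) force
    qed (auto simp: set_borel_measurable_def)
    have "?c * \<bar>G t\<bar> = \<bar>LBINT r:{0<..<t}. dkern_s t r * G r\<bar>"
      unfolding eq[OF t, symmetric] by (simp add: abs_mult)
    also have "\<dots> \<le> (LBINT r:{0<..<t}. \<bar>dkern_s t r * G r\<bar>)"
      using set_integral_norm_bound[OF iG] by simp
    also have "\<dots> \<le> (LBINT r:{0<..<t}. C * (?w r * \<bar>G r\<bar>))"
      by (rule set_integral_mono[OF set_integrable_abs[OF iG] iwC b])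
    also have "\<dots> = C * (LBINT r:{0<..<t}. ?w r * \<bar>G r\<bar>)" by simp
    finally have "\<bar>G t\<bar> \<le> (C * (LBINT r:{0<..<t}. ?w r * \<bar>G r\<bar>)) / ?c"
      using c by (subst pos_le_divide_eq) (auto simp: mult.commute)
    then show "\<bar>G t\<bar> \<le> C / ?c * (LBINT r:{0<..<t}. ?w r * \<bar>G r\<bar>)" by simp
  qed (use C c in auto)
qed

end

section \<open>The differentiated equation for p = -1 and its continuous solution\<close>

lemma gauss_tail_exp_bound: "gauss_tail z \<le> 4 * exp (- z)"
proof -
  have "gauss_tail z = (\<integral>u. heat_flux (z + u) 1 \<partial>power_measure 2)" using integral_heat_flux_2[of 1 z] by simp
  also have "\<dots> \<le> norm (\<integral>u. heat_flux (z + u) 1 \<partial>power_measure 2)" by simp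
  also have "\<dots> \<le> (\<integral>u. 4 * exp (- z) * exp (- (1 * u)) \<partial>power_measure 2)"
  proof (rule norm_integral_le_AE)
    have b: "norm (heat_flux (z + u) 1) \<le> 4 * exp (- z) * exp (- (1 * u))" for u
      using abs_heat_flux_le[of 1 "z + u"] by (simp add: mult.assoc exp_add[symmetric])
    show "integrable (power_measure 2) (\<lambda>u. heat_flux (z + u) 1)"
      by (rule integrable_power_measure_exp_bound[of 2 1, where C="4 * exp (- z)"]) (use b in auto)
    show "AE u in power_measure 2. norm (heat_flux (z + u) 1) \<le> 4 * exp (- z) * exp (- (1 * u))" using b by simp
  qed (auto intro!: integrable_power_measure_exp[of 2 1, simplified])
  also have "\<dots> = 4 * exp (- z)" using integral_power_measure_exp[of 2 1] by (simp add: Gamma_numeral)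
  finally show ?thesis .
qed

lemma gauss_tail_at_top: "(gauss_tail \<longlongrightarrow> 0) at_top"
proof (rule Lim_null_comparison)
  show "\<forall>\<^sub>F z in at_top. norm (gauss_tail z) \<le> 4 * exp (- z)"
    using gauss_tail_exp_bound gauss_tail_nonneg by (intro always_eventually) simp
  show "((\<lambda>z::real. 4 * exp (- z)) \<longlongrightarrow> 0) at_top" by real_asymp
qed

lemma set_integrable_continuous_Ioo:
  fixes f :: "real \<Rightarrow> real"
  assumes "continuous_on {0..t} f"
  shows "set_integrable lborel {0<..<t} f"
  by (rule set_integrable_subset[OF borel_integrable_compact[OF compact_Icc assms, folded set_integrable_def]]) auto

locale smooth_boundary = smooth_curve +
  assumes b0: "b0 < 0"
begin

text \<open>For t > 0 this is sqrt(2 pi) times the probability of W t \<le> b t, and the left side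
  of the integral equation for p = -1.\<close>

definition hit :: "real \<Rightarrow> real" where "hit t = gauss_tail (- b t / sqrt t)"

definition dhit :: "real \<Rightarrow> real" where
  "dhit t = (if 0 < t then exp (- (b t / sqrt t)\<^sup>2 / 2) * (db t / sqrt t - b t / (2 * t * sqrt t)) else 0)"

lemma DERIV_hit:
  assumes "0 < t"
  shows "(hit has_real_derivative dhit t) (at t)"
proof -
  have dg: "((\<lambda>t. - b t) has_real_derivative - db t) (at t)" "((\<lambda>t. t) has_real_derivative 1) (at t)"
    using assms by (auto intro!: derivative_eq_intros DERIV_b)
  have "((\<lambda>t. - b t / sqrt t) has_real_derivative - (db t / sqrt t - b t / (2 * t * sqrt t))) (at t)"
    by (rule DERIV_cong[OF DERIV_divide_sqrt[OF dg]]) (use assms in simp_all)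
  note d = DERIV_chain2[OF DERIV_gauss_tail this]
  have "(- b t / sqrt t)\<^sup>2 = (b t / sqrt t)\<^sup>2" by (simp add: power_divide)
  then show ?thesis
    using d assms unfolding hit_def[abs_def] dhit_def by (simp only: minus_mult_minus if_True)
qed

text \<open>Here the negative starting value is decisive: near 0 the curve stays below b0/2, and the
  resulting factor e^(-k/t) with k = b0^2/8 beats the singular factor t^(-3/2).\<close>

lemma dhit_tendsto_0: "(dhit \<longlongrightarrow> 0) (at_right 0)"
proof -
  obtain C where C: "0 \<le> C" "\<And>t. 0 < t \<Longrightarrow> t \<le> 1 \<Longrightarrow> \<bar>db t\<bar> \<le> C * t powr (- \<epsilon>)"
    using constant_exists[of 1] by (metis zero_less_one)
  define k where "k = b0\<^sup>2 / 8"
  have k: "0 < k" using b0 by (simp add: k_def)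
  have ev: "\<forall>\<^sub>F t in at_right 0. b t < b0 / 2" "\<forall>\<^sub>F t in at_right 0. 2 * b0 < b t"
    by (rule order_tendstoD(2)[OF b_tendsto], use b0 in linarith)
       (rule order_tendstoD(1)[OF b_tendsto], use b0 in linarith)
  have ev1: "\<forall>\<^sub>F t in at_right 0. 0 < t \<and> t \<le> (1::real)"
    unfolding eventually_at_right_field by (intro exI[of _ 1]) auto
  show ?thesis
  proof (rule Lim_null_comparison)
    show "\<forall>\<^sub>F t in at_right 0. norm (dhit t) \<le> (C - b0) * (exp (- k / t) * t powr (- 3 / 2))"
      using ev ev1
    proof eventually_elim
      case (elim t)
      have t: "0 < t" "t \<le> 1" using elim by auto
      have "\<bar>b0 / 2\<bar> \<le> \<bar>b t\<bar>" using elim b0 by linarith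
      then have "(b0 / 2)\<^sup>2 \<le> (b t)\<^sup>2" by (simp only: abs_le_square_iff)
      then have "k \<le> (b t)\<^sup>2 / 2" by (simp add: k_def power_divide)
      then have "k / t \<le> (b t)\<^sup>2 / 2 / t" using t by (intro divide_right_mono) auto
      then have "exp (- (b t / sqrt t)\<^sup>2 / 2) \<le> exp (- k / t)"
        using t by (simp add: power_divide mult.commute)
      moreover have "\<bar>db t / sqrt t - b t / (2 * t * sqrt t)\<bar> \<le> (C - b0) * t powr (- 3 / 2)"
      proof -
        have s3: "t * sqrt t = t powr (3 / 2)" using t by (simp add: powr_half_sqrt[symmetric] powr_mult_base)
        have "\<bar>db t / sqrt t\<bar> \<le> C * t powr (- \<epsilon>) / t powr (1 / 2)"
          using C(2)[OF t] t by (simp add: powr_half_sqrt[symmetric] divide_right_mono)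
        also have "\<dots> = C * t powr (- \<epsilon> - 1 / 2)" by (rule mult_powr_divide)
        also have "\<dots> \<le> C * t powr (- 3 / 2)" using t C(1) eps by (intro mult_left_mono powr_mono') auto
        finally have 1: "\<bar>db t / sqrt t\<bar> \<le> C * t powr (- 3 / 2)" .
        have "\<bar>b t / (2 * t * sqrt t)\<bar> = (- b t / 2) / (t powr (3 / 2))"
          using elim b0 t by (simp add: s3[symmetric] abs_mult)
        also have "\<dots> \<le> (- b0) / t powr (3 / 2)" using elim by (intro divide_right_mono) auto
        also have "\<dots> = - b0 * t powr (- 3 / 2)" using powr_minus_divide[of t "3 / 2"] by simp
        finally have 2: "\<bar>b t / (2 * t * sqrt t)\<bar> \<le> - b0 * t powr (- 3 / 2)" .
        have "\<bar>db t / sqrt t - b t / (2 * t * sqrt t)\<bar> \<le> \<bar>db t / sqrt t\<bar> + \<bar>b t / (2 * t * sqrt t)\<bar>" by (rule abs_triangle_ineq4)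
        also have "\<dots> \<le> C * t powr (- 3 / 2) + - b0 * t powr (- 3 / 2)" by (rule add_mono[OF 1 2])
        finally show ?thesis by (simp add: algebra_simps)
      qed
      ultimately have "\<bar>dhit t\<bar> \<le> exp (- k / t) * ((C - b0) * t powr (- 3 / 2))"
        unfolding dhit_def using t by (simp only: if_True abs_mult abs_exp_cancel) (intro mult_mono, auto)
      then show ?case by (simp add: mult_ac)
    qed
    have "((\<lambda>t. exp (- k / t) * t powr (- 3 / 2)) \<longlongrightarrow> 0) (at_right 0)" using k by real_asymp
    from tendsto_mult_left[OF this, of "C - b0"]
    show "((\<lambda>t. (C - b0) * (exp (- k / t) * t powr (- 3 / 2))) \<longlongrightarrow> 0) (at_right 0)" by simp
  qed
qed

lemma continuous_dhit: "continuous_on {0..} dhit"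
  unfolding continuous_on_eq_continuous_within
proof
  fix t :: real assume t: "t \<in> {0..}"
  show "continuous (at t within {0..}) dhit"
  proof (cases "t = 0")
    case True
    have "(dhit \<longlongrightarrow> dhit 0) (at_right 0)" using dhit_tendsto_0 by (simp add: dhit_def)
    moreover have "at 0 within {0..} = (at_right (0::real))"
      by (rule at_within_Ici_at_right)
    ultimately show ?thesis using True by (simp add: continuous_within)
  next
    case False
    then have t0: "0 < t" using t by simp
    have "isCont (\<lambda>t. exp (- (b t / sqrt t)\<^sup>2 / 2) * (db t / sqrt t - b t / (2 * t * sqrt t))) t"
      using t0 by (intro continuous_intros isCont_b isCont_db) auto
    moreover have "\<forall>\<^sub>F x in nhds t. dhit x = exp (- (b x / sqrt x)\<^sup>2 / 2) * (db x / sqrt x - b x / (2 * x * sqrt x))"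
      using t0 by (intro eventually_mono[OF eventually_nhds_in_open[of "{0<..}" t]]) (auto simp: dhit_def)
    ultimately have "isCont dhit t" by (simp only: isCont_cong)
    then show ?thesis by (rule continuous_at_imp_continuous_at_within)
  qed
qed

lemma dhit_measurable [measurable]: "dhit \<in> borel_measurable borel"
  unfolding dhit_def by measurable

lemma hit_eq_integral:
  assumes t: "0 < t"
  shows "hit t = (LBINT r:{0<..<t}. dhit r)"
proof -
  have "(LBINT r=ereal 0..ereal t. dhit r) = hit t - 0"
  proof (rule interval_integral_FTC_integrable[where F=hit])
    show "ereal 0 < ereal t" using t by simp
    show "(hit has_vector_derivative dhit x) (at x)" if "ereal 0 < ereal x" "ereal x < ereal t" for x
      using DERIV_hit[of x] that by (simp add: has_real_derivative_iff_has_vector_derivative)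
    show "isCont dhit x" if "ereal 0 < ereal x" "ereal x < ereal t" for x
      using that by (intro continuous_on_interior[OF continuous_dhit]) (auto simp: interior_real_atLeast)
    show "set_integrable lborel (einterval (ereal 0) (ereal t)) dhit"
      using set_integrable_continuous_Ioo[OF continuous_on_subset[OF continuous_dhit], of t] by simp
    have "filterlim (\<lambda>r. - b r / sqrt r) at_top (at_right 0)"
    proof (rule filterlim_at_top_mono)
      have "0 < - b0 / 2" using b0 by simp
      then show "filterlim (\<lambda>r. (- b0 / 2) / sqrt r) at_top (at_right 0)" by real_asymp
      have "\<forall>\<^sub>F r in at_right 0. b r < b0 / 2" by (rule order_tendstoD(2)[OF b_tendsto]) (use b0 in linarith)
      moreover have "\<forall>\<^sub>F r in at_right (0::real). 0 < r" by (simp add: eventually_at_right_less)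
      ultimately show "\<forall>\<^sub>F r in at_right 0. (- b0 / 2) / sqrt r \<le> - b r / sqrt r"
        by eventually_elim (intro divide_right_mono, auto)
    qed
    from filterlim_compose[OF gauss_tail_at_top this]
    have "(hit \<longlongrightarrow> 0) (at_right 0)" by (simp add: hit_def[abs_def])
    then show "((hit \<circ> real_of_ereal) \<longlongrightarrow> 0) (at_right (ereal 0))" by (simp add: ereal_tendsto_simps)
    have "isCont hit t" using DERIV_hit[OF t] by (rule DERIV_isCont)
    then have "(hit \<longlongrightarrow> hit t) (at_left t)" by (simp add: isCont_def filterlim_at_split)
    then show "((hit \<circ> real_of_ereal) \<longlongrightarrow> hit t) (at_left (ereal t))" by (simp add: ereal_tendsto_simps)
  qed
  then show ?thesis using t by (simp add: interval_lebesgue_integral_def)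
qed

end

text \<open>Banach's theorem is used in the complete space of bounded continuous functions on the
  line; clamping the argument to [0,T] embeds the continuous functions on [0,T] into it.\<close>

lemma clamp_bcontfun:
  fixes g :: "real \<Rightarrow> real"
  assumes "continuous_on {0..T} g" "0 < T"
  shows "(\<lambda>t. g (max 0 (min T t))) \<in> bcontfun"
proof -
  have "compact (g ` {0..T})" by (intro compact_continuous_image assms) simp
  then obtain B where B: "\<And>x. x \<in> {0..T} \<Longrightarrow> norm (g x) \<le> B"
    by (metis bounded_iff compact_imp_bounded image_eqI)
  show ?thesis
  proof (rule bcontfun_normI)
    show "continuous_on UNIV (\<lambda>t. g (max 0 (min T t)))"
      by (rule continuous_on_compose2[OF assms(1)]) (auto intro!: continuous_intros simp: assms less_imp_le)
    show "norm (g (max 0 (min T x))) \<le> B" for x using assms(2) by (intro B) auto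
  qed
qed

context smooth_boundary
begin

text \<open>The Volterra operator with kernel \<open>dkern_t\<close> after s = \<tau> - r and f(t) =
  e^(lt) h(t). In the variable r the singularity sits at r = 0 for every \<tau>, so one integrable
  majorant gives continuity in \<tau>, and e^(-lr) makes the norm small. Here \<tau> is a real time
  variable, not the passage time.\<close>

definition delay :: "real \<Rightarrow> (real \<Rightarrow> real) \<Rightarrow> real \<Rightarrow> real" where
  "delay l h \<tau> = (LBINT r. indicator {0<..} r * indicator {0<..} (\<tau> - r) * dkern_t \<tau> (\<tau> - r) * exp (- (l * r)) * h (\<tau> - r))"

lemma delay_integrand_bound:
  assumes C: "0 \<le> C" "\<And>s t. 0 \<le> s \<Longrightarrow> s < t \<Longrightarrow> t \<le> T \<Longrightarrow> \<bar>dkern_t t s\<bar> \<le> C * (t - s) powr (- \<theta>)"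
    and h: "\<And>x. \<bar>h x\<bar> \<le> B" and \<tau>: "\<tau> \<le> T"
  shows "\<bar>indicator {0<..} r * indicator {0<..} (\<tau> - r) * dkern_t \<tau> (\<tau> - r) * exp (- (l * r)) * h (\<tau> - r)\<bar>
    \<le> indicator {0<..} r * (r powr (- \<theta>) * exp (- (l * r))) * (C * B)"
proof (cases "0 < r \<and> r < \<tau>")
  case True
  have "\<bar>dkern_t \<tau> (\<tau> - r)\<bar> \<le> C * r powr (- \<theta>)" using C(2)[of "\<tau> - r" \<tau>] True \<tau> by simp
  then have "\<bar>dkern_t \<tau> (\<tau> - r)\<bar> * exp (- (l * r)) * \<bar>h (\<tau> - r)\<bar> \<le> C * r powr (- \<theta>) * exp (- (l * r)) * B"
    using h[of "\<tau> - r"] C(1) by (intro mult_mono) auto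
  then show ?thesis using True by (simp add: abs_mult mult_ac)
next
  case False
  have "0 \<le> B" using h[of 0] by linarith
  then show ?thesis using False C(1) by (auto simp: indicator_def)
qed

lemma integrable_delay_bound:
  assumes "0 < l"
  shows "integrable lborel (\<lambda>r. indicator {0<..} r * (r powr (- \<theta>) * exp (- (l * r))) * K)"
    and "(LBINT r. indicator {0<..} r * (r powr (- \<theta>) * exp (- (l * r))) * K) = Gamma (1 - \<theta>) / l powr (1 - \<theta>) * K"
proof -
  have a: "0 < 1 - \<theta>" using theta by simp
  have "integrable lborel (\<lambda>r. indicator {0<..} r * (r powr (- \<theta>) * exp (- (l * r))))"
    using integrable_power_measure_exp[OF a assms] by (subst (asm) integrable_power_measure_iff) (auto simp: set_integrable_def)
  then show "integrable lborel (\<lambda>r. indicator {0<..} r * (r powr (- \<theta>) * exp (- (l * r))) * K)" by simp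
  have "(LBINT r. indicator {0<..} r * (r powr (- \<theta>) * exp (- (l * r)))) = Gamma (1 - \<theta>) / l powr (1 - \<theta>)"
    using integral_power_measure_exp[OF a assms] by (subst (asm) integral_power_measure) (auto simp: set_lebesgue_integral_def)
  then show "(LBINT r. indicator {0<..} r * (r powr (- \<theta>) * exp (- (l * r))) * K) = Gamma (1 - \<theta>) / l powr (1 - \<theta>) * K"
    by (simp only: integral_mult_left_zero)
qed

lemma integrable_delay:
  assumes C: "0 \<le> C" "\<And>s t. 0 \<le> s \<Longrightarrow> s < t \<Longrightarrow> t \<le> T \<Longrightarrow> \<bar>dkern_t t s\<bar> \<le> C * (t - s) powr (- \<theta>)"
    and h: "\<And>x. \<bar>h x\<bar> \<le> B" "h \<in> borel_measurable borel" and \<tau>: "\<tau> \<le> T" and l: "0 < l"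
  shows "integrable lborel (\<lambda>r. indicator {0<..} r * indicator {0<..} (\<tau> - r) * dkern_t \<tau> (\<tau> - r) * exp (- (l * r)) * h (\<tau> - r))"
proof (rule Bochner_Integration.integrable_bound[OF integrable_delay_bound(1)[OF l, of "C * B"]])
  note [measurable] = h(2)
  show "(\<lambda>r. indicator {0<..} r * indicator {0<..} (\<tau> - r) * dkern_t \<tau> (\<tau> - r) * exp (- (l * r)) * h (\<tau> - r)) \<in> borel_measurable lborel"
    by measurable
  show "AE r in lborel. norm (indicator {0<..} r * indicator {0<..} (\<tau> - r) * dkern_t \<tau> (\<tau> - r) * exp (- (l * r)) * h (\<tau> - r))
    \<le> norm (indicator {0<..} r * (r powr (- \<theta>) * exp (- (l * r))) * (C * B))"
    using delay_integrand_bound[OF C h(1) \<tau>, of _ l] by (intro AE_I2) (simp only: real_norm_def, meson abs_ge_self order_trans)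
qed

lemma continuous_delay:
  assumes h: "\<And>x. \<bar>h x\<bar> \<le> B" "continuous_on UNIV h" and l: "0 < l" and T: "0 < T"
  shows "continuous_on {0..T} (delay l h)"
  unfolding continuous_on_eq_continuous_within
proof
  fix t0 assume t0: "t0 \<in> {0..T}"
  have hm[measurable]: "h \<in> borel_measurable borel" using h(2) by (rule borel_measurable_continuous_onI)
  obtain C where C: "0 \<le> C" "\<And>s t. 0 \<le> s \<Longrightarrow> s < t \<Longrightarrow> t \<le> T \<Longrightarrow> \<bar>dkern_t t s\<bar> \<le> C * (t - s) powr (- \<theta>)"
    using dkern_bounds[OF T] by metis
  show "continuous (at t0 within {0..T}) (delay l h)"
    unfolding delay_def
  proof (rule continuous_within_integral_dominated[OF _ t0 integrable_delay_bound(1)[OF l, of "C * B"]])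
    fix t assume t: "t \<in> {0..T}"
    show "AE r in lborel. \<bar>indicator {0<..} r * indicator {0<..} (t - r) * dkern_t t (t - r) * exp (- (l * r)) * h (t - r)\<bar>
       \<le> indicator {0<..} r * (r powr (- \<theta>) * exp (- (l * r))) * (C * B)"
      using delay_integrand_bound[where h=h and l=l, OF C h(1), of t] t by (intro AE_I2) auto
  next
    show "AE r in lborel. continuous (at t0 within {0..T}) (\<lambda>t. indicator {0<..} r * indicator {0<..} (t - r) * dkern_t t (t - r) * exp (- (l * r)) * h (t - r))"
      \<comment> \<open>As a function of t the integrand can jump where t crosses r, because of the
        indicator of r < t. At t0 this affects only r = t0.\<close>
      using AE_lborel_singleton[of t0]
    proof eventually_elim
      case (elim r)
      have "isCont (\<lambda>t. indicator {0<..} r * indicator {0<..} (t - r) * dkern_t t (t - r) * exp (- (l * r)) * h (t - r)) t0"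
      proof (cases "0 < r \<and> r < t0")
        case True
        have "isCont h (t0 - r)" using h(2) by (simp add: continuous_on_eq_continuous_at)
        then have ih: "isCont (\<lambda>t. h (t - r)) t0" by (intro isCont_o2[where f="\<lambda>t. t - r" and g=h] continuous_intros)
        have ib: "isCont (\<lambda>t. b (t - r)) t0" by (intro isCont_o2[where f="\<lambda>t. t - r" and g=b] continuous_intros isCont_b)
        have "isCont (\<lambda>t. dkern_t t (t - r) * exp (- (l * r)) * h (t - r)) t0"
          unfolding dkern_t_def bz_def using True ih ib
          by (intro continuous_intros isCont_db isCont_b) auto
        moreover have "\<forall>\<^sub>F t in nhds t0. indicator {0<..} r * indicator {0<..} (t - r) * dkern_t t (t - r) * exp (- (l * r)) * h (t - r) = dkern_t t (t - r) * exp (- (l * r)) * h (t - r)"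
          using True by (intro eventually_mono[OF eventually_nhds_in_open[of "{r<..}" t0]]) auto
        ultimately show ?thesis by (simp only: isCont_cong)
      next
        case False
        have "\<forall>\<^sub>F t in nhds t0. indicator {0<..} r * indicator {0<..} (t - r) * dkern_t t (t - r) * exp (- (l * r)) * h (t - r) = 0"
        proof (cases "0 < r")
          case True
          then show ?thesis using False elim by (intro eventually_mono[OF eventually_nhds_in_open[of "{..<r}" t0]]) auto
        qed (auto intro: always_eventually)
        then show ?thesis by (simp only: isCont_cong) simp
      qed
      then show ?case by (rule continuous_at_imp_continuous_at_within)
    qed
  qed measurable
qed

text \<open>The equation is the formal t-derivative of the one for p = -1, the diagonal value of the
  kernel contributing the term sqrt(pi/2) f. After the substitution f(t) = e^(lt) h(t), l is chosen
  so that the right side is a contraction in h with factor 1/2.\<close>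

theorem volterra_solution_exists:
  assumes T: "0 < T"
  obtains f where "continuous_on UNIV f"
    "\<And>t. 0 < t \<Longrightarrow> t \<le> T \<Longrightarrow> sqrt (pi / 2) * f t + (LBINT s:{0<..<t}. dkern_t t s * f s) = dhit t"
proof -
  let ?k = "sqrt (pi / 2)"
  have k: "0 < ?k" by simp
  obtain C where C: "0 \<le> C" "\<And>s t. 0 \<le> s \<Longrightarrow> s < t \<Longrightarrow> t \<le> T \<Longrightarrow> \<bar>dkern_t t s\<bar> \<le> C * (t - s) powr (- \<theta>)"
    using dkern_bounds[OF T] by metis
  obtain l where l: "0 < l" "C / ?k * (Gamma (1 - \<theta>) / l powr (1 - \<theta>)) \<le> 1 / 2"
    using small_weight_exists[OF theta(2), of "C / ?k"] C(1) k by (metis divide_nonneg_pos)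
  define \<Phi> where "\<Phi> = (\<lambda>h t. (exp (- (l * t)) * dhit t - delay l h t) / ?k)"
  define cl where "cl = (\<lambda>t. max 0 (min T t))"
  have cl: "cl t \<in> {0..T}" for t using T by (auto simp: cl_def)
  define F :: "(real \<Rightarrow>\<^sub>C real) \<Rightarrow> (real \<Rightarrow>\<^sub>C real)" where "F = (\<lambda>h. Bcontfun (\<lambda>t. \<Phi> (apply_bcontfun h) (cl t)))"
  have hb: "\<bar>apply_bcontfun h x\<bar> \<le> norm h" for h :: "real \<Rightarrow>\<^sub>C real" and x using norm_bounded[of h x] by simp
  have hm[measurable]: "apply_bcontfun h \<in> borel_measurable borel" for h :: "real \<Rightarrow>\<^sub>C real"
    by (rule borel_measurable_continuous_onI) simp
  have F: "apply_bcontfun (F h) t = \<Phi> (apply_bcontfun h) (cl t)" for h t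
  proof -
    have "continuous_on {0..T} (\<Phi> (apply_bcontfun h))"
      unfolding \<Phi>_def using k by (intro continuous_intros continuous_on_subset[OF continuous_dhit] continuous_delay[OF hb _ l(1) T]) auto
    then have "(\<lambda>t. \<Phi> (apply_bcontfun h) (cl t)) \<in> bcontfun" unfolding cl_def by (rule clamp_bcontfun[OF _ T])
    then show ?thesis unfolding F_def by (simp add: Bcontfun_inverse)
  qed
  have "\<exists>!h. F h = h"
  proof (rule banach_fix_type[of "1/2"])
    show "\<forall>h1 h2. dist (F h1) (F h2) \<le> 1 / 2 * dist h1 h2"
    proof (intro allI dist_bound)
      fix h1 h2 :: "real \<Rightarrow>\<^sub>C real" and t :: real
      let ?g = "\<lambda>h r. indicator {0<..} r * indicator {0<..} (cl t - r) * dkern_t (cl t) (cl t - r) * exp (- (l * r)) * h (cl t - r)"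
      have clT: "cl t \<le> T" using cl[of t] by simp
      define d where "d = (\<lambda>x. apply_bcontfun h2 x - apply_bcontfun h1 x)"
      have db: "\<bar>d x\<bar> \<le> dist h1 h2" for x
        using dist_bounded[of h1 x h2] by (simp add: d_def dist_real_def abs_minus_commute)
      have [measurable]: "d \<in> borel_measurable borel" unfolding d_def by measurable
      have i: "integrable lborel (?g (apply_bcontfun h))" for h :: "real \<Rightarrow>\<^sub>C real"
        by (rule integrable_delay[OF C hb hm clT l(1)])
      have "dist (apply_bcontfun (F h1) t) (apply_bcontfun (F h2) t) = \<bar>delay l (apply_bcontfun h2) (cl t) - delay l (apply_bcontfun h1) (cl t)\<bar> / ?k"
        using k unfolding F \<Phi>_def dist_real_def diff_divide_distrib[symmetric] abs_divide by simp
      also have "delay l (apply_bcontfun h2) (cl t) - delay l (apply_bcontfun h1) (cl t) = (LBINT r. ?g (apply_bcontfun h2) r - ?g (apply_bcontfun h1) r)"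
        unfolding delay_def by (rule Bochner_Integration.integral_diff[OF i i, symmetric])
      also have "\<dots> = (LBINT r. ?g d r)" by (simp add: d_def right_diff_distrib)
      also have "\<bar>\<dots>\<bar> / ?k \<le> (Gamma (1 - \<theta>) / l powr (1 - \<theta>) * (C * dist h1 h2)) / ?k"
      proof (rule divide_right_mono)
        have "norm (LBINT r. ?g d r) \<le> (LBINT r. indicator {0<..} r * (r powr (- \<theta>) * exp (- (l * r))) * (C * dist h1 h2))"
          by (rule norm_integral_le_AE[OF integrable_delay[where h=d, OF C db _ clT l(1)] integrable_delay_bound(1)[OF l(1)]])
             (measurable, intro AE_I2, unfold real_norm_def, rule delay_integrand_bound[where h=d, OF C db clT])
        then show "\<bar>LBINT r. ?g d r\<bar> \<le> Gamma (1 - \<theta>) / l powr (1 - \<theta>) * (C * dist h1 h2)"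
          unfolding integrable_delay_bound(2)[OF l(1)] by simp
      qed (use k in simp)
      also have "\<dots> = (C / ?k * (Gamma (1 - \<theta>) / l powr (1 - \<theta>))) * dist h1 h2" by (simp add: mult_ac)
      also have "\<dots> \<le> 1 / 2 * dist h1 h2" by (intro mult_right_mono l(2)) simp
      finally show "dist (apply_bcontfun (F h1) t) (apply_bcontfun (F h2) t) \<le> 1 / 2 * dist h1 h2" .
    qed
  qed auto
  then obtain h where h: "F h = h" by blast
  define f where "f = (\<lambda>t. exp (l * t) * apply_bcontfun h t)"
  show ?thesis
  proof (rule that[of f])
    show "continuous_on UNIV f" unfolding f_def by (intro continuous_intros) auto
    fix t assume t: "0 < t" "t \<le> T"
    have clt: "cl t = t" using t by (simp add: cl_def)
    have "?k * apply_bcontfun h t = exp (- (l * t)) * dhit t - delay l (apply_bcontfun h) t"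
      using F[of h t] k unfolding h clt \<Phi>_def by (simp add: field_simps)
    then have "exp (l * t) * (?k * apply_bcontfun h t) = exp (l * t) * exp (- (l * t)) * dhit t - exp (l * t) * delay l (apply_bcontfun h) t"
      by (simp add: right_diff_distrib)
    moreover have "exp (l * t) * exp (- (l * t)) = (1::real)" by (simp add: exp_minus)
    moreover have "exp (l * t) * delay l (apply_bcontfun h) t = (LBINT s:{0<..<t}. dkern_t t s * f s)"
    proof -
      have "exp (l * t) * delay l (apply_bcontfun h) t = (LBINT r:{0<..<t}. dkern_t t (t - r) * f (t - r))"
        unfolding delay_def set_lebesgue_integral_def integral_mult_right_zero[symmetric]
      proof (rule Bochner_Integration.integral_cong[OF refl])
        fix r
        have "exp (l * t) * exp (- (l * r)) = exp (l * (t - r))" by (simp add: exp_add[symmetric] algebra_simps)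
        then show "exp (l * t) * (indicator {0<..} r * indicator {0<..} (t - r) * dkern_t t (t - r) * exp (- (l * r)) * apply_bcontfun h (t - r))
          = indicator {0<..<t} r *\<^sub>R (dkern_t t (t - r) * f (t - r))"
          by (auto simp: indicator_def f_def)
      qed
      also have "\<dots> = (LBINT s:{0<..<t}. dkern_t t s * f s)"
        by (rule set_integral_reflect(2)[of t "\<lambda>s. dkern_t t s * f s"])
      finally show ?thesis .
    qed
    ultimately show "?k * f t + (LBINT s:{0<..<t}. dkern_t t s * f s) = dhit t"
      by (simp add: f_def mult_ac)
  qed
qed

end

lemma integral_zero_imp_zero:
  fixes D :: "real \<Rightarrow> real"
  assumes c: "continuous_on UNIV D" and 0: "\<And>t. 0 < t \<Longrightarrow> t \<le> T \<Longrightarrow> (LBINT s:{0<..<t}. D s) = 0"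
    and T: "0 < T" and t: "0 \<le> t" "t \<le> T"
  shows "D t = 0"
proof -
  have ct: "continuous_on {0..T} D" by (rule continuous_on_subset[OF c]) simp
  have "integral {0..y} D = 0" if y: "y \<in> {0..T}" for y
  proof (cases "y = 0")
    case False
    have "integral {0..y} D = integral {0<..<y} D"
      by (rule integral_spike_set; rule negligible_subset[of "{0, y}"]; auto)
    also have "\<dots> = (LBINT s:{0<..<y}. D s)"
      by (rule set_borel_integral_eq_integral(2)[symmetric]) (rule set_integrable_continuous_Ioo, rule continuous_on_subset[OF c], simp)
    finally show ?thesis using 0[of y] y False by simp
  qed simp
  then have "((\<lambda>y. integral {0..y} D) has_vector_derivative 0) (at t within {0..T})"
    by - (rule has_vector_derivative_transform[where f="\<lambda>_. 0"], use t in simp_all)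
  moreover have "((\<lambda>y. integral {0..y} D) has_vector_derivative D t) (at t within {0..T})"
    by (rule integral_has_vector_derivative[OF ct]) (use t in auto)
  moreover have "at t within {0..T} \<noteq> bot" using t T by (simp add: trivial_limit_within islimpt_Icc)
  ultimately show ?thesis using vector_derivative_unique_within by blast
qed

context smooth_boundary
begin

text \<open>Instead of differentiating the kernel equation, its derivative is integrated over (0,t).
  After exchanging integrals the inner integral of \<open>dkern_t\<close> is the kernel minus its
  diagonal value, and the latter cancels against the term sqrt(pi/2) f.\<close>

lemma volterra_integrated:
  assumes f: "continuous_on UNIV f"
    and eq: "\<And>t. 0 < t \<Longrightarrow> t \<le> T \<Longrightarrow> sqrt (pi / 2) * f t + (LBINT s:{0<..<t}. dkern_t t s * f s) = dhit t"
    and t: "0 < t" "t \<le> T"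
  shows "(LBINT s:{0<..<t}. kern t s * f s) = hit t"
proof -
  have fm[measurable]: "f \<in> borel_measurable borel" using f by (rule borel_measurable_continuous_onI)
  let ?k = "sqrt (pi / 2)"
  obtain C where C: "0 \<le> C" "\<And>s r. 0 \<le> s \<Longrightarrow> s < r \<Longrightarrow> r \<le> t \<Longrightarrow> \<bar>dkern_t r s\<bar> \<le> C * (r - s) powr (- \<theta>)"
    using dkern_bounds[OF t(1)] by metis
  have fI: "set_integrable lborel {0<..<t} f" by (rule set_integrable_continuous_Ioo) (rule continuous_on_subset[OF f], simp)
  define J where "J = (LBINT u:{0<..<t}. u powr (- \<theta>))"
  let ?g = "\<lambda>s r. (indicator {0<..} s * indicator {0<..} (r - s) * indicator {..<t} r) * (dkern_t r s * f s) :: real"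
  have inner: "(LBINT r. ?g s r) = indicator {0<..<t} s * (f s * (LBINT r:{s<..<t}. dkern_t r s))"
    and innerI: "integrable lborel (?g s)"
    and innerB: "(LBINT r. norm (?g s r)) \<le> indicator {0<..<t} s * \<bar>f s\<bar> * (C * J)" for s
  proof -
    have "integrable lborel (?g s) \<and> (LBINT r. ?g s r) = indicator {0<..<t} s * (f s * (LBINT r:{s<..<t}. dkern_t r s))
      \<and> (LBINT r. norm (?g s r)) \<le> indicator {0<..<t} s * \<bar>f s\<bar> * (C * J)"
    proof (cases "0 < s \<and> s < t")
      case True
      have g: "?g s = (\<lambda>r. f s * (indicator {s<..<t} r *\<^sub>R dkern_t r s))" using True by (auto simp: indicator_def fun_eq_iff)
      have I: "set_integrable lborel {s<..<t} (\<lambda>r. dkern_t r s)" using True by (intro set_integrable_dkern_t) auto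
      have Ip: "set_integrable lborel {s<..<t} (\<lambda>r. C * (r - s) powr (- \<theta>))" by (intro set_integrable_mult_right set_integrable_powr_shift)
      have "(LBINT r:{s<..<t}. \<bar>dkern_t r s\<bar>) \<le> (LBINT r:{s<..<t}. C * (r - s) powr (- \<theta>))"
        by (rule set_integral_mono[OF set_integrable_abs[OF I] Ip]) (use C True in auto)
      also have "\<dots> = C * (LBINT r:{s<..<t}. (r - s) powr (- \<theta>))" by simp
      also have "(LBINT r:{s<..<t}. (r - s) powr (- \<theta>)) = (LBINT u. indicator {0<..<t - s} u * u powr (- \<theta>))"
        unfolding set_lebesgue_integral_def
        by (subst lborel_integral_real_affine[where c=1 and t=s]) (auto simp: indicator_def intro!: Bochner_Integration.integral_cong)
      also have "\<dots> \<le> J" unfolding J_def set_lebesgue_integral_def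
        using set_integrable_powr[OF theta(2), of t] set_integrable_powr[OF theta(2), of "t - s"] True
        by (intro integral_mono) (auto simp: set_integrable_def indicator_def)
      finally have "(LBINT r:{s<..<t}. \<bar>dkern_t r s\<bar>) \<le> C * J" using C(1) by (simp add: mult_left_mono)
      moreover have "(LBINT r. norm (?g s r)) = \<bar>f s\<bar> * (LBINT r:{s<..<t}. \<bar>dkern_t r s\<bar>)"
      proof -
        have "norm (?g s r) = \<bar>f s\<bar> * (indicator {s<..<t} r *\<^sub>R \<bar>dkern_t r s\<bar>)" for r
          using True by (auto simp: indicator_def abs_mult)
        then show ?thesis by (simp only: set_lebesgue_integral_def integral_mult_right_zero)
      qed
      ultimately have "(LBINT r. norm (?g s r)) \<le> \<bar>f s\<bar> * (C * J)" by (simp add: mult_left_mono)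
      then show ?thesis using I True unfolding g by (simp add: set_lebesgue_integral_def set_integrable_def)
    next
      case False
      then have "?g s = (\<lambda>r. 0)" by (auto simp: indicator_def fun_eq_iff)
      then show ?thesis using False by (auto simp: indicator_def)
    qed
    then show "(LBINT r. ?g s r) = indicator {0<..<t} s * (f s * (LBINT r:{s<..<t}. dkern_t r s))"
      "integrable lborel (?g s)" "(LBINT r. norm (?g s r)) \<le> indicator {0<..<t} s * \<bar>f s\<bar> * (C * J)" by blast+
  qed
  have gi: "integrable (lborel \<Otimes>\<^sub>M lborel) (\<lambda>(s, r). ?g s r)"
  proof (rule lborel_pair.Fubini_integrable)
    show "(\<lambda>(s, r). ?g s r) \<in> borel_measurable (lborel \<Otimes>\<^sub>M lborel)" by measurable
    show "AE s in lborel. integrable lborel (\<lambda>r. case (s, r) of (s, r) \<Rightarrow> ?g s r)" using innerI by simp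
    show "integrable lborel (\<lambda>s. LBINT r. norm (case (s, r) of (s, r) \<Rightarrow> ?g s r))"
    proof (rule Bochner_Integration.integrable_bound)
      show "integrable lborel (\<lambda>s. indicator {0<..<t} s * \<bar>f s\<bar> * (C * J))"
        using set_integrable_abs[OF fI] by (simp add: set_integrable_def)
      show "(\<lambda>s. LBINT r. norm (case (s, r) of (s, r) \<Rightarrow> ?g s r)) \<in> borel_measurable lborel" by measurable
      show "AE s in lborel. norm (LBINT r. norm (case (s, r) of (s, r) \<Rightarrow> ?g s r)) \<le> norm (indicator {0<..<t} s * \<bar>f s\<bar> * (C * J))"
      proof (rule AE_I2)
        fix s
        have "0 \<le> (LBINT r. norm (?g s r))" by (rule Bochner_Integration.integral_nonneg) simp
        with innerB[of s] show "norm (LBINT r. norm (case (s, r) of (s, r) \<Rightarrow> ?g s r)) \<le> norm (indicator {0<..<t} s * \<bar>f s\<bar> * (C * J))"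
          by (simp only: prod.case real_norm_def abs_of_nonneg)
      qed
    qed
  qed
  have outer: "(LBINT s. ?g s r) = indicator {0<..<t} r * (LBINT s:{0<..<r}. dkern_t r s * f s)" for r
  proof -
    have "(LBINT s. ?g s r) = (LBINT s. indicator {..<t} r * (indicator {0<..<r} s *\<^sub>R (dkern_t r s * f s)))"
      by (rule Bochner_Integration.integral_cong) (auto simp: indicator_def)
    also have "\<dots> = indicator {..<t} r * (LBINT s:{0<..<r}. dkern_t r s * f s)" by (simp add: set_lebesgue_integral_def)
    also have "\<dots> = indicator {0<..<t} r * (LBINT s:{0<..<r}. dkern_t r s * f s)"
    proof (cases "0 < r")
      case False
      then have "{0<..<r} = {}" by auto
      then have "(LBINT s:{0<..<r}. dkern_t r s * f s) = 0" by (simp add: set_lebesgue_integral_def)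
      then show ?thesis by (simp only: mult_zero_right)
    qed (auto simp: indicator_def)
    finally show ?thesis .
  qed
  have dI: "set_integrable lborel {0<..<t} dhit"
    by (rule set_integrable_continuous_Ioo) (rule continuous_on_subset[OF continuous_dhit], simp)
  have kf: "set_integrable lborel {0<..<t} (\<lambda>s. ?k * f s)" using fI by (rule set_integrable_mult_right)
  have "(LBINT s. LBINT r. ?g s r) = (LBINT r. LBINT s. ?g s r)"
    using lborel_pair.Fubini_integral[OF gi] by simp
  also have "\<dots> = (LBINT r:{0<..<t}. dhit r - ?k * f r)"
    unfolding outer set_lebesgue_integral_def[of _ "{0<..<t}"]
    using eq t by (intro Bochner_Integration.integral_cong) (auto simp: indicator_def algebra_simps)
  also have "\<dots> = hit t - (LBINT s:{0<..<t}. ?k * f s)"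
    using set_integral_diff(2)[OF dI kf] hit_eq_integral[OF t(1)] by simp
  finally have 1: "(LBINT s. LBINT r. ?g s r) = hit t - (LBINT s:{0<..<t}. ?k * f s)" .
  have gI: "set_integrable lborel {0<..<t} (\<lambda>s. f s * (LBINT r:{s<..<t}. dkern_t r s))"
    using lborel_pair.integrable_fst'[OF gi] by (simp add: inner set_integrable_def)
  have "(LBINT s:{0<..<t}. kern t s * f s) = (LBINT s:{0<..<t}. ?k * f s + f s * (LBINT r:{s<..<t}. dkern_t r s))"
  proof (rule set_lebesgue_integral_cong)
    show "\<forall>s. s \<in> {0<..<t} \<longrightarrow> kern t s * f s = ?k * f s + f s * (LBINT r:{s<..<t}. dkern_t r s)"
      using kern_eq_integral_t[of _ t] by (auto simp: algebra_simps)
  qed simp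
  also have "\<dots> = (LBINT s:{0<..<t}. ?k * f s) + (LBINT s:{0<..<t}. f s * (LBINT r:{s<..<t}. dkern_t r s))"
    by (rule set_integral_add(2)[OF kf gI])
  also have "(LBINT s:{0<..<t}. f s * (LBINT r:{s<..<t}. dkern_t r s)) = (LBINT s. LBINT r. ?g s r)"
    unfolding inner by (simp add: set_lebesgue_integral_def)
  finally show ?thesis unfolding 1 by simp
qed

lemma exp_bz_bound:
  assumes T: "0 < T"
  obtains K where "0 \<le> K" "\<And>s t. 0 \<le> s \<Longrightarrow> s < t \<Longrightarrow> t \<le> T \<Longrightarrow> exp (- (b s - b t) / sqrt (t - s)) \<le> K"
proof -
  obtain C where C: "0 \<le> C" "\<And>s t. 0 \<le> s \<Longrightarrow> s < t \<Longrightarrow> t \<le> T \<Longrightarrow> \<bar>bz t s\<bar> \<le> C * (t - s) powr (1 / 2 - \<epsilon>)"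
    using dkern_bounds[OF T] by metis
  show ?thesis
  proof (rule that[of "exp (C * T powr (1 / 2 - \<epsilon>))"])
    fix s t :: real assume st: "0 \<le> s" "s < t" "t \<le> T"
    have "- (b s - b t) / sqrt (t - s) \<le> \<bar>bz t s\<bar>"
    proof -
      have "- (b s - b t) / sqrt (t - s) = - bz t s" by (simp only: bz_def minus_divide_left)
      then show ?thesis by simp
    qed
    also have "\<dots> \<le> C * (t - s) powr (1 / 2 - \<epsilon>)" by (rule C(2)[OF st])
    also have "\<dots> \<le> C * T powr (1 / 2 - \<epsilon>)" using st C(1) eps by (intro mult_left_mono powr_mono2) auto
    finally show "exp (- (b s - b t) / sqrt (t - s)) \<le> exp (C * T powr (1 / 2 - \<epsilon>))" by simp
  qed simp
qed

lemma passage_kernel_kern: "s < t \<Longrightarrow> passage_kernel (- 1) (b s - b t) (t - s) = kern t s"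
  using passage_kernel_minus_1[of "t - s" "b s - b t"] by (simp add: kern_def bz_def)

lemma stieltjes_density:
  assumes D: "continuous_on UNIV D" and t: "0 < t"
  shows "(LBINT s:{0<..<t}. kern t s * D s) = sqrt (pi / 2) * (LBINT s:{0<..<t}. D s)
    - (LBINT r:{0<..<t}. dkern_s t r * (LBINT s:{0<..<r}. D s))"
    and "set_integrable lborel {0<..<t} (\<lambda>r. dkern_s t r * (LBINT s:{0<..<r}. D s))"
proof -
  let ?q = "\<lambda>s. indicator {0<..<t} s * D s"
  have q: "integrable lborel ?q"
    using set_integrable_continuous_Ioo[OF continuous_on_subset[OF D subset_UNIV], of t] by (simp add: set_integrable_def)
  have in1: "(LBINT s. ?q s * indicator {..<r} s) = (LBINT s:{0<..<r}. D s)" if "r \<in> {0<..<t}" for r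
    unfolding set_lebesgue_integral_def using that by (intro Bochner_Integration.integral_cong) (auto simp: indicator_def)
  note S = kern_stieltjes[where \<sigma>="\<lambda>s. s" and q="?q", OF sigma_finite_lborel t _ q]
  have "(LBINT s:{0<..<t}. kern t s * D s) = (LBINT s. ?q s * kern t s)"
    unfolding set_lebesgue_integral_def by (simp add: mult_ac)
  also have "\<dots> = sqrt (pi / 2) * (LBINT s. ?q s) - (LBINT r:{0<..<t}. dkern_s t r * (LBINT s. ?q s * indicator {..<r} s))"
    by (rule S(1)) (auto simp: indicator_def split: if_splits)
  also have "(LBINT r:{0<..<t}. dkern_s t r * (LBINT s. ?q s * indicator {..<r} s)) = (LBINT r:{0<..<t}. dkern_s t r * (LBINT s:{0<..<r}. D s))"
    by (rule set_lebesgue_integral_cong) (auto simp only: in1 sets_lborel borel_open open_greaterThanLessThan)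
  finally show "(LBINT s:{0<..<t}. kern t s * D s) = sqrt (pi / 2) * (LBINT s:{0<..<t}. D s)
    - (LBINT r:{0<..<t}. dkern_s t r * (LBINT s:{0<..<r}. D s))"
    by (simp add: set_lebesgue_integral_def)
  have "set_integrable lborel {0<..<t} (\<lambda>r. dkern_s t r * (LBINT s. ?q s * indicator {..<r} s))"
    by (rule S(2)) (auto simp: indicator_def split: if_splits)
  then show "set_integrable lborel {0<..<t} (\<lambda>r. dkern_s t r * (LBINT s:{0<..<r}. D s))"
    by (rule set_integrable_cong[THEN iffD1, OF refl refl, rotated]) (simp only: in1)
qed

lemma density_primitive:
  fixes D :: "real \<Rightarrow> real"
  assumes D: "continuous_on UNIV D"
  shows "(\<lambda>r. LBINT s:{0<..<r}. D s) \<in> borel_measurable borel"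
    and "\<And>t. t \<le> T \<Longrightarrow> \<bar>LBINT s:{0<..<t}. D s\<bar> \<le> (LBINT s:{0<..<T}. \<bar>D s\<bar>)"
proof -
  have [measurable]: "D \<in> borel_measurable borel" using D by (rule borel_measurable_continuous_onI)
  have eq: "(\<lambda>r. LBINT s:{0<..<r}. D s) = (\<lambda>r. LBINT s. indicator {0<..} s * indicator {0<..} (r - s) * D s)"
    unfolding set_lebesgue_integral_def by (intro ext Bochner_Integration.integral_cong) (auto simp: indicator_def)
  show "(\<lambda>r. LBINT s:{0<..<r}. D s) \<in> borel_measurable borel" unfolding eq by measurable
  fix t assume t: "t \<le> T"
  have i: "set_integrable lborel {0<..<t} D" for t by (rule set_integrable_continuous_Ioo) (rule continuous_on_subset[OF D], simp)
  have "\<bar>LBINT s:{0<..<t}. D s\<bar> \<le> (LBINT s:{0<..<t}. \<bar>D s\<bar>)" using set_integral_norm_bound[OF i[of t]] by simp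
  also have "\<dots> \<le> (LBINT s:{0<..<T}. \<bar>D s\<bar>)"
    using set_integrable_abs[OF i[of t]] set_integrable_abs[OF i[of T]] t
    unfolding set_lebesgue_integral_def set_integrable_def by (intro integral_mono) (auto simp: indicator_def)
  finally show "\<bar>LBINT s:{0<..<t}. D s\<bar> \<le> (LBINT s:{0<..<T}. \<bar>D s\<bar>)" .
qed

text \<open>With right side zero, the primitive of D satisfies the homogeneous second-kind equation
  and vanishes; so does its derivative D.\<close>

lemma kern_density_unique:
  assumes D: "continuous_on UNIV D" and T: "0 < T"
    and 0: "\<And>t. 0 < t \<Longrightarrow> t \<le> T \<Longrightarrow> (LBINT s:{0<..<t}. kern t s * D s) = 0"
    and t: "0 \<le> t" "t \<le> T"
  shows "D t = 0"
proof (rule integral_zero_imp_zero[OF D _ T t])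
  fix t assume "0 < t" "t \<le> T"
  then show "(LBINT s:{0<..<t}. D s) = 0"
    by (rule volterra_unique[where G="\<lambda>r. LBINT s:{0<..<r}. D s", OF density_primitive(1)[OF D] density_primitive(2)[OF D], rotated 2])
       (use stieltjes_density(1)[OF D] 0 in auto)
qed

end

section \<open>The density of the first passage time\<close>

locale brownian_boundary = smooth_boundary +
  fixes M :: "'a measure" and W :: "real \<Rightarrow> 'a \<Rightarrow> real"
  assumes bm: "standard_brownian_motion M W"
begin

sublocale prob_space M using bm by (simp add: standard_brownian_motion_def)

lemma b_0: "b 0 < 0" using b_nonpos[of 0] b0 by simp

lemma passage_measurable [measurable]: "first_passage_time W b \<in> borel_measurable M"
  by (rule first_passage_measurable'[OF bm continuous_b b_0 zero_less_one])

definition cdf :: "real \<Rightarrow> real" where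
  "cdf t = measure M {\<omega> \<in> space M. first_passage_time W b \<omega> < ereal t}"

abbreviation (input) "before t \<omega> \<equiv> (if first_passage_time W b \<omega> < ereal t then 1 else 0 :: real)"
text \<open>\<open>real_of_ereal\<close> sends \<infinity> to 0; the factor \<open>before t\<close>,
  or a restriction to finite passage times, removes these paths where \<open>time\<close> is
  used.\<close>

abbreviation (input) "time \<omega> \<equiv> real_of_ereal (first_passage_time W b \<omega>)"

lemma before_time: "before t \<omega> \<noteq> 0 \<Longrightarrow> 0 \<le> time \<omega> \<and> time \<omega> < t"
  using first_passage_nonneg[of W b \<omega>] by (cases "first_passage_time W b \<omega>") (auto split: if_splits)

lemma integral_before: "(\<integral>\<omega>. before t \<omega> \<partial>M) = cdf t"
proof -
  have "(\<integral>\<omega>. before t \<omega> \<partial>M) = (\<integral>\<omega>. indicator {\<omega> \<in> space M. first_passage_time W b \<omega> < ereal t} \<omega> \<partial>M)"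
    by (rule Bochner_Integration.integral_cong) (auto simp: indicator_def)
  then show ?thesis by (simp add: cdf_def)
qed

lemma law_kern:
  assumes t: "0 < t"
  shows "(\<integral>\<omega>. before t \<omega> * kern t (time \<omega>) \<partial>M) = hit t"
proof -
  obtain K where K: "0 \<le> K" "\<And>s t'. 0 \<le> s \<Longrightarrow> s < t' \<Longrightarrow> t' \<le> t \<Longrightarrow> exp (- (b s - b t') / sqrt (t' - s)) \<le> K"
    using exp_bz_bound[OF t] by blast
  have int: "integrable M (\<lambda>\<omega>. before t \<omega> * ((t - time \<omega>) powr (- (- 1 + 1) / 2) * exp (- (b (time \<omega>) - b t) / sqrt (t - time \<omega>))))"
  proof (rule integrable_const_bound[where B=K])
    show "AE \<omega> in M. norm (before t \<omega> * ((t - time \<omega>) powr (- (- 1 + 1) / 2) * exp (- (b (time \<omega>) - b t) / sqrt (t - time \<omega>)))) \<le> K"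
    proof (rule AE_I2)
      fix \<omega>
      show "norm (before t \<omega> * ((t - time \<omega>) powr (- (- 1 + 1) / 2) * exp (- (b (time \<omega>) - b t) / sqrt (t - time \<omega>)))) \<le> K"
      proof (cases "before t \<omega> = 0")
        case False
        then show ?thesis using before_time[OF False] K(2)[of "time \<omega>" t] by (simp split: if_splits)
      qed (use K(1) in auto)
    qed
  qed measurable
  have "hit t = passage_kernel (- 1) (- b t) t" using passage_kernel_minus_1[OF t] by (simp add: hit_def)
  also have "\<dots> = (\<integral>\<omega>. before t \<omega> * passage_kernel (- 1) (b (time \<omega>) - b t) (t - time \<omega>) \<partial>M)"
    by (rule first_passage_kernel(1)[OF bm continuous_b b_0 t _ int]) simp
  also have "\<dots> = (\<integral>\<omega>. before t \<omega> * kern t (time \<omega>) \<partial>M)"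
  proof (rule Bochner_Integration.integral_cong[OF refl])
    fix \<omega> show "before t \<omega> * passage_kernel (- 1) (b (time \<omega>) - b t) (t - time \<omega>) = before t \<omega> * kern t (time \<omega>)"
      using before_time[of \<omega> t] passage_kernel_kern[of "time \<omega>" t] by auto
  qed
  finally show ?thesis by simp
qed

lemma cdf_volterra:
  assumes t: "0 < t"
  shows "hit t = sqrt (pi / 2) * cdf t - (LBINT r:{0<..<t}. dkern_s t r * cdf r)"
    and "set_integrable lborel {0<..<t} (\<lambda>r. dkern_s t r * cdf r)"
proof -
  have q: "integrable M (before t)" by (rule integrable_const_bound[where B=1]) auto
  have in1: "(\<integral>\<omega>. before t \<omega> * indicator {..<r} (time \<omega>) \<partial>M) = cdf r" if "r \<in> {0<..<t}" for r
  proof -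
    have "(\<integral>\<omega>. before t \<omega> * indicator {..<r} (time \<omega>) \<partial>M) = (\<integral>\<omega>. before r \<omega> \<partial>M)"
    proof (rule Bochner_Integration.integral_cong[OF refl])
      fix \<omega> show "before t \<omega> * indicator {..<r} (time \<omega>) = before r \<omega>"
        using that first_passage_nonneg[of W b \<omega>] by (cases "first_passage_time W b \<omega>") (auto simp: indicator_def)
    qed
    then show ?thesis by (simp add: integral_before)
  qed
  note S = kern_stieltjes[where N=M and \<sigma>=time and q="before t", OF sigma_finite_measure_axioms t _ q before_time]
  have "hit t = sqrt (pi / 2) * (\<integral>\<omega>. before t \<omega> \<partial>M) - (LBINT r:{0<..<t}. dkern_s t r * (\<integral>\<omega>. before t \<omega> * indicator {..<r} (time \<omega>) \<partial>M))"
    unfolding law_kern[OF t, symmetric] by (rule S(1)) measurable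
  also have "(LBINT r:{0<..<t}. dkern_s t r * (\<integral>\<omega>. before t \<omega> * indicator {..<r} (time \<omega>) \<partial>M)) = (LBINT r:{0<..<t}. dkern_s t r * cdf r)"
    by (rule set_lebesgue_integral_cong) (auto simp only: in1 sets_lborel borel_open open_greaterThanLessThan)
  finally show "hit t = sqrt (pi / 2) * cdf t - (LBINT r:{0<..<t}. dkern_s t r * cdf r)" unfolding integral_before .
  have "set_integrable lborel {0<..<t} (\<lambda>r. dkern_s t r * (\<integral>\<omega>. before t \<omega> * indicator {..<r} (time \<omega>) \<partial>M))"
    by (rule S(2)) measurable
  then show "set_integrable lborel {0<..<t} (\<lambda>r. dkern_s t r * cdf r)"
    by (rule set_integrable_cong[THEN iffD1, OF refl refl, rotated]) (simp only: in1)
qed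

lemma cdf_mono: "s \<le> t \<Longrightarrow> cdf s \<le> cdf t"
  unfolding cdf_def by (rule finite_measure_mono) (auto elim: less_le_trans)

lemma cdf_measurable [measurable]: "cdf \<in> borel_measurable borel"
  by (rule borel_measurable_mono) (auto simp: mono_def cdf_mono)

lemma cdf_bounds: "0 \<le> cdf t" "cdf t \<le> 1" by (auto simp: cdf_def)

text \<open>The distribution function and the primitive of the Volterra solution satisfy the same
  inhomogeneous equation in terms of \<open>dkern_s\<close>; their difference is bounded and
  measurable, so uniqueness identifies them on (0,T].\<close>

lemma local_density_exists:
  assumes T: "0 < T"
  obtains f where "continuous_on UNIV f" "\<And>t. 0 < t \<Longrightarrow> t \<le> T \<Longrightarrow> cdf t = (LBINT s:{0<..<t}. f s)"
proof -
  obtain f where f: "continuous_on UNIV f"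
    "\<And>t. 0 < t \<Longrightarrow> t \<le> T \<Longrightarrow> sqrt (pi / 2) * f t + (LBINT s:{0<..<t}. dkern_t t s * f s) = dhit t"
    using volterra_solution_exists[OF T] by blast
  note [measurable] = density_primitive(1)[OF f(1)]
  define G where "G = (\<lambda>t. cdf t - (LBINT s:{0<..<t}. f s))"
  have "G t = 0" if "0 < t" "t \<le> T" for t
  proof (rule volterra_unique[OF _ _ _ that])
    show "G \<in> borel_measurable borel" unfolding G_def by measurable
    fix t assume t: "0 < t" "t \<le> T"
    show "\<bar>G t\<bar> \<le> 1 + (LBINT s:{0<..<T}. \<bar>f s\<bar>)"
      using density_primitive(2)[OF f(1) t(2)] cdf_bounds[of t] unfolding G_def by linarith
    have "hit t = sqrt (pi / 2) * (LBINT s:{0<..<t}. f s) - (LBINT r:{0<..<t}. dkern_s t r * (LBINT s:{0<..<r}. f s))"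
      using volterra_integrated[OF f t] stieltjes_density(1)[OF f(1) t(1)] by simp
    with cdf_volterra(1)[OF t(1)]
    have "sqrt (pi / 2) * G t = (LBINT r:{0<..<t}. dkern_s t r * cdf r) - (LBINT r:{0<..<t}. dkern_s t r * (LBINT s:{0<..<r}. f s))"
      unfolding G_def right_diff_distrib by linarith
    also have "\<dots> = (LBINT r:{0<..<t}. dkern_s t r * cdf r - dkern_s t r * (LBINT s:{0<..<r}. f s))"
      by (rule set_integral_diff(2)[OF cdf_volterra(2)[OF t(1)] stieltjes_density(2)[OF f(1) t(1)], symmetric])
    finally show "sqrt (pi / 2) * G t = (LBINT r:{0<..<t}. dkern_s t r * G r)" unfolding G_def right_diff_distrib .
  qed
  then show ?thesis using that[OF f(1)] by (simp add: G_def)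
qed

text \<open>Local solutions agree on common intervals because they are continuous with equal
  primitives, so they glue together. Nonnegativity comes from the monotonicity of the distribution
  function.\<close>

lemma density_exists:
  obtains f where "continuous_on UNIV f" "\<And>t. 0 \<le> f t" "\<And>t. 0 < t \<Longrightarrow> cdf t = (LBINT s:{0<..<t}. f s)"
proof -
  have "\<exists>f. continuous_on UNIV f \<and> (\<forall>t. 0 < t \<and> t \<le> real (Suc n) \<longrightarrow> cdf t = (LBINT s:{0<..<t}. f s))" for n
    using local_density_exists[of "real (Suc n)"] by (metis of_nat_0_less_iff zero_less_Suc)
  then obtain F where F: "\<And>n::nat. continuous_on UNIV (F n)" "\<And>n t. 0 < t \<Longrightarrow> t \<le> real (Suc n) \<Longrightarrow> cdf t = (LBINT s:{0<..<t}. F n s)"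
    by metis
  have Fi: "set_integrable lborel {0<..<t} (F n)" for n t
    by (rule set_integrable_continuous_Ioo) (rule continuous_on_subset[OF F(1)], simp)
  have agree: "F m t = F n t" if mn: "m \<le> n" and t: "0 \<le> t" "t \<le> real (Suc m)" for m n t
  proof -
    have "F m t - F n t = 0"
    proof (rule integral_zero_imp_zero[OF _ _ _ t])
      show "continuous_on UNIV (\<lambda>t. F m t - F n t)" by (intro continuous_intros F)
      show "(LBINT s:{0<..<u}. F m s - F n s) = 0" if "0 < u" "u \<le> real (Suc m)" for u
      proof -
        have "u \<le> real (Suc n)" using that(2) mn by simp
        from F(2)[OF that] F(2)[OF that(1) this] set_integral_diff(2)[OF Fi Fi, of u m n]
        show ?thesis by linarith
      qed
    qed simp
    then show ?thesis by simp
  qed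
  \<comment> \<open>The index floor(t) works because F n is valid up to n + 1. Negative times
    receive the value at 0, which keeps f continuous and nonnegative on the whole line.\<close>
  define f where "f = (\<lambda>t. F (nat \<lfloor>max 0 t\<rfloor>) (max 0 t))"
  have fF: "f t = F n (max 0 t)" if "t \<le> real (Suc n)" for n t
  proof -
    define m where "m = nat \<lfloor>max 0 t\<rfloor>"
    have 0: "0 \<le> max 0 t" by simp
    have 1: "max 0 t \<le> real (Suc m)" unfolding m_def by linarith
    have 2: "max 0 t \<le> real (Suc n)" using that by simp
    show ?thesis
    proof (cases "m \<le> n")
      case True
      show ?thesis unfolding f_def m_def[symmetric] by (rule agree[OF True 0 1])
    next
      case False
      then have "n \<le> m" by simp
      show ?thesis unfolding f_def m_def[symmetric] by (rule agree[OF \<open>n \<le> m\<close> 0 2, symmetric])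
    qed
  qed
  have cont: "continuous_on UNIV f"
  proof -
    have "isCont f t" for t
    proof -
      obtain n :: nat where n: "t < real n" using reals_Archimedean2 by blast
      have "isCont (\<lambda>t. F n (max 0 t)) t"
        using F(1)[of n] by (intro isCont_o2[where f="max 0" and g="F n"]) (auto simp: continuous_on_eq_continuous_at intro!: continuous_intros)
      moreover have "\<forall>\<^sub>F x in nhds t. f x = F n (max 0 x)"
        using n by (intro eventually_mono[OF eventually_nhds_in_open[of "{..<real n}" t]]) (auto intro!: fF)
      ultimately show ?thesis by (simp only: isCont_cong)
    qed
    then show ?thesis by (simp add: continuous_at_imp_continuous_on)
  qed
  have cdf: "cdf t = (LBINT s:{0<..<t}. f s)" if t: "0 < t" for t
  proof -
    obtain n :: nat where n: "t < real n" using reals_Archimedean2 by blast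
    have "(LBINT s:{0<..<t}. f s) = (LBINT s:{0<..<t}. F n s)"
    proof (rule set_lebesgue_integral_cong)
      show "\<forall>s. s \<in> {0<..<t} \<longrightarrow> f s = F n s" using fF[of _ n] n by auto
    qed simp
    then show ?thesis using F(2)[of t n] t n by simp
  qed
  have fi: "set_integrable lborel {0<..<t} f" for t
    by (rule set_integrable_continuous_Ioo) (rule continuous_on_subset[OF cont], simp)
  have nonneg: "0 \<le> f t" if t: "0 \<le> t" for t
  proof (rule ccontr)
    assume neg: "\<not> 0 \<le> f t"
    have ct: "continuous_on {0..t + 1} f" by (rule continuous_on_subset[OF cont]) simp
    have I: "integral {0..y} f = cdf y" if y: "0 < y" for y
    proof -
      have "integral {0..y} f = integral {0<..<y} f"
        by (rule integral_spike_set; rule negligible_subset[of "{0, y}"]; auto)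
      also have "\<dots> = (LBINT s:{0<..<y}. f s)" by (rule set_borel_integral_eq_integral(2)[OF fi, symmetric])
      finally show ?thesis using cdf[OF y] by simp
    qed
    have "((\<lambda>y. integral {0..y} f) has_real_derivative f t) (at t within {0..t + 1})"
      by (rule integral_has_real_derivative[OF ct]) (use t in auto)
    from has_real_derivative_neg_dec_right[OF this] neg obtain d where d: "0 < d"
      "\<And>h. 0 < h \<Longrightarrow> t + h \<in> {0..t + 1} \<Longrightarrow> h < d \<Longrightarrow> integral {0..t + h} f < integral {0..t} f" by auto
    define h where "h = min (d / 2) 1"
    have h: "0 < h" "h < d" "t + h \<in> {0..t + 1}" using d(1) t by (auto simp: h_def)
    have "integral {0..t} f \<le> cdf (t + h)"
    proof (cases "t = 0")
      case False
      then show ?thesis using I[of t] t h cdf_mono[of t "t + h"] by auto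
    qed (use cdf_bounds in auto)
    also have "\<dots> = integral {0..t + h} f" using I[of "t + h"] t h by simp
    also have "\<dots> < integral {0..t} f" by (rule d(2)[OF h(1,3,2)])
    finally show False by simp
  qed
  have "0 \<le> f t" for t
    using nonneg[of t] nonneg[of 0] by (cases "0 \<le> t") (auto simp: f_def)
  then show ?thesis using that[OF cont _ cdf] by blast
qed

text \<open>Removing the paths with infinite passage time leaves a possibly defective law. The
  half-lines below a form a generating class closed under intersection, and on it both measures
  equal \<open>cdf a\<close>.\<close>

lemma law_eq_density:
  assumes f: "continuous_on UNIV f" "\<And>t. 0 \<le> f t" "\<And>t. 0 < t \<Longrightarrow> cdf t = (LBINT s:{0<..<t}. f s)"
  shows "distr (density M (\<lambda>\<omega>. indicator {..<\<infinity>} (first_passage_time W b \<omega>))) borel time = density lborel (\<lambda>s. ennreal (indicator {0<..} s * f s))"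
    (is "?\<mu> = ?\<nu>")
proof (rule measure_eqI_generator_eq[where E="range lessThan" and \<Omega>=UNIV and A="\<lambda>n::nat. {..<real n}"])
  have [measurable]: "f \<in> borel_measurable borel" using f(1) by (rule borel_measurable_continuous_onI)
  show "Int_stable (range (lessThan :: real \<Rightarrow> real set))"
  proof (rule Int_stableI)
    fix A B assume "A \<in> range (lessThan :: real \<Rightarrow> real set)" "B \<in> range (lessThan :: real \<Rightarrow> real set)"
    then obtain u v where "A = {..<u}" "B = {..<v}" by blast
    then have "A \<inter> B = {..<min u v}" by auto
    then show "A \<inter> B \<in> range lessThan" by blast
  qed
  have sig: "sets borel = sigma_sets UNIV (range (lessThan :: real \<Rightarrow> real set))"
    by (subst borel_Iio) simp
  show "sets ?\<mu> = sigma_sets UNIV (range lessThan)" "sets ?\<nu> = sigma_sets UNIV (range lessThan)" by (simp_all add: sig[symmetric])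
  have mu: "emeasure ?\<mu> {..<a} = ennreal (cdf a)" for a
  proof -
    have "emeasure ?\<mu> {..<a} = (\<integral>\<^sup>+\<omega>. indicator {..<\<infinity>} (first_passage_time W b \<omega>) * indicator (time -` {..<a} \<inter> space M) \<omega> \<partial>M)"
      by (subst emeasure_distr) (auto simp: emeasure_density)
    also have "\<dots> = (\<integral>\<^sup>+\<omega>. indicator {\<omega> \<in> space M. first_passage_time W b \<omega> < ereal a} \<omega> \<partial>M)"
    proof (rule nn_integral_cong)
      fix \<omega> assume "\<omega> \<in> space M"
      then show "indicator {..<\<infinity>} (first_passage_time W b \<omega>) * indicator (time -` {..<a} \<inter> space M) \<omega> = (indicator {\<omega> \<in> space M. first_passage_time W b \<omega> < ereal a} \<omega> :: ennreal)"
        using first_passage_nonneg[of W b \<omega>] by (cases "first_passage_time W b \<omega>") (auto simp: indicator_def)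
    qed
    also have "\<dots> = ennreal (cdf a)" by (simp add: cdf_def emeasure_eq_measure)
    finally show ?thesis .
  qed
  have nu: "emeasure ?\<nu> {..<a} = ennreal (cdf a)" for a
  proof -
    have "emeasure ?\<nu> {..<a} = (\<integral>\<^sup>+s. ennreal (indicator {0<..<a} s *\<^sub>R f s) \<partial>lborel)"
      by (subst emeasure_density) (auto intro!: nn_integral_cong simp: indicator_def)
    also have "\<dots> = ennreal (LBINT s:{0<..<a}. f s)"
      unfolding set_lebesgue_integral_def
    proof (rule nn_integral_eq_integral)
      show "integrable lborel (\<lambda>s. indicator {0<..<a} s *\<^sub>R f s)"
        using set_integrable_continuous_Ioo[OF continuous_on_subset[OF f(1) subset_UNIV], of a] by (simp add: set_integrable_def)
    qed (use f(2) in auto)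
    also have "(LBINT s:{0<..<a}. f s) = cdf a"
    proof (cases "0 < a")
      case False
      have e1: "{\<omega> \<in> space M. first_passage_time W b \<omega> < ereal a} = {}"
      proof -
        have "\<not> first_passage_time W b \<omega> < ereal a" for \<omega>
        proof
          assume "first_passage_time W b \<omega> < ereal a"
          from le_less_trans[OF first_passage_nonneg this] show False using False by simp
        qed
        then show ?thesis by blast
      qed
      have e2: "{0<..<a} = {}" using False by auto
      show ?thesis unfolding cdf_def e1 e2 by (simp add: set_lebesgue_integral_def)
    qed (simp add: f(3))
    finally show ?thesis .
  qed
  show "emeasure ?\<mu> X = emeasure ?\<nu> X" if "X \<in> range lessThan" for X using that mu nu by auto
  show "emeasure ?\<mu> {..<real i} \<noteq> \<infinity>" for i by (simp add: mu)
  show "(\<Union>i. {..<real i}) = UNIV" using reals_Archimedean2 by auto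
qed auto

lemma law_integral:
  fixes g :: "real \<Rightarrow> real"
  assumes f: "continuous_on UNIV f" "\<And>t. 0 \<le> f t" "\<And>t. 0 < t \<Longrightarrow> cdf t = (LBINT s:{0<..<t}. f s)"
    and [measurable]: "g \<in> borel_measurable borel"
  shows "integrable M (\<lambda>\<omega>. before t \<omega> * g (time \<omega>)) \<longleftrightarrow> set_integrable lborel {0<..<t} (\<lambda>s. g s * f s)"
    and "(\<integral>\<omega>. before t \<omega> * g (time \<omega>) \<partial>M) = (LBINT s:{0<..<t}. g s * f s)"
proof -
  have [measurable]: "f \<in> borel_measurable borel" using f(1) by (rule borel_measurable_continuous_onI)
  let ?d = "density M (\<lambda>\<omega>. ennreal (indicator {..<\<infinity>} (first_passage_time W b \<omega>)))"
  have d: "density M (\<lambda>\<omega>. indicator {..<\<infinity>} (first_passage_time W b \<omega>)) = ?d"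
    by (rule arg_cong[where f="density M"]) (auto simp: indicator_def)
  let ?G = "\<lambda>s. indicator {..<t} s * g s"
  have e1: "indicator {..<\<infinity>} (first_passage_time W b \<omega>) *\<^sub>R ?G (time \<omega>) = before t \<omega> * g (time \<omega>)" for \<omega>
    using first_passage_nonneg[of W b \<omega>] by (cases "first_passage_time W b \<omega>") (auto simp: indicator_def)
  have e2: "(indicator {0<..} s * f s) *\<^sub>R ?G s = indicator {0<..<t} s *\<^sub>R (g s * f s)" for s
    by (auto simp: indicator_def)
  have L: "distr ?d borel time = density lborel (\<lambda>s. ennreal (indicator {0<..} s * f s))"
    unfolding d[symmetric] by (rule law_eq_density[OF f])
  have "integrable M (\<lambda>\<omega>. before t \<omega> * g (time \<omega>)) \<longleftrightarrow> integrable ?d (\<lambda>\<omega>. ?G (time \<omega>))"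
    unfolding e1[symmetric] by (rule integrable_density[symmetric]) auto
  also have "\<dots> \<longleftrightarrow> integrable (distr ?d borel time) ?G" by (rule integrable_distr_eq[symmetric]) auto
  also have "\<dots> \<longleftrightarrow> set_integrable lborel {0<..<t} (\<lambda>s. g s * f s)"
    unfolding L set_integrable_def e2[symmetric] by (rule integrable_density) (use f(2) in auto)
  finally show "integrable M (\<lambda>\<omega>. before t \<omega> * g (time \<omega>)) \<longleftrightarrow> set_integrable lborel {0<..<t} (\<lambda>s. g s * f s)" .
  have "(\<integral>\<omega>. before t \<omega> * g (time \<omega>) \<partial>M) = (\<integral>\<omega>. ?G (time \<omega>) \<partial>?d)"
    unfolding e1[symmetric] by (rule integral_density[symmetric]) auto
  also have "\<dots> = (\<integral>s. ?G s \<partial>distr ?d borel time)" by (rule integral_distr[symmetric]) auto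
  also have "\<dots> = (LBINT s:{0<..<t}. g s * f s)"
    unfolding L set_lebesgue_integral_def e2[symmetric] by (rule integral_density) (use f(2) in auto)
  finally show "(\<integral>\<omega>. before t \<omega> * g (time \<omega>) \<partial>M) = (LBINT s:{0<..<t}. g s * f s)" .
qed

lemma time_density:
  assumes f: "continuous_on UNIV f" "\<And>t. 0 \<le> f t" "\<And>t. 0 < t \<Longrightarrow> cdf t = (LBINT s:{0<..<t}. f s)"
  shows "has_time_density M (first_passage_time W b) f"
  unfolding has_time_density_def
proof (intro conjI allI impI ballI)
  have [measurable]: "f \<in> borel_measurable borel" using f(1) by (rule borel_measurable_continuous_onI)
  show "first_passage_time W b \<in> borel_measurable M" by measurable
  show "0 \<le> f t" for t by (rule f(2))
  fix A :: "real set" assume A[measurable]: "A \<in> sets borel" and sub: "A \<subseteq> {0..}"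
  let ?d = "density M (\<lambda>\<omega>. indicator {..<\<infinity>} (first_passage_time W b \<omega>))"
  have eqA: "{\<omega> \<in> space M. first_passage_time W b \<omega> \<in> ereal ` A} = {\<omega> \<in> space M. first_passage_time W b \<omega> < \<infinity> \<and> time \<omega> \<in> A}"
    (is "?L = ?R")
  proof (intro Collect_cong conj_cong refl)
    fix \<omega> show "first_passage_time W b \<omega> \<in> ereal ` A \<longleftrightarrow> first_passage_time W b \<omega> < \<infinity> \<and> time \<omega> \<in> A"
      using first_passage_nonneg[of W b \<omega>] by (cases "first_passage_time W b \<omega>") auto
  qed
  have "emeasure M ?R = (\<integral>\<^sup>+\<omega>. indicator ?R \<omega> \<partial>M)" by (rule nn_integral_indicator[symmetric]) measurable
  also have "\<dots> = (\<integral>\<^sup>+\<omega>. indicator {..<\<infinity>} (first_passage_time W b \<omega>) * indicator (time -` A \<inter> space M) \<omega> \<partial>M)"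
    by (rule nn_integral_cong) (auto simp: indicator_def)
  also have "\<dots> = emeasure (distr ?d borel time) A"
    by (subst emeasure_distr) (auto simp: emeasure_density)
  also have "\<dots> = (\<integral>\<^sup>+s. ennreal (indicator {0<..} s * f s) * indicator A s \<partial>lborel)"
  proof -
    have L: "distr ?d borel time = density lborel (\<lambda>s. ennreal (indicator {0<..} s * f s))"
      by (rule law_eq_density[OF f])
    show ?thesis unfolding L by (rule emeasure_density) measurable
  qed
  also have "\<dots> = (\<integral>\<^sup>+t\<in>A. ennreal (f t) \<partial>lborel)"
  proof (rule nn_integral_cong_AE)
    show "AE s in lborel. ennreal (indicator {0<..} s * f s) * indicator A s = ennreal (f s) * indicator A s"
      using AE_lborel_singleton[of 0] by eventually_elim (use sub in \<open>auto simp: indicator_def\<close>)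
  qed
  finally show "emeasure M ?L = (\<integral>\<^sup>+t\<in>A. ennreal (f t) \<partial>lborel)" unfolding eqA .
qed

end

section \<open>The integral equations\<close>

lemma passage_kernel_bound:
  assumes p: "p < 1" and r: "0 < r"
  shows "\<bar>passage_kernel p x r\<bar> \<le> 4 * (r powr (- (p + 1) / 2) * exp (- x / sqrt r))"
proof -
  have a: "0 < 1 - p" and e: "(1 - p) / 2 - 1 = - (p + 1) / 2" using p by (auto simp: field_simps)
  have G: "0 < Gamma (1 - p)" using a by (rule Gamma_real_pos)
  have "\<bar>\<integral>u. heat_flux (x + u) r \<partial>power_measure (1 - p)\<bar> \<le> (\<integral>u. \<bar>heat_flux (x + u) r\<bar> \<partial>power_measure (1 - p))"
    by (rule integral_abs_bound)
  also have "\<dots> \<le> 4 * Gamma (1 - p) * (r powr (- (p + 1) / 2) * exp (- x / sqrt r))"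
    using integral_heat_flux_bound(2)[OF a r] unfolding e .
  finally have "\<bar>\<integral>u. heat_flux (x + u) r \<partial>power_measure (1 - p)\<bar> / Gamma (1 - p) \<le> 4 * (r powr (- (p + 1) / 2) * exp (- x / sqrt r))"
    using G by (simp add: pos_divide_le_eq mult_ac)
  then show ?thesis unfolding passage_kernel_eq[OF p r] using G by (simp add: abs_divide)
qed

lemma passage_kernel_measurable:
  assumes p: "p < 1" and [measurable]: "f \<in> borel_measurable N" "g \<in> borel_measurable N"
  shows "(\<lambda>x. passage_kernel p (f x) (g x)) \<in> borel_measurable N"
proof -
  have "is_parabolic_cylinder p (parabolic_cylinder p)"
    unfolding parabolic_cylinder_eq[OF p] by (rule is_parabolic_cylinder_integral[OF p])
  then have "continuous_on UNIV (parabolic_cylinder p)"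
    by (simp add: is_parabolic_cylinder_def holomorphic_on_imp_continuous_on)
  then have "continuous_on UNIV (\<lambda>x. parabolic_cylinder p (complex_of_real x))"
    by (rule continuous_on_compose2) (auto intro!: continuous_intros)
  then have "continuous_on UNIV (parabolic_cylinder_real p)"
    unfolding parabolic_cylinder_real_def[abs_def] by (rule continuous_on_Re)
  then have [measurable]: "parabolic_cylinder_real p \<in> borel_measurable borel" by (rule borel_measurable_continuous_onI)
  show ?thesis unfolding passage_kernel_def by measurable
qed

context smooth_boundary
begin

text \<open>The Hoelder bound on b keeps the exponential bounded for x on the curve, and lowering x
  only decreases it. What remains is the singularity (t-s)^(-(p+1)/2), integrable because p <
  1.\<close>

lemma weight_integrable:
  assumes D: "continuous_on UNIV D" and p: "p < 1" and t: "0 < t" and x: "x \<le> b t"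
  shows "integrable lborel (\<lambda>s. indicator {0<..<t} s * D s * ((t - s) powr (- (p + 1) / 2) * exp (- (b s - x) / sqrt (t - s))))"
proof -
  have [measurable]: "D \<in> borel_measurable borel" using D by (rule borel_measurable_continuous_onI)
  obtain K where K: "0 \<le> K" "\<And>s t'. 0 \<le> s \<Longrightarrow> s < t' \<Longrightarrow> t' \<le> t \<Longrightarrow> exp (- (b s - b t') / sqrt (t' - s)) \<le> K"
    using exp_bz_bound[OF t] by blast
  have "compact (D ` {0..t})" by (intro compact_continuous_image continuous_on_subset[OF D]) auto
  then obtain B where B: "\<And>s. s \<in> {0..t} \<Longrightarrow> \<bar>D s\<bar> \<le> B"
    by (metis bounded_iff compact_imp_bounded image_eqI real_norm_def)
  have "\<bar>D 0\<bar> \<le> B" using t by (intro B) auto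
  then have B0: "0 \<le> B" by linarith
  have "set_integrable lborel {0<..<t} (\<lambda>s. (t - s) powr (- ((p + 1) / 2)) * (B * K))"
    using p by (intro set_integrable_mult_left set_integrable_powr_reflect) auto
  then have i: "integrable lborel (\<lambda>s. indicator {0<..<t} s *\<^sub>R ((t - s) powr (- ((p + 1) / 2)) * (B * K)))"
    by (simp add: set_integrable_def)
  show ?thesis
  proof (rule Bochner_Integration.integrable_bound[OF i])
    show "AE s in lborel. norm (indicator {0<..<t} s * D s * ((t - s) powr (- (p + 1) / 2) * exp (- (b s - x) / sqrt (t - s))))
      \<le> norm (indicator {0<..<t} s *\<^sub>R ((t - s) powr (- ((p + 1) / 2)) * (B * K)))"
    proof (rule AE_I2)
      fix s
      show "norm (indicator {0<..<t} s * D s * ((t - s) powr (- (p + 1) / 2) * exp (- (b s - x) / sqrt (t - s))))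
        \<le> norm (indicator {0<..<t} s *\<^sub>R ((t - s) powr (- ((p + 1) / 2)) * (B * K)))"
      proof (cases "s \<in> {0<..<t}")
        case True
        have "- (b s - x) / sqrt (t - s) \<le> - (b s - b t) / sqrt (t - s)" using True x by (intro divide_right_mono) auto
        then have "exp (- (b s - x) / sqrt (t - s)) \<le> exp (- (b s - b t) / sqrt (t - s))" by (simp only: exp_le_cancel_iff)
        also have "\<dots> \<le> K" using True by (intro K(2)) auto
        finally have "exp (- (b s - x) / sqrt (t - s)) \<le> K" .
        then have "\<bar>D s\<bar> * ((t - s) powr (- (p + 1) / 2) * exp (- (b s - x) / sqrt (t - s))) \<le> B * ((t - s) powr (- (p + 1) / 2) * K)"
          using B[of s] True B0 by (intro mult_mono) auto
        then show ?thesis using True B0 K(1) by (simp add: abs_mult mult_ac minus_divide_left)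
      qed simp
    qed
  qed measurable
qed

lemma weighted_times_density:
  assumes D: "continuous_on UNIV D" and t: "0 < t"
  shows "weighted_times lborel (\<lambda>s. s) (\<lambda>s. indicator {0<..<t} s * D s) t b"
proof
  show "0 < t" "continuous_on UNIV b" by (fact t, rule continuous_b)
  show "integrable lborel (\<lambda>s. indicator {0<..<t} s * D s)"
    using set_integrable_continuous_Ioo[OF continuous_on_subset[OF D subset_UNIV], of t] by (simp add: set_integrable_def)
  show "0 \<le> s \<and> s < t" if "indicator {0<..<t} s * D s \<noteq> 0" for s
    using that by (auto simp: indicator_def split: if_splits)
qed auto

end

context brownian_boundary
begin

text \<open>The kernel identity for the passage time, with its expectation written through the
  density; absolute convergence comes from \<open>weight_integrable\<close>.\<close>

lemma density_solves:
  assumes f: "continuous_on UNIV f" "\<And>t. 0 \<le> f t" "\<And>t. 0 < t \<Longrightarrow> cdf t = (LBINT s:{0<..<t}. f s)" and p: "p < 1"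
  shows "solves_passage_equation p b f"
  unfolding solves_passage_equation_def
proof (intro allI impI)
  fix t :: real assume t: "0 < t"
  note [measurable] = passage_kernel_measurable[OF p]
  let ?g = "\<lambda>s. (t - s) powr (- (p + 1) / 2) * exp (- (b s - b t) / sqrt (t - s))"
  let ?k = "\<lambda>s. passage_kernel p (b s - b t) (t - s)"
  have "set_integrable lborel {0<..<t} (\<lambda>s. ?g s * f s)"
    using weight_integrable[OF f(1) p t order_refl] by (simp add: set_integrable_def mult_ac)
  moreover have "integrable M (\<lambda>\<omega>. before t \<omega> * ?g (time \<omega>)) \<longleftrightarrow> set_integrable lborel {0<..<t} (\<lambda>s. ?g s * f s)"
    by (rule law_integral(1)[OF f]) measurable
  ultimately have int: "integrable M (\<lambda>\<omega>. before t \<omega> * ?g (time \<omega>))" by simp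
  have km: "?k \<in> borel_measurable borel" by measurable
  have "integrable M (\<lambda>\<omega>. before t \<omega> * ?k (time \<omega>))"
    by (rule first_passage_kernel(2)[OF bm continuous_b b_0 t p int])
  moreover have "integrable M (\<lambda>\<omega>. before t \<omega> * ?k (time \<omega>)) \<longleftrightarrow> set_integrable lborel {0<..<t} (\<lambda>s. ?k s * f s)"
    by (rule law_integral(1)[OF f]) (auto intro: km)
  ultimately have 1: "set_integrable lborel {0<..<t} (\<lambda>s. ?k s * f s)" by simp
  have "passage_kernel p (- b t) t = (\<integral>\<omega>. before t \<omega> * ?k (time \<omega>) \<partial>M)"
    by (rule first_passage_kernel(1)[OF bm continuous_b b_0 t p int])
  also have "\<dots> = (LBINT s:{0<..<t}. ?k s * f s)"
    by (rule law_integral(2)[OF f]) (auto intro: km)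
  finally show "set_integrable lborel {0<..<t} (\<lambda>s. ?k s * f s) \<and> passage_kernel p (- b t) t = (LBINT s:{0<..<t}. ?k s * f s)"
    using 1 by blast
qed

text \<open>Run the Brownian motion backwards in time from \<open>(x0, t0)\<close> until it meets the boundary: the kernel is a
  martingale along the path, so a vanishing boundary potential vanishes below the boundary.\<close>

lemma potential_vanishes_below:
  assumes D: "continuous_on UNIV D" and p: "p < 1"
    and eq: "\<And>t. 0 < t \<Longrightarrow> (LBINT s:{0<..<t}. passage_kernel p (b s - b t) (t - s) * D s) = 0"
    and t0: "0 < t0" and x0: "x0 < b t0"
  shows "(LBINT s:{0<..<t0}. passage_kernel p (b s - x0) (t0 - s) * D s) = 0"
proof -
  have [measurable]: "D \<in> borel_measurable borel" using D by (rule borel_measurable_continuous_onI)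
  note [measurable] = passage_kernel_measurable[OF p]
  \<comment> \<open>The reversed path is at x0 - W r at time t0 - r, and W r \<le> c r says that it
    has reached b(t0 - r). It starts strictly below the curve, so c 0 < 0.\<close>
  define c where "c = (\<lambda>r. x0 - b (t0 - r))"
  have c: "continuous_on UNIV c" unfolding c_def
    by (intro continuous_intros continuous_on_compose2[OF continuous_b]) auto
  have c0: "c 0 < 0" using x0 by (simp add: c_def)
  define \<tau> where "\<tau> = first_passage_time W c"
  define \<sigma> where "\<sigma> = (\<lambda>\<omega>. real_of_ereal (\<tau> \<omega>))"
  have [measurable]: "\<tau> \<in> borel_measurable M"
    unfolding \<tau>_def by (rule first_passage_measurable'[OF bm c c0 zero_less_one])
  have [measurable]: "\<sigma> \<in> borel_measurable M" unfolding \<sigma>_def by measurable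
  have \<tau>0: "0 \<le> \<tau> \<omega>" for \<omega> unfolding \<tau>_def by (rule first_passage_nonneg)
  define q where "q = (\<lambda>\<omega> s. if \<tau> \<omega> < ereal (t0 - s) then 1 else 0 :: real)"
  have q: "q \<omega> s = (if \<tau> \<omega> < \<infinity> \<and> \<sigma> \<omega> < t0 - s then 1 else 0)" for \<omega> s
    using \<tau>0[of \<omega>] by (cases "\<tau> \<omega>") (auto simp: q_def \<sigma>_def)
  have q1: "0 \<le> \<sigma> \<omega> \<and> \<sigma> \<omega> < t0 - s" if "q \<omega> s \<noteq> 0" for \<omega> s
    using that \<tau>0[of \<omega>] by (auto simp: q \<sigma>_def real_of_ereal_pos split: if_splits)
  have [measurable]: "(\<lambda>(\<omega>, s). q \<omega> s) \<in> borel_measurable (M \<Otimes>\<^sub>M lborel)" unfolding q by measurable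
  define \<alpha> where "\<alpha> = (p + 1) / 2"
  have al: "\<alpha> < 1" using p by (simp add: \<alpha>_def)
  obtain K where K: "0 \<le> K" "\<And>s t. 0 \<le> s \<Longrightarrow> s < t \<Longrightarrow> t \<le> t0 \<Longrightarrow> exp (- (b s - b t) / sqrt (t - s)) \<le> K"
    using exp_bz_bound[OF t0] by blast
  have "compact (D ` {0..t0})" by (intro compact_continuous_image continuous_on_subset[OF D]) auto
  then obtain B where B: "\<And>s. s \<in> {0..t0} \<Longrightarrow> \<bar>D s\<bar> \<le> B"
    by (metis bounded_iff compact_imp_bounded image_eqI real_norm_def)
  have "\<bar>D 0\<bar> \<le> B" using t0 by (intro B) auto
  then have B0: "0 \<le> B" by linarith
  interpret P: pair_sigma_finite M lborel ..
  let ?B = "\<lambda>\<omega> s. indicator {0<..<t0} s * q \<omega> s * (t0 - \<sigma> \<omega> - s) powr (- \<alpha>)"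
  let ?E = "\<lambda>\<omega> s. exp (- (c (\<sigma> \<omega>) - c (t0 - s)) / sqrt (t0 - s - \<sigma> \<omega>))"
  let ?H = "\<lambda>\<omega> s. indicator {0<..<t0} s * (q \<omega> s * (passage_kernel p (c (\<sigma> \<omega>) - c (t0 - s)) (t0 - s - \<sigma> \<omega>) * D s))"
  have [measurable]: "c \<in> borel_measurable borel" using c by (rule borel_measurable_continuous_onI)
  \<comment> \<open>For each path the singular integral in s is, after reflection, one over (0,T)
    with T \<le> t0; hence J bounds it uniformly in \<omega>, which gives integrability on the
    product space.\<close>
  define J where "J = (LBINT u:{0<..<t0}. u powr (- \<alpha>))"
  have inner: "integrable lborel (?B \<omega>) \<and> (LBINT s. ?B \<omega> s) \<le> J" for \<omega>
  proof (cases "\<tau> \<omega> < ereal t0")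
    case True
    define T where "T = t0 - \<sigma> \<omega>"
    have T: "0 < T \<and> T \<le> t0" using True \<tau>0[of \<omega>] by (cases "\<tau> \<omega>") (auto simp: T_def \<sigma>_def)
    have "?B \<omega> = (\<lambda>s. indicator {0<..<T} s *\<^sub>R (T - s) powr (- \<alpha>))"
      using T True \<tau>0[of \<omega>] unfolding q by (auto simp: fun_eq_iff indicator_def T_def)
    moreover have "set_integrable lborel {0<..<T} (\<lambda>s. (T - s) powr (- \<alpha>))" by (rule set_integrable_powr_reflect[OF al])
    moreover have "(LBINT s:{0<..<T}. (T - s) powr (- \<alpha>)) \<le> J"
    proof -
      have "(LBINT s:{0<..<T}. (T - s) powr (- \<alpha>)) = (LBINT s:{0<..<T}. s powr (- \<alpha>))" by (rule set_integral_reflect(2)[of T "\<lambda>s. s powr (- \<alpha>)"])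
      also have "\<dots> \<le> J" unfolding J_def set_lebesgue_integral_def
        using set_integrable_powr[OF al, of T] set_integrable_powr[OF al, of t0] T
        by (intro integral_mono) (auto simp: set_integrable_def indicator_def)
      finally show ?thesis .
    qed
    ultimately show ?thesis by (simp add: set_integrable_def set_lebesgue_integral_def)
  next
    case False
    have "q \<omega> s = 0" if "0 < s" for s
    proof -
      have "ereal (t0 - s) < ereal t0" using that by simp
      then have "\<not> \<tau> \<omega> < ereal (t0 - s)" using False less_trans by blast
      then show ?thesis by (simp add: q_def)
    qed
    then have "?B \<omega> = (\<lambda>s. 0)" by (auto simp: indicator_def)
    moreover have "0 \<le> J" unfolding J_def set_lebesgue_integral_def by (rule Bochner_Integration.integral_nonneg) simp
    ultimately show ?thesis by simp
  qed
  have Bpos: "0 \<le> ?B \<omega> s" for \<omega> s by (simp add: q_def)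
  have Bi: "integrable (M \<Otimes>\<^sub>M lborel) (\<lambda>(\<omega>, s). ?B \<omega> s)"
  proof (rule P.Fubini_integrable)
    show "(\<lambda>(\<omega>, s). ?B \<omega> s) \<in> borel_measurable (M \<Otimes>\<^sub>M lborel)" by measurable
    show "AE \<omega> in M. integrable lborel (\<lambda>s. case (\<omega>, s) of (\<omega>, s) \<Rightarrow> ?B \<omega> s)" using inner by simp
    show "integrable M (\<lambda>\<omega>. LBINT s. norm (case (\<omega>, s) of (\<omega>, s) \<Rightarrow> ?B \<omega> s))"
    proof (rule integrable_const_bound[where B=J])
      show "AE \<omega> in M. norm (LBINT s. norm (case (\<omega>, s) of (\<omega>, s) \<Rightarrow> ?B \<omega> s)) \<le> J"
      proof (rule AE_I2)
        fix \<omega>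
        have "(LBINT s. norm (?B \<omega> s)) = (LBINT s. ?B \<omega> s)" using Bpos by (simp only: real_norm_def abs_of_nonneg)
        moreover have "0 \<le> (LBINT s. ?B \<omega> s)" by (rule Bochner_Integration.integral_nonneg) (rule Bpos)
        ultimately show "norm (LBINT s. norm (case (\<omega>, s) of (\<omega>, s) \<Rightarrow> ?B \<omega> s)) \<le> J"
          using inner[of \<omega>] by (simp only: prod.case real_norm_def abs_of_nonneg)
      qed
    qed measurable
  qed
  \<comment> \<open>With T = t0 - \<sigma> the exponent is a quotient of the increment of b between
    s and T, since x0 cancels; so the bound for the original curve applies.\<close>
  have Eb: "?E \<omega> s \<le> K" if "s \<in> {0<..<t0}" "q \<omega> s \<noteq> 0" for \<omega> s
    using K(2)[of s "t0 - \<sigma> \<omega>"] q1[OF that(2)] that(1) by (simp add: c_def algebra_simps)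
  let ?F = "\<lambda>\<omega> s. indicator {0<..<t0} s * (q \<omega> s * ((t0 - s - \<sigma> \<omega>) powr (- \<alpha>) * ?E \<omega> s))"
  have Fi: "integrable (M \<Otimes>\<^sub>M lborel) (\<lambda>(\<omega>, s). ?F \<omega> s)"
  proof (rule Bochner_Integration.integrable_bound[OF integrable_mult_right[OF Bi, of K]])
    show "(\<lambda>(\<omega>, s). ?F \<omega> s) \<in> borel_measurable (M \<Otimes>\<^sub>M lborel)" by measurable
    have "\<bar>?F \<omega> s\<bar> \<le> \<bar>K * ?B \<omega> s\<bar>" for \<omega> s
    proof (cases "s \<in> {0<..<t0} \<and> q \<omega> s \<noteq> 0")
      case True
      then have "(t0 - s - \<sigma> \<omega>) powr (- \<alpha>) * ?E \<omega> s \<le> (t0 - s - \<sigma> \<omega>) powr (- \<alpha>) * K" using Eb by (intro mult_left_mono) auto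
      then show ?thesis using True K(1) by (simp add: q_def abs_mult algebra_simps split: if_splits)
    qed auto
    then show "AE x in M \<Otimes>\<^sub>M lborel. norm (case x of (\<omega>, s) \<Rightarrow> ?F \<omega> s) \<le> norm (K * (case x of (\<omega>, s) \<Rightarrow> ?B \<omega> s))" by auto
  qed
  have Hi: "integrable (M \<Otimes>\<^sub>M lborel) (\<lambda>(\<omega>, s). ?H \<omega> s)"
  proof (rule Bochner_Integration.integrable_bound[OF integrable_mult_right[OF Fi, of "4 * B"]])
    show "(\<lambda>(\<omega>, s). ?H \<omega> s) \<in> borel_measurable (M \<Otimes>\<^sub>M lborel)" by measurable
    have "\<bar>?H \<omega> s\<bar> \<le> \<bar>4 * B * ?F \<omega> s\<bar>" for \<omega> s
    proof (cases "s \<in> {0<..<t0} \<and> q \<omega> s \<noteq> 0")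
      case True
      have r: "0 < t0 - s - \<sigma> \<omega>" using True q1[of \<omega> s] by auto
      have "\<bar>passage_kernel p (c (\<sigma> \<omega>) - c (t0 - s)) (t0 - s - \<sigma> \<omega>)\<bar> * \<bar>D s\<bar> \<le> (4 * ((t0 - s - \<sigma> \<omega>) powr (- (p + 1) / 2) * ?E \<omega> s)) * B"
        using True B[of s] by (intro mult_mono passage_kernel_bound[OF p r]) auto
      moreover have "- (p + 1) / 2 = - \<alpha>" unfolding \<alpha>_def by (rule minus_divide_left[symmetric])
      ultimately show ?thesis using True B0 by (simp add: q_def abs_mult mult_ac split: if_splits)
    qed auto
    then show "AE x in M \<Otimes>\<^sub>M lborel. norm (case x of (\<omega>, s) \<Rightarrow> ?H \<omega> s) \<le> norm (4 * B * (case x of (\<omega>, s) \<Rightarrow> ?F \<omega> s))" by auto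
  qed
  have "(LBINT s:{0<..<t0}. passage_kernel p (b s - x0) (t0 - s) * D s) = (LBINT s. (\<integral>\<omega>. ?H \<omega> s \<partial>M))"
    unfolding set_lebesgue_integral_def
  proof (rule integral_cong_AE)
    show "(\<lambda>s. indicator {0<..<t0} s *\<^sub>R (passage_kernel p (b s - x0) (t0 - s) * D s)) \<in> borel_measurable lborel" by measurable
    show "(\<lambda>s. \<integral>\<omega>. ?H \<omega> s \<partial>M) \<in> borel_measurable lborel" by measurable
    \<comment> \<open>The kernel identity at horizon t0 - s needs integrability for that fixed s;
      Fubini grants it for almost every s, which suffices under the integral.\<close>
    show "AE s in lborel. indicator {0<..<t0} s *\<^sub>R (passage_kernel p (b s - x0) (t0 - s) * D s) = (\<integral>\<omega>. ?H \<omega> s \<partial>M)"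
      using P.AE_integrable_snd[OF Fi]
    proof eventually_elim
      case (elim s)
      show ?case
      proof (cases "s \<in> {0<..<t0}")
        case True
        have T: "0 < t0 - s" using True by simp
        have e: "- (p + 1) / 2 = - \<alpha>" unfolding \<alpha>_def by (rule minus_divide_left[symmetric])
        have "integrable M (\<lambda>\<omega>. q \<omega> s * ((t0 - s - \<sigma> \<omega>) powr (- (p + 1) / 2) * ?E \<omega> s))"
          using elim True unfolding e by simp
        then have "passage_kernel p (- c (t0 - s)) (t0 - s) = (\<integral>\<omega>. q \<omega> s * passage_kernel p (c (\<sigma> \<omega>) - c (t0 - s)) (t0 - s - \<sigma> \<omega>) \<partial>M)"
          unfolding q_def \<sigma>_def \<tau>_def by (rule first_passage_kernel(1)[OF bm c c0 T p])
        moreover have "- c (t0 - s) = b s - x0" by (simp add: c_def)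
        ultimately have "passage_kernel p (b s - x0) (t0 - s) = (\<integral>\<omega>. q \<omega> s * passage_kernel p (c (\<sigma> \<omega>) - c (t0 - s)) (t0 - s - \<sigma> \<omega>) \<partial>M)"
          by simp
        then have "passage_kernel p (b s - x0) (t0 - s) * D s = (\<integral>\<omega>. (q \<omega> s * passage_kernel p (c (\<sigma> \<omega>) - c (t0 - s)) (t0 - s - \<sigma> \<omega>)) * D s \<partial>M)"
          by simp
        then show ?thesis using True by (simp add: mult.assoc)
      qed simp
    qed
  qed
  also have "\<dots> = (\<integral>\<omega>. (LBINT s. ?H \<omega> s) \<partial>M)" using P.Fubini_integral[OF Hi] by simp
  \<comment> \<open>For a fixed path the integral in s is the assumed equation at the time T = t0 -
    \<sigma> \<omega>, since c (\<sigma> \<omega>) - c (t0 - s) = b s - b T. Paths that do not meet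
    the curve before t0 contribute nothing.\<close>
  also have "\<dots> = (\<integral>\<omega>. 0 \<partial>M)"
  proof (rule Bochner_Integration.integral_cong[OF refl])
    fix \<omega>
    show "(LBINT s. ?H \<omega> s) = 0"
    proof (cases "\<tau> \<omega> < ereal t0")
      case True
      define T where "T = t0 - \<sigma> \<omega>"
      have T: "0 < T \<and> T \<le> t0" using True \<tau>0[of \<omega>] by (cases "\<tau> \<omega>") (auto simp: T_def \<sigma>_def)
      have "(LBINT s. ?H \<omega> s) = (LBINT s:{0<..<T}. passage_kernel p (b s - b T) (T - s) * D s)"
        unfolding set_lebesgue_integral_def
      proof (rule Bochner_Integration.integral_cong[OF refl])
        fix s
        have e: "c (\<sigma> \<omega>) - c (t0 - s) = b s - b T" "t0 - s - \<sigma> \<omega> = T - s" by (auto simp: c_def T_def)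
        have qs: "q \<omega> s = (if s < T then 1 else 0)" using True by (auto simp: q T_def)
        show "?H \<omega> s = indicator {0<..<T} s *\<^sub>R (passage_kernel p (b s - b T) (T - s) * D s)"
          unfolding e qs using T by (auto simp: indicator_def)
      qed
      then show ?thesis using eq[OF conjunct1[OF T]] by simp
    next
      case False
      have "q \<omega> s = 0" if "0 < s" for s
      proof -
        have "ereal (t0 - s) < ereal t0" using that by simp
      then have "\<not> \<tau> \<omega> < ereal (t0 - s)" using False less_trans by blast
        then show ?thesis by (simp add: q_def)
      qed
      then have "?H \<omega> = (\<lambda>s. 0)" by (auto simp: indicator_def)
      then show ?thesis by simp
    qed
  qed
  finally show ?thesis by simp
qed

lemma solution_difference_zero:
  assumes D: "continuous_on UNIV D" and p: "p < 1"
    and eq: "\<And>t. 0 < t \<Longrightarrow> (LBINT s:{0<..<t}. passage_kernel p (b s - b t) (t - s) * D s) = 0"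
    and t: "0 \<le> t"
  shows "D t = 0"
proof (rule kern_density_unique[OF D, of "t + 1"])
  fix t0 :: real assume t0: "0 < t0"
  interpret weighted_times lborel "\<lambda>s. s" "\<lambda>s. indicator {0<..<t0} s * D s" t0 b
    by (rule weighted_times_density[OF D t0])
  have flux0: "flux x = 0" if x: "x < b t0" for x
  proof (rule abel_injective[OF exp_decay_below_flux _ _ x, of "1 - p"])
    fix y assume y: "y < b t0"
    have "(LBINT s. indicator {0<..<t0} s * D s * passage_kernel p (b s - y) (t0 - s)) = (LBINT s:{0<..<t0}. passage_kernel p (b s - y) (t0 - s) * D s)"
      by (simp add: set_lebesgue_integral_def mult_ac)
    also have "\<dots> = 0" by (rule potential_vanishes_below[OF D p eq t0 y])
    finally show "(\<integral>u. flux (y - u) \<partial>power_measure (1 - p)) = 0"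
      using flux_kernel(1)[OF p weight_integrable[OF D p t0 less_imp_le[OF y]]] by simp
  qed (use p in simp)
  \<comment> \<open>The transform of order 2 is taken at the curve point itself and uses only values
    of the flux strictly below it, so no limit towards the curve is needed.\<close>
  have "(\<integral>u. flux (b t0 - u) \<partial>power_measure 2) = (\<integral>u. 0 \<partial>power_measure 2)"
  proof (rule integral_cong_AE)
    show "AE u in power_measure 2. flux (b t0 - u) = 0"
      using AE_power_measure by eventually_elim (simp add: flux0)
    have "(\<lambda>u. b t0 - u) \<in> measurable (power_measure 2) borel" by simp
    then show "(\<lambda>u. flux (b t0 - u)) \<in> borel_measurable (power_measure 2)" by (rule measurable_compose[OF _ flux_measurable])
  qed simp
  moreover have "(\<integral>u. flux (b t0 - u) \<partial>power_measure (1 - (- 1))) = Gamma (1 - (- 1)) * (LBINT s. indicator {0<..<t0} s * D s * passage_kernel (- 1) (b s - b t0) (t0 - s))"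
    by (rule flux_kernel(1)[OF _ weight_integrable[OF D _ t0 order_refl]]) simp_all
  moreover have "1 - (- 1) = (2::real)" "Gamma (2::real) = 1" by (simp_all add: Gamma_numeral)
  ultimately have "(LBINT s. indicator {0<..<t0} s * D s * passage_kernel (- 1) (b s - b t0) (t0 - s)) = 0"
    by (simp only: integral_zero mult_1)
  moreover have "(LBINT s:{0<..<t0}. kern t0 s * D s) = (LBINT s. indicator {0<..<t0} s * D s * passage_kernel (- 1) (b s - b t0) (t0 - s))"
    unfolding set_lebesgue_integral_def
  proof (rule Bochner_Integration.integral_cong[OF refl])
    fix s show "indicator {0<..<t0} s *\<^sub>R (kern t0 s * D s) = indicator {0<..<t0} s * D s * passage_kernel (- 1) (b s - b t0) (t0 - s)"
      by (cases "s < t0") (simp_all add: passage_kernel_kern)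
  qed
  ultimately show "(LBINT s:{0<..<t0}. kern t0 s * D s) = 0" by (simp only:)
qed (use t in auto)

theorem passage_equation_unique:
  assumes f: "continuous_on UNIV f" "solves_passage_equation p b f"
    and g: "continuous_on {0..} g" "solves_passage_equation p b g" and p: "p < 1" and t: "0 \<le> t"
  shows "g t = f t"
proof -
  \<comment> \<open>g is only continuous on [0, \<infinity>); freezing its argument at 0 for
    negative s makes D continuous on the line.\<close>
  define D where "D = (\<lambda>s. f s - g (max 0 s))"
  have D: "continuous_on UNIV D"
    unfolding D_def by (intro continuous_intros f continuous_on_compose2[OF g(1)]) auto
  have "D t = 0"
  proof (rule solution_difference_zero[OF D p _ t])
    fix t :: real assume t: "0 < t"
    let ?k = "\<lambda>s. passage_kernel p (b s - b t) (t - s)"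
    have F: "set_integrable lborel {0<..<t} (\<lambda>s. ?k s * f s)" "passage_kernel p (- b t) t = (LBINT s:{0<..<t}. ?k s * f s)"
      and G: "set_integrable lborel {0<..<t} (\<lambda>s. ?k s * g s)" "passage_kernel p (- b t) t = (LBINT s:{0<..<t}. ?k s * g s)"
      using f(2) g(2) t unfolding solves_passage_equation_def by auto
    have "(LBINT s:{0<..<t}. ?k s * D s) = (LBINT s:{0<..<t}. ?k s * f s - ?k s * g s)"
      by (rule set_lebesgue_integral_cong) (auto simp: D_def right_diff_distrib)
    also have "\<dots> = 0" using set_integral_diff(2)[OF F(1) G(1)] F(2) G(2) by simp
    finally show "(LBINT s:{0<..<t}. ?k s * D s) = 0" .
  qed
  then show ?thesis using t by (simp add: D_def)
qed

end

section \<open>From the hypotheses of the theorem to a smooth boundary with negative start\<close>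

text \<open>At time u the path lies on or below the curve with probability \<open>kern u 0\<close> /
  sqrt(2 pi), which tends to 1/2 because b(u) is of smaller order than sqrt u. By reverse Fatou this
  happens at infinitely many of the times 1/(n+1) with probability at least 1/2, and then \<tau> =
  0.\<close>

lemma (in smooth_curve) zero_start_not_regular:
  assumes bm: "standard_brownian_motion M W" and b0: "b0 = 0"
  shows "measure M {\<omega> \<in> space M. first_passage_time W b \<omega> = 0} \<noteq> 0"
proof
  assume zero: "measure M {\<omega> \<in> space M. first_passage_time W b \<omega> = 0} = 0"
  interpret prob_space M using bm by (simp add: standard_brownian_motion_def)
  have [measurable]: "first_passage_time W b \<in> borel_measurable M"
    by (rule first_passage_measurable[OF bm]) (rule continuous_on_subset[OF continuous_b], simp)
  define u where "u = (\<lambda>n::nat. 1 / real (Suc n))"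
  have u: "0 < u n" for n by (simp add: u_def)
  define E where "E = (\<lambda>n. {\<omega> \<in> space M. W (u n) \<omega> \<le> b (u n)})"
  have E[measurable]: "E n \<in> sets M" for n
  proof -
    have [measurable]: "W (u n) \<in> borel_measurable M" by (rule bm_measurable[OF bm less_imp_le[OF u]])
    show ?thesis unfolding E_def by measurable
  qed
  have PE: "prob (E n) = kern (u n) 0 / sqrt (2 * pi)" for n
  proof -
    have "sqrt (2 * pi) * prob (E n) = gauss_tail (- b (u n) / sqrt (u n))"
      unfolding E_def by (rule bm_prob_le[OF bm, where c="\<lambda>_. - 1"]) (auto simp: u)
    moreover have "kern (u n) 0 = gauss_tail (- b (u n) / sqrt (u n))"
      using b_nonpos[of 0] b0 by (simp add: kern_def bz_def)
    ultimately show ?thesis by (simp add: field_simps)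
  qed
  have "filterlim u (at_right 0) sequentially" unfolding u_def by real_asymp
  from filterlim_compose[OF kern_diag_tendsto(1)[OF order_refl] this]
  have lim: "(\<lambda>n. kern (u n) 0) \<longlonglongrightarrow> sqrt (pi / 2)" .
  have PElim: "(\<lambda>n. prob (E n)) \<longlonglongrightarrow> sqrt (pi / 2) / sqrt (2 * pi)"
    unfolding PE using lim by (intro tendsto_divide tendsto_const) auto
  define U where "U = (\<lambda>N. \<Union>n\<in>{N..}. E n)"
  have U[measurable]: "U N \<in> sets M" for N unfolding U_def by measurable
  have "decseq U" unfolding U_def decseq_def by (intro allI impI UN_mono) auto
  then have Ulim: "(\<lambda>N. prob (U N)) \<longlonglongrightarrow> prob (\<Inter>N. U N)"
    using U by (intro finite_Lim_measure_decseq) auto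
  have "(\<Inter>N. U N) \<subseteq> {\<omega> \<in> space M. first_passage_time W b \<omega> = 0}"
  proof
    fix \<omega> assume \<omega>: "\<omega> \<in> (\<Inter>N. U N)"
    have le: "first_passage_time W b \<omega> \<le> ereal (u N)" for N
    proof -
      from \<omega> obtain n where n: "N \<le> n" "\<omega> \<in> E n" unfolding U_def by blast
      have "first_passage_time W b \<omega> \<le> ereal (u n)"
        unfolding first_passage_time_def using n u[of n] by (intro INF_lower) (auto simp: E_def)
      also have "\<dots> \<le> ereal (u N)" using n(1) by (simp add: u_def frac_le)
      finally show ?thesis .
    qed
    have "first_passage_time W b \<omega> = 0"
    proof (cases "first_passage_time W b \<omega>")
      case (real r)
      have "r \<le> u N" for N using le[of N] real by simp
      then have "r \<le> 0"
        by (intro LIMSEQ_le_const[OF LIMSEQ_inverse_real_of_nat]) (auto simp: u_def inverse_eq_divide)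
      then show ?thesis using real first_passage_nonneg[of W b \<omega>] by simp
    qed (use le[of 0] first_passage_nonneg[of W b \<omega>] in auto)
    moreover have "\<omega> \<in> space M" using \<omega> unfolding U_def E_def by auto
    ultimately show "\<omega> \<in> {\<omega> \<in> space M. first_passage_time W b \<omega> = 0}" by simp
  qed
  then have "prob (\<Inter>N. U N) \<le> prob {\<omega> \<in> space M. first_passage_time W b \<omega> = 0}"
    by (rule finite_measure_mono) measurable
  then have "prob (\<Inter>N. U N) = 0" using zero by (simp add: measure_le_0_iff)
  with Ulim have U0: "(\<lambda>N. prob (U N)) \<longlonglongrightarrow> 0" by simp
  have "prob (E n) \<le> prob (U n)" for n by (rule finite_measure_mono) (auto simp: U_def)
  then have "sqrt (pi / 2) / sqrt (2 * pi) \<le> 0" by (intro LIMSEQ_le[OF PElim U0]) auto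
  moreover have "0 < sqrt (pi / 2) / sqrt (2 * pi)" by simp
  ultimately show False by linarith
qed

lemma solves_passage_equation_cong:
  assumes "\<And>t. 0 < t \<Longrightarrow> b t = c t"
  shows "solves_passage_equation p b f \<longleftrightarrow> solves_passage_equation p c f"
  unfolding solves_passage_equation_def
proof (intro iff_allI imp_cong refl)
  fix t :: real assume t: "0 < t"
  have "set_integrable lborel {0<..<t} (\<lambda>s. passage_kernel p (b s - b t) (t - s) * f s) \<longleftrightarrow>
      set_integrable lborel {0<..<t} (\<lambda>s. passage_kernel p (c s - c t) (t - s) * f s)"
    by (rule set_integrable_cong) (use assms t in auto)
  moreover have "(LBINT s:{0<..<t}. passage_kernel p (b s - b t) (t - s) * f s) = (LBINT s:{0<..<t}. passage_kernel p (c s - c t) (t - s) * f s)"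
    by (rule set_lebesgue_integral_cong) (use assms t in auto)
  ultimately show "(set_integrable lborel {0<..<t} (\<lambda>s. passage_kernel p (b s - b t) (t - s) * f s) \<and>
      passage_kernel p (- b t) t = (LBINT s:{0<..<t}. passage_kernel p (b s - b t) (t - s) * f s)) \<longleftrightarrow>
    (set_integrable lborel {0<..<t} (\<lambda>s. passage_kernel p (c s - c t) (t - s) * f s) \<and>
      passage_kernel p (- c t) t = (LBINT s:{0<..<t}. passage_kernel p (c s - c t) (t - s) * f s))"
    using assms[OF t] by simp
qed

text \<open>The growth condition concerns only small t. On [e,T] the derivative has a bound B by
  compactness, and the factor T^\<epsilon> in A brings it to the required form because
  t^(-\<epsilon>) \<ge> T^(-\<epsilon>).\<close>

lemma smooth_curve_of_C1:
  assumes C1: "\<And>T. T > 0 \<Longrightarrow> b C1_differentiable_on {0<..T}"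
    and eps: "0 < \<epsilon>" "\<epsilon> < 1 / 2"
    and bigo: "(\<lambda>t. \<bar>deriv b t\<bar>) \<in> O[at_right 0](\<lambda>t. t powr (- \<epsilon>))"
    and lim: "(b \<longlongrightarrow> b0) (at_right 0)"
  shows "smooth_curve (\<lambda>t. if t \<le> 0 then b0 else b t) (\<lambda>t. if t \<le> 0 then 0 else deriv b t) b0 \<epsilon>"
proof
  have ex: "\<exists>D. (\<forall>x\<in>{0<..T}. (b has_vector_derivative D x) (at x)) \<and> continuous_on {0<..T} D" if "0 < T" for T
    using C1[OF that] by (simp add: C1_differentiable_on_def)
  have d: "(b has_real_derivative deriv b t) (at t)" if t: "0 < t" for t
  proof -
    obtain D where "(b has_vector_derivative D t) (at t)" using ex[OF t] t by force
    then have "(b has_real_derivative D t) (at t)" by (simp add: has_real_derivative_iff_has_vector_derivative)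
    then show ?thesis using DERIV_imp_deriv by metis
  qed
  have cT: "continuous_on {0<..T} (deriv b)" if T: "0 < T" for T
  proof -
    obtain D where D: "\<And>x. x \<in> {0<..T} \<Longrightarrow> (b has_vector_derivative D x) (at x)" "continuous_on {0<..T} D" using ex[OF T] by blast
    have "D x = deriv b x" if "x \<in> {0<..T}" for x
      by (rule DERIV_imp_deriv[symmetric]) (use D(1)[OF that] in \<open>simp add: has_real_derivative_iff_has_vector_derivative\<close>)
    then show ?thesis by (rule continuous_on_eq[OF D(2)])
  qed
  have c: "isCont (deriv b) t" if t: "0 < t" for t
    by (rule continuous_on_interior[OF continuous_on_subset[OF cT[of "t + 1"], of "{0<..<t + 1}"]]) (use t in \<open>auto simp: interior_open\<close>)
  show "((\<lambda>t. if t \<le> 0 then b0 else b t) has_real_derivative (if t \<le> 0 then 0 else deriv b t)) (at t)" if t: "0 < t" for t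
  proof -
    have "((\<lambda>t. if t \<le> 0 then b0 else b t) has_real_derivative deriv b t) (at t)"
      by (rule has_field_derivative_transform_within_open[OF d[OF t], of "{0<..}"]) (use t in auto)
    then show ?thesis using t by simp
  qed
  have "continuous_on {0<..} (deriv b)" using c by (intro continuous_at_imp_continuous_on) auto
  then show "continuous_on {0<..} (\<lambda>t. if t \<le> 0 then 0 else deriv b t)"
    by (rule continuous_on_cong[THEN iffD1, rotated 2]) auto
  show "((\<lambda>t. if t \<le> 0 then b0 else b t) \<longlongrightarrow> b0) (at_right 0)"
  proof (rule Lim_transform_eventually[OF lim])
    show "\<forall>\<^sub>F x in at_right 0. b x = (if x \<le> 0 then b0 else b x)"
      using eventually_at_right_less[of 0] by eventually_elim simp
  qed
  show "\<exists>C. \<forall>t. 0 < t \<and> t \<le> T \<longrightarrow> \<bar>if t \<le> 0 then 0 else deriv b t\<bar> \<le> C * t powr (- \<epsilon>)" if T: "0 < T" for T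
  proof -
    obtain C where "\<forall>\<^sub>F t in at_right 0. norm \<bar>deriv b t\<bar> \<le> C * norm (t powr (- \<epsilon>))"
      using landau_o.bigE[OF bigo] by blast
    then obtain e where e: "0 < e" "\<And>t. 0 < t \<Longrightarrow> t < e \<Longrightarrow> \<bar>deriv b t\<bar> \<le> C * t powr (- \<epsilon>)"
      unfolding eventually_at_right_field by auto
    have "continuous_on {e..T} (deriv b)" using c e(1) by (intro continuous_at_imp_continuous_on) auto
    then have "compact (deriv b ` {e..T})" by (rule compact_continuous_image) simp
    then obtain B where B: "\<And>t. t \<in> {e..T} \<Longrightarrow> \<bar>deriv b t\<bar> \<le> B"
      by (metis bounded_iff compact_imp_bounded image_eqI real_norm_def)
    define A where "A = max C (max 0 B * T powr \<epsilon>)"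
    have "\<bar>deriv b t\<bar> \<le> A * t powr (- \<epsilon>)" if t: "0 < t" "t \<le> T" for t
    proof (cases "t < e")
      case True
      have "\<bar>deriv b t\<bar> \<le> C * t powr (- \<epsilon>)" by (rule e(2)[OF t(1) True])
      also have "\<dots> \<le> A * t powr (- \<epsilon>)" by (intro mult_right_mono) (auto simp: A_def)
      finally show ?thesis .
    next
      case False
      have "\<bar>deriv b t\<bar> \<le> max 0 B * 1" using B[of t] False t by auto
      also have "\<dots> \<le> max 0 B * (T powr \<epsilon> * t powr (- \<epsilon>))"
      proof (rule mult_left_mono)
        have "T powr (- \<epsilon>) \<le> t powr (- \<epsilon>)" using t eps by (intro powr_mono2') auto
        then have "T powr \<epsilon> * T powr (- \<epsilon>) \<le> T powr \<epsilon> * t powr (- \<epsilon>)" by (intro mult_left_mono) auto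
        then show "1 \<le> T powr \<epsilon> * t powr (- \<epsilon>)" using T by (simp add: powr_add[symmetric])
      qed simp
      also have "\<dots> = (max 0 B * T powr \<epsilon>) * t powr (- \<epsilon>)" by simp
      also have "\<dots> \<le> A * t powr (- \<epsilon>)" by (intro mult_right_mono) (auto simp: A_def)
      finally show ?thesis .
    qed
    then show ?thesis by (intro exI[of _ A]) auto
  qed
qed (use eps in auto)

theorem theorem3:
  fixes M :: "'a measure" and W :: "real \<Rightarrow> 'a \<Rightarrow> real"
    and b :: "real \<Rightarrow> real" and \<epsilon> :: real
  assumes "standard_brownian_motion M W"
    and "regular_boundary M W b"
    and "\<And>T. T > 0 \<Longrightarrow> b C1_differentiable_on {0<..T}"
    and "0 < \<epsilon>" and "\<epsilon> < 1 / 2"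
    and "(\<lambda>t. \<bar>deriv b t\<bar>) \<in> O[at_right 0](\<lambda>t. t powr (- \<epsilon>))"
  shows "\<exists>f. continuous_on {0..} f \<and>
           has_time_density M (first_passage_time W b) f \<and>
           (\<forall>p<1. solves_passage_equation p b f \<and>
              (\<forall>g. continuous_on {0..} g \<and> solves_passage_equation p b g
                 \<longrightarrow> (\<forall>t\<ge>0. g t = f t)))"
proof -
  obtain b0 where b0: "b0 \<le> 0" "(b \<longlongrightarrow> b0) (at_right 0)"
    and reg: "measure M {\<omega> \<in> space M. first_passage_time W b \<omega> = 0} = 0"
    using assms(2) unfolding regular_boundary_def boundary_def by blast
  \<comment> \<open>The values of b at t \<le> 0 are arbitrary, whereas the locales use the
    continuous extension by b0. Passage time and equation look only at t > 0, so both transfer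
    between b and c.\<close>
  define c where "c = (\<lambda>t. if t \<le> 0 then b0 else b t)"
  have bc: "b t = c t" if "0 < t" for t using that by (simp add: c_def)
  have sc: "solves_passage_equation p b h \<longleftrightarrow> solves_passage_equation p c h" for p h
    by (rule solves_passage_equation_cong) (rule bc)
  have fp: "first_passage_time W b = first_passage_time W c"
    unfolding first_passage_time_def by (intro ext arg_cong[where f=Inf] image_cong) (auto simp: bc)
  interpret smooth_curve c "\<lambda>t. if t \<le> 0 then 0 else deriv b t" b0 \<epsilon>
    unfolding c_def by (rule smooth_curve_of_C1[OF assms(3-6) b0(2)])
  have neg: "b0 < 0"
  proof -
    have "b0 \<noteq> 0" using zero_start_not_regular[OF assms(1)] reg unfolding fp by blast
    then show ?thesis using b0(1) by simp
  qed
  interpret brownian_boundary c "\<lambda>t. if t \<le> 0 then 0 else deriv b t" b0 \<epsilon> M W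
    by unfold_locales (use neg assms(1) in auto)
  obtain f where f: "continuous_on UNIV f" "\<And>t. 0 \<le> f t" "\<And>t. 0 < t \<Longrightarrow> cdf t = (LBINT s:{0<..<t}. f s)"
    using density_exists by blast
  show ?thesis
  proof (intro exI[of _ f] conjI allI impI)
    show "continuous_on {0..} f" by (rule continuous_on_subset[OF f(1)]) simp
    show "has_time_density M (first_passage_time W b) f" unfolding fp by (rule time_density[OF f])
    fix p :: real assume p: "p < 1"
    have sol: "solves_passage_equation p c f" by (rule density_solves[OF f p])
    then show "solves_passage_equation p b f" by (rule sc[THEN iffD2])
    fix g t assume g: "continuous_on {0..} g \<and> solves_passage_equation p b g" and t: "0 \<le> (t::real)"
    have "solves_passage_equation p c g" using sc[of p g] g by blast
    then show "g t = f t" by (rule passage_equation_unique[OF f(1) sol conjunct1[OF g] _ p t])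
  qed
qed

end
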